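(* Let $T>0$ and let $1<p,q,m,n<\infty$ satisfy $\frac2p+\frac1m=1$ and $\frac2q+\frac1n=1$. Let $(v,\theta)$ be a weak solution on $(0,T)\times\mathbb{T}^3$ of the temperature equation $$\theta_t+v\cdot\nabla\theta=0,\qquad \mathrm{div}\,v=0,$$ such that $$\theta\in L^\infty(0,T;L^2(\mathbb{T}^3))\cap L^p(0,T;L^q(\mathbb{T}^3)),\qquad v\in L^m(0,T;L^n(\mathbb{T}^3)).$$ Then the functions $$D_\varepsilon(v,\theta)=-\frac14\int_{\mathbb{T}^3}\nabla\varphi_\varepsilon(\ell)\cdot\delta v(\ell)\,|\delta\theta(\ell)|^2\,d\ell$$ converge, as $\varepsilon\to0$, in the sense of distributions to a distribution $D(v,\theta)$, and $D(v,\theta)$ satisfies the local energy equation $$\partial_t\Big(\tfrac12|\theta|^2\Big)+\mathrm{div}\Big(\tfrac12 v\theta^2\Big)=D(v,\theta)$$ in the sense of distributions. Moreover, the following $4/3$ law holds: $$S(v,\theta,\theta)=-\frac43D(v,\theta),$$ where $$S(v,\theta,\theta)=-\lim_{\lambda\to0}\frac1\lambda\int_{\partial B}\ell\cdot\delta v(\lambda\ell)\,|\delta\theta(\lambda\ell)|^2\,\frac{d\sigma(\ell)}{4\pi}.$$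
   Context: $\mathbb{T}^3$ is the three-dimensional torus (functions are extended periodically). Here $v$ is a vector field and $\theta$ a scalar function on $(0,T)\times\mathbb{T}^3$. For a function $f=f(x,t)$ and $\ell\in\mathbb{R}^3$, $\delta f(\ell)=f(x+\ell,t)-f(x,t)$ is the increment, regarded as a function of $(x,t)$. $\varphi(x)=C_0e^{-1/(1-|x|^2)}$ for $|x|<1$, $\varphi(x)=0$ for $|x|\ge1$, is the standard mollifier with $\int_{\mathbb{R}^3}\varphi\,dx=1$, and $\varphi_\varepsilon(x)=\varepsilon^{-3}\varphi(x/\varepsilon)$. $B$ is the unit ball of $\mathbb{R}^3$, $\partial B=\{x\in\mathbb{R}^3:|x|=1\}$ and $\sigma$ is the surface measure on $\partial B$. Weak solution means that the equations hold in the sense of distributions, with the transport term written as $\mathrm{div}(v\theta)$. Limits as $\varepsilon\to0$ and $\lambda\to0$ are in the sense of distributions on $(0,T)\times\mathbb{T}^3$. *)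

theory Defs
  imports "HOL-Analysis.Analysis"
begin

text \<open>
  The torus is \<open>\<real>\<^sup>3 / \<int>\<^sup>3\<close>: functions on \<open>(0,T)\<close> times the torus are functions of \<open>(t, x)\<close> that
  are 1-periodic in each coordinate of \<open>x\<close>.  Integrals over the torus are integrals over the
  fundamental cell centred at the origin, so that the support of the mollifier of width
  \<open>\<epsilon> < 1/2\<close> lies inside the cell.
\<close>

type_synonym space = "real ^ 3"
type_synonym spacetime = "real \<times> (real ^ 3)"

definition torus_cell :: "space set" where
  "torus_cell = cbox (- ((1/2) *\<^sub>R One)) ((1/2) *\<^sub>R One)"

definition torus_cyl :: "real \<Rightarrow> spacetime set" where
  "torus_cyl T = {0<..<T} \<times> torus_cell"

text \<open>
  Elements of the Lebesgue spaces are represented by Borel functions (every class contains one);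
  only their values for \<open>t \<in> (0,T)\<close> matter.
\<close>

definition torus_field :: "real \<Rightarrow> (spacetime \<Rightarrow> 'b::real_normed_vector) \<Rightarrow> bool" where
  "torus_field T f \<longleftrightarrow>
     f \<in> borel_measurable (restrict_space borel ({0<..<T} \<times> UNIV)) \<and>
     (\<forall>t\<in>{0<..<T}. \<forall>x. \<forall>b\<in>Basis. f (t, x + b) = f (t, x))"

definition in_Lq :: "real \<Rightarrow> (space \<Rightarrow> 'b::real_normed_vector) \<Rightarrow> bool" where
  "in_Lq q g \<longleftrightarrow> set_integrable lborel torus_cell (\<lambda>x. norm (g x) powr q)"

definition Lq_norm :: "real \<Rightarrow> (space \<Rightarrow> 'b::real_normed_vector) \<Rightarrow> real" where
  "Lq_norm q g = (LINT x:torus_cell|lborel. norm (g x) powr q) powr (1 / q)"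

definition in_LpLq :: "real \<Rightarrow> real \<Rightarrow> real \<Rightarrow> (spacetime \<Rightarrow> 'b::real_normed_vector) \<Rightarrow> bool" where
  "in_LpLq T p q f \<longleftrightarrow> torus_field T f \<and>
     (AE t in lborel. t \<in> {0<..<T} \<longrightarrow> in_Lq q (\<lambda>x. f (t, x))) \<and>
     set_integrable lborel {0<..<T} (\<lambda>t. Lq_norm q (\<lambda>x. f (t, x)) powr p)"

definition in_LinfLq :: "real \<Rightarrow> real \<Rightarrow> (spacetime \<Rightarrow> 'b::real_normed_vector) \<Rightarrow> bool" where
  "in_LinfLq T q f \<longleftrightarrow> torus_field T f \<and>
     (\<exists>C. AE t in lborel. t \<in> {0<..<T} \<longrightarrow>
        in_Lq q (\<lambda>x. f (t, x)) \<and> Lq_norm q (\<lambda>x. f (t, x)) \<le> C)"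

text \<open>Iterated directional derivatives; for directions in \<open>Basis\<close> these are the partial derivatives.\<close>

primrec pderivs :: "'a::euclidean_space list \<Rightarrow> ('a \<Rightarrow> real) \<Rightarrow> 'a \<Rightarrow> real" where
  "pderivs [] f = f"
| "pderivs (b # bs) f = (\<lambda>z. frechet_derivative (pderivs bs f) (at z) b)"

definition smooth_fun :: "('a::euclidean_space \<Rightarrow> real) \<Rightarrow> bool" where
  "smooth_fun f \<longleftrightarrow> (\<forall>bs. set bs \<subseteq> Basis \<longrightarrow> (\<forall>z. pderivs bs f differentiable (at z)))"

definition time_deriv :: "(spacetime \<Rightarrow> real) \<Rightarrow> spacetime \<Rightarrow> real" where
  "time_deriv \<psi> = (\<lambda>(t, x). deriv (\<lambda>s. \<psi> (s, x)) t)"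

definition gradient :: "('a::euclidean_space \<Rightarrow> real) \<Rightarrow> 'a \<Rightarrow> 'a" where
  "gradient f x = (\<Sum>b\<in>Basis. frechet_derivative f (at x) b *\<^sub>R b)"

definition space_gradient :: "(spacetime \<Rightarrow> real) \<Rightarrow> spacetime \<Rightarrow> space" where
  "space_gradient \<psi> = (\<lambda>(t, x). gradient (\<lambda>y. \<psi> (t, y)) x)"

definition vanishes_outside :: "real \<Rightarrow> real \<Rightarrow> (spacetime \<Rightarrow> real) \<Rightarrow> bool" where
  "vanishes_outside a b \<psi> \<longleftrightarrow> (\<forall>t x. t \<notin> {a..b} \<longrightarrow> \<psi> (t, x) = 0)"

definition test_functions :: "real \<Rightarrow> (spacetime \<Rightarrow> real) set" where
  "test_functions T = {\<psi>. smooth_fun \<psi> \<and>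
     (\<forall>t x. \<forall>b\<in>Basis. \<psi> (t, x + b) = \<psi> (t, x)) \<and>
     (\<exists>a b. 0 < a \<and> b < T \<and> vanishes_outside a b \<psi>)}"

text \<open>
  A distribution on \<open>(0,T)\<close> times the torus is a linear functional on \<open>test_functions T\<close> that is
  sequentially continuous; its values outside \<open>test_functions T\<close> are irrelevant.
\<close>

type_synonym functional = "(spacetime \<Rightarrow> real) \<Rightarrow> real"

definition null_sequence :: "real \<Rightarrow> (nat \<Rightarrow> spacetime \<Rightarrow> real) \<Rightarrow> bool" where
  "null_sequence T \<psi> \<longleftrightarrow> (\<forall>k. \<psi> k \<in> test_functions T) \<and>
     (\<exists>a b. 0 < a \<and> b < T \<and> (\<forall>k. vanishes_outside a b (\<psi> k))) \<and>
     (\<forall>bs. set bs \<subseteq> Basis \<longrightarrow> uniform_limit UNIV (\<lambda>k. pderivs bs (\<psi> k)) (\<lambda>_. 0) sequentially)"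

definition is_distribution :: "real \<Rightarrow> functional \<Rightarrow> bool" where
  "is_distribution T D \<longleftrightarrow>
     (\<forall>\<psi>\<in>test_functions T. \<forall>\<eta>\<in>test_functions T. D (\<lambda>z. \<psi> z + \<eta> z) = D \<psi> + D \<eta>) \<and>
     (\<forall>c. \<forall>\<psi>\<in>test_functions T. D (\<lambda>z. c * \<psi> z) = c * D \<psi>) \<and>
     (\<forall>\<psi>. null_sequence T \<psi> \<longrightarrow> (\<lambda>k. D (\<psi> k)) \<longlonglongrightarrow> 0)"

definition locally_integrable :: "real \<Rightarrow> (spacetime \<Rightarrow> real) \<Rightarrow> bool" where
  "locally_integrable T f \<longleftrightarrow>
     (\<forall>a b. 0 < a \<longrightarrow> b < T \<longrightarrow> set_integrable lborel ({a..b} \<times> torus_cell) f)"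

text \<open>A locally integrable function as a distribution, and distributional derivatives of functions.\<close>

definition dist_of :: "real \<Rightarrow> (spacetime \<Rightarrow> real) \<Rightarrow> functional" where
  "dist_of T f \<psi> = (LINT z:torus_cyl T|lborel. f z * \<psi> z)"

definition dist_dt :: "real \<Rightarrow> (spacetime \<Rightarrow> real) \<Rightarrow> functional" where
  "dist_dt T f \<psi> = - (LINT z:torus_cyl T|lborel. f z * time_deriv \<psi> z)"

definition dist_div :: "real \<Rightarrow> (spacetime \<Rightarrow> space) \<Rightarrow> functional" where
  "dist_div T w \<psi> = - (LINT z:torus_cyl T|lborel. w z \<bullet> space_gradient \<psi> z)"

text \<open>
  Convergence of functions in the sense of distributions.  Local integrability is demanded
  explicitly, because the integral of a non-integrable function is 0 by convention.
\<close>

definition tendsto_dist ::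
    "real \<Rightarrow> (real \<Rightarrow> spacetime \<Rightarrow> real) \<Rightarrow> functional \<Rightarrow> real filter \<Rightarrow> bool" where
  "tendsto_dist T f D F \<longleftrightarrow>
     (\<forall>\<^sub>F r in F. locally_integrable T (f r)) \<and>
     (\<forall>\<psi>\<in>test_functions T. ((\<lambda>r. dist_of T (f r) \<psi>) \<longlongrightarrow> D \<psi>) F)"

definition weak_solution :: "real \<Rightarrow> (spacetime \<Rightarrow> space) \<Rightarrow> (spacetime \<Rightarrow> real) \<Rightarrow> bool" where
  "weak_solution T v \<theta> \<longleftrightarrow>
     (\<forall>\<psi>\<in>test_functions T.
        dist_dt T \<theta> \<psi> + dist_div T (\<lambda>z. \<theta> z *\<^sub>R v z) \<psi> = 0 \<and>
        dist_div T v \<psi> = 0)"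

definition increment :: "(spacetime \<Rightarrow> 'b::ab_group_add) \<Rightarrow> space \<Rightarrow> spacetime \<Rightarrow> 'b" where
  "increment f l = (\<lambda>(t, x). f (t, x + l) - f (t, x))"

definition bump :: "space \<Rightarrow> real" where
  "bump x = (if norm x < 1 then exp (- 1 / (1 - (norm x)\<^sup>2)) else 0)"

definition C0 :: real where
  "C0 = 1 / (LINT x|lborel. bump x)"

definition mollifier :: "space \<Rightarrow> real" where
  "mollifier x = C0 * bump x"

definition mollifier_eps :: "real \<Rightarrow> space \<Rightarrow> real" where
  "mollifier_eps \<epsilon> x = mollifier (x /\<^sub>R \<epsilon>) / \<epsilon> ^ 3"

definition D_eps :: "(spacetime \<Rightarrow> space) \<Rightarrow> (spacetime \<Rightarrow> real) \<Rightarrow> real \<Rightarrow> spacetime \<Rightarrow> real" where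
  "D_eps v \<theta> \<epsilon> z =
     - (1/4) * (LINT l:torus_cell|lborel.
         (gradient (mollifier_eps \<epsilon>) l \<bullet> increment v l z) * \<bar>increment \<theta> l z\<bar>\<^sup>2)"

text \<open>
  Surface measure on the unit sphere, \<open>\<sigma>(A) = 3 |{r \<omega>. 0 < r < 1, \<omega> \<in> A}|\<close>: the image of Lebesgue
  measure on the punctured unit ball under radial projection \<open>sgn x = x / |x|\<close>, times 3.
\<close>

definition surface_measure :: "space measure" where
  "surface_measure =
     scale_measure 3
       (distr (restrict_space lborel (ball 0 1 - {0})) (restrict_space borel (sphere 0 1)) sgn)"

definition sphere_flux ::
    "(spacetime \<Rightarrow> space) \<Rightarrow> (spacetime \<Rightarrow> real) \<Rightarrow> real \<Rightarrow> spacetime \<Rightarrow> real" where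
  "sphere_flux v \<theta> r z =
     (1 / r) * ((LINT l|surface_measure.
         (l \<bullet> increment v (r *\<^sub>R l) z) * \<bar>increment \<theta> (r *\<^sub>R l) z\<bar>\<^sup>2) / (4 * pi))"

end

(* Writing \<delta>f = f(x + l) - f(x), the tested quantity is governed by two functions of the shift l:
   the flux F(l) = \<integral> \<psi> \<delta>v |\<delta>\<theta>|^2 and the energy correlation H(l), for which div F = 4 H weakly in l
   and H(0) is the left-hand side of the local energy equation tested with \<psi>.
   The identity is the equation for \<theta>(t,x) \<theta>(s,y): for fixed (s,y) the weak equation is tested with
   \<psi>(t,x) \<chi>(y-x) \<rho>(t-s) and weighted with \<theta>(s,y), and symmetrically in the other variable, so that the
   derivatives of \<rho> cancel and \<theta> never has to be differentiated; then \<rho> tends to the Dirac measure.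
   F and H are continuous by the L1-continuity of translations, since Young's inequality bounds all
   products of increments by W(t,x) + W(t,x+l) with one integrable W.
   Taking \<chi> to be the mollifier gives D_eps -> H(0). Taking radial \<chi> that increase to the indicator
   of a ball of radius r gives r^2 \<integral> w . F(r w) d\<sigma>(w) = 4 \<integral>_{B_r} H, whence the factor 4/3. *)
theory Submission
  imports Defs
begin

text \<open>What shapes the proof is that \<open>v\<close> has no bound uniform in time. When \<rho>
  tends to the Dirac measure, the factor mollified in time converges only in L1 of space-time, so
  the other factor has to lie in L^infinity(0,T;L1). This is available for \<theta> and \<theta>^2,
  by \<theta> in L^infinity(0,T;L2), but not for products with v; hence two mirrored versions of the
  limit.

  Expanding \<delta>v |\<delta>\<theta>|^2 gives six products. Those pairing \<theta> v at one point
  with \<theta> at the other are governed by transport; those pairing v with \<theta>^2 at the other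
  point by div v = 0; \<theta>^2 v at x does not depend on l. For \<theta>^2 v at x + l no equation
  is available: the shift is moved onto \<psi> and one integrates by parts in l.

  The exponents in time differ from those in space, so a pointwise Young inequality does not give an
  integrable W. Since shifts in x keep t fixed, Young is applied to slices normalised by their
  norms, and a second time in t.

  The factor 4/3 is 4 |B_r| / (4 pi r^3).\<close>

section \<open>Smooth functions\<close>

lemma pderivs_snoc: "pderivs (bs @ [b]) f = pderivs bs (\<lambda>z. frechet_derivative f (at z) b)"
  by (induction bs) auto

text \<open>Smoothness is a greatest fixed point: a set of differentiable functions that contains
  the partial derivatives of its members contains all iterated ones. Exhibiting such a set replaces
  Leibniz and Faa di Bruno formulas in the closure lemmas.\<close>

lemma smooth_fun_coinduct:
  assumes "f \<in> S" and "\<And>g z. g \<in> S \<Longrightarrow> g differentiable (at z)"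
    and "\<And>g b. g \<in> S \<Longrightarrow> b \<in> Basis \<Longrightarrow> (\<lambda>z. frechet_derivative g (at z) b) \<in> S"
  shows "smooth_fun f"
proof -
  have "pderivs bs f \<in> S" if "set bs \<subseteq> Basis" for bs
    using that assms by (induction bs) auto
  then show ?thesis
    using assms by (auto simp: smooth_fun_def)
qed

lemma smooth_fun_differentiable: "smooth_fun f \<Longrightarrow> f differentiable (at z)"
  unfolding smooth_fun_def by (metis empty_subsetI list.set(1) pderivs.simps(1))

lemma smooth_fun_has_derivative:
  "smooth_fun f \<Longrightarrow> (f has_derivative frechet_derivative f (at z)) (at z)"
  using smooth_fun_differentiable frechet_derivative_works by blast

lemma smooth_fun_deriv:
  assumes "smooth_fun f" "b \<in> Basis"
  shows "smooth_fun (\<lambda>z. frechet_derivative f (at z) b)"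
  unfolding smooth_fun_def
proof (intro allI impI)
  fix bs :: "'a list" and z assume "set bs \<subseteq> Basis"
  \<comment> \<open>Differentiating along b first means appending b to the list, because
    \<open>pderivs\<close> treats the head as the outermost derivative.\<close>
  then have "set (bs @ [b]) \<subseteq> Basis" using assms by auto
  then have "pderivs (bs @ [b]) f differentiable at z"
    using assms unfolding smooth_fun_def by blast
  then show "pderivs bs (\<lambda>z. frechet_derivative f (at z) b) differentiable at z"
    by (simp add: pderivs_snoc)
qed

lemma smooth_fun_continuous: "smooth_fun f \<Longrightarrow> continuous_on S f"
  by (meson continuous_at_imp_continuous_on differentiable_imp_continuous_within smooth_fun_differentiable)

lemma smooth_fun_const: "smooth_fun (\<lambda>z. c)"
  by (rule smooth_fun_coinduct[where S = "range (\<lambda>c z. c)"]) auto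

lemma smooth_fun_linear:
  assumes "bounded_linear f" shows "smooth_fun f"
proof (rule smooth_fun_coinduct[where S = "insert f (range (\<lambda>c z. c))"])
  have *: "frechet_derivative f (at z) = f" for z
    using assms bounded_linear_imp_has_derivative frechet_derivative_at by metis
  fix g b assume "g \<in> insert f (range (\<lambda>c z. c))"
  then show "(\<lambda>z. frechet_derivative g (at z) b) \<in> insert f (range (\<lambda>c z. c))"
    by (auto simp: *)
qed (auto intro: bounded_linear_imp_differentiable assms)

lemma frechet_derivative_plus_fun:
  fixes f g :: "'a::real_normed_vector \<Rightarrow> real"
  assumes "f differentiable at z" "g differentiable at z"
  shows "frechet_derivative (\<lambda>z. f z + g z) (at z) b
    = frechet_derivative f (at z) b + frechet_derivative g (at z) b"
proof -
  have "((\<lambda>z. f z + g z) has_derivative (\<lambda>b. frechet_derivative f (at z) b + frechet_derivative g (at z) b)) (at z)"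
    using assms by (intro has_derivative_add) (auto simp: frechet_derivative_works)
  then show ?thesis using frechet_derivative_at by metis
qed

lemma frechet_derivative_times_fun:
  fixes f g :: "'a::real_normed_vector \<Rightarrow> real"
  assumes "f differentiable at z" "g differentiable at z"
  shows "frechet_derivative (\<lambda>z. f z * g z) (at z) b
    = f z * frechet_derivative g (at z) b + frechet_derivative f (at z) b * g z"
proof -
  have "((\<lambda>z. f z * g z) has_derivative (\<lambda>b. f z * frechet_derivative g (at z) b + frechet_derivative f (at z) b * g z)) (at z)"
    using assms by (intro has_derivative_mult) (auto simp: frechet_derivative_works)
  then show ?thesis using frechet_derivative_at by metis
qed

text \<open>The derivative of a product is a sum of two products, so products of smooth functions
  are not visibly closed under differentiation; their finite sums are.\<close>

inductive_set products_span :: "('a::euclidean_space \<Rightarrow> real) set" where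
  times: "smooth_fun f \<Longrightarrow> smooth_fun g \<Longrightarrow> (\<lambda>z. f z * g z) \<in> products_span"
| plus: "f \<in> products_span \<Longrightarrow> g \<in> products_span \<Longrightarrow> (\<lambda>z. f z + g z) \<in> products_span"

lemma products_span_closed:
  assumes "h \<in> products_span"
  shows "(\<forall>z. h differentiable (at z)) \<and>
    (\<forall>b\<in>Basis. (\<lambda>z. frechet_derivative h (at z) b) \<in> products_span)"
  using assms
proof induction
  case (times f g)
  then show ?case
    by (simp add: frechet_derivative_times_fun smooth_fun_differentiable differentiable_mult)
      (intro ballI products_span.intros smooth_fun_deriv)
next
  case (plus f g)
  then show ?case
    by (auto simp: frechet_derivative_plus_fun intro!: products_span.plus)
qed

lemma products_span_smooth: "h \<in> products_span \<Longrightarrow> smooth_fun h"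
  by (rule smooth_fun_coinduct[where S = products_span]) (auto dest: products_span_closed)

lemma smooth_fun_mult: "smooth_fun f \<Longrightarrow> smooth_fun g \<Longrightarrow> smooth_fun (\<lambda>z. f z * g z)"
  by (rule products_span_smooth) (rule products_span.times)

lemma smooth_fun_add:
  assumes "smooth_fun f" "smooth_fun g" shows "smooth_fun (\<lambda>z. f z + g z)"
proof -
  have "(\<lambda>z. f z * 1 + g z * 1) \<in> products_span"
    using assms by (intro products_span.intros smooth_fun_const)
  then show ?thesis using products_span_smooth by fastforce
qed

lemma smooth_fun_minus:
  assumes "smooth_fun f" "smooth_fun g" shows "smooth_fun (\<lambda>z. f z - g z)"
  using smooth_fun_add[OF assms(1) smooth_fun_mult[OF smooth_fun_const[of "-1"] assms(2)]] by simp

lemma smooth_fun_sum: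
  "(\<And>i. i \<in> I \<Longrightarrow> smooth_fun (f i)) \<Longrightarrow> smooth_fun (\<lambda>z. \<Sum>i\<in>I. f i z)"
  by (induction I rule: infinite_finite_induct) (auto intro: smooth_fun_const smooth_fun_add)

lemma smooth_fun_norm_sq:
  fixes L :: "'a::euclidean_space \<Rightarrow> 'b::euclidean_space"
  assumes "bounded_linear L"
  shows "smooth_fun (\<lambda>z. (norm (L z - y))\<^sup>2)"
proof -
  have "smooth_fun (\<lambda>z. (L z \<bullet> b - y \<bullet> b) * (L z \<bullet> b - y \<bullet> b))" for b
    by (intro smooth_fun_mult smooth_fun_minus smooth_fun_const smooth_fun_linear
        bounded_linear_inner_left_comp assms)
  then have "smooth_fun (\<lambda>z. \<Sum>b\<in>Basis. (L z \<bullet> b - y \<bullet> b) * (L z \<bullet> b - y \<bullet> b))"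
    by (intro smooth_fun_sum)
  moreover have "(norm (L z - y))\<^sup>2 = (\<Sum>b\<in>Basis. (L z \<bullet> b - y \<bullet> b) * (L z \<bullet> b - y \<bullet> b))" for z
    unfolding power2_norm_eq_inner by (subst euclidean_inner) (simp add: inner_diff_left)
  ultimately show ?thesis by simp
qed

text \<open>\<open>G k\<close> stands for the k-th derivative of the outer function. Differentiating
  \<open>G k (p z) * q z\<close> raises k in one term and moves the chain rule factor into the
  smooth multiplier, so sums of such terms form a closed set.\<close>

inductive_set comp_span :: "(nat \<Rightarrow> real \<Rightarrow> real) \<Rightarrow> ('a::euclidean_space \<Rightarrow> real) \<Rightarrow> ('a \<Rightarrow> real) set"
  for G and p where
  times: "smooth_fun q \<Longrightarrow> (\<lambda>z. G k (p z) * q z) \<in> comp_span G p"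
| plus: "f \<in> comp_span G p \<Longrightarrow> g \<in> comp_span G p \<Longrightarrow> (\<lambda>z. f z + g z) \<in> comp_span G p"

lemma frechet_derivative_comp_real:
  fixes p :: "'a::real_normed_vector \<Rightarrow> real"
  assumes "(g has_real_derivative g') (at (p z))" "p differentiable at z"
  shows "(\<lambda>z. g (p z)) differentiable at z"
    and "frechet_derivative (\<lambda>z. g (p z)) (at z) b = g' * frechet_derivative p (at z) b"
proof -
  have *: "((\<lambda>z. g (p z)) has_derivative (\<lambda>b. g' * frechet_derivative p (at z) b)) (at z)"
    using has_derivative_compose[of p "frechet_derivative p (at z)" z UNIV g "\<lambda>x. g' * x"] assms
    by (simp add: frechet_derivative_works has_field_derivative_def)
  show "(\<lambda>z. g (p z)) differentiable at z" using * differentiable_def by blast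
  show "frechet_derivative (\<lambda>z. g (p z)) (at z) b = g' * frechet_derivative p (at z) b"
    using frechet_derivative_at[OF *] by metis
qed

lemma comp_span_closed:
  assumes G: "\<And>k s. (G k has_real_derivative G (Suc k) s) (at s)" and p: "smooth_fun p"
    and "h \<in> comp_span G p"
  shows "(\<forall>z. h differentiable (at z)) \<and>
    (\<forall>b\<in>Basis. (\<lambda>z. frechet_derivative h (at z) b) \<in> comp_span G p)"
  using assms(3)
proof induction
  case (times q k)
  have 1: "(\<lambda>z. G k (p z)) differentiable at z" for z
    by (rule frechet_derivative_comp_real(1)[OF G]) (simp add: p smooth_fun_differentiable)
  have 2: "frechet_derivative (\<lambda>z. G k (p z)) (at z) b = G (Suc k) (p z) * frechet_derivative p (at z) b" for z b
    by (rule frechet_derivative_comp_real(2)[OF G]) (simp add: p smooth_fun_differentiable)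
  have 3: "(\<lambda>z. frechet_derivative (\<lambda>z. G k (p z) * q z) (at z) b) \<in> comp_span G p" if "b \<in> Basis" for b
  proof -
    have "(\<lambda>z. G k (p z) * frechet_derivative q (at z) b
        + G (Suc k) (p z) * (frechet_derivative p (at z) b * q z)) \<in> comp_span G p"
      by (intro comp_span.intros smooth_fun_mult smooth_fun_deriv that p times)
    then show ?thesis
      using 1 times by (simp add: frechet_derivative_times_fun smooth_fun_differentiable 2 mult.assoc)
  qed
  show ?case using 1 3 times by (simp add: differentiable_mult smooth_fun_differentiable)
next
  case (plus f g)
  then show ?case
    by (auto simp: frechet_derivative_plus_fun intro!: comp_span.plus)
qed

lemma smooth_fun_compose:
  assumes "\<And>k s. (G k has_real_derivative G (Suc k) s) (at s)" and "smooth_fun p"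
  shows "smooth_fun (\<lambda>z. G k (p z))"
proof -
  have "(\<lambda>z. G k (p z) * 1) \<in> comp_span G p"
    by (intro comp_span.intros smooth_fun_const)
  then show ?thesis
    by (intro smooth_fun_coinduct[where S = "comp_span G p"]) (auto dest: comp_span_closed[of G p, OF assms])
qed

lemma frechet_derivative_cong_open:
  assumes "open U" "z \<in> U" "\<And>w. w \<in> U \<Longrightarrow> f w = g w"
  shows "frechet_derivative f (at z) = frechet_derivative g (at z)"
proof -
  have "(f has_derivative D) (at z) \<longleftrightarrow> (g has_derivative D) (at z)" for D
    using has_derivative_transform_within_open[OF _ assms(1,2), of f D UNIV g]
      has_derivative_transform_within_open[OF _ assms(1,2), of g D UNIV f] assms(3) by auto
  then show ?thesis by (simp add: frechet_derivative_def)
qed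

lemma pderivs_cong_open:
  assumes "open U" "\<And>w. w \<in> U \<Longrightarrow> f w = g w" "z \<in> U"
  shows "pderivs bs f z = pderivs bs g z"
  using assms(3)
proof (induction bs arbitrary: z)
  case (Cons b bs)
  then show ?case
    using frechet_derivative_cong_open[OF assms(1), of z "pderivs bs f" "pderivs bs g"] by simp
qed (use assms in auto)

text \<open>Iterated derivatives at a point depend only on the germ there. This gives access to
  periodised bumps, each of which agrees near every point with a single translated bump.\<close>

lemma smooth_fun_local:
  assumes "\<And>z. \<exists>U g. open U \<and> z \<in> U \<and> smooth_fun g \<and> (\<forall>w\<in>U. f w = g w)"
  shows "smooth_fun f"
  unfolding smooth_fun_def
proof (intro allI impI)
  fix bs :: "'a list" and z assume bs: "set bs \<subseteq> Basis"
  obtain U g where U: "open U" "z \<in> U" "smooth_fun g" "\<forall>w\<in>U. f w = g w"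
    using assms by blast
  have "pderivs bs g differentiable at z" using U(3) bs by (auto simp: smooth_fun_def)
  then show "pderivs bs f differentiable at z"
    unfolding differentiable_def
    using has_derivative_transform_within_open[OF _ U(1,2), of "pderivs bs g" _ UNIV "pderivs bs f"]
      pderivs_cong_open[OF U(1), of f g] U(4) by metis
qed

text \<open>With u = 1/s, differentiation sends P(u) exp(-u) to u^2 (P(u) - P'(u)) exp(-u). The
  family is closed under differentiation, so all derivatives of exp(-1/s), extended by 0, are
  reached by iterating a map on polynomials.\<close>

definition flat_exp :: "real poly \<Rightarrow> real \<Rightarrow> real" where
  "flat_exp P s = (if s > 0 then poly P (1 / s) * exp (- (1 / s)) else 0)"

lemma tendsto_poly_times_exp_minus:
  fixes P :: "real poly"
  shows "((\<lambda>u. poly P u * exp (- u)) \<longlongrightarrow> 0) at_top"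
proof -
  have "((\<lambda>u. coeff P i * (u ^ i / exp u)) \<longlongrightarrow> 0) at_top" for i
    by (intro tendsto_mult_right_zero tendsto_power_div_exp_0)
  then have "((\<lambda>u. \<Sum>i\<le>degree P. coeff P i * (u ^ i / exp u)) \<longlongrightarrow> 0) at_top"
    by (intro tendsto_null_sum)
  moreover have "(\<Sum>i\<le>degree P. coeff P i * (u ^ i / exp u)) = poly P u * exp (- u)" for u
    by (simp add: poly_altdef sum_distrib_right exp_minus divide_inverse mult.assoc)
  ultimately show ?thesis by simp
qed

lemma flat_exp_deriv:
  "(flat_exp P has_real_derivative flat_exp (monom 1 2 * (P - pderiv P)) s) (at s)"
proof -
  consider "s > 0" | "s < 0" | "s = 0" by linarith
  then show ?thesis
  proof cases
    case 1
    have "((\<lambda>s. 1 / s) has_real_derivative - (1 / s\<^sup>2)) (at s)"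
      using 1 by (auto intro!: derivative_eq_intros simp: power2_eq_square)
    from DERIV_mult[OF DERIV_chain2[OF poly_DERIV this] DERIV_chain2[OF DERIV_exp DERIV_minus[OF this]]]
    have "((\<lambda>s. poly P (1 / s) * exp (- (1 / s))) has_real_derivative
        flat_exp (monom 1 2 * (P - pderiv P)) s) (at s)"
      by (rule DERIV_cong) (use 1 in \<open>simp add: flat_exp_def poly_monom power_divide algebra_simps\<close>)
    moreover have "\<forall>\<^sub>F s in nhds s. poly P (1 / s) * exp (- (1 / s)) = flat_exp P s"
    proof (rule eventually_mono)
      show "\<forall>\<^sub>F s in nhds s. s \<in> {0<..}" using 1 by (intro eventually_nhds_in_open) auto
    qed (simp add: flat_exp_def)
    ultimately show ?thesis by (rule DERIV_cong_ev[OF refl _ refl, THEN iffD1, rotated])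
  next
    case 2
    have "\<forall>\<^sub>F s in nhds s. 0 = flat_exp P s"
    proof (rule eventually_mono)
      show "\<forall>\<^sub>F s in nhds s. s \<in> {..<0}" using 2 by (intro eventually_nhds_in_open) auto
    qed (simp add: flat_exp_def)
    moreover have "((\<lambda>s. 0) has_real_derivative flat_exp (monom 1 2 * (P - pderiv P)) s) (at s)"
      using 2 by (simp add: flat_exp_def)
    ultimately show ?thesis by (rule DERIV_cong_ev[OF refl _ refl, THEN iffD1])
  next
    case 3
    \<comment> \<open>From the right the difference quotient at 0 is u P(u) exp(-u) with u = 1/h,
      where the exponential beats the polynomial.\<close>
    have "((\<lambda>h. flat_exp P h / h) \<longlongrightarrow> 0) (at_right 0)"
    proof -
      have "((\<lambda>h. poly (monom 1 1 * P) (1 / h) * exp (- (1 / h))) \<longlongrightarrow> 0) (at_right 0)"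
        by (rule filterlim_compose[OF tendsto_poly_times_exp_minus])
          (simp add: filterlim_inverse_at_top_right flip: inverse_eq_divide)
      moreover have "\<forall>\<^sub>F h in at_right 0. poly (monom 1 1 * P) (1 / h) * exp (- (1 / h)) = flat_exp P h / h"
        using eventually_at_right_less by eventually_elim (simp add: flat_exp_def poly_monom)
      ultimately show ?thesis by (simp add: tendsto_cong)
    qed
    moreover have "((\<lambda>h. flat_exp P h / h) \<longlongrightarrow> 0) (at_left 0)"
    proof -
      have "\<forall>\<^sub>F h in at_left 0. 0 = flat_exp P h / h"
        by (rule eventually_mono[OF eventually_at_left_real[of "-1" 0]]) (auto simp: flat_exp_def)
      then show ?thesis by (simp add: tendsto_eventually eventually_mono)
    qed
    ultimately have "((\<lambda>h. flat_exp P h / h) \<longlongrightarrow> 0) (at 0)"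
      using filterlim_at_split by blast
    then show ?thesis using 3 by (simp add: DERIV_def flat_exp_def)
  qed
qed

text \<open>At 1 - |x|^2 this is the unnormalised profile of the mollifier; at c (r^2 - |x|^2) with
  c > 0 it is a smooth bump supported in the ball of radius r.\<close>

definition flat :: "real \<Rightarrow> real" where
  "flat s = (if s > 0 then exp (- (1 / s)) else 0)"

definition flat' :: "real \<Rightarrow> real" where
  "flat' s = (if s > 0 then exp (- (1 / s)) / s\<^sup>2 else 0)"

lemma flat_deriv: "(flat has_real_derivative flat' s) (at s)"
proof -
  have "flat_exp 1 = flat" "flat_exp (monom 1 2 * (1 - pderiv 1)) s = flat' s"
    by (auto simp: flat_exp_def flat_def flat'_def poly_monom power_divide)
  then show ?thesis using flat_exp_deriv[of 1 s] by simp
qed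

lemma smooth_fun_flat: assumes "smooth_fun p" shows "smooth_fun (\<lambda>z. flat (p z))"
proof -
  define G where "G k = flat_exp (((\<lambda>P. monom 1 2 * (P - pderiv P)) ^^ k) 1)" for k
  have "(G k has_real_derivative G (Suc k) s) (at s)" for k s
    unfolding G_def by (simp add: flat_exp_deriv)
  from smooth_fun_compose[of G p 0, OF this assms]
  show ?thesis by (simp add: G_def flat_exp_def flat_def cong: if_cong)
qed

lemma flat_nonneg: "0 \<le> flat s" and flat_le_1: "flat s \<le> 1" and flat'_nonneg: "0 \<le> flat' s"
  by (auto simp: flat_def flat'_def)

lemma continuous_on_flat: "continuous_on S flat"
  by (meson DERIV_isCont continuous_at_imp_continuous_on flat_deriv)

lemma flat_borel [measurable]: "flat \<in> borel_measurable borel"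
  by (intro borel_measurable_continuous_onI continuous_on_flat)

lemma flat'_borel [measurable]: "flat' \<in> borel_measurable borel"
  unfolding flat'_def by measurable

section \<open>Limits under the integral sign and L1 continuity of translations\<close>

section \<open>Translation in L1 and dominated convergence\<close>

text \<open>Convergence in L1 gives almost everywhere convergence only along a subsequence; this
  principle carries the conclusions drawn there over to the full sequence. A sequence that does not
  converge to L stays away from L on an infinite set of indices, and its enumeration has no
  subsequence tending to L.\<close>

lemma LIMSEQ_subsequence_principle:
  fixes X :: "nat \<Rightarrow> 'a::metric_space"
  assumes "\<And>r :: nat \<Rightarrow> nat. strict_mono r \<Longrightarrow> \<exists>s :: nat \<Rightarrow> nat. strict_mono s \<and> (\<lambda>k. X (r (s k))) \<longlonglongrightarrow> L"
  shows "X \<longlonglongrightarrow> L"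
proof (rule ccontr)
  assume "\<not> X \<longlonglongrightarrow> L"
  then obtain e where e: "e > 0" "\<And>n. \<exists>k\<ge>n. dist (X k) L \<ge> e"
    unfolding lim_sequentially by (meson not_le)
  then have inf: "infinite {k. dist (X k) L \<ge> e}"
    by (metis (mono_tags, lifting) finite_nat_set_iff_bounded_le mem_Collect_eq not_less_eq_eq)
  define r where "r = enumerate {k. dist (X k) L \<ge> e}"
  have "strict_mono r" unfolding r_def by (rule strict_mono_enumerate[OF inf])
  then obtain s where "(\<lambda>k. X (r (s k))) \<longlonglongrightarrow> L" using assms[of r] by blast
  moreover have "dist (X (r k)) L \<ge> e" for k
    using enumerate_in_set[OF inf] unfolding r_def by auto
  ultimately show False
    using e(1) unfolding lim_sequentially by (meson not_le order_refl)
qed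

text \<open>The majorants may vary with k as long as they converge almost everywhere and in L1. This
  is the situation for shifted products, whose natural majorant is shifted along with them.\<close>

lemma generalized_dominated_convergence:
  fixes f :: "nat \<Rightarrow> 'a \<Rightarrow> 'b::{banach, second_countable_topology}"
  assumes f_meas [measurable]: "\<And>k. f k \<in> borel_measurable M" "F \<in> borel_measurable M"
    and g: "\<And>k. integrable M (g k)" "integrable M G"
    and bound: "\<And>k x. norm (f k x) \<le> g k x"
    and lim: "AE x in M. (\<lambda>k. f k x) \<longlonglongrightarrow> F x" "AE x in M. (\<lambda>k. g k x) \<longlonglongrightarrow> G x"
    and L1: "(\<lambda>k. \<integral>x. \<bar>g k x - G x\<bar> \<partial>M) \<longlonglongrightarrow> 0"
  shows "(\<lambda>k. integral\<^sup>L M (f k)) \<longlonglongrightarrow> integral\<^sup>L M F"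
proof -
  have [measurable]: "g k \<in> borel_measurable M" "G \<in> borel_measurable M" for k
    using g by (auto dest: borel_measurable_integrable)
  \<comment> \<open>The damping factor brings \<open>f k\<close> below the fixed majorant |G|, where
    ordinary dominated convergence applies; what it removes is at most |g k - G|, which vanishes in
    L1.\<close>
  define c where "c k x = (if g k x = 0 then 0 else min 1 (\<bar>G x\<bar> / g k x))" for k x
  have [measurable]: "(\<lambda>x. c k x) \<in> borel_measurable M" for k unfolding c_def by measurable
  have gnn: "0 \<le> g k x" for k x using bound[of k x] norm_ge_zero order_trans by blast
  have c01: "0 \<le> c k x" "c k x \<le> 1" "c k x * g k x \<le> \<bar>G x\<bar>"
    "(1 - c k x) * g k x \<le> \<bar>g k x - G x\<bar>" for k x
  proof -
    show "0 \<le> c k x" "c k x \<le> 1" using gnn[of k x] by (auto simp: c_def)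
    have "c k x * g k x = min (g k x) \<bar>G x\<bar>"
    proof (cases "g k x = 0")
      case False
      then have "g k x > 0" using gnn[of k x] by simp
      then show ?thesis by (auto simp: c_def min_def field_simps)
    qed auto
    then show "c k x * g k x \<le> \<bar>G x\<bar>" "(1 - c k x) * g k x \<le> \<bar>g k x - G x\<bar>"
      using gnn[of k x] by (auto simp: left_diff_distrib)
  qed
  have fi: "integrable M (f k)" for k
    by (rule Bochner_Integration.integrable_bound[OF g(1)[of k]]) (use bound gnn in auto)
  have cfb: "norm (c k x *\<^sub>R f k x) \<le> \<bar>G x\<bar>" for k x
    using mult_left_mono[OF bound[of k x] c01(1)[of k x]] c01[of k x] by simp
  have cfi: "integrable M (\<lambda>x. c k x *\<^sub>R f k x)" for k
    by (rule Bochner_Integration.integrable_bound[OF g(2)]) (use cfb in auto)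
  have "AE x in M. (\<lambda>k. c k x *\<^sub>R f k x) \<longlonglongrightarrow> F x"
    using lim
  proof eventually_elim
    case (elim x)
    show ?case
    proof (cases "G x = 0")
      case True
      have "(\<lambda>k. f k x) \<longlonglongrightarrow> 0"
        by (rule Lim_null_comparison[OF _ elim(2)[unfolded True]]) (simp add: bound)
      then have "F x = 0" using elim(1) LIMSEQ_unique by blast
      moreover have "c k x *\<^sub>R f k x = 0" for k
        using cfb[of k x] unfolding True by (metis abs_zero norm_le_zero_iff)
      ultimately show ?thesis by (simp only: tendsto_const)
    next
      case False
      have "G x \<ge> 0" using LIMSEQ_le_const[OF elim(2)] gnn by blast
      have "\<forall>\<^sub>F k in sequentially. g k x \<noteq> 0"
        using tendsto_imp_eventually_ne[OF elim(2) False] .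
      then have ev: "\<forall>\<^sub>F k in sequentially. min 1 (\<bar>G x\<bar> / g k x) = c k x"
        by eventually_elim (simp add: c_def)
      have "(\<lambda>k. min 1 (\<bar>G x\<bar> / g k x)) \<longlonglongrightarrow> min 1 (\<bar>G x\<bar> / G x)"
        by (intro tendsto_intros elim False)
      then have "(\<lambda>k. c k x) \<longlonglongrightarrow> 1"
        using Lim_transform_eventually[OF _ ev] False \<open>G x \<ge> 0\<close> by simp
      from tendsto_scaleR[OF this elim(1)] show ?thesis by simp
    qed
  qed
  then have 1: "(\<lambda>k. \<integral>x. c k x *\<^sub>R f k x \<partial>M) \<longlonglongrightarrow> integral\<^sup>L M F"
    by (intro integral_dominated_convergence[where w = "\<lambda>x. \<bar>G x\<bar>"])
      (use cfb g(2) in auto)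
  have "norm (integral\<^sup>L M (f k) - (\<integral>x. c k x *\<^sub>R f k x \<partial>M)) \<le> (\<integral>x. \<bar>g k x - G x\<bar> \<partial>M)" for k
  proof -
    have "norm (integral\<^sup>L M (f k) - (\<integral>x. c k x *\<^sub>R f k x \<partial>M))
        = norm (\<integral>x. f k x - c k x *\<^sub>R f k x \<partial>M)"
      by (simp add: fi cfi)
    also have "\<dots> \<le> (\<integral>x. \<bar>g k x - G x\<bar> \<partial>M)"
    proof (rule order_trans[OF integral_norm_bound integral_mono])
      fix x
      have "f k x - c k x *\<^sub>R f k x = (1 - c k x) *\<^sub>R f k x" by (simp add: scaleR_left_diff_distrib)
      then have "norm (f k x - c k x *\<^sub>R f k x) = (1 - c k x) * norm (f k x)"
        using c01(2)[of k x] by simp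
      also have "\<dots> \<le> (1 - c k x) * g k x"
        using c01(2)[of k x] bound[of k x] by (intro mult_left_mono) auto
      finally show "norm (f k x - c k x *\<^sub>R f k x) \<le> \<bar>g k x - G x\<bar>" using c01(4)[of k x] by simp
    qed (use fi cfi g in \<open>auto intro!: integrable_norm\<close>)
    finally show ?thesis .
  qed
  then have "(\<lambda>k. integral\<^sup>L M (f k) - (\<integral>x. c k x *\<^sub>R f k x \<partial>M)) \<longlonglongrightarrow> 0"
    by (intro Lim_null_comparison[OF _ L1]) auto
  from tendsto_add[OF this 1] show ?thesis by simp
qed

lemma nn_integral_lborel_shift:
  fixes f :: "'a::euclidean_space \<Rightarrow> ennreal"
  assumes [measurable]: "f \<in> borel_measurable borel"
  shows "(\<integral>\<^sup>+x. f (x + a) \<partial>lborel) = (\<integral>\<^sup>+x. f x \<partial>lborel)"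
proof -
  have "(\<integral>\<^sup>+x. f x \<partial>distr lborel borel ((+) a)) = (\<integral>\<^sup>+x. f (a + x) \<partial>lborel)"
    by (rule nn_integral_distr) auto
  then show ?thesis by (simp add: lborel_distr_plus add.commute)
qed

lemma integrable_lborel_shift:
  fixes f :: "'a::euclidean_space \<Rightarrow> 'b::{banach, second_countable_topology}"
  assumes "integrable lborel f"
  shows "integrable lborel (\<lambda>x. f (x + a))"
proof -
  have [measurable]: "f \<in> borel_measurable borel" using assms by (auto dest: borel_measurable_integrable)
  have "integrable (distr lborel borel ((+) a)) f" using assms by (simp add: lborel_distr_plus)
  then show ?thesis by (subst (asm) integrable_distr_eq) (auto simp: add.commute)
qed

lemma integral_lborel_shift:
  fixes f :: "'a::euclidean_space \<Rightarrow> 'b::{banach, second_countable_topology}"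
  assumes [measurable]: "f \<in> borel_measurable borel"
  shows "(\<integral>x. f (x + a) \<partial>lborel) = (\<integral>x. f x \<partial>lborel)"
proof -
  have "(\<integral>x. f x \<partial>distr lborel borel ((+) a)) = (\<integral>x. f (a + x) \<partial>lborel)"
    by (rule integral_distr) auto
  then show ?thesis by (simp add: lborel_distr_plus add.commute)
qed

text \<open>Translation preserves measure, so the symmetric difference of U and its translate has
  twice the measure of the part of U that is lost. That part shrinks to 0 by dominated convergence,
  since a point of an open set stays in the set under small shifts.\<close>

lemma translation_L1_open:
  fixes U :: "'a::euclidean_space set"
  assumes U: "open U" "emeasure lborel U < \<infinity>" and h: "h \<longlonglongrightarrow> 0"
  shows "(\<lambda>k. \<integral>x. \<bar>indicator U (x + h k) - indicator U x :: real\<bar> \<partial>lborel) \<longlonglongrightarrow> 0"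
proof -
  have [measurable]: "U \<in> sets borel" using U by auto
  have i: "integrable lborel (indicator U :: 'a \<Rightarrow> real)" using U by auto
  note ih = integrable_lborel_shift[OF i]
  have ip: "integrable lborel (\<lambda>x. indicator U x * (1 - indicator U (x + a)) :: real)" for a
    by (rule Bochner_Integration.integrable_bound[OF i]) (auto split: split_indicator)
  have eq: "(\<integral>x. \<bar>indicator U (x + a) - indicator U x :: real\<bar> \<partial>lborel)
    = 2 * (\<integral>x. indicator U x * (1 - indicator U (x + a)) \<partial>lborel)" for a
  proof -
    have "(\<integral>x. \<bar>indicator U (x + a) - indicator U x :: real\<bar> \<partial>lborel)
      = (\<integral>x. (indicator U (x + a) - indicator U x)
        + 2 * (indicator U x * (1 - indicator U (x + a))) \<partial>lborel)"
      by (rule Bochner_Integration.integral_cong) (auto split: split_indicator)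
    also have "\<dots> = 2 * (\<integral>x. indicator U x * (1 - indicator U (x + a)) \<partial>lborel)"
      using integral_lborel_shift[of "indicator U :: 'a \<Rightarrow> real" a] i ih ip by simp
    finally show ?thesis .
  qed
  have "(\<lambda>k. \<integral>x. indicator U x * (1 - indicator U (x + h k)) \<partial>lborel) \<longlonglongrightarrow> (\<integral>x. (0::real) \<partial>(lborel::'a measure))"
  proof (rule integral_dominated_convergence[where w = "indicator U"])
    show "AE x in lborel. (\<lambda>k. indicator U x * (1 - indicator U (x + h k)) :: real) \<longlonglongrightarrow> 0"
    proof (rule AE_I2)
      fix x
      show "(\<lambda>k. indicator U x * (1 - indicator U (x + h k)) :: real) \<longlonglongrightarrow> 0"
      proof (cases "x \<in> U")
        case True
        have "(\<lambda>k. x + h k) \<longlonglongrightarrow> x + 0" by (intro tendsto_intros h)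
        then have "\<forall>\<^sub>F k in sequentially. x + h k \<in> U"
          using topological_tendstoD[OF _ U(1)] True by fastforce
        then have "\<forall>\<^sub>F k in sequentially. indicator U x * (1 - indicator U (x + h k)) = (0::real)"
          by eventually_elim simp
        then show ?thesis by (rule tendsto_eventually)
      qed auto
    qed
  qed (use i in \<open>auto split: split_indicator\<close>)
  then show ?thesis unfolding eq by (simp add: tendsto_mult_right_zero)
qed

text \<open>Induction over the integrable functions. Indicators of Borel sets are approximated from
  outside by open sets, and translating both functions leaves their L1 distance unchanged, so the
  approximation is equally good before and after the shift.\<close>

lemma translation_L1:
  fixes f :: "'a::euclidean_space \<Rightarrow> 'b::{banach, second_countable_topology}"
  assumes f: "integrable lborel f" and h: "h \<longlonglongrightarrow> 0"
  shows "(\<lambda>k. \<integral>x. norm (f (x + h k) - f x) \<partial>lborel) \<longlonglongrightarrow> 0"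
  using f
proof induction
  case (base A c)
  have [measurable]: "A \<in> sets borel" using base by auto
  have iA: "integrable lborel (indicator A :: 'a \<Rightarrow> real)" using base by auto
  have "(\<lambda>k. \<integral>x. \<bar>indicator A (x + h k) - indicator A x :: real\<bar> \<partial>lborel) \<longlonglongrightarrow> 0"
  proof (rule LIMSEQ_I)
    fix e :: real assume "e > 0"
    then obtain U where U: "open U" "A \<subseteq> U" "emeasure lborel (U - A) < e / 3"
      using outer_regular_lborel[of A "e/3"] by (auto simp: ennreal_divide_numeral)
    have [measurable]: "U \<in> sets borel" using U by auto
    have "emeasure lborel U \<le> emeasure lborel A + emeasure lborel (U - A)"
      using emeasure_subadditive[of A lborel "U - A"] U(2) by (simp add: Un_absorb1)
    also have "\<dots> < \<infinity>" using base(2) U(3) by (simp add: less_top order.strict_trans)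
    finally have Ufin: "emeasure lborel U < \<infinity>" .
    have iU: "integrable lborel (indicator U :: 'a \<Rightarrow> real)" using Ufin by auto
    have UA: "(\<integral>x. \<bar>indicator U x - indicator A x :: real\<bar> \<partial>lborel) < e / 3"
    proof -
      have "(\<integral>x. \<bar>indicator U x - indicator A x :: real\<bar> \<partial>lborel) = (\<integral>x. indicator (U - A) x \<partial>lborel)"
        using U(2) by (intro Bochner_Integration.integral_cong) (auto split: split_indicator)
      also have "\<dots> = measure lborel (U - A)" by simp
      also have "\<dots> < e / 3" using U(3) \<open>e > 0\<close> unfolding measure_def
        by (metis divide_pos_pos ennreal_less_iff enn2real_less_iff enn2real_nonneg ennreal_enn2real_if order_less_imp_le zero_less_numeral not_less_iff_gr_or_eq infinity_ennreal_def less_top)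
      finally show ?thesis .
    qed
    have UAh: "(\<integral>x. \<bar>indicator U (x + a) - indicator A (x + a) :: real\<bar> \<partial>lborel) < e / 3" for a
      using integral_lborel_shift[of "\<lambda>x. \<bar>indicator U x - indicator A x :: real\<bar>" a] UA by simp
    obtain N where N: "\<And>k. k \<ge> N \<Longrightarrow>
        \<bar>\<integral>x. \<bar>indicator U (x + h k) - indicator U x :: real\<bar> \<partial>lborel\<bar> < e / 3"
      using LIMSEQ_D[OF translation_L1_open[OF U(1) Ufin h], of "e/3"] \<open>e > 0\<close> by auto
    show "\<exists>N. \<forall>k\<ge>N. norm ((\<integral>x. \<bar>indicator A (x + h k) - indicator A x :: real\<bar> \<partial>lborel) - 0) < e"
    proof (intro exI allI impI)
      fix k assume "N \<le> k"
      have ints: "integrable lborel (\<lambda>x. \<bar>indicator U (x + h k) - indicator A (x + h k) :: real\<bar>)"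
        "integrable lborel (\<lambda>x. \<bar>indicator U (x + h k) - indicator U x :: real\<bar>)"
        "integrable lborel (\<lambda>x. \<bar>indicator U x - indicator A x :: real\<bar>)"
        using iA iU integrable_lborel_shift[OF iA] integrable_lborel_shift[OF iU] by auto
      have "(\<integral>x. \<bar>indicator A (x + h k) - indicator A x :: real\<bar> \<partial>lborel)
        \<le> (\<integral>x. \<bar>indicator U (x + h k) - indicator A (x + h k)\<bar> + \<bar>indicator U (x + h k) - indicator U x\<bar>
            + \<bar>indicator U x - indicator A x\<bar> \<partial>lborel)"
        using ints iA integrable_lborel_shift[OF iA]
        by (intro integral_mono) (auto split: split_indicator)
      also have "\<dots> = (\<integral>x. \<bar>indicator U (x + h k) - indicator A (x + h k)\<bar> \<partial>lborel)
         + (\<integral>x. \<bar>indicator U (x + h k) - indicator U x\<bar> \<partial>lborel)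
            + (\<integral>x. \<bar>indicator U x - indicator A x\<bar> \<partial>lborel)"
        using ints by simp
      also have "\<dots> < e" using UA UAh[of "h k"] N[OF \<open>N \<le> k\<close>] by linarith
      finally show "norm ((\<integral>x. \<bar>indicator A (x + h k) - indicator A x :: real\<bar> \<partial>lborel) - 0) < e"
        by simp
    qed
  qed
  then have "(\<lambda>k. (\<integral>x. \<bar>indicator A (x + h k) - indicator A x :: real\<bar> \<partial>lborel) * norm c) \<longlonglongrightarrow> 0"
    by (rule tendsto_mult_left_zero)
  moreover have "(\<integral>x. norm (indicator A (x + a) *\<^sub>R c - indicator A x *\<^sub>R c) \<partial>lborel)
     = (\<integral>x. \<bar>indicator A (x + a) - indicator A x :: real\<bar> \<partial>lborel) * norm c" for a
    by (simp flip: scaleR_left_diff_distrib)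
  ultimately show ?case by simp
next
  case (add f g)
  note i = add(1,2) integrable_lborel_shift[OF add(1)] integrable_lborel_shift[OF add(2)]
  show ?case
  proof (rule Lim_null_comparison)
    show "\<forall>\<^sub>F k in sequentially. norm (\<integral>x. norm (f (x + h k) + g (x + h k) - (f x + g x)) \<partial>lborel)
      \<le> (\<integral>x. norm (f (x + h k) - f x) \<partial>lborel) + (\<integral>x. norm (g (x + h k) - g x) \<partial>lborel)"
    proof (intro always_eventually allI)
      fix k
      have "(\<integral>x. norm (f (x + h k) + g (x + h k) - (f x + g x)) \<partial>lborel)
        \<le> (\<integral>x. norm (f (x + h k) - f x) + norm (g (x + h k) - g x) \<partial>lborel)"
        using i by (intro integral_mono integrable_norm Bochner_Integration.integrable_add
            Bochner_Integration.integrable_diff) (auto simp: norm_diff_triangle_ineq)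
      also have "\<dots> = (\<integral>x. norm (f (x + h k) - f x) \<partial>lborel) + (\<integral>x. norm (g (x + h k) - g x) \<partial>lborel)"
        using i by (intro Bochner_Integration.integral_add integrable_norm Bochner_Integration.integrable_diff)
      finally show "norm (\<integral>x. norm (f (x + h k) + g (x + h k) - (f x + g x)) \<partial>lborel)
        \<le> (\<integral>x. norm (f (x + h k) - f x) \<partial>lborel) + (\<integral>x. norm (g (x + h k) - g x) \<partial>lborel)"
        by simp
    qed
    show "(\<lambda>k. (\<integral>x. norm (f (x + h k) - f x) \<partial>lborel) + (\<integral>x. norm (g (x + h k) - g x) \<partial>lborel)) \<longlonglongrightarrow> 0"
      using tendsto_add[OF add(3,4)] by simp
  qed
next
  case (lim f s)
  have [measurable]: "f \<in> borel_measurable borel" "\<And>i. s i \<in> borel_measurable borel"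
    using lim by (auto dest: borel_measurable_integrable)
  have "(\<lambda>i. \<integral>x. norm (s i x - f x) \<partial>lborel) \<longlonglongrightarrow> (\<integral>x. 0 \<partial>(lborel::'a measure))"
  proof (rule integral_dominated_convergence[where w = "\<lambda>x. 3 * norm (f x)"])
    show "AE x in lborel. (\<lambda>i. norm (s i x - f x)) \<longlonglongrightarrow> 0"
      using lim(2) by (intro AE_I2 tendsto_norm_zero LIM_zero) simp
    show "AE x in lborel. norm (norm (s i x - f x)) \<le> 3 * norm (f x)" for i
      using lim(3)[of _ i] norm_triangle_ineq4[of "s i _" "f _"] by (auto intro!: AE_I2) (smt (verit))
  qed (use lim in auto)
  then have sf: "(\<lambda>i. \<integral>x. norm (s i x - f x) \<partial>lborel) \<longlonglongrightarrow> 0" by simp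
  show ?case
  proof (rule LIMSEQ_I)
    fix e :: real assume "e > 0"
    then obtain i where i: "(\<integral>x. norm (s i x - f x) \<partial>lborel) < e / 3"
      using LIMSEQ_D[OF sf, of "e/3"] by (metis abs_ge_self diff_zero divide_pos_pos order_le_less_trans order_refl real_norm_def zero_less_numeral)
    obtain N where N: "\<And>k. k \<ge> N \<Longrightarrow> norm ((\<integral>x. norm (s i (x + h k) - s i x) \<partial>lborel) - 0) < e / 3"
      using LIMSEQ_D[OF lim.IH[of i], of "e/3"] \<open>e > 0\<close> by auto
    note ii = lim(1)[of i] lim(4) integrable_lborel_shift[OF lim(1)[of i]] integrable_lborel_shift[OF lim(4)]
    show "\<exists>N. \<forall>k\<ge>N. norm ((\<integral>x. norm (f (x + h k) - f x) \<partial>lborel) - 0) < e"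
    proof (intro exI allI impI)
      fix k assume "N \<le> k"
      have "(\<integral>x. norm (f (x + h k) - f x) \<partial>lborel)
        \<le> (\<integral>x. norm (s i (x + h k) - f (x + h k)) + norm (s i (x + h k) - s i x)
            + norm (s i x - f x) \<partial>lborel)"
      proof (intro integral_mono integrable_norm Bochner_Integration.integrable_add
            Bochner_Integration.integrable_diff ii)
        fix x
        have "f (x + h k) - f x = - (s i (x + h k) - f (x + h k)) + (s i (x + h k) - s i x)
            + (s i x - f x)" by simp
        then show "norm (f (x + h k) - f x) \<le> norm (s i (x + h k) - f (x + h k))
            + norm (s i (x + h k) - s i x) + norm (s i x - f x)"
          by (metis add_mono_thms_linordered_semiring(3) norm_minus_cancel norm_triangle_ineq norm_triangle_le)
      qed
      also have "\<dots> = (\<integral>x. norm (s i (x + h k) - f (x + h k)) \<partial>lborel)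
          + (\<integral>x. norm (s i (x + h k) - s i x) \<partial>lborel) + (\<integral>x. norm (s i x - f x) \<partial>lborel)"
        by (simp add: ii)
      also have "(\<integral>x. norm (s i (x + h k) - f (x + h k)) \<partial>lborel) = (\<integral>x. norm (s i x - f x) \<partial>lborel)"
        by (rule integral_lborel_shift) measurable
      finally show "norm ((\<integral>x. norm (f (x + h k) - f x) \<partial>lborel) - 0) < e"
        using i N[OF \<open>N \<le> k\<close>] by simp
    qed
  qed
qed

section \<open>The lattice, its fundamental cell and translation invariance on the torus\<close>

section \<open>Periodic functions and the torus cell\<close>

definition periodic :: "(space \<Rightarrow> 'b) \<Rightarrow> bool" where
  "periodic g \<longleftrightarrow> (\<forall>b\<in>Basis. \<forall>x. g (x + b) = g x)"

definition lattice :: "space set" where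
  "lattice = {k. \<forall>b\<in>Basis. k \<bullet> b \<in> \<int>}"

text \<open>Rounding selects exactly one lattice point for every x, also on the faces of the cell,
  so x - \<open>nearest\<close> x is a canonical representative of x modulo the lattice.\<close>

definition nearest :: "space \<Rightarrow> space" where
  "nearest x = (\<Sum>b\<in>Basis. of_int (round (x \<bullet> b)) *\<^sub>R b)"

lemma nearest_inner: "b \<in> Basis \<Longrightarrow> nearest x \<bullet> b = of_int (round (x \<bullet> b))"
  by (simp add: nearest_def)

lemma nearest_lattice: "nearest x \<in> lattice"
  by (simp add: lattice_def nearest_inner)

lemma lattice_closed: "k \<in> lattice \<Longrightarrow> l \<in> lattice \<Longrightarrow> k + l \<in> lattice"
  "k \<in> lattice \<Longrightarrow> l \<in> lattice \<Longrightarrow> k - l \<in> lattice" "k \<in> lattice \<Longrightarrow> - k \<in> lattice" "0 \<in> lattice"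
  "b \<in> Basis \<Longrightarrow> b \<in> lattice"
  by (auto simp: lattice_def inner_simps inner_Basis)

lemma round_add_Int: "(k::real) \<in> \<int> \<Longrightarrow> of_int (round (x + k)) = of_int (round x) + k"
proof (elim Ints_cases)
  fix z assume z: "k = of_int z"
  have "x + of_int z + 1/2 = (x + 1/2) + of_int z" by simp
  then show ?thesis unfolding z round_def by (simp only: floor_add_int[symmetric] of_int_add)
qed

lemma nearest_add: "k \<in> lattice \<Longrightarrow> nearest (x + k) = nearest x + k"
  by (rule euclidean_eqI) (simp add: nearest_inner inner_simps lattice_def round_add_Int)

lemma nearest_add_Basis: "b \<in> Basis \<Longrightarrow> nearest (x + b) = nearest x + b"
  by (rule nearest_add) (rule lattice_closed)

lemma periodic_lattice:
  assumes "periodic g" "k \<in> lattice" shows "g (x + k) = g x"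
proof -
  have nat: "g (x + of_nat n *\<^sub>R b) = g x" if "b \<in> Basis" for x b n
  proof (induction n arbitrary: x)
    case (Suc n)
    have "g (x + of_nat (Suc n) *\<^sub>R b) = g ((x + of_nat n *\<^sub>R b) + b)" by (simp add: algebra_simps)
    then show ?case using assms(1) that Suc by (simp add: periodic_def)
  qed simp
  have int: "g (x + of_int n *\<^sub>R b) = g x" if "b \<in> Basis" for x b n
  proof (cases "n \<ge> 0")
    case True then show ?thesis using nat[OF that, of x "nat n"] by simp
  next
    case False then show ?thesis using nat[OF that, of "x + of_int n *\<^sub>R b" "nat (- n)"] by simp
  qed
  have "g (x + (\<Sum>b\<in>B. (k \<bullet> b) *\<^sub>R b)) = g x" if "finite B" "B \<subseteq> Basis" for B
    using that
  proof (induction B arbitrary: x)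
    case (insert b B)
    then have "k \<bullet> b \<in> \<int>" using assms by (auto simp: lattice_def)
    then obtain n where "k \<bullet> b = of_int n" by (auto elim: Ints_cases)
    then show ?case
      using insert int[of b x n] insert.IH[of "x + (k \<bullet> b) *\<^sub>R b"] by (simp add: add.assoc)
  qed simp
  from this[of Basis] show ?thesis by (simp add: euclidean_representation)
qed

lemma periodic_nearest: "periodic g \<Longrightarrow> g (x - nearest x) = g x"
  using periodic_lattice[of g "- nearest x" x] by (simp add: lattice_closed nearest_lattice)

lemma periodic_minus_nearest: "periodic (\<lambda>x. g (x - nearest x))"
  by (simp add: periodic_def nearest_add_Basis)

lemma periodic_shift: "periodic g \<Longrightarrow> periodic (\<lambda>x. g (x + a))"
  by (simp add: periodic_def add.commute add.left_commute)

lemma nearest_borel [measurable]: "nearest \<in> borel_measurable borel"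
  unfolding nearest_def round_def by measurable

lemma mem_torus_cell: "x \<in> torus_cell \<longleftrightarrow> (\<forall>b\<in>Basis. \<bar>x \<bullet> b\<bar> \<le> 1/2)"
  by (auto simp: torus_cell_def mem_box inner_simps inner_Basis abs_le_iff)

lemma torus_cell_borel [measurable]: "torus_cell \<in> sets borel"
  by (simp add: torus_cell_def)

lemma frac_mem_torus_cell: "x - nearest x \<in> torus_cell"
  unfolding mem_torus_cell
  using of_int_round_abs_le[of "x \<bullet> _"] by (auto simp: inner_simps nearest_inner abs_minus_commute)

text \<open>The points that round to 0 form a half-open cube, whose lattice translates tile space
  without overlap; the closed \<open>torus_cell\<close> differs from it at most on the faces, which
  are null.\<close>

lemma AE_torus_cell: "AE x in lborel. x \<in> torus_cell \<longleftrightarrow> nearest x = 0"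
proof -
  let ?h = "(1/2) *\<^sub>R One :: space"
  have "cbox (- ?h) ?h - box (- ?h) ?h \<in> null_sets lborel"
    by (rule null_sets_cbox_Diff_box)
  then have "AE x in lborel. x \<notin> cbox (- ?h) ?h - box (- ?h) ?h" by (rule AE_not_in)
  then show ?thesis
  proof eventually_elim
    case (elim x)
    have "nearest x = 0" if "x \<in> box (- ?h) ?h"
    proof (rule euclidean_eqI)
      fix b :: space assume b: "b \<in> Basis"
      then have "\<bar>x \<bullet> b\<bar> < 1/2" using that by (auto simp: mem_box)
      then have "round (x \<bullet> b) = 0" by (intro round_unique') simp
      then show "nearest x \<bullet> b = 0 \<bullet> b" using b by (simp add: nearest_inner)
    qed
    moreover have "x \<in> torus_cell" if "nearest x = 0"
      using frac_mem_torus_cell[of x] that by simp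
    ultimately show ?case using elim unfolding torus_cell_def by blast
  qed
qed

lemma countable_lattice: "countable lattice"
proof -
  have "lattice \<subseteq> (\<lambda>f. \<chi> i. f i) ` (PiE UNIV (\<lambda>_. \<int>))"
  proof
    fix k assume k: "k \<in> lattice"
    have "k $ i \<in> \<int>" for i
      using k by (auto simp: lattice_def Basis_vec_def inner_axis dest!: bspec[of _ _ "axis i 1"])
    then show "k \<in> (\<lambda>f. \<chi> i. f i) ` (PiE UNIV (\<lambda>_. \<int>))"
      by (intro image_eqI[of _ _ "\<lambda>i. k $ i"]) (auto simp: vec_eq_iff)
  qed
  moreover have "countable (PiE (UNIV::3 set) (\<lambda>_. \<int> :: real set))"
    by (intro countable_PiE) (auto simp: countable_int)
  ultimately show ?thesis by (meson countable_image countable_subset)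
qed

text \<open>Unfolding over the lattice: space is the disjoint union of the translates of the
  half-open cell \<open>Q\<close>, and also of the translates of the shifted cell. Cutting the
  shifted cell along the first tiling and moving the pieces back by lattice vectors reassembles
  \<open>Q\<close>, and a periodic function does not notice the move.\<close>

lemma nn_integral_cell_shift:
  assumes [measurable]: "h \<in> borel_measurable borel" and h: "periodic (h :: space \<Rightarrow> ennreal)"
  shows "(\<integral>\<^sup>+x. indicator torus_cell x * h (x + a) \<partial>lborel) = (\<integral>\<^sup>+x. indicator torus_cell x * h x \<partial>lborel)"
proof -
  define Q where "Q = {x. nearest x = 0}"
  have [measurable]: "Q \<in> sets borel" unfolding Q_def by measurable
  have cell: "(\<integral>\<^sup>+x. indicator torus_cell x * g x \<partial>lborel) = (\<integral>\<^sup>+x. indicator Q x * g x \<partial>lborel)" for g :: "space \<Rightarrow> ennreal"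
    by (rule nn_integral_cong_AE) (use AE_torus_cell in \<open>auto elim!: eventually_mono simp: Q_def split: split_indicator\<close>)
  have inf: "infinite lattice"
  proof
    assume fin: "finite lattice"
    obtain b :: space where b: "b \<in> Basis" by (meson SOME_Basis)
    have "range (\<lambda>n::nat. real n *\<^sub>R b) \<subseteq> lattice"
      using b by (auto simp: lattice_def inner_Basis)
    moreover have "inj (\<lambda>n::nat. real n *\<^sub>R b)" using b by (auto simp: inj_on_def)
    ultimately show False using fin finite_subset range_inj_infinite by blast
  qed
  define e where "e = from_nat_into lattice"
  have e: "bij_betw e UNIV lattice" unfolding e_def
    using bij_betw_from_nat_into[OF countable_lattice inf] .
  have el: "e n \<in> lattice" for n using e by (auto simp: bij_betw_def)
  have eall: "\<exists>n. e n = k" if "k \<in> lattice" for k using e that unfolding bij_betw_def by (metis imageE)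
  have einj: "e n = e m \<Longrightarrow> n = m" for n m using e by (auto simp: bij_betw_def inj_on_def)
  \<comment> \<open>Exactly one lattice vector equals \<open>nearest x\<close>, so the sum collapses
    to a single term; \<open>part2\<close> is the same for the shifted tiling.\<close>
  have part1: "(\<Sum>n. c * indicator {x. nearest x = e n} x) = c" for c :: ennreal and x
  proof -
    obtain n where "e n = nearest x" using eall nearest_lattice by blast
    then show ?thesis
      by (intro suminf_cmult_indicator[where i = n and f = "\<lambda>_. c"])
        (auto simp: disjoint_family_on_def dest: einj)
  qed
  have Qe: "x + e n - a \<in> Q \<longleftrightarrow> - nearest (x - a) = e n" for x n
    using nearest_add[OF el[of n], of "x - a"]
    by (simp add: Q_def algebra_simps) (metis add.commute add_eq_0_iff2 neg_eq_iff_add_eq_0)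
  have part2: "(\<Sum>n. c * indicator Q (x + e n - a)) = c" for c :: ennreal and x
  proof -
    obtain n where "e n = - nearest (x - a)" using eall nearest_lattice lattice_closed(3) by blast
    then have "x + e n - a \<in> Q" using Qe[of x n] by simp
    then have "(\<Sum>n. c * indicator {x. x + e n - a \<in> Q} x) = c"
      by (intro suminf_cmult_indicator[where i = n and f = "\<lambda>_. c"])
        (auto simp: disjoint_family_on_def Qe dest: einj)
    moreover have "indicator {x. x + e n - a \<in> Q} x = (indicator Q (x + e n - a) :: ennreal)" for n
      by (auto split: split_indicator)
    ultimately show ?thesis by simp
  qed
  have "(\<integral>\<^sup>+x. indicator Q x * h (x + a) \<partial>lborel) = (\<integral>\<^sup>+x. indicator Q (x - a) * h x \<partial>lborel)"
    using nn_integral_lborel_shift[of "\<lambda>x. indicator Q (x - a) * h x" a] by simp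
  also have "\<dots> = (\<integral>\<^sup>+x. (\<Sum>n. (indicator Q (x - a) * h x) * indicator {x. nearest x = e n} x) \<partial>lborel)"
    by (simp only: part1)
  also have "\<dots> = (\<Sum>n. \<integral>\<^sup>+x. (indicator Q (x - a) * h x) * indicator {x. nearest x = e n} x \<partial>lborel)"
    by (rule nn_integral_suminf) measurable
  also have "\<dots> = (\<Sum>n. \<integral>\<^sup>+x. (indicator Q x * h x) * indicator Q (x + e n - a) \<partial>lborel)"
  proof (rule arg_cong[where f = suminf], rule ext)
    fix n
    have "(\<integral>\<^sup>+x. (indicator Q (x - a) * h x) * indicator {x. nearest x = e n} x \<partial>lborel)
      = (\<integral>\<^sup>+x. (indicator Q (x + e n - a) * h (x + e n)) * indicator {x. nearest x = e n} (x + e n) \<partial>lborel)"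
      by (rule nn_integral_lborel_shift[symmetric]) measurable
    also have "\<dots> = (\<integral>\<^sup>+x. (indicator Q x * h x) * indicator Q (x + e n - a) \<partial>lborel)"
      by (rule nn_integral_cong)
        (auto simp: periodic_lattice[OF h el] nearest_add[OF el] Q_def split: split_indicator)
    finally show "(\<integral>\<^sup>+x. (indicator Q (x - a) * h x) * indicator {x. nearest x = e n} x \<partial>lborel)
      = (\<integral>\<^sup>+x. (indicator Q x * h x) * indicator Q (x + e n - a) \<partial>lborel)" .
  qed
  also have "\<dots> = (\<integral>\<^sup>+x. (\<Sum>n. (indicator Q x * h x) * indicator Q (x + e n - a)) \<partial>lborel)"
    by (rule nn_integral_suminf[symmetric]) measurable
  also have "\<dots> = (\<integral>\<^sup>+x. indicator Q x * h x \<partial>lborel)"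
    by (simp only: part2)
  finally show ?thesis unfolding cell .
qed

section \<open>Finite measures for the cell, the time interval and the cylinder\<close>

definition cell_measure :: "space measure" where
  "cell_measure = density lborel (indicator torus_cell)"

definition time_measure :: "real \<Rightarrow> real measure" where
  "time_measure T = density lborel (indicator {0<..<T})"

text \<open>The product form makes Fubini in time and space directly available;
  \<open>cyl_measure_eq\<close> identifies the measure with Lebesgue measure on
  \<open>torus_cyl T\<close>.\<close>

definition cyl_measure :: "real \<Rightarrow> spacetime measure" where
  "cyl_measure T = time_measure T \<Otimes>\<^sub>M cell_measure"

lemma sets_cell_measure [measurable_cong, simp]: "sets cell_measure = sets borel"
  and space_cell_measure [simp]: "space cell_measure = UNIV"
  and sets_time_measure [measurable_cong, simp]: "sets (time_measure T) = sets borel"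
  and space_time_measure [simp]: "space (time_measure T) = UNIV"
  by (simp_all add: cell_measure_def time_measure_def)

lemma sets_cyl_measure [measurable_cong, simp]: "sets (cyl_measure T) = sets borel"
proof -
  have "sets (cyl_measure T) = sets (borel \<Otimes>\<^sub>M borel)"
    unfolding cyl_measure_def by (rule sets_pair_measure_cong) auto
  then show ?thesis by (simp only: borel_prod)
qed

lemma space_cyl_measure [simp]: "space (cyl_measure T) = UNIV"
  by (simp add: cyl_measure_def space_pair_measure)

lemma emeasure_cell_measure_UNIV: "emeasure cell_measure UNIV = 1"
proof -
  have "emeasure cell_measure UNIV = emeasure lborel torus_cell"
    by (simp add: cell_measure_def emeasure_density)
  also have "\<dots> = 1"
    unfolding torus_cell_def
    by (subst emeasure_lborel_cbox) (auto simp: inner_simps)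
  finally show ?thesis .
qed

lemma measure_cell_measure_UNIV [simp]: "measure cell_measure UNIV = 1"
  by (simp add: measure_def emeasure_cell_measure_UNIV)

interpretation cell: finite_measure cell_measure
  by standard (simp add: emeasure_cell_measure_UNIV)

lemma finite_time_measure: "finite_measure (time_measure T)"
proof
  have "emeasure (time_measure T) UNIV = emeasure lborel {0<..<T}"
    by (simp add: time_measure_def emeasure_density)
  also have "\<dots> \<le> emeasure lborel {0..T}" by (intro emeasure_mono) auto
  finally show "emeasure (time_measure T) (space (time_measure T)) \<noteq> \<infinity>"
    by (auto simp: emeasure_lborel_Icc_eq top_unique split: if_splits)
qed

interpretation time: finite_measure "time_measure T" for T by (rule finite_time_measure)
interpretation cyl: pair_sigma_finite "time_measure T" cell_measure for T ..

interpretation cyl: finite_measure "cyl_measure T" for T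
  unfolding cyl_measure_def
  by (intro finite_measure_pair_measure finite_time_measure cell.finite_measure_axioms)

lemma cyl_measure_eq: "cyl_measure T = density lborel (indicator (torus_cyl T))"
proof -
  have "cyl_measure T = density (lborel \<Otimes>\<^sub>M lborel)
      (\<lambda>(t, x). indicator {0<..<T} t * indicator torus_cell x)"
    unfolding cyl_measure_def time_measure_def cell_measure_def
    by (rule pair_measure_density)
      (auto intro: sigma_finite_lborel cell.sigma_finite_measure_axioms[unfolded cell_measure_def])
  also have "(\<lambda>(t, x). indicator {0<..<T} t * indicator torus_cell x :: ennreal) = indicator (torus_cyl T)"
    by (auto simp: torus_cyl_def split: split_indicator)
  finally show ?thesis by (simp add: lborel_prod)
qed

lemma nn_integral_cell_measure_shift:
  assumes [measurable]: "h \<in> borel_measurable borel" and h: "periodic (h :: space \<Rightarrow> ennreal)"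
  shows "(\<integral>\<^sup>+x. h (x + a) \<partial>cell_measure) = (\<integral>\<^sup>+x. h x \<partial>cell_measure)"
  unfolding cell_measure_def
  by (subst (1 2) nn_integral_density) (use nn_integral_cell_shift[OF assms] in auto)

text \<open>Invariance of nonnegative integrals becomes an equality of image measures under
  reduction to the cell, so that integrability and the integrals of Banach valued functions transfer
  together.\<close>

lemma distr_cell_shift:
  "distr cell_measure borel (\<lambda>x. (x + a) - nearest (x + a)) = distr cell_measure borel (\<lambda>x. x - nearest x)"
proof (rule measure_eqI)
  fix A assume "A \<in> sets (distr cell_measure borel (\<lambda>x. (x + a) - nearest (x + a)))"
  then have [measurable]: "A \<in> sets borel" by simp
  let ?h = "\<lambda>x. indicator A (x - nearest x) :: ennreal"
  have "emeasure (distr cell_measure borel (\<lambda>x. (x + b) - nearest (x + b))) A = (\<integral>\<^sup>+x. ?h (x + b) \<partial>cell_measure)" for b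
    by (simp add: nn_integral_distr flip: nn_integral_indicator)
  from this[of a] this[of 0]
  show "emeasure (distr cell_measure borel (\<lambda>x. (x + a) - nearest (x + a))) A
      = emeasure (distr cell_measure borel (\<lambda>x. x - nearest x)) A"
    using nn_integral_cell_measure_shift[of ?h a] periodic_minus_nearest[of "\<lambda>x. indicator A x :: ennreal"] by simp
qed simp

lemma cell_shift:
  fixes h :: "space \<Rightarrow> 'b::{banach, second_countable_topology}"
  assumes [measurable]: "h \<in> borel_measurable borel" and h: "periodic h"
  shows integrable_cell_shift: "integrable cell_measure (\<lambda>x. h (x + a)) \<longleftrightarrow> integrable cell_measure h"
    and integral_cell_shift: "(\<integral>x. h (x + a) \<partial>cell_measure) = (\<integral>x. h x \<partial>cell_measure)"
proof -
  have 1: "integrable cell_measure (\<lambda>x. h (x + b)) \<longleftrightarrow> integrable (distr cell_measure borel (\<lambda>x. (x + b) - nearest (x + b))) h" for b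
    by (subst integrable_distr_eq) (auto simp: periodic_nearest[OF h])
  have 2: "(\<integral>x. h (x + b) \<partial>cell_measure) = (\<integral>x. h x \<partial>distr cell_measure borel (\<lambda>x. (x + b) - nearest (x + b)))" for b
    by (subst integral_distr) (auto simp: periodic_nearest[OF h])
  show "integrable cell_measure (\<lambda>x. h (x + a)) \<longleftrightarrow> integrable cell_measure h"
    using 1[of a] 1[of 0] distr_cell_shift[of a] by simp
  show "(\<integral>x. h (x + a) \<partial>cell_measure) = (\<integral>x. h x \<partial>cell_measure)"
    using 2[of a] 2[of 0] distr_cell_shift[of a] by simp
qed

definition shift :: "space \<Rightarrow> spacetime \<Rightarrow> spacetime" where
  "shift a z = (fst z, snd z + a)"

definition x_periodic :: "(spacetime \<Rightarrow> 'b) \<Rightarrow> bool" where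
  "x_periodic f \<longleftrightarrow> (\<forall>t. periodic (\<lambda>x. f (t, x)))"

lemma borel_spacetime: "(borel :: spacetime measure) = borel \<Otimes>\<^sub>M borel"
  by (simp add: borel_prod)

lemma fst_borel [measurable (raw)]: "f \<in> borel_measurable M \<Longrightarrow> (\<lambda>x. fst (f x :: spacetime)) \<in> borel_measurable M"
  and snd_borel [measurable (raw)]: "f \<in> borel_measurable M \<Longrightarrow> (\<lambda>x. snd (f x :: spacetime)) \<in> borel_measurable M"
  by (auto intro: measurable_fst' measurable_snd' simp: borel_spacetime simp del: borel_prod)

lemma Pair_borel_spacetime [measurable (raw)]:
  "f \<in> M \<rightarrow>\<^sub>M borel \<Longrightarrow> g \<in> M \<rightarrow>\<^sub>M borel \<Longrightarrow> (\<lambda>x. (f x :: real, g x :: space)) \<in> borel_measurable M"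
  by (rule borel_measurable_Pair)

lemma shift_borel [measurable (raw)]:
  "f \<in> borel_measurable M \<Longrightarrow> g \<in> borel_measurable M \<Longrightarrow> (\<lambda>x. shift (g x) (f x)) \<in> borel_measurable M"
  unfolding shift_def by (intro Pair_borel_spacetime borel_measurable_add fst_borel snd_borel)

lemma fst_shift [simp]: "fst (shift a z) = fst z" and snd_shift [simp]: "snd (shift a z) = snd z + a"
  and shift_Pair [simp]: "shift a (t, x) = (t, x + a)" and shift_0 [simp]: "shift 0 z = z"
  and shift_shift [simp]: "shift a (shift b z) = shift (a + b) z"
  by (auto simp: shift_def add_ac)

lemma x_periodic_nearest: "x_periodic f \<Longrightarrow> f (fst z, snd z - nearest (snd z)) = f z"
  using periodic_nearest[of "\<lambda>x. f (fst z, x)" "snd z"] by (simp add: x_periodic_def)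

lemma nn_integral_cyl:
  "f \<in> borel_measurable borel \<Longrightarrow>
    (\<integral>\<^sup>+z. f z \<partial>cyl_measure T) = (\<integral>\<^sup>+t. \<integral>\<^sup>+x. f (t, x) \<partial>cell_measure \<partial>time_measure T)"
  unfolding cyl_measure_def
  by (rule cell.nn_integral_fst[symmetric])
    (subst measurable_cong_sets[OF sets_cyl_measure[unfolded cyl_measure_def] refl])

lemma nn_integral_cyl_shift:
  assumes [measurable]: "h \<in> borel_measurable borel" and h: "x_periodic (h :: spacetime \<Rightarrow> ennreal)"
  shows "(\<integral>\<^sup>+z. h (shift a z) \<partial>cyl_measure T) = (\<integral>\<^sup>+z. h z \<partial>cyl_measure T)"
proof -
  have "(\<integral>\<^sup>+x. h (t, x + a) \<partial>cell_measure) = (\<integral>\<^sup>+x. h (t, x) \<partial>cell_measure)" for t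
    using h nn_integral_cell_measure_shift[of "\<lambda>x. h (t, x)" a] by (simp add: x_periodic_def)
  then show ?thesis by (simp add: nn_integral_cyl)
qed

lemma distr_cyl_shift:
  "distr (cyl_measure T) borel (\<lambda>z. (fst z, snd (shift a z) - nearest (snd (shift a z))))
    = distr (cyl_measure T) borel (\<lambda>z. (fst z, snd z - nearest (snd z)))"
proof (rule measure_eqI)
  fix A assume "A \<in> sets (distr (cyl_measure T) borel (\<lambda>z. (fst z, snd (shift a z) - nearest (snd (shift a z)))))"
  then have [measurable]: "A \<in> sets borel" by simp
  let ?h = "\<lambda>z. indicator A (fst z, snd z - nearest (snd z)) :: ennreal"
  have "emeasure (distr (cyl_measure T) borel (\<lambda>z. (fst z, snd (shift b z) - nearest (snd (shift b z))))) A
      = (\<integral>\<^sup>+z. ?h (shift b z) \<partial>cyl_measure T)" for b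
    by (simp add: nn_integral_distr flip: nn_integral_indicator)
  from this[of a] this[of 0]
  show "emeasure (distr (cyl_measure T) borel (\<lambda>z. (fst z, snd (shift a z) - nearest (snd (shift a z))))) A
      = emeasure (distr (cyl_measure T) borel (\<lambda>z. (fst z, snd z - nearest (snd z)))) A"
    using nn_integral_cyl_shift[of ?h T a]
    by (simp add: x_periodic_def periodic_def nearest_add_Basis)
qed simp

lemma cyl_shift:
  fixes h :: "spacetime \<Rightarrow> 'b::{banach, second_countable_topology}"
  assumes [measurable]: "h \<in> borel_measurable borel" and h: "x_periodic h"
  shows integrable_cyl_shift: "integrable (cyl_measure T) (\<lambda>z. h (shift a z)) \<longleftrightarrow> integrable (cyl_measure T) h"
    and integral_cyl_shift: "(\<integral>z. h (shift a z) \<partial>cyl_measure T) = (\<integral>z. h z \<partial>cyl_measure T)"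
proof -
  have eq: "h (fst z, snd (shift b z) - nearest (snd (shift b z))) = h (shift b z)" for b z
    using x_periodic_nearest[OF h, of "shift b z"] by simp
  have 1: "integrable (cyl_measure T) (\<lambda>z. h (shift b z)) \<longleftrightarrow>
    integrable (distr (cyl_measure T) borel (\<lambda>z. (fst z, snd (shift b z) - nearest (snd (shift b z))))) h" for b
    by (subst integrable_distr_eq) (auto simp only: eq, measurable)
  have 2: "(\<integral>z. h (shift b z) \<partial>cyl_measure T)
    = (\<integral>z. h z \<partial>distr (cyl_measure T) borel (\<lambda>z. (fst z, snd (shift b z) - nearest (snd (shift b z)))))" for b
    by (subst integral_distr) (auto simp only: eq, measurable)
  show "integrable (cyl_measure T) (\<lambda>z. h (shift a z)) \<longleftrightarrow> integrable (cyl_measure T) h"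
    using 1[of a] 1[of 0] distr_cyl_shift[of T a] by simp
  show "(\<integral>z. h (shift a z) \<partial>cyl_measure T) = (\<integral>z. h z \<partial>cyl_measure T)"
    using 2[of a] 2[of 0] distr_cyl_shift[of T a] by simp
qed

section \<open>Shifts on the cylinder: L1 continuity and dominated functionals of the shift\<close>

section \<open>Continuity under spatial shifts\<close>

lemma x_periodic_shift: "x_periodic f \<Longrightarrow> x_periodic (\<lambda>z. f (shift a z))"
  unfolding x_periodic_def using periodic_shift[of "\<lambda>x. f (_, x)" a] by auto

lemma x_periodic_compose: "x_periodic f \<Longrightarrow> x_periodic (\<lambda>z. F (f z))"
  and x_periodic_compose2: "x_periodic f \<Longrightarrow> x_periodic g \<Longrightarrow> x_periodic (\<lambda>z. G (f z) (g z))"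
  by (simp_all add: x_periodic_def periodic_def)

lemma integral_cyl_eq_lborel:
  fixes f :: "spacetime \<Rightarrow> 'b::{banach, second_countable_topology}"
  assumes [measurable]: "f \<in> borel_measurable borel"
  shows "(\<integral>z. f z \<partial>cyl_measure T) = (\<integral>z. indicator (torus_cyl T) z *\<^sub>R f z \<partial>lborel)"
    and "integrable (cyl_measure T) f \<longleftrightarrow> integrable lborel (\<lambda>z. indicator (torus_cyl T) z *\<^sub>R f z)"
proof -
  have [measurable]: "torus_cyl T \<in> sets borel"
    unfolding torus_cyl_def borel_spacetime by measurable
  have *: "cyl_measure T = density lborel (\<lambda>z. ennreal (indicator (torus_cyl T) z))"
    unfolding cyl_measure_eq by (rule arg_cong[where f = "density lborel"]) (auto split: split_indicator)
  show "(\<integral>z. f z \<partial>cyl_measure T) = (\<integral>z. indicator (torus_cyl T) z *\<^sub>R f z \<partial>lborel)"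
    unfolding * by (subst integral_density) auto
  show "integrable (cyl_measure T) f \<longleftrightarrow> integrable lborel (\<lambda>z. indicator (torus_cyl T) z *\<^sub>R f z)"
    unfolding * by (subst integrable_density) auto
qed

lemma torus_cyl_borel [measurable]: "torus_cyl T \<in> sets borel"
  unfolding torus_cyl_def borel_spacetime by measurable

lemma nn_integral_cyl_eq_lborel:
  assumes [measurable]: "f \<in> borel_measurable borel"
  shows "(\<integral>\<^sup>+z. f z \<partial>cyl_measure T) = (\<integral>\<^sup>+z. indicator (torus_cyl T) z * f z \<partial>lborel)"
  by (simp add: cyl_measure_eq nn_integral_density)

text \<open>The box [-1,1]^3 is covered by finitely many translated cells, over each of which the
  norm of a periodic function has the same integral. The truncation to this box is integrable on the
  whole space and still agrees with \<open>f\<close> on the cell after a small shift.\<close>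

lemma integrable_two_cells:
  fixes f :: "spacetime \<Rightarrow> 'b::{banach, second_countable_topology}"
  assumes [measurable]: "f \<in> borel_measurable borel" and per: "x_periodic f" and int: "integrable (cyl_measure T) f"
  shows "integrable lborel (\<lambda>z. indicator ({0<..<T} \<times> cbox (- One) One) z *\<^sub>R f z)"
proof -
  let ?B = "cbox (- One) One :: space set"
  have [measurable]: "{0<..<T} \<times> ?B \<in> sets borel" unfolding borel_spacetime by measurable
  have "?B \<subseteq> (\<Union>a\<in>?B. ball a (1/2))" by force
  from compactE_image[OF compact_cbox open_ball this]
  obtain S where S: "finite S" "?B \<subseteq> (\<Union>a\<in>S. ball a (1/2))" by metis
  have S': "\<exists>a\<in>S. x - a \<in> torus_cell" if x: "x \<in> ?B" for x
  proof -
    obtain a where "a \<in> S" "norm (x - a) < 1/2"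
      using S(2) x by (auto simp: dist_norm norm_minus_commute subset_iff)
    then show ?thesis using Basis_le_norm[of _ "x - a"] by (force simp: mem_torus_cell)
  qed
  have nn: "(\<integral>\<^sup>+z. norm (f z) \<partial>cyl_measure T) < \<infinity>"
    using int by (simp add: integrable_iff_bounded)
  have "(\<integral>\<^sup>+z. norm (indicator ({0<..<T} \<times> ?B) z *\<^sub>R f z) \<partial>lborel)
     \<le> (\<integral>\<^sup>+z. (\<Sum>a\<in>S. indicator (torus_cyl T) (shift (- a) z) * ennreal (norm (f z))) \<partial>lborel)"
  proof (rule nn_integral_mono)
    fix z :: spacetime
    show "ennreal (norm (indicator ({0<..<T} \<times> ?B) z *\<^sub>R f z))
      \<le> (\<Sum>a\<in>S. indicator (torus_cyl T) (shift (- a) z) * ennreal (norm (f z)))"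
    proof (cases "z \<in> {0<..<T} \<times> ?B")
      case True
      then obtain a where a: "a \<in> S" "snd z - a \<in> torus_cell" using S'[of "snd z"] by auto
      then have "shift (- a) z \<in> torus_cyl T" using True by (auto simp: torus_cyl_def shift_def)
      then have "ennreal (norm (f z)) \<le> indicator (torus_cyl T) (shift (- a) z) * ennreal (norm (f z))" by simp
      also have "\<dots> \<le> (\<Sum>a\<in>S. indicator (torus_cyl T) (shift (- a) z) * ennreal (norm (f z)))"
        using S(1) a(1) by (intro member_le_sum) auto
      finally show ?thesis using True by simp
    qed simp
  qed
  also have "\<dots> = (\<Sum>a\<in>S. \<integral>\<^sup>+z. indicator (torus_cyl T) (shift (- a) z) * ennreal (norm (f z)) \<partial>lborel)"
    by (rule nn_integral_sum) measurable
  also have "\<dots> = (\<Sum>a\<in>S. \<integral>\<^sup>+z. norm (f z) \<partial>cyl_measure T)"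
  proof (rule sum.cong[OF refl])
    fix a
    have "(\<integral>\<^sup>+z. indicator (torus_cyl T) (shift (- a) z) * ennreal (norm (f z)) \<partial>lborel)
      = (\<integral>\<^sup>+z. indicator (torus_cyl T) (shift (- a) (z + (0, a))) * ennreal (norm (f (z + (0, a)))) \<partial>lborel)"
      by (rule nn_integral_lborel_shift[symmetric]) measurable
    also have "\<dots> = (\<integral>\<^sup>+z. indicator (torus_cyl T) z * ennreal (norm (f (shift a z))) \<partial>lborel)"
      by (rule nn_integral_cong) (simp add: shift_def plus_prod_def)
    also have "\<dots> = (\<integral>\<^sup>+z. norm (f (shift a z)) \<partial>cyl_measure T)"
      by (simp add: nn_integral_cyl_eq_lborel)
    also have "\<dots> = (\<integral>\<^sup>+z. norm (f z) \<partial>cyl_measure T)"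
      by (rule nn_integral_cyl_shift) (use per in \<open>auto simp: x_periodic_def periodic_def\<close>)
    finally show "(\<integral>\<^sup>+z. indicator (torus_cyl T) (shift (- a) z) * ennreal (norm (f z)) \<partial>lborel)
       = (\<integral>\<^sup>+z. norm (f z) \<partial>cyl_measure T)" .
  qed
  also have "\<dots> < \<infinity>" using nn by (simp add: ennreal_mult_less_top of_nat_less_top)
  finally show ?thesis unfolding integrable_iff_bounded by simp
qed

text \<open>Periodicity removes the fixed part l of the shift. The remaining shift a k - l is
  eventually shorter than 1/2 and keeps the cell inside the larger box, where translation continuity
  on the whole space applies.\<close>

lemma shift_L1:
  fixes f :: "spacetime \<Rightarrow> 'b::{banach, second_countable_topology}"
  assumes [measurable]: "f \<in> borel_measurable borel" and per: "x_periodic f" and int: "integrable (cyl_measure T) f"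
    and a: "a \<longlonglongrightarrow> l"
  shows "(\<lambda>k. \<integral>z. norm (f (shift (a k) z) - f (shift l z)) \<partial>cyl_measure T) \<longlonglongrightarrow> 0"
proof -
  let ?B = "cbox (- One) One :: space set"
  define F where "F z = indicator ({0<..<T} \<times> ?B) z *\<^sub>R f z" for z
  have F: "integrable lborel F"
    using integrable_two_cells[OF assms(1-3)] by (simp add: F_def[abs_def])
  define h where "h k = (0::real, a k - l)" for k
  have al: "(\<lambda>k. a k - l) \<longlonglongrightarrow> 0" using a by (simp add: LIM_zero)
  then have h: "h \<longlonglongrightarrow> 0" unfolding h_def zero_prod_def by (intro tendsto_Pair tendsto_const)
  have "\<forall>\<^sub>F k in sequentially. norm (a k - l) < 1/2"
    using tendstoD[OF al, of "1/2"] by simp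
  then have "\<forall>\<^sub>F k in sequentially. norm (\<integral>z. norm (f (shift (a k) z) - f (shift l z)) \<partial>cyl_measure T)
      \<le> (\<integral>z. norm (F (z + h k) - F z) \<partial>lborel)"
  proof eventually_elim
    case (elim k)
    have "(\<integral>z. norm (f (shift (a k) z) - f (shift l z)) \<partial>cyl_measure T)
      = (\<integral>z. norm (f (shift (a k - l) (shift l z)) - f (shift l z)) \<partial>cyl_measure T)" by simp
    also have "\<dots> = (\<integral>z. norm (f (shift (a k - l) z) - f z) \<partial>cyl_measure T)"
      using per
      by (intro integral_cyl_shift[where h = "\<lambda>z. norm (f (shift (a k - l) z) - f z)"])
        (auto intro!: x_periodic_compose2[where G = "\<lambda>x y. norm (x - y)"] x_periodic_shift)
    also have "\<dots> = (\<integral>z. indicator (torus_cyl T) z *\<^sub>R norm (f (shift (a k - l) z) - f z) \<partial>lborel)"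
      by (intro integral_cyl_eq_lborel) measurable
    also have "\<dots> \<le> (\<integral>z. norm (F (z + h k) - F z) \<partial>lborel)"
    proof (rule integral_mono)
      fix z :: spacetime
      show "indicator (torus_cyl T) z *\<^sub>R norm (f (shift (a k - l) z) - f z) \<le> norm (F (z + h k) - F z)"
      proof (cases "z \<in> torus_cyl T")
        case True
        then obtain t x where z: "z = (t, x)" "0 < t" "t < T" "x \<in> torus_cell" by (auto simp: torus_cyl_def)
        have "\<bar>(x + (a k - l)) \<bullet> b\<bar> \<le> 1" if b: "b \<in> Basis" for b
          using z(4) b elim Basis_le_norm[OF b, of "a k - l"] unfolding mem_torus_cell inner_add_left
          by (smt (verit) field_sum_of_halves)
        then have "x + (a k - l) \<in> ?B" "x \<in> ?B"
          using z(4) by (force simp: mem_box mem_torus_cell abs_le_iff)+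
        then show ?thesis using z True by (simp add: F_def h_def)
      qed simp
    next
      show "integrable lborel (\<lambda>z. norm (F (z + h k) - F z))"
        using F integrable_lborel_shift[OF F] by auto
      have "integrable (cyl_measure T) (\<lambda>z. norm (f (shift (a k - l) z) - f z))"
        using int integrable_cyl_shift[OF assms(1,2), of T "a k - l"] by auto
      then show "integrable lborel (\<lambda>z. indicator (torus_cyl T) z *\<^sub>R norm (f (shift (a k - l) z) - f z))"
        by (subst (asm) integral_cyl_eq_lborel) auto
    qed
    finally show ?case by simp
  qed
  from Lim_null_comparison[OF this translation_L1[OF F h]] show ?thesis .
qed

lemma integrable_cyl_diff_shift:
  fixes f :: "spacetime \<Rightarrow> 'b::{banach, second_countable_topology}"
  assumes [measurable]: "f \<in> borel_measurable borel" and per: "x_periodic f" and int: "integrable (cyl_measure T) f"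
  shows "integrable (cyl_measure T) (\<lambda>z. f (shift a z) - f (shift b z))"
  using int integrable_cyl_shift[OF assms(1,2), of T] by auto

text \<open>Along a subsequence the shifts of both \<open>u\<close> and \<open>W\<close> converge
  almost everywhere. The majorant W z + W (shift l z) moves with l, which calls for the generalised
  form of dominated convergence; the subsequence principle then returns to the full
  sequence.\<close>

lemma continuous_shift_functional:
  fixes u :: "spacetime \<Rightarrow> 'e::{banach, second_countable_topology}"
    and \<Phi> :: "spacetime \<Rightarrow> 'e \<Rightarrow> 'e \<Rightarrow> 'r::{banach, second_countable_topology}"
  assumes u_meas [measurable]: "u \<in> borel_measurable borel" and u: "x_periodic u" "integrable (cyl_measure T) u"
    and W_meas [measurable]: "W \<in> borel_measurable borel" and W: "x_periodic W" "integrable (cyl_measure T) (W :: _ \<Rightarrow> real)"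
    and Phi_meas [measurable]: "\<And>l. (\<lambda>z. \<Phi> z (u z) (u (shift l z))) \<in> borel_measurable borel"
    and cont: "\<And>z a. continuous_on UNIV (\<Phi> z a)"
    and bound: "\<And>z l. norm (\<Phi> z (u z) (u (shift l z))) \<le> W z + W (shift l z)"
  shows "continuous_on UNIV (\<lambda>l. \<integral>z. \<Phi> z (u z) (u (shift l z)) \<partial>cyl_measure T)"
  unfolding continuous_on_sequentially
proof (intro allI ballI impI, elim conjE)
  fix a :: "nat \<Rightarrow> space" and l assume al: "a \<longlonglongrightarrow> l"
  let ?I = "\<lambda>l. \<integral>z. \<Phi> z (u z) (u (shift l z)) \<partial>cyl_measure T"
  show "(?I \<circ> a) \<longlonglongrightarrow> ?I l"
  proof (rule LIMSEQ_subsequence_principle)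
    fix r :: "nat \<Rightarrow> nat" assume r: "strict_mono r"
    have ar: "(\<lambda>k. a (r k)) \<longlonglongrightarrow> l" using LIMSEQ_subseq_LIMSEQ[OF al r] by (simp add: o_def)
    obtain s where s: "strict_mono s"
      "AE z in cyl_measure T. (\<lambda>k. u (shift (a (r (s k))) z) - u (shift l z)) \<longlonglongrightarrow> 0"
      using tendsto_L1_AE_subseq[OF integrable_cyl_diff_shift[OF u_meas u] shift_L1[OF u_meas u ar]] by blast
    have ars: "(\<lambda>k. a (r (s k))) \<longlonglongrightarrow> l" using LIMSEQ_subseq_LIMSEQ[OF ar s(1)] by (simp add: o_def)
    obtain s' where s': "strict_mono s'"
      "AE z in cyl_measure T. (\<lambda>k. W (shift (a (r (s (s' k)))) z) - W (shift l z)) \<longlonglongrightarrow> 0"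
      using tendsto_L1_AE_subseq[OF integrable_cyl_diff_shift[OF W_meas W] shift_L1[OF W_meas W ars]] by blast
    have arss: "(\<lambda>k. a (r (s (s' k)))) \<longlonglongrightarrow> l" using LIMSEQ_subseq_LIMSEQ[OF ars s'(1)] by (simp add: o_def)
    have Wi: "integrable (cyl_measure T) (\<lambda>z. W (shift l z))" for l
      using integrable_cyl_shift[OF W_meas W(1), of T l] W(2) by simp
    have "(\<lambda>k. ?I (a (r (s (s' k))))) \<longlonglongrightarrow> ?I l"
    proof (rule generalized_dominated_convergence[where g = "\<lambda>k z. W z + W (shift (a (r (s (s' k)))) z)"
          and G = "\<lambda>z. W z + W (shift l z)"])
      show "AE z in cyl_measure T. (\<lambda>k. \<Phi> z (u z) (u (shift (a (r (s (s' k)))) z))) \<longlonglongrightarrow> \<Phi> z (u z) (u (shift l z))"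
        using s(2)
      proof eventually_elim
        case (elim z)
        have "(\<lambda>k. u (shift (a (r (s k))) z)) \<longlonglongrightarrow> u (shift l z)" using elim by (rule LIM_zero_cancel)
        from LIMSEQ_subseq_LIMSEQ[OF this s'(1)]
        have "(\<lambda>k. u (shift (a (r (s (s' k)))) z)) \<longlonglongrightarrow> u (shift l z)" by (simp add: o_def)
        with cont[of z "u z"] show ?case
          unfolding continuous_on_eq_continuous_at[OF open_UNIV]
          by (auto intro: isCont_tendsto_compose)
      qed
      show "AE z in cyl_measure T. (\<lambda>k. W z + W (shift (a (r (s (s' k)))) z)) \<longlonglongrightarrow> W z + W (shift l z)"
        using s'(2) by eventually_elim (auto intro!: tendsto_intros dest: LIM_zero_cancel)
      show "(\<lambda>k. \<integral>z. \<bar>W z + W (shift (a (r (s (s' k)))) z) - (W z + W (shift l z))\<bar> \<partial>cyl_measure T) \<longlonglongrightarrow> 0"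
        using shift_L1[OF W_meas W arss] by simp
    qed (use W Wi bound in auto)
    with s s' show "\<exists>s. strict_mono s \<and> (\<lambda>k. (?I \<circ> a) (r (s k))) \<longlonglongrightarrow> ?I l"
      by (intro exI[of _ "s \<circ> s'"]) (auto simp: strict_mono_o)
  qed
qed

text \<open>Joint integrability for Fubini between the cylinder and a finite measure N of parameters
  on which the shift depends. The second part of the majorant is integrated over z first, where
  shift invariance makes the result independent of the parameter.\<close>

lemma integrable_cyl_pair:
  fixes h :: "spacetime \<times> 'c \<Rightarrow> 'b::{banach, second_countable_topology}"
  assumes N: "finite_measure N" and e [measurable]: "e \<in> borel_measurable N"
    and [measurable]: "h \<in> borel_measurable (cyl_measure T \<Otimes>\<^sub>M N)"
    and W_meas [measurable]: "W \<in> borel_measurable borel" and W: "x_periodic W" "integrable (cyl_measure T) (W :: _ \<Rightarrow> real)"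
    and bound: "\<And>z w. w \<in> space N \<Longrightarrow> norm (h (z, w)) \<le> K * (W z + W (shift (e w) z))"
  shows "integrable (cyl_measure T \<Otimes>\<^sub>M N) h"
proof -
  interpret N: finite_measure N by fact
  interpret pair_sigma_finite "cyl_measure T" N ..
  have W1: "integrable (cyl_measure T \<Otimes>\<^sub>M N) (\<lambda>(z, w). W z)"
  proof -
    have "(\<integral>\<^sup>+p. ennreal \<bar>W (fst p)\<bar> \<partial>(cyl_measure T \<Otimes>\<^sub>M N))
        = (\<integral>\<^sup>+z. \<integral>\<^sup>+w. ennreal \<bar>W z\<bar> \<partial>N \<partial>cyl_measure T)"
      by (subst N.nn_integral_fst[symmetric]) auto
    also have "\<dots> = (\<integral>\<^sup>+z. ennreal \<bar>W z\<bar> \<partial>cyl_measure T) * emeasure N (space N)"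
      by (simp add: nn_integral_multc)
    also have "\<dots> < \<infinity>"
      using W(2) N.emeasure_finite[of "space N"] unfolding infinity_ennreal_def
      by (auto simp: integrable_iff_bounded ennreal_mult_less_top less_top[symmetric] ennreal_mult_eq_top_iff)
    finally show ?thesis by (simp add: integrable_iff_bounded case_prod_beta)
  qed
  have W2: "integrable (cyl_measure T \<Otimes>\<^sub>M N) (\<lambda>(z, w). W (shift (e w) z))"
  proof -
    have "(\<integral>\<^sup>+p. ennreal \<bar>W (shift (e (snd p)) (fst p))\<bar> \<partial>(cyl_measure T \<Otimes>\<^sub>M N))
        = (\<integral>\<^sup>+w. \<integral>\<^sup>+z. ennreal \<bar>W (shift (e w) z)\<bar> \<partial>cyl_measure T \<partial>N)"
      by (subst nn_integral_snd[symmetric]) (auto simp: case_prod_beta)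
    also have "\<dots> = (\<integral>\<^sup>+w. \<integral>\<^sup>+z. ennreal \<bar>W z\<bar> \<partial>cyl_measure T \<partial>N)"
      using W(1) by (intro nn_integral_cong nn_integral_cyl_shift[where h = "\<lambda>z. ennreal \<bar>W z\<bar>"])
        (auto simp: x_periodic_def periodic_def)
    also have "\<dots> = (\<integral>\<^sup>+z. ennreal \<bar>W z\<bar> \<partial>cyl_measure T) * emeasure N (space N)"
      by simp
    also have "\<dots> < \<infinity>"
      using W(2) N.emeasure_finite[of "space N"] unfolding infinity_ennreal_def
      by (auto simp: integrable_iff_bounded ennreal_mult_less_top less_top[symmetric] ennreal_mult_eq_top_iff)
    finally show ?thesis by (simp add: integrable_iff_bounded case_prod_beta)
  qed
  have "integrable (cyl_measure T \<Otimes>\<^sub>M N) (\<lambda>p. K * (W (fst p) + W (shift (e (snd p)) (fst p))))"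
    using W1 W2 unfolding case_prod_beta
    by (intro Bochner_Integration.integrable_mult_right Bochner_Integration.integrable_add)
  then show ?thesis
  proof (rule Bochner_Integration.integrable_bound)
    show "AE p in cyl_measure T \<Otimes>\<^sub>M N. norm (h p) \<le> norm (K * (W (fst p) + W (shift (e (snd p)) (fst p))))"
    proof (rule AE_I2)
      fix p assume "p \<in> space (cyl_measure T \<Otimes>\<^sub>M N)"
      then have "snd p \<in> space N" by (auto simp: space_pair_measure)
      from bound[OF this, of "fst p"]
      show "norm (h p) \<le> norm (K * (W (fst p) + W (shift (e (snd p)) (fst p))))"
        unfolding prod.collapse real_norm_def by linarith
    qed
  qed measurable
qed

section \<open>Doubled variables with a mollified time difference\<close>

section \<open>Mollification in time\<close>

lemma sets_time_cell [measurable_cong]: "sets (time_measure T \<Otimes>\<^sub>M cell_measure) = sets borel"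
  using sets_cyl_measure[of T] unfolding cyl_measure_def .

lemma sets_lborel_pair [measurable_cong]:
  "sets (lborel \<Otimes>\<^sub>M lborel :: spacetime measure) = sets borel"
  by (simp only: lborel_prod sets_lborel)

lemma translation_L1_eps:
  fixes f :: "'a::euclidean_space \<Rightarrow> 'b::{banach, second_countable_topology}"
  assumes f: "integrable lborel f" and "e > 0"
  shows "\<exists>d>0. \<forall>h. norm h < d \<longrightarrow> (\<integral>x. norm (f (x + h) - f x) \<partial>lborel) < e"
proof -
  have "isCont (\<lambda>h. \<integral>x. norm (f (x + h) - f x) \<partial>lborel) 0"
    unfolding continuous_at_sequentially using translation_L1[OF f] by (simp add: o_def)
  then have "\<exists>d>0. \<forall>h. dist h 0 < d \<longrightarrow> dist (\<integral>x. norm (f (x + h) - f x) \<partial>lborel) (\<integral>x. norm (f (x + 0) - f x) \<partial>lborel) < e"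
    using assms(2) unfolding continuous_at_eps_delta by blast
  then show ?thesis by simp
qed

lemma nn_integral_lborel_minus:
  fixes f :: "'a::euclidean_space \<Rightarrow> ennreal"
  assumes [measurable]: "f \<in> borel_measurable borel"
  shows "(\<integral>\<^sup>+x. f (- x) \<partial>lborel) = (\<integral>\<^sup>+x. f x \<partial>lborel)"
proof -
  have "(lborel :: 'a measure) = distr lborel borel uminus"
    using lborel_affine[of "-1" "0::'a"] by (simp add: density_1)
  then have "(\<integral>\<^sup>+x. f x \<partial>lborel) = (\<integral>\<^sup>+x. f x \<partial>distr lborel borel uminus)" by simp
  also have "\<dots> = (\<integral>\<^sup>+x. f (- x) \<partial>lborel)" by (rule nn_integral_distr) auto
  finally show ?thesis by simp
qed

lemma tendsto_ennreal_0:
  fixes X :: "nat \<Rightarrow> ennreal"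
  assumes "\<And>e. e > 0 \<Longrightarrow> \<forall>\<^sub>F j in sequentially. X j \<le> ennreal e"
  shows "X \<longlonglongrightarrow> 0"
proof (rule order_tendstoI)
  fix a :: ennreal assume "0 < a"
  then obtain e where e: "e > 0" "ennreal e < a"
    by (metis dense ennreal_cases ennreal_less_zero_iff order_less_imp_le top.extremum_strict)
  show "\<forall>\<^sub>F j in sequentially. X j < a"
    using assms[OF e(1)] by eventually_elim (use e(2) in auto)
qed simp

lemma distr_cell_minus: "distr cell_measure borel uminus = cell_measure"
proof (rule measure_eqI)
  fix A assume "A \<in> sets (distr cell_measure borel uminus)"
  then have [measurable]: "A \<in> sets borel" by simp
  have "emeasure (distr cell_measure borel uminus) A = (\<integral>\<^sup>+x. indicator A (- x) \<partial>cell_measure)"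
    by (simp add: nn_integral_distr flip: nn_integral_indicator)
  also have "\<dots> = (\<integral>\<^sup>+x. indicator torus_cell x * indicator A (- x) \<partial>lborel)"
    by (simp add: cell_measure_def nn_integral_density)
  also have "\<dots> = (\<integral>\<^sup>+x. indicator torus_cell (- x) * indicator A (- x) \<partial>lborel)"
    by (intro nn_integral_cong) (auto simp: mem_torus_cell split: split_indicator)
  also have "\<dots> = (\<integral>\<^sup>+x. indicator torus_cell x * indicator A x \<partial>lborel)"
    by (rule nn_integral_lborel_minus[where f = "\<lambda>x. indicator torus_cell x * indicator A x"]) measurable
  also have "\<dots> = emeasure cell_measure A"
    by (simp add: cell_measure_def emeasure_density mult.commute)
  finally show "emeasure (distr cell_measure borel uminus) A = emeasure cell_measure A" .
qed simp

lemma integral_cell_minus: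
  fixes h :: "space \<Rightarrow> 'b::{banach, second_countable_topology}"
  assumes [measurable]: "h \<in> borel_measurable borel"
  shows "(\<integral>x. h (- x) \<partial>cell_measure) = (\<integral>x. h x \<partial>cell_measure)"
proof -
  have "(\<integral>x. h x \<partial>distr cell_measure borel uminus) = (\<integral>x. h (- x) \<partial>cell_measure)"
    by (rule integral_distr) auto
  then show ?thesis by (simp add: distr_cell_minus)
qed

lemma integrable_pair_mult:
  fixes f :: "'a \<Rightarrow> real" and g :: "'b \<Rightarrow> real"
  assumes "finite_measure M" "finite_measure N" and f: "integrable M f" and g: "integrable N g"
  shows "integrable (M \<Otimes>\<^sub>M N) (\<lambda>p. f (fst p) * g (snd p))"
proof -
  interpret M: finite_measure M by fact
  interpret N: finite_measure N by fact
  have [measurable]: "f \<in> borel_measurable M" "g \<in> borel_measurable N"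
    using f g by (auto dest: borel_measurable_integrable)
  have "(\<integral>\<^sup>+p. ennreal (norm (f (fst p) * g (snd p))) \<partial>(M \<Otimes>\<^sub>M N))
      = (\<integral>\<^sup>+x. \<integral>\<^sup>+y. ennreal (norm (f x)) * ennreal (norm (g y)) \<partial>N \<partial>M)"
    by (subst N.nn_integral_fst[symmetric]) (auto simp: abs_mult ennreal_mult)
  also have "\<dots> = (\<integral>\<^sup>+x. ennreal (norm (f x)) \<partial>M) * (\<integral>\<^sup>+y. ennreal (norm (g y)) \<partial>N)"
    by (simp add: nn_integral_cmult nn_integral_multc)
  also have "\<dots> < \<infinity>" using f g by (simp add: integrable_iff_bounded ennreal_mult_less_top)
  finally show ?thesis by (simp add: integrable_iff_bounded)
qed

text \<open>Either the right-hand side is infinite, or the difference is integrable and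
  \<open>b\<close> with it. This allows comparison with a candidate limit whose integrability has
  not been established beforehand.\<close>

lemma nn_integral_norm_diff_bound:
  fixes a b :: "'a \<Rightarrow> 'b::{banach, second_countable_topology}"
  assumes a: "integrable M a" and b [measurable]: "b \<in> borel_measurable M"
  shows "ennreal (norm (integral\<^sup>L M a - integral\<^sup>L M b)) \<le> (\<integral>\<^sup>+x. ennreal (norm (a x - b x)) \<partial>M)"
proof (cases "(\<integral>\<^sup>+x. ennreal (norm (a x - b x)) \<partial>M) = \<infinity>")
  case False
  have [measurable]: "a \<in> borel_measurable M" using a by (auto dest: borel_measurable_integrable)
  have i: "integrable M (\<lambda>x. a x - b x)"
    using False by (auto simp: integrable_iff_bounded less_top)
  from Bochner_Integration.integrable_diff[OF a this] have bi: "integrable M b" by simp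
  have "norm (integral\<^sup>L M a - integral\<^sup>L M b) = norm (\<integral>x. a x - b x \<partial>M)"
    using a bi by simp
  also have "ennreal \<dots> \<le> (\<integral>\<^sup>+x. ennreal (norm (a x - b x)) \<partial>M)"
    by (rule integral_norm_bound_ennreal[OF i])
  finally show ?thesis .
qed simp

text \<open>Evenness matters because interchanging the two copies of space-time reverses the time
  difference; boundedness of each member keeps the pairings in doubled variables integrable.\<close>

definition approx_identity :: "(nat \<Rightarrow> real \<Rightarrow> real) \<Rightarrow> bool" where
  "approx_identity \<rho> \<longleftrightarrow> (\<forall>j. \<rho> j \<in> borel_measurable borel \<and> (\<forall>h. 0 \<le> \<rho> j h \<and> \<rho> j (- h) = \<rho> j h) \<and>
     (\<exists>B. \<forall>h. \<rho> j h \<le> B) \<and> integrable lborel (\<rho> j) \<and> (\<integral>h. \<rho> j h \<partial>lborel) = 1 \<and>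
     (\<forall>h. 1 / real (Suc j) \<le> \<bar>h\<bar> \<longrightarrow> \<rho> j h = 0))"

lemma approx_identityD:
  assumes "approx_identity \<rho>"
  shows "\<rho> j \<in> borel_measurable borel" "0 \<le> \<rho> j h" "\<rho> j (- h) = \<rho> j h" "\<exists>B. \<forall>h. \<rho> j h \<le> B"
    "integrable lborel (\<rho> j)" "(\<integral>h. \<rho> j h \<partial>lborel) = 1" "1 / real (Suc j) \<le> \<bar>h\<bar> \<Longrightarrow> \<rho> j h = 0"
  using assms by (auto simp: approx_identity_def simp del: of_nat_Suc)

text \<open>The pairing in doubled variables p = ((t,x),(s,y)): the space kernel sees y - x, the
  time kernel t - s.\<close>

definition smear :: "real \<Rightarrow> (real \<Rightarrow> real) \<Rightarrow> (spacetime \<Rightarrow> real) \<Rightarrow> (spacetime \<Rightarrow> real) \<Rightarrow> (space \<Rightarrow> real) \<Rightarrow> real" where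
  "smear T \<rho> f g k = (\<integral>p. f (fst p) * g (snd p) * (k (snd (snd p) - snd (fst p)) * \<rho> (fst (fst p) - fst (snd p)))
     \<partial>(cyl_measure T \<Otimes>\<^sub>M cyl_measure T))"

lemma nn_integral_time_le:
  assumes [measurable]: "f \<in> borel_measurable borel"
  shows "(\<integral>\<^sup>+t. f t \<partial>time_measure T) \<le> (\<integral>\<^sup>+t. f t \<partial>lborel)"
  unfolding time_measure_def
  by (subst nn_integral_density) (auto intro!: nn_integral_mono split: split_indicator)

lemma integral_time_eq_lborel:
  fixes f :: "real \<Rightarrow> real"
  assumes [measurable]: "f \<in> borel_measurable borel" and "\<And>t. t \<notin> {0<..<T} \<Longrightarrow> f t = 0"
  shows "(\<integral>t. f t \<partial>time_measure T) = (\<integral>t. f t \<partial>lborel)"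
    and "integrable (time_measure T) f \<longleftrightarrow> integrable lborel f"
proof -
  have *: "time_measure T = density lborel (\<lambda>t. ennreal (indicator {0<..<T} t))"
    unfolding time_measure_def by (rule arg_cong[where f = "density lborel"]) (auto split: split_indicator)
  have **: "indicator {0<..<T} t *\<^sub>R f t = f t" for t using assms(2)[of t] by (auto split: split_indicator)
  show "(\<integral>t. f t \<partial>time_measure T) = (\<integral>t. f t \<partial>lborel)"
    unfolding * by (subst integral_density) (auto simp only: **, measurable)
  show "integrable (time_measure T) f \<longleftrightarrow> integrable lborel f"
    unfolding * by (subst integrable_density) (auto simp only: **, measurable)
qed

text \<open>Since \<open>f\<close> vanishes outside (0,T), the time integral may run over the whole
  line, and the error is at most the \<rho>-average of the L1 distances between \<open>f\<close> and
  its time translates. These are small on the shrinking support of \<open>\<rho> j\<close>.\<close>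

lemma time_mollify_L1:
  fixes f :: "spacetime \<Rightarrow> real"
  assumes [measurable]: "f \<in> borel_measurable borel" and f: "integrable (cyl_measure T) f"
    and f0: "\<And>t x. t \<notin> {0<..<T} \<Longrightarrow> f (t, x) = 0" and \<rho>: "approx_identity \<rho>"
  shows "(\<lambda>j. \<integral>\<^sup>+z. ennreal \<bar>(\<integral>t. f (t, snd z) * \<rho> j (t - fst z) \<partial>time_measure T) - f z\<bar> \<partial>cyl_measure T)
    \<longlonglongrightarrow> 0"
proof -
  have [measurable]: "\<rho> j \<in> borel_measurable borel" for j by (rule approx_identityD[OF \<rho>])
  have rnn: "0 \<le> \<rho> j h" for j h by (rule approx_identityD[OF \<rho>])
  define F where "F z = indicator torus_cell (snd z) * f z" for z
  have F_eq: "F z = indicator (torus_cyl T) z *\<^sub>R f z" for z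
    using f0[of "fst z" "snd z"] by (auto simp: F_def torus_cyl_def mem_Times_iff split: split_indicator)
  have F: "integrable lborel F" unfolding F_eq[abs_def]
    using integral_cyl_eq_lborel(2)[of f T] f by simp
  have [measurable]: "F \<in> borel_measurable borel" unfolding F_eq[abs_def] by measurable
  let ?N = "\<lambda>j. \<integral>\<^sup>+z. ennreal \<bar>(\<integral>t. f (t, snd z) * \<rho> j (t - fst z) \<partial>time_measure T) - f z\<bar> \<partial>cyl_measure T"
  have [measurable]: "(\<lambda>z. \<integral>t. f (t, snd z) * \<rho> j (t - fst z) \<partial>time_measure T) \<in> borel_measurable borel" for j
    by (rule time.borel_measurable_lebesgue_integral) measurable
  have N_le: "?N j \<le> (\<integral>\<^sup>+h. ennreal (\<rho> j h) * ennreal (\<integral>z. norm (F (z + (h, 0)) - F z) \<partial>lborel) \<partial>lborel)" for j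
  proof -
    have fx: "AE x in cell_measure. integrable lborel (\<lambda>t. f (t, x))"
    proof -
      have "AE x in cell_measure. integrable (time_measure T) (\<lambda>t. f (t, x))"
        using f unfolding cyl_measure_def by (intro cyl.AE_integrable_snd) (simp add: case_prod_beta')
      then show ?thesis
        by eventually_elim (subst (asm) integral_time_eq_lborel(2), auto simp: f0)
    qed
    let ?q = "\<lambda>s x. \<integral>\<^sup>+h. ennreal (\<rho> j h) * ennreal \<bar>f (s + h, x) - f (s, x)\<bar> \<partial>lborel"
    have pt: "ennreal \<bar>(\<integral>t. f (t, x) * \<rho> j (t - s) \<partial>time_measure T) - f (s, x)\<bar> \<le> ?q s x"
      if x: "integrable lborel (\<lambda>t. f (t, x))" for s x
    proof -
      obtain B where B: "\<And>h. \<rho> j h \<le> B" using approx_identityD(4)[OF \<rho>] by blast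
      have "(\<integral>t. f (t, x) * \<rho> j (t - s) \<partial>time_measure T) = (\<integral>t. f (t, x) * \<rho> j (t - s) \<partial>lborel)"
        by (rule integral_time_eq_lborel(1)) (auto simp: f0)
      also have "\<dots> = (\<integral>h. f (h + s, x) * \<rho> j h \<partial>lborel)"
        using integral_lborel_shift[of "\<lambda>t. f (t, x) * \<rho> j (t - s)" s] by simp
      finally have 1: "(\<integral>t. f (t, x) * \<rho> j (t - s) \<partial>time_measure T) = (\<integral>h. f (h + s, x) * \<rho> j h \<partial>lborel)" .
      have 2: "f (s, x) = (\<integral>h. f (s, x) * \<rho> j h \<partial>lborel)" using approx_identityD(6)[OF \<rho>] by simp
      have "integrable lborel (\<lambda>h. B * f (h + s, x))" using integrable_lborel_shift[OF x, of s] by simp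
      then have 3: "integrable lborel (\<lambda>h. f (h + s, x) * \<rho> j h)"
        by (rule Bochner_Integration.integrable_bound)
          (use B rnn[of j] order_trans[OF rnn[of j] B] in \<open>auto intro!: AE_I2 mult_right_mono simp: abs_mult mult.commute[of "f _"]\<close>)
      have "ennreal (norm ((\<integral>h. f (h + s, x) * \<rho> j h \<partial>lborel) - (\<integral>h. f (s, x) * \<rho> j h \<partial>lborel)))
        \<le> (\<integral>\<^sup>+h. ennreal (norm (f (h + s, x) * \<rho> j h - f (s, x) * \<rho> j h)) \<partial>lborel)"
        by (rule nn_integral_norm_diff_bound[OF 3]) measurable
      also have "\<dots> = ?q s x"
      proof (intro nn_integral_cong)
        fix h
        have "norm (f (h + s, x) * \<rho> j h - f (s, x) * \<rho> j h) = \<rho> j h * \<bar>f (s + h, x) - f (s, x)\<bar>"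
          unfolding left_diff_distrib[symmetric] using rnn by (simp add: abs_mult add.commute)
        then show "ennreal (norm (f (h + s, x) * \<rho> j h - f (s, x) * \<rho> j h))
            = ennreal (\<rho> j h) * ennreal \<bar>f (s + h, x) - f (s, x)\<bar>"
          using rnn by (simp add: ennreal_mult)
      qed
      finally show ?thesis unfolding 1 2[symmetric] by simp
    qed
    have "?N j = (\<integral>\<^sup>+x. \<integral>\<^sup>+s. ennreal \<bar>(\<integral>t. f (t, x) * \<rho> j (t - s) \<partial>time_measure T) - f (s, x)\<bar> \<partial>time_measure T \<partial>cell_measure)"
      unfolding cyl_measure_def by (subst cyl.nn_integral_snd[symmetric]) (auto simp: case_prod_unfold)
    also have "\<dots> \<le> (\<integral>\<^sup>+x. \<integral>\<^sup>+s. ?q s x \<partial>lborel \<partial>cell_measure)"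
    proof (rule nn_integral_mono_AE, use fx in eventually_elim)
      case (elim x)
      have "(\<integral>\<^sup>+s. ennreal \<bar>(\<integral>t. f (t, x) * \<rho> j (t - s) \<partial>time_measure T) - f (s, x)\<bar> \<partial>time_measure T)
          \<le> (\<integral>\<^sup>+s. ?q s x \<partial>time_measure T)"
        by (intro nn_integral_mono pt elim)
      also have "\<dots> \<le> (\<integral>\<^sup>+s. ?q s x \<partial>lborel)" by (rule nn_integral_time_le) measurable
      finally show ?case .
    qed
    also have "\<dots> = (\<integral>\<^sup>+x. indicator torus_cell x * (\<integral>\<^sup>+s. ?q s x \<partial>lborel) \<partial>lborel)"
      unfolding cell_measure_def by (rule nn_integral_density) measurable
    also have "\<dots> = (\<integral>\<^sup>+x. \<integral>\<^sup>+s. indicator torus_cell x * ?q s x \<partial>lborel \<partial>lborel)"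
      by (simp add: nn_integral_cmult)
    also have "\<dots> = (\<integral>\<^sup>+z. indicator torus_cell (snd z) * ?q (fst z) (snd z) \<partial>(lborel \<Otimes>\<^sub>M lborel))"
      by (subst lborel_pair.nn_integral_snd[symmetric]) (auto simp: case_prod_unfold)
    also have "\<dots> = (\<integral>\<^sup>+z. (\<integral>\<^sup>+h. ennreal (\<rho> j h) * ennreal (norm (F (z + (h, 0)) - F z)) \<partial>lborel) \<partial>lborel)"
      unfolding lborel_prod
      by (intro nn_integral_cong) (auto simp: F_def plus_prod_def split: split_indicator)
    also have "\<dots> = (\<integral>\<^sup>+h. \<integral>\<^sup>+z. ennreal (\<rho> j h) * ennreal (norm (F (z + (h, 0)) - F z)) \<partial>lborel \<partial>lborel)"
      by (rule lborel_pair.Fubini') measurable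
    also have "\<dots> = (\<integral>\<^sup>+h. ennreal (\<rho> j h) * ennreal (\<integral>z. norm (F (z + (h, 0)) - F z) \<partial>lborel) \<partial>lborel)"
      using F integrable_lborel_shift[OF F] by (simp add: nn_integral_cmult nn_integral_eq_integral)
    finally show ?thesis .
  qed
  show ?thesis
  proof (rule tendsto_ennreal_0)
    fix e :: real assume "e > 0"
    obtain d where d: "d > 0" "\<forall>h. norm h < d \<longrightarrow> (\<integral>z. norm (F (z + h) - F z) \<partial>lborel) < e"
      using translation_L1_eps[OF F \<open>e > 0\<close>] by (elim exE conjE)
    obtain J where J: "1 / real (Suc J) < d" using d(1) nat_approx_posE by blast
    have "?N j \<le> ennreal e" if "j \<ge> J" for j
    proof -
      have "(\<integral>\<^sup>+h. ennreal (\<rho> j h) * ennreal (\<integral>z. norm (F (z + (h, 0)) - F z) \<partial>lborel) \<partial>lborel)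
         \<le> (\<integral>\<^sup>+h. ennreal (\<rho> j h) * ennreal e \<partial>lborel)"
      proof (rule nn_integral_mono)
        fix h :: real
        show "ennreal (\<rho> j h) * ennreal (\<integral>z. norm (F (z + (h, 0)) - F z) \<partial>lborel) \<le> ennreal (\<rho> j h) * ennreal e"
        proof (cases "\<bar>h\<bar> < d")
          case True
          then have "norm (h, 0::space) < d" by (simp add: norm_Pair)
          from d(2)[rule_format, OF this] show ?thesis by (intro mult_left_mono ennreal_leI) auto
        next
          case False
          have "1 / real (Suc j) \<le> 1 / real (Suc J)" using that by (simp add: frac_le)
          then have "\<rho> j h = 0" using False J by (intro approx_identityD(7)[OF \<rho>]) linarith
          then show ?thesis by simp
        qed
      qed
      also have "\<dots> = (\<integral>\<^sup>+h. ennreal (\<rho> j h) \<partial>lborel) * ennreal e" by (simp add: nn_integral_multc)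
      also have "(\<integral>\<^sup>+h. ennreal (\<rho> j h) \<partial>lborel) = 1"
        using rnn approx_identityD[OF \<rho>] by (subst nn_integral_eq_integral) auto
      finally show ?thesis using N_le[of j] by simp
    qed
    then show "\<forall>\<^sub>F j in sequentially. ?N j \<le> ennreal e" by (auto simp: eventually_sequentially)
  qed
qed

text \<open>The norm of L^infinity(0,T;L1). Stated with the nonnegative integral, so that finiteness
  of the slice integrals is part of the bound.\<close>

definition slice_bounded :: "real \<Rightarrow> (spacetime \<Rightarrow> real) \<Rightarrow> bool" where
  "slice_bounded T g \<longleftrightarrow> (\<exists>C. AE t in time_measure T. (\<integral>\<^sup>+x. ennreal \<bar>g (t, x)\<bar> \<partial>cell_measure) \<le> ennreal C)"

lemma finite_cyl: "finite_measure (cyl_measure T)"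
  by (rule cyl.finite_measure_axioms)

lemma integrable_smear:
  fixes f g :: "spacetime \<Rightarrow> real" and k :: "space \<Rightarrow> real" and \<rho> :: "real \<Rightarrow> real"
  assumes f: "integrable (cyl_measure T) f" and g: "integrable (cyl_measure T) g"
    and [measurable]: "k \<in> borel_measurable borel" "\<rho> \<in> borel_measurable borel"
    and k: "\<And>x. \<bar>k x\<bar> \<le> B" and \<rho>: "\<And>h. \<bar>\<rho> h\<bar> \<le> B'"
  shows "integrable (cyl_measure T \<Otimes>\<^sub>M cyl_measure T)
    (\<lambda>p. f (fst p) * g (snd p) * (k (snd (snd p) - snd (fst p)) * \<rho> (fst (fst p) - fst (snd p))))"
proof -
  have [measurable]: "f \<in> borel_measurable borel" "g \<in> borel_measurable borel"
    using f g by (auto dest: borel_measurable_integrable)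
  have "integrable (cyl_measure T \<Otimes>\<^sub>M cyl_measure T) (\<lambda>p. (B * B') * (f (fst p) * g (snd p)))"
    by (rule Bochner_Integration.integrable_mult_right, rule integrable_pair_mult[OF finite_cyl finite_cyl f g])
  then show ?thesis
  proof (rule Bochner_Integration.integrable_bound)
    have "B \<ge> 0" "B' \<ge> 0" using order_trans[OF abs_ge_zero k] order_trans[OF abs_ge_zero \<rho>] by auto
    then have "\<bar>k x * \<rho> h\<bar> \<le> \<bar>B * B'\<bar>" for x h
      unfolding abs_mult by (intro mult_mono) (use k \<rho> in auto)
    from mult_left_mono[OF this abs_ge_zero]
    have "\<bar>a * (k x * \<rho> h)\<bar> \<le> \<bar>B * B' * a\<bar>" for a x h
      by (simp only: abs_mult mult.commute[of "\<bar>B\<bar> * \<bar>B'\<bar>"])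
    then
    show "AE p in cyl_measure T \<Otimes>\<^sub>M cyl_measure T. norm (f (fst p) * g (snd p) * (k (snd (snd p) - snd (fst p)) * \<rho> (fst (fst p) - fst (snd p))))
        \<le> norm (B * B' * (f (fst p) * g (snd p)))"
      by (intro AE_I2) (simp only: real_norm_def)
  qed measurable
qed

text \<open>Once the t-integral is carried out, \<open>f\<close> enters through its time
  mollification, evaluated at the time of \<open>g\<close>. At a fixed time the spatial integrals of
  the two factors separate, so the slice bound for \<open>g\<close> reduces the error to B C times
  the L1 error of the mollification.\<close>

lemma smear_limit:
  fixes f g :: "spacetime \<Rightarrow> real" and k :: "space \<Rightarrow> real"
  assumes [measurable]: "f \<in> borel_measurable borel" and f: "integrable (cyl_measure T) f"
    and f0: "\<And>t x. t \<notin> {0<..<T} \<Longrightarrow> f (t, x) = 0" and \<rho>: "approx_identity \<rho>"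
    and [measurable]: "g \<in> borel_measurable borel" and g: "integrable (cyl_measure T) g" "slice_bounded T g"
    and [measurable]: "k \<in> borel_measurable borel" and k: "\<And>x. \<bar>k x\<bar> \<le> B"
  shows "(\<lambda>j. smear T (\<rho> j) f g k) \<longlonglongrightarrow>
    (\<integral>z. g z * (\<integral>x. f (fst z, x) * k (snd z - x) \<partial>cell_measure) \<partial>cyl_measure T)"
proof -
  interpret ZZ: pair_sigma_finite "cyl_measure T" "cyl_measure T" ..
  have [measurable]: "\<rho> j \<in> borel_measurable borel" for j by (rule approx_identityD[OF \<rho>])
  have B: "0 \<le> B" using order_trans[OF abs_ge_zero k] .
  obtain C where C: "AE t in time_measure T. (\<integral>\<^sup>+x. ennreal \<bar>g (t, x)\<bar> \<partial>cell_measure) \<le> ennreal C"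
    using g(2) by (auto simp: slice_bounded_def)
  define fj where "fj j z = (\<integral>t. f (t, snd z) * \<rho> j (t - fst z) \<partial>time_measure T)" for j z
  have [measurable]: "fj j \<in> borel_measurable borel" for j
    unfolding fj_def[abs_def] by (rule time.borel_measurable_lebesgue_integral) measurable
  define N where "N j = (\<integral>\<^sup>+z. ennreal \<bar>fj j z - f z\<bar> \<partial>cyl_measure T)" for j
  have N: "N \<longlonglongrightarrow> 0" unfolding N_def[abs_def] fj_def
    by (rule time_mollify_L1[OF _ f f0 \<rho>]) auto
  let ?L = "\<integral>z. g z * (\<integral>x. f (fst z, x) * k (snd z - x) \<partial>cell_measure) \<partial>cyl_measure T"
  have le: "ennreal (norm (smear T (\<rho> j) f g k - ?L)) \<le> ennreal (B * C) * N j" for j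
  proof -
    obtain B' where B': "\<And>h. \<bar>\<rho> j h\<bar> \<le> B'"
      using approx_identityD(2,4)[OF \<rho>, of j] by (metis abs_of_nonneg)
    note int = integrable_smear[where k = k and \<rho> = "\<rho> j", OF f g(1) _ _ k B']
    have int': "integrable (cyl_measure T \<Otimes>\<^sub>M cyl_measure T)
        (\<lambda>(x, y). f x * g y * (k (snd y - snd x) * \<rho> j (fst x - fst y)))"
      using int by (simp add: case_prod_unfold)
    have inner: "integrable (cyl_measure T) (\<lambda>x. f x * (k (snd y - snd x) * \<rho> j (fst x - fst y)))" for y
    proof -
      have "integrable (cyl_measure T) (\<lambda>x. (B * B') * f x)" using f by simp
      then show ?thesis
      proof (rule Bochner_Integration.integrable_bound)
        have "\<bar>k x * \<rho> j h\<bar> \<le> \<bar>B * B'\<bar>" for x h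
          unfolding abs_mult by (intro mult_mono order_trans[OF k] order_trans[OF B']) auto
        from mult_right_mono[OF this abs_ge_zero]
        show "AE x in cyl_measure T. norm (f x * (k (snd y - snd x) * \<rho> j (fst x - fst y))) \<le> norm (B * B' * f x)"
          by (intro AE_I2) (simp add: abs_mult mult.commute)
      qed measurable
    qed
    have inner_pair: "integrable (time_measure T \<Otimes>\<^sub>M cell_measure) (\<lambda>(t, x). f (t, x) * (k (snd y - x) * \<rho> j (t - fst y)))" for y
      using inner[of y] unfolding cyl_measure_def by (simp add: case_prod_unfold)
    have inner_eq: "(\<integral>x. f x * (k (snd y - snd x) * \<rho> j (fst x - fst y)) \<partial>cyl_measure T)
        = (\<integral>x. fj j (fst y, x) * k (snd y - x) \<partial>cell_measure)" for y
    proof -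
      have "(\<integral>x. f x * (k (snd y - snd x) * \<rho> j (fst x - fst y)) \<partial>cyl_measure T)
        = (\<integral>x. \<integral>t. f (t, x) * (k (snd y - x) * \<rho> j (t - fst y)) \<partial>time_measure T \<partial>cell_measure)"
        unfolding cyl_measure_def by (subst cyl.integral_snd[OF inner_pair]) (simp add: case_prod_unfold)
      also have "\<dots> = (\<integral>x. \<integral>t. k (snd y - x) * (f (t, x) * \<rho> j (t - fst y)) \<partial>time_measure T \<partial>cell_measure)"
        by (simp add: mult_ac)
      also have "\<dots> = (\<integral>x. fj j (fst y, x) * k (snd y - x) \<partial>cell_measure)"
        by (simp add: fj_def mult.commute)
      finally show ?thesis .
    qed
    have inner_int: "integrable cell_measure (\<lambda>x. fj j (fst y, x) * k (snd y - x))" for y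
    proof -
      have "integrable cell_measure (\<lambda>x. \<integral>t. f (t, x) * (k (snd y - x) * \<rho> j (t - fst y)) \<partial>time_measure T)"
        by (rule cyl.integrable_snd[OF inner_pair])
      also have "(\<lambda>x. \<integral>t. f (t, x) * (k (snd y - x) * \<rho> j (t - fst y)) \<partial>time_measure T)
        = (\<lambda>x. \<integral>t. k (snd y - x) * (f (t, x) * \<rho> j (t - fst y)) \<partial>time_measure T)"
        by (simp add: mult_ac)
      finally show ?thesis by (simp add: fj_def mult.commute)
    qed
    have sm: "smear T (\<rho> j) f g k = (\<integral>y. g y * (\<integral>x. fj j (fst y, x) * k (snd y - x) \<partial>cell_measure) \<partial>cyl_measure T)"
    proof -
      have "smear T (\<rho> j) f g k = (\<integral>y. \<integral>x. f x * g y * (k (snd y - snd x) * \<rho> j (fst x - fst y)) \<partial>cyl_measure T \<partial>cyl_measure T)"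
        unfolding smear_def by (subst ZZ.integral_snd[OF int']) (simp add: case_prod_unfold)
      also have "\<dots> = (\<integral>y. \<integral>x. g y * (f x * (k (snd y - snd x) * \<rho> j (fst x - fst y))) \<partial>cyl_measure T \<partial>cyl_measure T)"
        by (simp add: mult_ac)
      finally show ?thesis by (simp add: inner_eq)
    qed
    have smi: "integrable (cyl_measure T) (\<lambda>y. g y * (\<integral>x. fj j (fst y, x) * k (snd y - x) \<partial>cell_measure))"
    proof -
      have "integrable (cyl_measure T) (\<lambda>y. \<integral>x. f x * g y * (k (snd y - snd x) * \<rho> j (fst x - fst y)) \<partial>cyl_measure T)"
        by (rule ZZ.integrable_snd[OF int'])
      also have "(\<lambda>y. \<integral>x. f x * g y * (k (snd y - snd x) * \<rho> j (fst x - fst y)) \<partial>cyl_measure T)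
         = (\<lambda>y. \<integral>x. g y * (f x * (k (snd y - snd x) * \<rho> j (fst x - fst y))) \<partial>cyl_measure T)"
        by (simp add: mult_ac)
      finally show ?thesis by (simp add: inner_eq)
    qed
    have "ennreal (norm (smear T (\<rho> j) f g k - ?L))
      \<le> (\<integral>\<^sup>+y. ennreal (norm (g y * (\<integral>x. fj j (fst y, x) * k (snd y - x) \<partial>cell_measure)
          - g y * (\<integral>x. f (fst y, x) * k (snd y - x) \<partial>cell_measure))) \<partial>cyl_measure T)"
      unfolding sm by (rule nn_integral_norm_diff_bound[OF smi]) measurable
    also have "\<dots> \<le> (\<integral>\<^sup>+y. ennreal \<bar>g y\<bar> * (ennreal B * (\<integral>\<^sup>+x. ennreal \<bar>fj j (fst y, x) - f (fst y, x)\<bar> \<partial>cell_measure)) \<partial>cyl_measure T)"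
    proof (rule nn_integral_mono)
      fix y :: spacetime
      have "ennreal (norm ((\<integral>x. fj j (fst y, x) * k (snd y - x) \<partial>cell_measure) - (\<integral>x. f (fst y, x) * k (snd y - x) \<partial>cell_measure)))
        \<le> (\<integral>\<^sup>+x. ennreal (norm (fj j (fst y, x) * k (snd y - x) - f (fst y, x) * k (snd y - x))) \<partial>cell_measure)"
        by (rule nn_integral_norm_diff_bound[OF inner_int]) measurable
      also have "\<dots> \<le> (\<integral>\<^sup>+x. ennreal B * ennreal \<bar>fj j (fst y, x) - f (fst y, x)\<bar> \<partial>cell_measure)"
      proof (rule nn_integral_mono)
        fix x
        have "norm (fj j (fst y, x) * k (snd y - x) - f (fst y, x) * k (snd y - x)) \<le> B * \<bar>fj j (fst y, x) - f (fst y, x)\<bar>"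
          unfolding left_diff_distrib[symmetric] using mult_right_mono[OF k[of "snd y - x"] abs_ge_zero[of "fj j (fst y, x) - f (fst y, x)"]]
          by (simp add: abs_mult mult.commute)
        then show "ennreal (norm (fj j (fst y, x) * k (snd y - x) - f (fst y, x) * k (snd y - x)))
           \<le> ennreal B * ennreal \<bar>fj j (fst y, x) - f (fst y, x)\<bar>"
          using B by (simp flip: ennreal_mult)
      qed
      also have "\<dots> = ennreal B * (\<integral>\<^sup>+x. ennreal \<bar>fj j (fst y, x) - f (fst y, x)\<bar> \<partial>cell_measure)"
        by (rule nn_integral_cmult) measurable
      finally show "ennreal (norm (g y * (\<integral>x. fj j (fst y, x) * k (snd y - x) \<partial>cell_measure)
          - g y * (\<integral>x. f (fst y, x) * k (snd y - x) \<partial>cell_measure)))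
          \<le> ennreal \<bar>g y\<bar> * (ennreal B * (\<integral>\<^sup>+x. ennreal \<bar>fj j (fst y, x) - f (fst y, x)\<bar> \<partial>cell_measure))"
        unfolding right_diff_distrib[symmetric] norm_mult by (simp add: ennreal_mult mult_left_mono)
    qed
    also have "\<dots> = (\<integral>\<^sup>+t. (\<integral>\<^sup>+y. ennreal \<bar>g (t, y)\<bar> * (ennreal B * (\<integral>\<^sup>+x. ennreal \<bar>fj j (t, x) - f (t, x)\<bar> \<partial>cell_measure)) \<partial>cell_measure) \<partial>time_measure T)"
      by (subst nn_integral_cyl) auto
    also have "\<dots> = (\<integral>\<^sup>+t. (\<integral>\<^sup>+y. ennreal \<bar>g (t, y)\<bar> \<partial>cell_measure) * (ennreal B * (\<integral>\<^sup>+x. ennreal \<bar>fj j (t, x) - f (t, x)\<bar> \<partial>cell_measure)) \<partial>time_measure T)"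
      by (intro nn_integral_cong nn_integral_multc) measurable
    also have "\<dots> \<le> (\<integral>\<^sup>+t. ennreal C * (ennreal B * (\<integral>\<^sup>+x. ennreal \<bar>fj j (t, x) - f (t, x)\<bar> \<partial>cell_measure)) \<partial>time_measure T)"
      by (rule nn_integral_mono_AE) (use C in eventually_elim, auto intro!: mult_right_mono)
    also have "\<dots> = ennreal (B * C) * N j"
      using B by (simp add: N_def nn_integral_cyl nn_integral_cmult ennreal_mult' mult_ac)
    finally show ?thesis .
  qed
  have "(\<lambda>j. ennreal (B * C) * N j) \<longlonglongrightarrow> ennreal (B * C) * 0"
    by (intro tendsto_mult_ennreal tendsto_const N) auto
  then have lim: "(\<lambda>j. ennreal (B * C) * N j) \<longlonglongrightarrow> 0" by simp
  have lim0: "(\<lambda>j. ennreal (norm (smear T (\<rho> j) f g k - ?L))) \<longlonglongrightarrow> 0"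
    by (rule tendsto_sandwich[OF always_eventually always_eventually tendsto_const lim]) (simp_all only: le zero_le simp_thms)
  have "(\<lambda>j. norm (smear T (\<rho> j) f g k - ?L)) \<longlonglongrightarrow> 0"
    by (rule ennreal_tendsto_0_iff[of "\<lambda>j. norm (smear T (\<rho> j) f g k - ?L)", THEN iffD1, OF norm_ge_zero lim0])
  then show ?thesis by (rule LIM_zero_cancel[OF tendsto_norm_zero_cancel])
qed

section \<open>Smooth kernels in space and time\<close>

section \<open>Periodised bumps\<close>

text \<open>With u = 1/s this is u^2 exp(-u) <= 2, a consequence of the quadratic Taylor bound of
  exp.\<close>

lemma flat'_le_2: "flat' s \<le> 2"
proof (cases "s > 0")
  case True
  have "(1 / s)\<^sup>2 / 2 \<le> exp (1 / s)"
  proof -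
    have "1 + 1 / s + (1 / s)\<^sup>2 / 2 \<le> exp (1 / s)"
      using exp_lower_Taylor_quadratic[of "1 / s"] True by simp
    then show ?thesis using True by (smt (verit) divide_pos_pos)
  qed
  then show ?thesis using True
    by (simp add: flat'_def exp_minus field_simps power2_eq_square)
qed (simp add: flat'_def)

text \<open>The steepness c allows two uses: c = 1/r^2 gives the mollifier of width r up to a
  factor, while for c tending to infinity the bumps increase to the indicator of the ball of radius
  r.\<close>

definition bump_on :: "real \<Rightarrow> real \<Rightarrow> space \<Rightarrow> real" where
  "bump_on c r x = flat (c * (r\<^sup>2 - (norm x)\<^sup>2))"

definition bump_grad :: "real \<Rightarrow> real \<Rightarrow> space \<Rightarrow> space" where
  "bump_grad c r x = (- 2 * c * flat' (c * (r\<^sup>2 - (norm x)\<^sup>2))) *\<^sub>R x"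

definition pbump :: "real \<Rightarrow> real \<Rightarrow> space \<Rightarrow> real" where
  "pbump c r x = bump_on c r (x - nearest x)"

definition pbump_grad :: "real \<Rightarrow> real \<Rightarrow> space \<Rightarrow> space" where
  "pbump_grad c r x = bump_grad c r (x - nearest x)"

lemma bump_on_borel [measurable]: "bump_on c r \<in> borel_measurable borel"
  and bump_grad_borel [measurable]: "bump_grad c r \<in> borel_measurable borel"
  unfolding bump_on_def bump_grad_def by measurable

lemma pbump_borel [measurable]: "pbump c r \<in> borel_measurable borel"
  and pbump_grad_borel [measurable]: "pbump_grad c r \<in> borel_measurable borel"
  unfolding pbump_def[abs_def] pbump_grad_def[abs_def] by measurable

lemma periodic_pbump: "periodic (pbump c r)" and periodic_pbump_grad: "periodic (pbump_grad c r)"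
  by (simp_all add: periodic_def pbump_def pbump_grad_def nearest_add_Basis)

lemma abs_bump_on_le: "\<bar>bump_on c r x\<bar> \<le> 1" and abs_pbump_le: "\<bar>pbump c r x\<bar> \<le> 1"
  by (simp_all add: bump_on_def pbump_def abs_le_iff flat_le_1 order_trans[OF _ flat_nonneg])

lemma bump_on_eq_0: "c > 0 \<Longrightarrow> r > 0 \<Longrightarrow> r \<le> norm x \<Longrightarrow> bump_on c r x = 0"
  and bump_grad_eq_0: "c > 0 \<Longrightarrow> r > 0 \<Longrightarrow> r \<le> norm x \<Longrightarrow> bump_grad c r x = 0"
proof -
  assume "c > 0" "r > 0" "r \<le> norm x"
  then have "c * (r\<^sup>2 - (norm x)\<^sup>2) \<le> 0" by (simp add: mult_le_0_iff power_mono)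
  then show "bump_on c r x = 0" "bump_grad c r x = 0"
    by (simp_all add: bump_on_def bump_grad_def flat_def flat'_def)
qed

lemma norm_bump_grad_le:
  assumes "c > 0" "r > 0" shows "norm (bump_grad c r x) \<le> 4 * c * r"
proof (cases "norm x < r")
  case True
  have "norm (bump_grad c r x) = 2 * c * flat' (c * (r\<^sup>2 - (norm x)\<^sup>2)) * norm x"
    using assms flat'_nonneg by (simp add: bump_grad_def abs_mult)
  also have "\<dots> \<le> 2 * c * 2 * r"
    using assms True flat'_nonneg flat'_le_2 by (intro mult_mono) auto
  finally show ?thesis by simp
next
  case False
  then show ?thesis using assms bump_grad_eq_0[of c r x] by simp
qed

lemma norm_pbump_grad_le: "c > 0 \<Longrightarrow> r > 0 \<Longrightarrow> norm (pbump_grad c r x) \<le> 4 * c * r"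
  unfolding pbump_grad_def by (rule norm_bump_grad_le)

lemma bump_on_has_derivative:
  "(bump_on c r has_derivative (\<lambda>h. bump_grad c r x \<bullet> h)) (at x)"
proof -
  have "((\<lambda>x. c * (r\<^sup>2 - x \<bullet> x)) has_derivative (\<lambda>h. - 2 * c * (x \<bullet> h))) (at x)"
    by (auto intro!: derivative_eq_intros simp: inner_commute)
  from has_derivative_compose[OF this flat_deriv[unfolded has_field_derivative_def]]
  show ?thesis by (simp add: bump_on_def[abs_def] bump_grad_def power2_norm_eq_inner mult_ac)
qed

text \<open>\<open>nearest\<close> jumps across the faces of the lattice cells, but there the bump
  vanishes. If w rounds to a lattice point other than k, then one coordinate of both w - k and w -
  \<open>nearest\<close> w is at least r in modulus, and both sides are 0.\<close>

lemma pbump_local: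
  assumes "0 < c" "0 < r" "r < 1/2" and k: "k \<in> lattice" "z - k \<in> torus_cell" and w: "norm (w - z) < 1/2 - r"
  shows "pbump c r w = bump_on c r (w - k)"
proof (cases "nearest w = k")
  case False
  have "k \<noteq> nearest w" using False by simp
  then obtain b where b: "b \<in> Basis" "(nearest w - k) \<bullet> b \<noteq> 0"
    by (metis euclidean_eqI inner_zero_left right_minus_eq)
  have "nearest w - k \<in> lattice" using k nearest_lattice lattice_closed(2) by blast
  then have "(nearest w - k) \<bullet> b \<in> \<int>" using b by (auto simp: lattice_def)
  then have one: "\<bar>(nearest w - k) \<bullet> b\<bar> \<ge> 1" using b(2) Ints_nonzero_abs_ge1 by blast
  have z: "\<bar>(z - k) \<bullet> b\<bar> \<le> 1/2" using k(2) b by (auto simp: mem_torus_cell)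
  have wb: "\<bar>(w - z) \<bullet> b\<bar> < 1/2 - r" using w Basis_le_norm[OF b(1), of "w - z"] by linarith
  have wn: "\<bar>(w - nearest w) \<bullet> b\<bar> \<le> 1/2" using frac_mem_torus_cell[of w] b by (auto simp: mem_torus_cell)
  \<comment> \<open>The two lattice points are at least 1 apart in this coordinate, and w is within
    1/2 of one and within 1 - r of the other; each distance is at least 1 minus the other.\<close>
  have "\<bar>(w - nearest w) \<bullet> b\<bar> \<ge> r" "\<bar>(w - k) \<bullet> b\<bar> \<ge> r"
    using one z wb wn assms(2,3) unfolding inner_diff_left by linarith+
  then have "norm (w - nearest w) \<ge> r" "norm (w - k) \<ge> r"
    using Basis_le_norm[OF b(1)] order_trans by blast+
  then show ?thesis using assms by (simp add: pbump_def bump_on_eq_0)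
qed (simp add: pbump_def)

lemma pbump_has_derivative:
  assumes "0 < c" "0 < r" "r < 1/2"
  shows "(pbump c r has_derivative (\<lambda>h. pbump_grad c r x \<bullet> h)) (at x)"
proof -
  have "((\<lambda>w. bump_on c r (w - nearest x)) has_derivative (\<lambda>h. pbump_grad c r x \<bullet> h)) (at x)"
    unfolding pbump_grad_def
    by (rule has_derivative_compose[OF _ bump_on_has_derivative]) (auto intro!: derivative_eq_intros)
  then show ?thesis
  proof (rule has_derivative_transform_within_open[of _ _ _ UNIV "ball x (1/2 - r)"])
    fix w assume "w \<in> ball x (1/2 - r)"
    then show "bump_on c r (w - nearest x) = pbump c r w"
      using pbump_local[OF assms nearest_lattice frac_mem_torus_cell]
      by (simp add: dist_norm norm_minus_commute)
  qed (use assms in auto)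
qed

text \<open>This includes the faces, where \<open>nearest\<close> need not be 0 but both bumps
  vanish. The gradients agree because the two functions coincide near x and derivatives are
  unique.\<close>

lemma pbump_cell:
  assumes "0 < c" "0 < r" "r < 1/2" "x \<in> torus_cell"
  shows "pbump c r x = bump_on c r x" "pbump_grad c r x = bump_grad c r x"
proof -
  have 0: "pbump c r w = bump_on c r w" if "norm (w - x) < 1/2 - r" for w
    using pbump_local[OF assms(1-3), of 0 x w] assms(4) that lattice_closed(4) by simp
  show "pbump c r x = bump_on c r x" using 0[of x] assms by simp
  have "(bump_on c r has_derivative (\<lambda>h. pbump_grad c r x \<bullet> h)) (at x)"
  proof (rule has_derivative_transform_within_open[OF pbump_has_derivative[OF assms(1-3)], of "ball x (1/2 - r)"])
    fix w assume "w \<in> ball x (1/2 - r)"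
    then show "pbump c r w = bump_on c r w" by (intro 0) (simp add: dist_norm norm_minus_commute)
  qed (use assms in auto)
  from has_derivative_unique[OF this bump_on_has_derivative]
  have "pbump_grad c r x \<bullet> h = bump_grad c r x \<bullet> h" for h by metis
  then show "pbump_grad c r x = bump_grad c r x" by (metis vector_eq_rdot)
qed

lemma smooth_fun_bump_on:
  assumes "bounded_linear L" shows "smooth_fun (\<lambda>z. bump_on c r (L z - y))"
  unfolding bump_on_def
  by (intro smooth_fun_flat smooth_fun_mult smooth_fun_minus smooth_fun_const smooth_fun_norm_sq assms)

lemma smooth_fun_pbump:
  fixes L :: "'a::euclidean_space \<Rightarrow> space"
  assumes "bounded_linear L" "0 < c" "0 < r" "r < 1/2"
  shows "smooth_fun (\<lambda>z. pbump c r (L z + y))"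
proof (rule smooth_fun_local)
  fix z
  define k where "k = nearest (L z + y)"
  define U where "U = (\<lambda>w. L w + y) -` ball (L z + y) (1/2 - r)"
  have "open U" unfolding U_def
    by (intro open_vimage open_ball continuous_intros linear_continuous_on assms)
  moreover have "z \<in> U" using assms by (simp add: U_def)
  moreover have "smooth_fun (\<lambda>w. bump_on c r (L w - (k - y)))" by (intro smooth_fun_bump_on assms)
  moreover have "\<forall>w\<in>U. pbump c r (L w + y) = bump_on c r (L w - (k - y))"
  proof
    fix w assume "w \<in> U"
    then have "norm ((L w + y) - (L z + y)) < 1/2 - r" by (simp add: U_def dist_norm norm_minus_commute)
    from pbump_local[OF assms(2-4) nearest_lattice frac_mem_torus_cell this]
    show "pbump c r (L w + y) = bump_on c r (L w - (k - y))" by (simp add: k_def algebra_simps)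
  qed
  ultimately show "\<exists>U g. open U \<and> z \<in> U \<and> smooth_fun g \<and> (\<forall>w\<in>U. pbump c r (L w + y) = g w)" by blast
qed

definition tbump :: "nat \<Rightarrow> real \<Rightarrow> real" where
  "tbump j h = flat ((1 / real (Suc j))\<^sup>2 - h\<^sup>2) / (\<integral>h. flat ((1 / real (Suc j))\<^sup>2 - h\<^sup>2) \<partial>lborel)"

definition tbump' :: "nat \<Rightarrow> real \<Rightarrow> real" where
  "tbump' j h = - 2 * h * flat' ((1 / real (Suc j))\<^sup>2 - h\<^sup>2) / (\<integral>h. flat ((1 / real (Suc j))\<^sup>2 - h\<^sup>2) \<partial>lborel)"

lemma tbump_deriv: "(tbump j has_real_derivative tbump' j h) (at h)"
proof -
  have "((\<lambda>h. flat ((1 / real (Suc j))\<^sup>2 - h\<^sup>2)) has_real_derivative flat' ((1 / real (Suc j))\<^sup>2 - h\<^sup>2) * (- 2 * h)) (at h)"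
    by (rule DERIV_chain2[OF flat_deriv]) (auto intro!: derivative_eq_intros)
  from DERIV_cdivide[OF this] show ?thesis
    unfolding tbump_def[abs_def] tbump'_def by (simp add: mult_ac)
qed

lemma tbump_borel [measurable]: "tbump j \<in> borel_measurable borel"
  and tbump'_borel [measurable]: "tbump' j \<in> borel_measurable borel"
  unfolding tbump_def[abs_def] tbump'_def[abs_def] by measurable

lemma tbump_eq_0:
  assumes "1 / real (Suc j) \<le> \<bar>h\<bar>" shows "tbump j h = 0" "tbump' j h = 0"
proof -
  have "(1 / real (Suc j))\<^sup>2 \<le> h\<^sup>2"
    using assms by (metis abs_le_square_iff abs_of_nonneg divide_nonneg_nonneg of_nat_0_le_iff zero_le_one)
  then show "tbump j h = 0" "tbump' j h = 0" by (simp_all add: tbump_def tbump'_def flat_def flat'_def)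
qed

lemma tbump_uminus: "tbump j (- h) = tbump j h" by (simp add: tbump_def)

lemma smooth_fun_tbump:
  fixes L :: "'a::euclidean_space \<Rightarrow> real"
  assumes "bounded_linear L" shows "smooth_fun (\<lambda>z. tbump j (L z - s))"
proof -
  have "smooth_fun (\<lambda>z. (1 / (\<integral>h. flat ((1 / real (Suc j))\<^sup>2 - h\<^sup>2) \<partial>lborel)) * flat ((1 / real (Suc j))\<^sup>2 - (norm (L z - s))\<^sup>2))"
    by (intro smooth_fun_flat smooth_fun_mult smooth_fun_minus smooth_fun_const smooth_fun_norm_sq assms)
  then show ?thesis by (simp add: tbump_def[abs_def])
qed

lemma approx_identity_tbump: "approx_identity tbump"
  unfolding approx_identity_def
proof (intro allI conjI impI)
  fix j h
  let ?d = "1 / real (Suc j)"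
  let ?f = "\<lambda>h. flat (?d\<^sup>2 - h\<^sup>2)"
  have int: "integrable lborel ?f"
  proof (rule Bochner_Integration.integrable_bound)
    show "integrable lborel (indicator {-?d..?d} :: real \<Rightarrow> real)" by simp
    have "?f h = 0" if "h \<notin> {-?d..?d}" for h
      using that abs_le_square_iff[of ?d h] by (auto simp: flat_def)
    then show "AE h in lborel. norm (?f h) \<le> norm (indicator {-?d..?d} h :: real)"
      by (intro AE_I2) (auto simp: flat_nonneg flat_le_1 split: split_indicator)
  qed measurable
  have pos: "integral\<^sup>L lborel ?f > 0"
  proof -
    have "integral\<^sup>L lborel ?f \<noteq> 0"
    proof
      assume "integral\<^sup>L lborel ?f = 0"
      then have "AE h in lborel. ?f h = 0"
        using integral_nonneg_eq_0_iff_AE[OF int] flat_nonneg by auto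
      moreover have "?f h \<noteq> 0" if "h \<in> {-?d<..<?d}" for h
      proof -
        have "h\<^sup>2 < ?d\<^sup>2" using that power_strict_mono[of "\<bar>h\<bar>" ?d 2] by auto
        then show ?thesis by (simp add: flat_def)
      qed
      ultimately have "AE h in lborel. h \<notin> {-?d<..<?d}" by (auto elim!: eventually_mono)
      then have "{-?d<..<?d} \<in> null_sets lborel" by (subst AE_iff_null_sets) auto
      then have "emeasure lborel {-?d<..<?d} = 0" by blast
      moreover have "emeasure lborel {-?d<..<?d} = ennreal (?d - - ?d)"
        by (rule emeasure_lborel_Ioo) (simp add: order_trans[of _ 0])
      ultimately show False by simp
    qed
    moreover have "integral\<^sup>L lborel ?f \<ge> 0" using flat_nonneg by (intro integral_nonneg_AE) auto
    ultimately show ?thesis by simp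
  qed
  show "tbump j \<in> borel_measurable borel" by measurable
  show "0 \<le> tbump j h" unfolding tbump_def using pos flat_nonneg by (intro divide_nonneg_nonneg) auto
  show "tbump j (- h) = tbump j h" by (simp add: tbump_def)
  show "\<exists>B. \<forall>h. tbump j h \<le> B"
    unfolding tbump_def using pos flat_le_1 by (intro exI[of _ "1 / integral\<^sup>L lborel ?f"] allI divide_right_mono) auto
  show "integrable lborel (tbump j)" unfolding tbump_def[abs_def] using int by (rule Bochner_Integration.integrable_divide)
  show "integral\<^sup>L lborel (tbump j) = 1" unfolding tbump_def[abs_def] using pos by simp
  show "tbump j h = 0" if "1 / real (Suc j) \<le> \<bar>h\<bar>" using tbump_eq_0(1)[OF that] .
qed

lemma tbump'_bounded: "\<exists>B. \<forall>h. \<bar>tbump' j h\<bar> \<le> B"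
proof (intro exI allI)
  let ?I = "\<integral>h. flat ((1 / real (Suc j))\<^sup>2 - h\<^sup>2) \<partial>lborel"
  fix h
  show "\<bar>tbump' j h\<bar> \<le> 4 / \<bar>?I\<bar>"
  proof (cases "1 / real (Suc j) \<le> \<bar>h\<bar>")
    case False
    moreover have "1 / real (Suc j) \<le> 1" by simp
    ultimately have "\<bar>h\<bar> \<le> 1" by linarith
    then have "2 * \<bar>h\<bar> * \<bar>flat' ((1 / real (Suc j))\<^sup>2 - h\<^sup>2)\<bar> \<le> 2 * 1 * 2"
      using flat'_nonneg flat'_le_2 by (intro mult_mono) auto
    then show ?thesis unfolding tbump'_def by (simp add: abs_mult divide_right_mono del: of_nat_Suc)
  qed (simp add: tbump_eq_0)
qed

lemma smear_swap:
  assumes [measurable]: "f \<in> borel_measurable borel" "g \<in> borel_measurable borel"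
    "k \<in> borel_measurable borel" "\<rho> \<in> borel_measurable borel"
  shows "smear T \<rho> f g k = smear T (\<lambda>h. \<rho> (- h)) g f (\<lambda>x. k (- x))"
proof -
  interpret ZZ: pair_sigma_finite "cyl_measure T" "cyl_measure T" ..
  have [measurable]: "(\<lambda>p. f (fst p) * g (snd p) * (k (snd (snd p) - snd (fst p)) * \<rho> (fst (fst p) - fst (snd p))))
      \<in> borel_measurable (cyl_measure T \<Otimes>\<^sub>M cyl_measure T)"
    by measurable
  from ZZ.integral_product_swap[OF this]
  show ?thesis by (simp add: smear_def case_prod_unfold mult.commute)
qed

text \<open>The limit of \<open>smear\<close> when the time kernel tends to the Dirac measure,
  expressed in the separation l = y - x.\<close>

definition correlation :: "real \<Rightarrow> (spacetime \<Rightarrow> real) \<Rightarrow> (spacetime \<Rightarrow> real) \<Rightarrow> (space \<Rightarrow> real) \<Rightarrow> real" where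
  "correlation T f g k = (\<integral>l. k l * (\<integral>z. f z * g (shift l z) \<partial>cyl_measure T) \<partial>cell_measure)"

text \<open>\<open>W\<close> dominates the product of \<open>f\<close> with every shift of
  \<open>g\<close>; this brings the integrals over z and l under Fubini for factors that may both be
  unbounded.\<close>

locale correlated =
  fixes T :: real and f g W :: "spacetime \<Rightarrow> real" and k :: "space \<Rightarrow> real" and B :: real and \<rho> :: "nat \<Rightarrow> real \<Rightarrow> real"
  assumes f_borel [measurable]: "f \<in> borel_measurable borel" and f_int: "integrable (cyl_measure T) f"
    and f0: "\<And>t x. t \<notin> {0<..<T} \<Longrightarrow> f (t, x) = 0" and f_per: "x_periodic f"
    and g_borel [measurable]: "g \<in> borel_measurable borel" and g_int: "integrable (cyl_measure T) g"
    and g0: "\<And>t x. t \<notin> {0<..<T} \<Longrightarrow> g (t, x) = 0" and g_per: "x_periodic g"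
    and k_borel [measurable]: "k \<in> borel_measurable borel" and k_bd: "\<And>x. \<bar>k x\<bar> \<le> B" and k_per: "periodic k"
    and W_borel [measurable]: "W \<in> borel_measurable borel" and W_per: "x_periodic W"
    and W_int: "integrable (cyl_measure T) W"
    and dom: "\<And>z l. \<bar>f z * g (shift l z)\<bar> \<le> W z + W (shift l z)"
    and \<rho>: "approx_identity \<rho>"
begin

lemma swap_pair:
  assumes "\<And>z l. \<bar>F z * G (shift (e l) z)\<bar> \<le> W z + W (shift (e l) z)"
    and [measurable]: "F \<in> borel_measurable borel" "G \<in> borel_measurable borel" "e \<in> borel_measurable borel" "k' \<in> borel_measurable borel"
    and k': "\<And>x. \<bar>k' x :: real\<bar> \<le> B"
  shows "(\<integral>z. F z * (\<integral>l. G (shift (e l) z) * k' l \<partial>cell_measure) \<partial>cyl_measure T)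
    = (\<integral>l. k' l * (\<integral>z. F z * G (shift (e l) z) \<partial>cyl_measure T) \<partial>cell_measure)"
proof -
  interpret P: pair_sigma_finite "cyl_measure T" cell_measure ..
  have int: "integrable (cyl_measure T \<Otimes>\<^sub>M cell_measure) (\<lambda>(z, l). F z * G (shift (e l) z) * k' l)"
  proof (rule integrable_cyl_pair[where W = W and K = B and e = e])
    fix z l
    have "\<bar>F z * G (shift (e l) z)\<bar> * \<bar>k' l\<bar> \<le> (W z + W (shift (e l) z)) * B"
      by (intro mult_mono assms(1) k') (use assms(1)[of z l] in auto)
    then show "norm (case (z, l) of (z, l) \<Rightarrow> F z * G (shift (e l) z) * k' l) \<le> B * (W z + W (shift (e l) z))"
      by (simp add: abs_mult mult.commute)
  qed (use W_per W_int cell.finite_measure_axioms in auto)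
  have "(\<integral>z. F z * (\<integral>l. G (shift (e l) z) * k' l \<partial>cell_measure) \<partial>cyl_measure T)
    = (\<integral>z. \<integral>l. F z * G (shift (e l) z) * k' l \<partial>cell_measure \<partial>cyl_measure T)"
    by (simp add: mult.assoc)
  also have "\<dots> = (\<integral>l. \<integral>z. F z * G (shift (e l) z) * k' l \<partial>cyl_measure T \<partial>cell_measure)"
    by (rule P.Fubini_integral[OF int, symmetric])
  also have "\<dots> = (\<integral>l. k' l * (\<integral>z. F z * G (shift (e l) z) \<partial>cyl_measure T) \<partial>cell_measure)"
    by (simp add: mult.commute)
  finally show ?thesis .
qed

text \<open>Here \<open>f\<close> is mollified in time and \<open>g\<close> carries the slice bound.
  The limit is rewritten in the separation l; reflecting l and then shifting z bring it to the form
  of \<open>correlation\<close>.\<close>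

lemma smear_tendsto_right:
  assumes "slice_bounded T g"
  shows "(\<lambda>j. smear T (\<rho> j) f g k) \<longlonglongrightarrow> correlation T f g k"
proof -
  have per: "periodic (\<lambda>x. f (fst z, x) * k (snd z - x))" for z
    using f_per periodic_lattice[OF k_per lattice_closed(3)[OF lattice_closed(5)], of _ "snd z - _"]
    by (auto simp: x_periodic_def periodic_def diff_diff_eq[symmetric])
  have "(\<integral>x. f (fst z, x) * k (snd z - x) \<partial>cell_measure) = (\<integral>l. f (shift l z) * k (- l) \<partial>cell_measure)" for z
    using integral_cell_shift[OF _ per[of z], of "snd z"] by (simp add: shift_def add.commute)
  then have "(\<integral>z. g z * (\<integral>x. f (fst z, x) * k (snd z - x) \<partial>cell_measure) \<partial>cyl_measure T)
     = (\<integral>z. g z * (\<integral>l. f (shift l z) * k (- l) \<partial>cell_measure) \<partial>cyl_measure T)" by simp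
  also have "\<dots> = (\<integral>l. k (- l) * (\<integral>z. g z * f (shift l z) \<partial>cyl_measure T) \<partial>cell_measure)"
  proof (rule swap_pair)
    show "\<bar>g z * f (shift l z)\<bar> \<le> W z + W (shift l z)" for z l
      using dom[of "shift l z" "- l"] by (simp add: mult.commute)
  qed (use k_bd in auto)
  also have "\<dots> = (\<integral>l. k l * (\<integral>z. g z * f (shift (- l) z) \<partial>cyl_measure T) \<partial>cell_measure)"
    using integral_cell_minus[of "\<lambda>l. k (- l) * (\<integral>z. g z * f (shift l z) \<partial>cyl_measure T)"] by simp
  also have "\<dots> = correlation T f g k"
  proof -
    have "(\<integral>z. g z * f (shift (- l) z) \<partial>cyl_measure T) = (\<integral>z. f z * g (shift l z) \<partial>cyl_measure T)" for l
      using integral_cyl_shift[of "\<lambda>z. g z * f (shift (- l) z)" T l]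
        x_periodic_compose2[OF g_per x_periodic_shift[OF f_per], of "(*)"] by (simp add: mult.commute)
    then show ?thesis by (simp add: correlation_def)
  qed
  finally show ?thesis
    using smear_limit[OF f_borel f_int f0 \<rho> g_borel g_int assms k_borel k_bd] by simp
qed

text \<open>The mirror image, for products whose second factor contains \<open>v\<close> and whose
  first factor carries the slice bound. Interchanging the two copies reflects the space kernel and
  leaves the even time kernel unchanged.\<close>

lemma smear_tendsto_left:
  assumes "slice_bounded T f"
  shows "(\<lambda>j. smear T (\<rho> j) f g k) \<longlonglongrightarrow> correlation T f g k"
proof -
  have per: "periodic (\<lambda>x. g (fst z, x) * k (- (snd z - x)))" for z
  proof -
    have "k (x + b - snd z) = k (x - snd z)" if "b \<in> Basis" for b x
      using k_per that unfolding periodic_def by (metis diff_add_eq)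
    then show ?thesis using g_per by (simp add: x_periodic_def periodic_def)
  qed
  have "(\<integral>x. g (fst z, x) * k (- (snd z - x)) \<partial>cell_measure) = (\<integral>l. g (shift l z) * k l \<partial>cell_measure)" for z
    using integral_cell_shift[OF _ per[of z], of "snd z"] by (simp add: shift_def add.commute)
  then have "(\<integral>z. f z * (\<integral>x. g (fst z, x) * k (- (snd z - x)) \<partial>cell_measure) \<partial>cyl_measure T)
     = (\<integral>z. f z * (\<integral>l. g (shift l z) * k l \<partial>cell_measure) \<partial>cyl_measure T)" by simp
  also have "\<dots> = correlation T f g k"
    unfolding correlation_def by (rule swap_pair) (use dom k_bd in auto)
  finally have eq: "(\<integral>z. f z * (\<integral>x. g (fst z, x) * k (- (snd z - x)) \<partial>cell_measure) \<partial>cyl_measure T) = correlation T f g k" .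
  have "smear T (\<rho> j) f g k = smear T (\<rho> j) g f (\<lambda>x. k (- x))" for j
    by (subst smear_swap) (auto simp: approx_identityD[OF \<rho>])
  then show ?thesis
    using smear_limit[OF g_borel g_int g0 \<rho> f_borel f_int assms, of "\<lambda>x. k (- x)" B] k_bd eq by simp
qed

end

section \<open>Calculus of periodic test functions\<close>

section \<open>Test functions\<close>

lemma has_derivative_gradient:
  fixes f :: "'a::euclidean_space \<Rightarrow> real"
  assumes "f differentiable at x"
  shows "(f has_derivative (\<lambda>h. gradient f x \<bullet> h)) (at x)"
proof -
  have lin: "linear (frechet_derivative f (at x))"
    using assms by (simp add: linear_frechet_derivative)
  have "frechet_derivative f (at x) h = gradient f x \<bullet> h" for h
  proof -
    have "frechet_derivative f (at x) h = frechet_derivative f (at x) (\<Sum>b\<in>Basis. (h \<bullet> b) *\<^sub>R b)"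
      by (simp add: euclidean_representation)
    also have "\<dots> = (\<Sum>b\<in>Basis. (h \<bullet> b) * frechet_derivative f (at x) b)"
      by (simp add: linear_sum[OF lin] linear_cmul[OF lin])
    also have "\<dots> = gradient f x \<bullet> h"
      unfolding gradient_def inner_sum_left inner_scaleR_left
      by (intro sum.cong refl) (simp add: inner_commute)
    finally show ?thesis .
  qed
  then show ?thesis using assms frechet_derivative_works by (metis (no_types, lifting) ext)
qed

lemma gradient_unique:
  assumes "(f has_derivative (\<lambda>h. g \<bullet> h)) (at x)" shows "gradient f x = g"
proof -
  have "frechet_derivative f (at x) = (\<lambda>h. g \<bullet> h)" using frechet_derivative_at[OF assms] by simp
  then show ?thesis by (simp add: gradient_def euclidean_representation)
qed

lemma smooth_fun_has_time_deriv:
  assumes "smooth_fun \<psi>"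
  shows "((\<lambda>s. \<psi> (s, x)) has_real_derivative time_deriv \<psi> (t, x)) (at t)"
    and "time_deriv \<psi> (t, x) = frechet_derivative \<psi> (at (t, x)) (1, 0)"
proof -
  have "((\<lambda>s. \<psi> (s, x)) has_derivative (\<lambda>h. frechet_derivative \<psi> (at (t, x)) (h, 0))) (at t)"
    by (rule has_derivative_compose[OF _ smooth_fun_has_derivative[OF assms], of "\<lambda>s. (s, x)"])
      (auto intro!: derivative_eq_intros)
  moreover have "(\<lambda>h. frechet_derivative \<psi> (at (t, x)) (h, 0)) = (*) (frechet_derivative \<psi> (at (t, x)) (1, 0))"
  proof
    fix h :: real
    show "frechet_derivative \<psi> (at (t, x)) (h, 0) = frechet_derivative \<psi> (at (t, x)) (1, 0) * h"
      using linear_cmul[OF linear_frechet_derivative[OF smooth_fun_differentiable[OF assms]], of "(t, x)" h "(1, 0)"]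
      by simp
  qed
  ultimately have *: "((\<lambda>s. \<psi> (s, x)) has_real_derivative frechet_derivative \<psi> (at (t, x)) (1, 0)) (at t)"
    by (simp only: has_field_derivative_def)
  then show "time_deriv \<psi> (t, x) = frechet_derivative \<psi> (at (t, x)) (1, 0)"
    by (simp add: time_deriv_def DERIV_imp_deriv)
  with * show "((\<lambda>s. \<psi> (s, x)) has_real_derivative time_deriv \<psi> (t, x)) (at t)" by simp
qed

lemma smooth_fun_has_space_gradient:
  assumes "smooth_fun \<psi>"
  shows "((\<lambda>y. \<psi> (t, y)) has_derivative (\<lambda>h. space_gradient \<psi> (t, x) \<bullet> h)) (at x)"
    and "space_gradient \<psi> (t, x) = (\<Sum>b\<in>Basis. frechet_derivative \<psi> (at (t, x)) (0, b) *\<^sub>R b)"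
proof -
  have *: "((\<lambda>y. \<psi> (t, y)) has_derivative (\<lambda>h. frechet_derivative \<psi> (at (t, x)) (0, h))) (at x)"
    by (rule has_derivative_compose[OF _ smooth_fun_has_derivative[OF assms], of "\<lambda>y. (t, y)"])
      (auto intro!: derivative_eq_intros)
  then show "((\<lambda>y. \<psi> (t, y)) has_derivative (\<lambda>h. space_gradient \<psi> (t, x) \<bullet> h)) (at x)"
    unfolding space_gradient_def by (auto intro!: has_derivative_gradient simp: differentiable_def)
  show "space_gradient \<psi> (t, x) = (\<Sum>b\<in>Basis. frechet_derivative \<psi> (at (t, x)) (0, b) *\<^sub>R b)"
    by (simp add: space_gradient_def gradient_def flip: fun_cong[OF frechet_derivative_at[OF *]])
qed

lemma time_deriv_unique:
  "((\<lambda>s. \<psi> (s, x)) has_real_derivative D) (at t) \<Longrightarrow> time_deriv \<psi> (t, x) = D"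
  by (simp add: time_deriv_def DERIV_imp_deriv)

lemma space_gradient_unique:
  "((\<lambda>y. \<psi> (t, y)) has_derivative (\<lambda>h. g \<bullet> h)) (at x) \<Longrightarrow> space_gradient \<psi> (t, x) = g"
  by (simp add: space_gradient_def gradient_unique)

lemma test_functionsD:
  assumes "\<psi> \<in> test_functions T"
  shows "smooth_fun \<psi>" "x_periodic \<psi>" "\<exists>a b. 0 < a \<and> b < T \<and> vanishes_outside a b \<psi>"
  using assms by (auto simp: test_functions_def x_periodic_def periodic_def)

lemma test_functionsI:
  "smooth_fun \<psi> \<Longrightarrow> x_periodic \<psi> \<Longrightarrow> 0 < a \<Longrightarrow> b < T \<Longrightarrow> vanishes_outside a b \<psi> \<Longrightarrow> \<psi> \<in> test_functions T"
  by (auto simp: test_functions_def x_periodic_def periodic_def)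

lemma vanishes_outside_deriv:
  fixes c :: spacetime
  assumes "vanishes_outside a b \<psi>"
  shows "vanishes_outside a b (\<lambda>z. frechet_derivative \<psi> (at z) c)"
  unfolding vanishes_outside_def
proof (intro allI impI)
  fix t :: real and x :: space assume t: "t \<notin> {a..b}"
  have "open (fst -` (- {a..b}) :: spacetime set)" by (intro open_vimage) (auto intro!: continuous_intros)
  moreover have "(t, x) \<in> fst -` (- {a..b})" using t by simp
  ultimately have "frechet_derivative \<psi> (at (t, x)) = frechet_derivative (\<lambda>_. 0) (at (t, x))"
    by (rule frechet_derivative_cong_open) (use assms in \<open>auto simp: vanishes_outside_def\<close>)
  then show "frechet_derivative \<psi> (at (t, x)) c = 0" by simp
qed

lemma x_periodic_deriv:
  assumes per: "x_periodic (\<psi> :: spacetime \<Rightarrow> real)" and diff: "\<And>z. \<psi> differentiable at z"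
  shows "x_periodic (\<lambda>z. frechet_derivative \<psi> (at z) c)"
  unfolding x_periodic_def periodic_def
proof (intro allI ballI)
  fix t :: real and b x :: space assume b: "b \<in> Basis"
  have "((\<lambda>z. \<psi> (z + (0, b))) has_derivative frechet_derivative \<psi> (at ((t, x) + (0, b)))) (at (t, x))"
    by (rule has_derivative_compose[of "\<lambda>z. z + (0, b)" "\<lambda>h. h"])
      (use diff frechet_derivative_works in \<open>auto intro!: derivative_eq_intros\<close>)
  moreover have "\<psi> (z + (0, b)) = \<psi> z" for z
    using per b by (cases z) (simp add: x_periodic_def periodic_def)
  ultimately have "frechet_derivative \<psi> (at (t, x)) = frechet_derivative \<psi> (at (t, x + b))"
    using frechet_derivative_at[of \<psi> _ "(t, x)"] by simp
  then show "frechet_derivative \<psi> (at (t, x + b)) c = frechet_derivative \<psi> (at (t, x)) c" by simp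
qed

lemma test_functions_deriv:
  assumes "\<psi> \<in> test_functions T" "c \<in> Basis"
  shows "(\<lambda>z. frechet_derivative \<psi> (at z) c) \<in> test_functions T"
proof -
  obtain a b where "0 < a" "b < T" "vanishes_outside a b \<psi>" using test_functionsD(3)[OF assms(1)] by blast
  then show ?thesis
    using test_functionsD[OF assms(1)] assms(2)
    by (intro test_functionsI[of _ a b] smooth_fun_deriv x_periodic_deriv vanishes_outside_deriv)
      (auto intro: smooth_fun_differentiable)
qed

lemma test_functions_bounded:
  assumes "\<psi> \<in> test_functions T"
  shows "\<exists>M. \<forall>z. \<bar>\<psi> z\<bar> \<le> M"
proof -
  obtain a b where ab: "vanishes_outside a b \<psi>" using test_functionsD(3)[OF assms] by blast
  have "compact ({a..b} \<times> torus_cell)" by (intro compact_Times) (auto simp: torus_cell_def)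
  then have "bounded (\<psi> ` ({a..b} \<times> torus_cell))"
    by (intro compact_imp_bounded compact_continuous_image smooth_fun_continuous test_functionsD[OF assms])
  then obtain M where M: "\<And>z. z \<in> {a..b} \<times> torus_cell \<Longrightarrow> \<bar>\<psi> z\<bar> \<le> M" by (auto simp: bounded_iff)
  have "\<bar>\<psi> z\<bar> \<le> max M 0" for z
  proof (cases "fst z \<in> {a..b}")
    case True
    have "\<psi> (fst z, snd z - nearest (snd z)) = \<psi> z"
      by (rule x_periodic_nearest[OF test_functionsD(2)[OF assms]])
    then show ?thesis using M[of "(fst z, snd z - nearest (snd z))"] True frac_mem_torus_cell by auto
  next
    case False
    then show ?thesis using ab by (cases z) (simp add: vanishes_outside_def)
  qed
  then show ?thesis by blast
qed

lemma test_functions_borel: "\<psi> \<in> test_functions T \<Longrightarrow> \<psi> \<in> borel_measurable borel"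
  by (intro borel_measurable_continuous_onI smooth_fun_continuous test_functionsD)

lemma time_deriv_test:
  assumes "\<psi> \<in> test_functions T" shows "time_deriv \<psi> \<in> test_functions T"
proof -
  have "time_deriv \<psi> = (\<lambda>z. frechet_derivative \<psi> (at z) (1, 0))"
    using smooth_fun_has_time_deriv(2)[OF test_functionsD(1)[OF assms]] by auto
  then show ?thesis using test_functions_deriv[OF assms, of "(1, 0)"] by (simp add: Basis_prod_def)
qed

lemma space_gradient_inner:
  assumes "\<psi> \<in> test_functions T" "b \<in> Basis"
  shows "(\<lambda>z. space_gradient \<psi> z \<bullet> b) = (\<lambda>z. frechet_derivative \<psi> (at z) (0, b))"
proof
  fix z
  have "space_gradient \<psi> (fst z, snd z) \<bullet> b = frechet_derivative \<psi> (at (fst z, snd z)) (0, b)"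
    unfolding smooth_fun_has_space_gradient(2)[OF test_functionsD(1)[OF assms(1)]] using assms(2) by simp
  then show "space_gradient \<psi> z \<bullet> b = frechet_derivative \<psi> (at z) (0, b)" by simp
qed

lemma space_gradient_test:
  assumes "\<psi> \<in> test_functions T" "b \<in> Basis"
  shows "(\<lambda>z. space_gradient \<psi> z \<bullet> b) \<in> test_functions T"
  using test_functions_deriv[OF assms(1), of "(0, b)"] assms
  by (simp add: space_gradient_inner Basis_prod_def)

lemma space_gradient_borel:
  assumes "\<psi> \<in> test_functions T" shows "space_gradient \<psi> \<in> borel_measurable borel"
  by (subst borel_measurable_euclidean_space) (use space_gradient_test[OF assms] test_functions_borel in blast)

lemma space_gradient_periodic:
  assumes "\<psi> \<in> test_functions T" shows "x_periodic (space_gradient \<psi>)"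
  unfolding x_periodic_def periodic_def
proof (intro allI ballI, rule euclidean_eqI)
  fix t x and b c :: space assume "b \<in> Basis" "c \<in> Basis"
  then show "space_gradient \<psi> (t, x + b) \<bullet> c = space_gradient \<psi> (t, x) \<bullet> c"
    using test_functionsD(2)[OF space_gradient_test[OF assms]] by (simp add: x_periodic_def periodic_def)
qed

lemma space_gradient_bounded:
  assumes "\<psi> \<in> test_functions T" shows "\<exists>M. \<forall>z. norm (space_gradient \<psi> z) \<le> M"
proof -
  have "\<forall>b\<in>Basis. \<exists>M. \<forall>z. \<bar>space_gradient \<psi> z \<bullet> b\<bar> \<le> M"
    using test_functions_bounded[OF space_gradient_test[OF assms]] by blast
  then obtain M where M: "\<And>b z. b \<in> Basis \<Longrightarrow> \<bar>space_gradient \<psi> z \<bullet> b\<bar> \<le> M b" by metis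
  have "norm (space_gradient \<psi> z) \<le> (\<Sum>b\<in>Basis. M b)" for z
    by (rule order_trans[OF norm_le_l1 sum_mono]) (rule M)
  then show ?thesis by blast
qed

lemma gradient_smooth_product:
  fixes f g :: "space \<Rightarrow> real"
  assumes "(f has_derivative (\<lambda>h. F \<bullet> h)) (at x)" "(g has_derivative (\<lambda>h. G \<bullet> h)) (at x)"
  shows "((\<lambda>x. f x * g x) has_derivative (\<lambda>h. (f x *\<^sub>R G + g x *\<^sub>R F) \<bullet> h)) (at x)"
  using has_derivative_mult[OF assms] by (simp add: inner_add_left mult.commute)

section \<open>Both equations, tested in one variable and weighted in the other\<close>

section \<open>Doubling the variables in the weak equation\<close>

text \<open>A common form of the two equations: (f, w) is (\<theta>, \<theta> v) for transport and
  (0, v) for incompressibility, so that the doubling argument is carried out once.\<close>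

definition solves :: "real \<Rightarrow> (spacetime \<Rightarrow> real) \<Rightarrow> (spacetime \<Rightarrow> space) \<Rightarrow> bool" where
  "solves T f w \<longleftrightarrow> (\<forall>\<psi>\<in>test_functions T.
     (\<integral>z. f z * time_deriv \<psi> z + w z \<bullet> space_gradient \<psi> z \<partial>cyl_measure T) = 0)"

lemma integrable_mult_bounded:
  fixes f h :: "'a \<Rightarrow> real"
  assumes f: "integrable M f" and [measurable]: "h \<in> borel_measurable M" and h: "\<And>x. \<bar>h x\<bar> \<le> B"
  shows "integrable M (\<lambda>x. f x * h x)"
proof (rule Bochner_Integration.integrable_bound)
  show "integrable M (\<lambda>x. B * f x)" using f by simp
  have "B \<ge> 0" using order_trans[OF abs_ge_zero h] .
  then show "AE x in M. norm (f x * h x) \<le> norm (B * f x)"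
    using mult_left_mono[OF h abs_ge_zero[of "f _"]] by (auto simp: abs_mult mult.commute)
qed (use f in measurable)

lemma integrable_mult_test:
  assumes "\<psi> \<in> test_functions T" "integrable (cyl_measure T) f"
  shows "integrable (cyl_measure T) (\<lambda>z. f z * \<psi> z)"
proof -
  obtain M where "\<And>z. \<bar>\<psi> z\<bar> \<le> M" using test_functions_bounded[OF assms(1)] by blast
  then show ?thesis
    using test_functions_borel[OF assms(1)] by (intro integrable_mult_bounded[OF assms(2), of _ M]) auto
qed

lemma integrable_inner_gradient:
  fixes w :: "spacetime \<Rightarrow> space"
  assumes "\<psi> \<in> test_functions T" "integrable (cyl_measure T) w"
  shows "integrable (cyl_measure T) (\<lambda>z. w z \<bullet> space_gradient \<psi> z)"
proof -
  have "integrable (cyl_measure T) (\<lambda>z. \<Sum>b\<in>Basis. (w z \<bullet> b) * (space_gradient \<psi> z \<bullet> b))"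
    using assms by (intro Bochner_Integration.integrable_sum integrable_mult_test space_gradient_test) auto
  then show ?thesis by (subst euclidean_inner) simp
qed

lemma abs_pbump_grad_inner_le:
  assumes "0 < c" "0 < r" "b \<in> Basis"
  shows "\<bar>pbump_grad c r x \<bullet> b\<bar> \<le> 4 * c * r"
  using Basis_le_norm[OF assms(3), of "pbump_grad c r x"] norm_pbump_grad_le[OF assms(1,2), of x] by linarith

lemma tbump_bounded: "\<exists>B. \<forall>h. \<bar>tbump j h\<bar> \<le> B"
  using approx_identityD(2,4)[OF approx_identity_tbump, of j] by (metis abs_of_nonneg)

lemma pbump_reflect_derivative:
  assumes "0 < c" "0 < r" "r < 1/2"
  shows "((\<lambda>x. pbump c r (y - x)) has_derivative (\<lambda>h. (- pbump_grad c r (y - x)) \<bullet> h)) (at x)"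
proof -
  have "((\<lambda>x. y - x) has_derivative (\<lambda>h. - h)) (at x)" by (auto intro!: derivative_eq_intros)
  from has_derivative_compose[OF this pbump_has_derivative[OF assms]] show ?thesis by simp
qed

lemma pbump_shift_derivative:
  assumes "0 < c" "0 < r" "r < 1/2"
  shows "((\<lambda>y. pbump c r (y - x)) has_derivative (\<lambda>h. pbump_grad c r (y - x) \<bullet> h)) (at y)"
proof -
  have "((\<lambda>y. y - x) has_derivative (\<lambda>h. h)) (at y)" by (auto intro!: derivative_eq_intros)
  from has_derivative_compose[OF this pbump_has_derivative[OF assms]] show ?thesis .
qed

lemma tbump'_uminus: "tbump' j (- h) = - tbump' j h" by (simp add: tbump'_def)

lemma tbump_shift_deriv: "((\<lambda>t. tbump j (t - s)) has_real_derivative tbump' j (t - s)) (at t)"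
proof -
  have "((\<lambda>t. t - s) has_real_derivative 1) (at t)" by (auto intro!: derivative_eq_intros)
  from DERIV_chain2[OF tbump_deriv this] show ?thesis by simp
qed

text \<open>For frozen Y = (s,y) the equation is tested in X with \<psi>(X) times both kernels and
  weighted by g(Y). Derivatives fall on the time kernel, on \<psi> and on the space kernel, the last
  with a minus sign because x enters through y - x.\<close>

lemma smear_equation_base:
  fixes f g :: "spacetime \<Rightarrow> real" and w :: "spacetime \<Rightarrow> space"
  assumes sol: "solves T f w" and \<psi>: "\<psi> \<in> test_functions T" and cr: "0 < c" "0 < r" "r < 1/2"
    and f: "integrable (cyl_measure T) f" and w: "integrable (cyl_measure T) w" and g: "integrable (cyl_measure T) g"
  shows "smear T (tbump' j) (\<lambda>z. f z * \<psi> z) g (pbump c r)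
    + smear T (tbump j) (\<lambda>z. f z * time_deriv \<psi> z + w z \<bullet> space_gradient \<psi> z) g (pbump c r)
    - (\<Sum>b\<in>Basis. smear T (tbump j) (\<lambda>z. (w z \<bullet> b) * \<psi> z) g (\<lambda>x. pbump_grad c r x \<bullet> b)) = 0"
proof -
  interpret ZZ: pair_sigma_finite "cyl_measure T" "cyl_measure T" ..
  obtain B where B: "\<And>h. \<bar>tbump j h\<bar> \<le> B" using tbump_bounded by blast
  obtain B' where B': "\<And>h. \<bar>tbump' j h\<bar> \<le> B'" using tbump'_bounded by blast
  \<comment> \<open>The factor \<psi> provides the compact support in time, so this function is
    admissible for every j and every Y.\<close>
  define \<eta> where "\<eta> Y = (\<lambda>z. \<psi> z * (pbump c r (snd Y - snd z) * tbump j (fst z - fst Y)))" for Y :: spacetime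
  have sm: "smooth_fun \<psi>" by (rule test_functionsD[OF \<psi>])
  obtain a b where ab: "0 < a" "b < T" "vanishes_outside a b \<psi>" using test_functionsD(3)[OF \<psi>] by blast
  have \<eta>: "\<eta> Y \<in> test_functions T" for Y
  proof (rule test_functionsI[of _ a b])
    have "smooth_fun (\<lambda>z::spacetime. pbump c r (- snd z + snd Y))"
      by (rule smooth_fun_pbump[OF _ cr]) (intro bounded_linear_minus bounded_linear_snd)
    then show "smooth_fun (\<eta> Y)"
      unfolding \<eta>_def using sm by (intro smooth_fun_mult smooth_fun_tbump bounded_linear_fst) simp_all
    have "pbump c r (snd Y - (x + b)) = pbump c r (snd Y - x)" if "b \<in> Basis" for b x
    proof -
      have "pbump c r ((snd Y - (x + b)) + b) = pbump c r (snd Y - (x + b))"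
        using periodic_pbump that unfolding periodic_def by blast
      moreover have "(snd Y - (x + b)) + b = snd Y - x" by simp
      ultimately show ?thesis by simp
    qed
    then show "x_periodic (\<eta> Y)"
      using test_functionsD(2)[OF \<psi>] by (simp add: x_periodic_def periodic_def \<eta>_def)
  qed (use ab in \<open>auto simp: vanishes_outside_def \<eta>_def\<close>)
  have dt: "time_deriv (\<eta> Y) z = time_deriv \<psi> z * (pbump c r (snd Y - snd z) * tbump j (fst z - fst Y))
      + \<psi> z * (pbump c r (snd Y - snd z) * tbump' j (fst z - fst Y))" for Y z
  proof -
    obtain t x where z: "z = (t, x)" by force
    have "((\<lambda>t. tbump j (t - fst Y)) has_real_derivative tbump' j (t - fst Y)) (at t)"
      by (rule tbump_shift_deriv)
    from DERIV_mult[OF smooth_fun_has_time_deriv(1)[OF sm] DERIV_cmult[OF this, of "pbump c r (snd Y - x)"]]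
    show ?thesis unfolding z \<eta>_def by (intro time_deriv_unique) (simp add: algebra_simps)
  qed
  have dx: "space_gradient (\<eta> Y) z = (pbump c r (snd Y - snd z) * tbump j (fst z - fst Y)) *\<^sub>R space_gradient \<psi> z
      - (\<psi> z * tbump j (fst z - fst Y)) *\<^sub>R pbump_grad c r (snd Y - snd z)" for Y z
  proof -
    obtain t x where z: "z = (t, x)" by force
    have "((\<lambda>x. tbump j (t - fst Y) * pbump c r (snd Y - x)) has_derivative
        (\<lambda>h. (- (tbump j (t - fst Y) *\<^sub>R pbump_grad c r (snd Y - x))) \<bullet> h)) (at x)"
      using has_derivative_mult_right[OF pbump_reflect_derivative[OF cr], of "tbump j (t - fst Y)"] by simp
    from gradient_smooth_product[OF smooth_fun_has_space_gradient(1)[OF sm] this]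
    show ?thesis unfolding z \<eta>_def by (intro space_gradient_unique) (simp add: algebra_simps)
  qed
  let ?K = "\<lambda>k \<rho> p. k (snd (snd p) - snd (fst p)) * \<rho> (fst (fst p) - fst (snd p)) :: real"
  have td: "time_deriv \<psi> \<in> test_functions T" by (rule time_deriv_test[OF \<psi>])
  have i1: "integrable (cyl_measure T \<Otimes>\<^sub>M cyl_measure T) (\<lambda>p. (f (fst p) * \<psi> (fst p)) * g (snd p) * ?K (pbump c r) (tbump' j) p)"
    by (rule integrable_smear[where B = 1 and B' = B'])
      (use integrable_mult_test[OF \<psi> f] g B' abs_pbump_le in auto)
  have i2: "integrable (cyl_measure T \<Otimes>\<^sub>M cyl_measure T)
     (\<lambda>p. (f (fst p) * time_deriv \<psi> (fst p) + w (fst p) \<bullet> space_gradient \<psi> (fst p)) * g (snd p) * ?K (pbump c r) (tbump j) p)"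
    by (rule integrable_smear[where B = 1 and B' = B])
      (use integrable_mult_test[OF td f] integrable_inner_gradient[OF \<psi> w] g B abs_pbump_le in auto)
  have i3: "integrable (cyl_measure T \<Otimes>\<^sub>M cyl_measure T)
     (\<lambda>p. ((w (fst p) \<bullet> b) * \<psi> (fst p)) * g (snd p) * ?K (\<lambda>x. pbump_grad c r x \<bullet> b) (tbump j) p)" if b: "b \<in> Basis" for b
    by (rule integrable_smear[where B = "4 * c * r" and B' = B])
      (use integrable_mult_test[OF \<psi>, of "\<lambda>z. w z \<bullet> b"] w g B abs_pbump_grad_inner_le[OF cr(1,2) b] in auto)
  let ?Q = "\<lambda>X Y. g Y * (f X * time_deriv (\<eta> Y) X + w X \<bullet> space_gradient (\<eta> Y) X)"
  have Q: "?Q (fst p) (snd p) = (f (fst p) * \<psi> (fst p)) * g (snd p) * ?K (pbump c r) (tbump' j) p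
     + (f (fst p) * time_deriv \<psi> (fst p) + w (fst p) \<bullet> space_gradient \<psi> (fst p)) * g (snd p) * ?K (pbump c r) (tbump j) p
     - (\<Sum>b\<in>Basis. ((w (fst p) \<bullet> b) * \<psi> (fst p)) * g (snd p) * ?K (\<lambda>x. pbump_grad c r x \<bullet> b) (tbump j) p)" for p
  proof -
    have "(\<Sum>b\<in>Basis. ((w (fst p) \<bullet> b) * \<psi> (fst p)) * g (snd p) * ?K (\<lambda>x. pbump_grad c r x \<bullet> b) (tbump j) p)
      = (\<psi> (fst p) * g (snd p) * tbump j (fst (fst p) - fst (snd p))) * (w (fst p) \<bullet> pbump_grad c r (snd (snd p) - snd (fst p)))"
      unfolding euclidean_inner[of "w (fst p)" "pbump_grad c r (snd (snd p) - snd (fst p))"] sum_distrib_left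
      by (intro sum.cong refl) simp
    then show ?thesis unfolding dt dx by (simp add: inner_diff_right algebra_simps)
  qed
  have Qi: "integrable (cyl_measure T \<Otimes>\<^sub>M cyl_measure T) (\<lambda>(X, Y). ?Q X Y)"
    using i1 i2 i3 unfolding case_prod_unfold Q
    by (intro Bochner_Integration.integrable_diff Bochner_Integration.integrable_add Bochner_Integration.integrable_sum)
  have "(\<integral>p. ?Q (fst p) (snd p) \<partial>(cyl_measure T \<Otimes>\<^sub>M cyl_measure T)) = (\<integral>Y. \<integral>X. ?Q X Y \<partial>cyl_measure T \<partial>cyl_measure T)"
    using ZZ.integral_snd[OF Qi] by (simp add: case_prod_unfold)
  also have "\<dots> = 0" using sol \<eta> by (simp add: solves_def)
  finally have "(\<integral>p. ?Q (fst p) (snd p) \<partial>(cyl_measure T \<Otimes>\<^sub>M cyl_measure T)) = 0" .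
  then show ?thesis
    unfolding Q using i1 i2 i3 by (simp add: smear_def)
qed

lemma smear_equation_weight:
  fixes f g :: "spacetime \<Rightarrow> real" and w :: "spacetime \<Rightarrow> space"
  assumes sol: "solves T f w" and \<psi>: "\<psi> \<in> test_functions T" and cr: "0 < c" "0 < r" "r < 1/2"
    and f: "integrable (cyl_measure T) f" and w: "integrable (cyl_measure T) w" and g: "integrable (cyl_measure T) g"
    and ab: "vanishes_outside a b \<psi>" and j: "1 / real (Suc j) < a" "b + 1 / real (Suc j) < T"
  shows "(\<Sum>b\<in>Basis. smear T (tbump j) (\<lambda>z. g z * \<psi> z) (\<lambda>z. w z \<bullet> b) (\<lambda>x. pbump_grad c r x \<bullet> b))
    - smear T (tbump' j) (\<lambda>z. g z * \<psi> z) f (pbump c r) = 0"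
proof -
  interpret ZZ: pair_sigma_finite "cyl_measure T" "cyl_measure T" ..
  obtain B where B: "\<And>h. \<bar>tbump j h\<bar> \<le> B" using tbump_bounded by blast
  obtain B' where B': "\<And>h. \<bar>tbump' j h\<bar> \<le> B'" using tbump'_bounded by blast
  define \<eta> where "\<eta> X = (\<lambda>z. pbump c r (snd z - snd X) * tbump j (fst z - fst X))" for X :: spacetime
  have \<eta>: "\<eta> X \<in> test_functions T" if "fst X \<in> {a..b}" for X
  proof (rule test_functionsI[of _ "a - 1 / real (Suc j)" "b + 1 / real (Suc j)"])
    have "smooth_fun (\<lambda>z::spacetime. pbump c r (snd z + - snd X))"
      by (rule smooth_fun_pbump[OF _ cr]) (intro bounded_linear_snd)
    then show "smooth_fun (\<eta> X)"
      unfolding \<eta>_def by (intro smooth_fun_mult smooth_fun_tbump bounded_linear_fst) simp_all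
    have "pbump c r ((x + b) - snd X) = pbump c r (x - snd X)" if "b \<in> Basis" for b x
      using periodic_pbump that unfolding periodic_def by (metis diff_add_eq)
    then show "x_periodic (\<eta> X)"
      by (simp add: x_periodic_def periodic_def \<eta>_def)
    show "vanishes_outside (a - 1 / real (Suc j)) (b + 1 / real (Suc j)) (\<eta> X)"
      unfolding vanishes_outside_def
    proof (intro allI impI)
      fix t x assume "t \<notin> {a - 1 / real (Suc j)..b + 1 / real (Suc j)}"
      then have "1 / real (Suc j) \<le> \<bar>t - fst X\<bar>" using that by (auto simp del: of_nat_Suc)
      then show "\<eta> X (t, x) = 0" by (simp add: \<eta>_def tbump_eq_0 del: of_nat_Suc)
    qed
  qed (use j in auto)
  have dt: "time_deriv (\<eta> X) z = - (pbump c r (snd z - snd X) * tbump' j (fst X - fst z))" for X z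
  proof -
    obtain t x where z: "z = (t, x)" by force
    have "((\<lambda>t. tbump j (t - fst X)) has_real_derivative tbump' j (t - fst X)) (at t)"
      by (rule tbump_shift_deriv)
    moreover have "tbump' j (t - fst X) = - tbump' j (fst X - t)"
      using tbump'_uminus[of j "fst X - t"] by simp
    ultimately show ?thesis
      using DERIV_cmult[of "\<lambda>t. tbump j (t - fst X)" "tbump' j (t - fst X)" t UNIV "pbump c r (x - snd X)"]
      unfolding z \<eta>_def by (intro time_deriv_unique) simp
  qed
  have dx: "space_gradient (\<eta> X) z = tbump j (fst X - fst z) *\<^sub>R pbump_grad c r (snd z - snd X)" for X z
  proof -
    obtain t x where z: "z = (t, x)" by force
    have "((\<lambda>x. pbump c r (x - snd X) * tbump j (t - fst X)) has_derivative
        (\<lambda>h. (tbump j (fst X - t) *\<^sub>R pbump_grad c r (x - snd X)) \<bullet> h)) (at x)"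
      using has_derivative_mult_right[OF pbump_shift_derivative[OF cr], of "tbump j (t - fst X)"]
        tbump_uminus[of j "t - fst X"] by (simp add: mult.commute[of "pbump c r (_ - snd X)"])
    then show ?thesis unfolding z \<eta>_def by (intro space_gradient_unique) simp
  qed
  let ?K = "\<lambda>k \<rho> p. k (snd (snd p) - snd (fst p)) * \<rho> (fst (fst p) - fst (snd p)) :: real"
  have i1: "integrable (cyl_measure T \<Otimes>\<^sub>M cyl_measure T) (\<lambda>p. (g (fst p) * \<psi> (fst p)) * f (snd p) * ?K (pbump c r) (tbump' j) p)"
    by (rule integrable_smear[where B = 1 and B' = B'])
      (use integrable_mult_test[OF \<psi> g] f B' abs_pbump_le in auto)
  have i3: "integrable (cyl_measure T \<Otimes>\<^sub>M cyl_measure T)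
     (\<lambda>p. (g (fst p) * \<psi> (fst p)) * (w (snd p) \<bullet> b) * ?K (\<lambda>x. pbump_grad c r x \<bullet> b) (tbump j) p)" if b: "b \<in> Basis" for b
    by (rule integrable_smear[where B = "4 * c * r" and B' = B])
      (use integrable_mult_test[OF \<psi> g] w B abs_pbump_grad_inner_le[OF cr(1,2) b] in auto)
  let ?Q = "\<lambda>X Y. (g X * \<psi> X) * (f Y * time_deriv (\<eta> X) Y + w Y \<bullet> space_gradient (\<eta> X) Y)"
  have Q: "?Q (fst p) (snd p) = 
     (\<Sum>b\<in>Basis. (g (fst p) * \<psi> (fst p)) * (w (snd p) \<bullet> b) * ?K (\<lambda>x. pbump_grad c r x \<bullet> b) (tbump j) p)
     - (g (fst p) * \<psi> (fst p)) * f (snd p) * ?K (pbump c r) (tbump' j) p" for p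
  proof -
    have "(\<Sum>b\<in>Basis. (g (fst p) * \<psi> (fst p)) * (w (snd p) \<bullet> b) * ?K (\<lambda>x. pbump_grad c r x \<bullet> b) (tbump j) p)
      = ((g (fst p) * \<psi> (fst p)) * tbump j (fst (fst p) - fst (snd p))) * (w (snd p) \<bullet> pbump_grad c r (snd (snd p) - snd (fst p)))"
      unfolding euclidean_inner[of "w (snd p)" "pbump_grad c r (snd (snd p) - snd (fst p))"] sum_distrib_left
      by (intro sum.cong refl) simp
    then show ?thesis unfolding dt dx by (simp add: algebra_simps)
  qed
  have Qi: "integrable (cyl_measure T \<Otimes>\<^sub>M cyl_measure T) (\<lambda>(X, Y). ?Q X Y)"
    using i1 i3 unfolding case_prod_unfold Q
    by (intro Bochner_Integration.integrable_diff Bochner_Integration.integrable_sum)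
  have "(\<integral>p. ?Q (fst p) (snd p) \<partial>(cyl_measure T \<Otimes>\<^sub>M cyl_measure T)) = (\<integral>X. \<integral>Y. ?Q X Y \<partial>cyl_measure T \<partial>cyl_measure T)"
    using ZZ.integral_fst[OF Qi] by (simp add: case_prod_unfold)
  also have "\<dots> = (\<integral>X. 0 \<partial>cyl_measure T)"
  proof (rule Bochner_Integration.integral_cong[OF refl])
    fix X :: spacetime
    show "(\<integral>Y. ?Q X Y \<partial>cyl_measure T) = 0"
    \<comment> \<open>For times of X outside the support of \<psi> the test function may fail to be
      admissible, but there the weight is 0.\<close>
    proof (cases "fst X \<in> {a..b}")
      case True
      then show ?thesis using sol \<eta>[OF True] by (simp add: solves_def)
    next
      case False
      then have "\<psi> X = 0" using ab by (cases X) (auto simp: vanishes_outside_def)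
      then show ?thesis by simp
    qed
  qed
  finally have "(\<integral>p. ?Q (fst p) (snd p) \<partial>(cyl_measure T \<Otimes>\<^sub>M cyl_measure T)) = 0" by simp
  then show ?thesis
    unfolding Q using i1 i3 by (simp add: smear_def)
qed

text \<open>Difference quotients of a periodic function have integral 0 by shift invariance, and the
  bound on the derivative dominates them. Measurability of the derivative is obtained from the same
  quotients.\<close>

lemma integral_cell_derivative:
  fixes g :: "space \<Rightarrow> real"
  assumes per: "periodic g" and d: "\<And>x. (g has_derivative (\<lambda>h. G x \<bullet> h)) (at x)" and bd: "\<And>x. norm (G x) \<le> M"
  shows "(\<integral>x. G x \<bullet> b \<partial>cell_measure) = 0"
proof -
  have "continuous_on UNIV g" using d by (meson continuous_at_imp_continuous_on has_derivative_continuous)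
  then have [measurable]: "g \<in> borel_measurable borel" by (rule borel_measurable_continuous_onI)
  define h :: "nat \<Rightarrow> real" where "h j = 1 / real (Suc j)" for j
  have h0: "h j > 0" for j by (simp add: h_def)
  have hlim: "h \<longlonglongrightarrow> 0" unfolding h_def by (rule LIMSEQ_Suc) (rule lim_1_over_n)
  define q where "q j x = (g (x + h j *\<^sub>R b) - g x) / h j" for j x
  have [measurable]: "q j \<in> borel_measurable borel" for j unfolding q_def[abs_def] by measurable
  have qlim: "(\<lambda>j. q j x) \<longlonglongrightarrow> G x \<bullet> b" for x
  proof -
    have "((\<lambda>s. g (x + s *\<^sub>R b)) has_derivative (\<lambda>s. G x \<bullet> (s *\<^sub>R b))) (at 0)"
      by (rule has_derivative_compose[of "\<lambda>s. x + s *\<^sub>R b" "\<lambda>s. s *\<^sub>R b"]) (use d in \<open>auto intro!: derivative_eq_intros\<close>)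
    then have "((\<lambda>s. g (x + s *\<^sub>R b)) has_real_derivative (G x \<bullet> b)) (at 0)"
      by (simp add: has_field_derivative_def mult_commute_abs)
    then have "((\<lambda>s. (g (x + s *\<^sub>R b) - g x) / s) \<longlongrightarrow> G x \<bullet> b) (at 0)" by (simp add: DERIV_def)
    moreover have "filterlim h (at 0) sequentially"
      unfolding filterlim_at using hlim h0 by (metis (mono_tags, lifting) UNIV_I always_eventually less_irrefl)
    ultimately show ?thesis unfolding q_def by (rule filterlim_compose)
  qed
  have [measurable]: "(\<lambda>x. G x \<bullet> b) \<in> borel_measurable borel"
    by (rule borel_measurable_LIMSEQ_real[OF qlim]) measurable
  have qbd: "\<bar>q j x\<bar> \<le> M * norm b" for j x
  proof -
    have "norm (g (x + h j *\<^sub>R b) - g x) \<le> M * norm ((x + h j *\<^sub>R b) - x)"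
    proof (rule differentiable_bound[of UNIV g "\<lambda>x h. G x \<bullet> h"])
      fix x
      show "onorm (\<lambda>h. G x \<bullet> h) \<le> M"
        using order_trans[OF Cauchy_Schwarz_ineq2 mult_right_mono[OF bd norm_ge_zero]]
        by (intro onorm_le) (auto simp: inner_commute)
    qed (use d in \<open>auto intro: has_derivative_at_withinI\<close>)
    then show ?thesis using h0[of j] by (simp add: q_def abs_divide field_simps)
  qed
  have "(\<lambda>j. \<integral>x. q j x \<partial>cell_measure) \<longlonglongrightarrow> (\<integral>x. G x \<bullet> b \<partial>cell_measure)"
    by (rule integral_dominated_convergence[where w = "\<lambda>_. M * norm b"]) (use qlim qbd in auto)
  moreover have "(\<integral>x. q j x \<partial>cell_measure) = 0" for j
  proof -
    obtain B where "\<And>x. \<bar>g x\<bar> \<le> B"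
    proof -
      have "bounded (g ` torus_cell)"
        by (intro compact_imp_bounded compact_continuous_image continuous_on_subset[OF \<open>continuous_on UNIV g\<close>])
          (auto simp: torus_cell_def)
      then obtain B where "\<And>x. x \<in> torus_cell \<Longrightarrow> \<bar>g x\<bar> \<le> B" by (auto simp: bounded_iff)
      then have "\<bar>g x\<bar> \<le> B" for x using frac_mem_torus_cell[of x] periodic_nearest[OF per, of x] by metis
      then show ?thesis by (rule that)
    qed
    then have "integrable cell_measure g"
      by (intro cell.integrable_const_bound[where B = B]) auto
    then show ?thesis
      using integrable_cell_shift[OF _ per, of "h j *\<^sub>R b"] integral_cell_shift[OF _ per, of "h j *\<^sub>R b"]
      by (simp add: q_def)
  qed
  ultimately show ?thesis by (simp add: LIMSEQ_const_iff)
qed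

section \<open>The weak divergence of the flux in the shift variable\<close>

section \<open>Correlation identities\<close>

lemma slice_bounded_mono:
  fixes f g :: "spacetime \<Rightarrow> real"
  assumes "slice_bounded T g" and [measurable]: "g \<in> borel_measurable borel"
    and "0 \<le> M" "\<And>z. \<bar>f z\<bar> \<le> M * \<bar>g z\<bar>"
  shows "slice_bounded T f"
proof -
  obtain C where C: "AE t in time_measure T. (\<integral>\<^sup>+x. ennreal \<bar>g (t, x)\<bar> \<partial>cell_measure) \<le> ennreal C"
    using assms(1) by (auto simp: slice_bounded_def)
  have "(\<integral>\<^sup>+x. ennreal \<bar>f (t, x)\<bar> \<partial>cell_measure) \<le> ennreal M * (\<integral>\<^sup>+x. ennreal \<bar>g (t, x)\<bar> \<partial>cell_measure)" for t
  proof -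
    have "(\<integral>\<^sup>+x. ennreal \<bar>f (t, x)\<bar> \<partial>cell_measure) \<le> (\<integral>\<^sup>+x. ennreal M * ennreal \<bar>g (t, x)\<bar> \<partial>cell_measure)"
      using assms(3,4) by (intro nn_integral_mono) (simp flip: ennreal_mult add: ennreal_leI)
    then show ?thesis by (simp add: nn_integral_cmult)
  qed
  note * = order_trans[OF this mult_left_mono[OF _ zero_le]]
  have "AE t in time_measure T. (\<integral>\<^sup>+x. ennreal \<bar>f (t, x)\<bar> \<partial>cell_measure) \<le> ennreal (M * C)"
    using C
  proof eventually_elim
    case (elim t)
    from *[OF elim] show ?case using assms(3) by (simp add: ennreal_mult')
  qed
  then show ?thesis unfolding slice_bounded_def by blast
qed

text \<open>The summands 1 and 2 in the domination hypothesis let the single function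
  \<open>W\<close> cover products of lower degree as well. The slice bound for (1 + |\<theta>|)^2
  likewise covers 1, \<theta> and \<theta>^2.\<close>

locale flow_base =
  fixes T :: real and v :: "spacetime \<Rightarrow> space" and \<theta> W :: "spacetime \<Rightarrow> real"
  assumes v_borel [measurable]: "v \<in> borel_measurable borel" and th_borel [measurable]: "\<theta> \<in> borel_measurable borel"
    and W_borel [measurable]: "W \<in> borel_measurable borel"
    and v_per: "x_periodic v" and th_per: "x_periodic \<theta>" and W_per: "x_periodic W"
    and v_0: "\<And>t x. t \<notin> {0<..<T} \<Longrightarrow> v (t, x) = 0" and th_0: "\<And>t x. t \<notin> {0<..<T} \<Longrightarrow> \<theta> (t, x) = 0"
    and W_int: "integrable (cyl_measure T) W"
    and dom: "\<And>z l. (1 + norm (v z) + norm (v (shift l z))) * (2 + \<bar>\<theta> z\<bar> + \<bar>\<theta> (shift l z)\<bar>)\<^sup>2 \<le> W z + W (shift l z)"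
    and th_slice: "slice_bounded T (\<lambda>z. (1 + \<bar>\<theta> z\<bar>)\<^sup>2)"
begin

text \<open>The form in which the domination is applied: the products to come split into a factor at
  most linear in the velocities and a factor at most quadratic in the temperatures.\<close>

lemma dom_mult:
  assumes "\<bar>x\<bar> \<le> M * (1 + norm (v z) + norm (v (shift l z)))" "\<bar>y\<bar> \<le> (2 + \<bar>\<theta> z\<bar> + \<bar>\<theta> (shift l z)\<bar>)\<^sup>2" "0 \<le> M"
  shows "\<bar>x * y\<bar> \<le> M * W z + M * W (shift l z)"
proof -
  have "\<bar>x * y\<bar> \<le> (M * (1 + norm (v z) + norm (v (shift l z)))) * (2 + \<bar>\<theta> z\<bar> + \<bar>\<theta> (shift l z)\<bar>)\<^sup>2"
    unfolding abs_mult using assms by (intro mult_mono) auto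
  also have "\<dots> \<le> M * (W z + W (shift l z))"
    unfolding mult.assoc using dom assms(3) by (intro mult_left_mono) auto
  finally show ?thesis by (simp add: distrib_left)
qed

lemma sq_dom:
  fixes a b :: real
  shows "1 \<le> (2 + \<bar>a\<bar> + \<bar>b\<bar>)\<^sup>2" "\<bar>a\<bar> \<le> (2 + \<bar>a\<bar> + \<bar>b\<bar>)\<^sup>2" "\<bar>b\<bar> \<le> (2 + \<bar>a\<bar> + \<bar>b\<bar>)\<^sup>2"
    "\<bar>a * b\<bar> \<le> (2 + \<bar>a\<bar> + \<bar>b\<bar>)\<^sup>2" "\<bar>b * a\<bar> \<le> (2 + \<bar>a\<bar> + \<bar>b\<bar>)\<^sup>2"
    "\<bar>a\<^sup>2\<bar> \<le> (2 + \<bar>a\<bar> + \<bar>b\<bar>)\<^sup>2" "\<bar>b\<^sup>2\<bar> \<le> (2 + \<bar>a\<bar> + \<bar>b\<bar>)\<^sup>2" "\<bar>(b - a)\<^sup>2\<bar> \<le> (2 + \<bar>a\<bar> + \<bar>b\<bar>)\<^sup>2"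
proof -
  let ?s = "2 + \<bar>a\<bar> + \<bar>b\<bar>"
  have m: "x * y \<le> ?s\<^sup>2" if "0 \<le> x" "x \<le> ?s" "0 \<le> y" "y \<le> ?s" for x y
    unfolding power2_eq_square using that by (intro mult_mono) auto
  show "1 \<le> ?s\<^sup>2" using m[of 1 1] by simp
  show "\<bar>a\<bar> \<le> ?s\<^sup>2" "\<bar>b\<bar> \<le> ?s\<^sup>2" using m[of 1 "\<bar>a\<bar>"] m[of 1 "\<bar>b\<bar>"] by auto
  show "\<bar>a * b\<bar> \<le> ?s\<^sup>2" "\<bar>b * a\<bar> \<le> ?s\<^sup>2" using m[of "\<bar>a\<bar>" "\<bar>b\<bar>"] by (auto simp: abs_mult mult.commute)
  have "\<bar>b - a\<bar> \<le> ?s" by linarith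
  then show "\<bar>a\<^sup>2\<bar> \<le> ?s\<^sup>2" "\<bar>b\<^sup>2\<bar> \<le> ?s\<^sup>2" "\<bar>(b - a)\<^sup>2\<bar> \<le> ?s\<^sup>2"
    using m[of "\<bar>a\<bar>" "\<bar>a\<bar>"] m[of "\<bar>b\<bar>" "\<bar>b\<bar>"] m[of "\<bar>b - a\<bar>" "\<bar>b - a\<bar>"]
    by (auto simp: abs_mult power2_eq_square)
qed

lemma W_shift_int: "integrable (cyl_measure T) (\<lambda>z. W (shift l z))"
  using integrable_cyl_shift[OF W_borel W_per] W_int by simp

lemma integrable_dominated:
  fixes f :: "spacetime \<Rightarrow> 'b::{banach, second_countable_topology}"
  assumes "f \<in> borel_measurable borel" "\<And>z. norm (f z) \<le> M * W z + M * W (shift l z)"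
  shows "integrable (cyl_measure T) f"
proof (rule Bochner_Integration.integrable_bound)
  show "integrable (cyl_measure T) (\<lambda>z. M * W z + M * W (shift l z))" using W_int W_shift_int by simp
  show "AE z in cyl_measure T. norm (f z) \<le> norm (M * W z + M * W (shift l z))"
    using assms(2) by (auto intro!: AE_I2 order_trans[OF _ abs_ge_self])
qed (use assms(1) in simp)

text \<open>All five are instances of the domination at shift 0, with the norm of \<open>v\<close>
  or 1 as velocity factor and 1, \<theta> or \<theta>^2 as temperature factor.\<close>

lemma v_int: "integrable (cyl_measure T) v"
  and th_int: "integrable (cyl_measure T) \<theta>"
  and th2_int: "integrable (cyl_measure T) (\<lambda>z. (\<theta> z)\<^sup>2)"
  and thv_int: "integrable (cyl_measure T) (\<lambda>z. \<theta> z *\<^sub>R v z)"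
  and th2v_int: "integrable (cyl_measure T) (\<lambda>z. (\<theta> z)\<^sup>2 *\<^sub>R v z)"
proof -
  have *: "norm y \<le> 1 * W z + 1 * W (shift 0 z)"
    if "norm y = \<bar>x * a\<bar>" "\<bar>x\<bar> \<le> 1 + norm (v z)" "\<bar>a\<bar> \<le> (2 + \<bar>\<theta> z\<bar> + \<bar>\<theta> z\<bar>)\<^sup>2"
    for x a :: real and z and y :: "'c::real_normed_vector"
    using dom_mult[of x 1 z 0 a] that norm_ge_zero[of "v z"] by (auto simp del: norm_ge_zero)
  show "integrable (cyl_measure T) v"
    by (rule integrable_dominated[OF _ *[of _ "norm (v _)" 1]]) (use sq_dom(1) in auto)
  show "integrable (cyl_measure T) \<theta>"
    by (rule integrable_dominated[OF _ *[of _ 1, OF _ _ sq_dom(2)]]) auto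
  show "integrable (cyl_measure T) (\<lambda>z. (\<theta> z)\<^sup>2)"
    by (rule integrable_dominated[OF _ *[of _ 1, OF _ _ sq_dom(6)]]) auto
  show "integrable (cyl_measure T) (\<lambda>z. \<theta> z *\<^sub>R v z)"
    by (rule integrable_dominated[OF _ *[of _ "norm (v _)", OF _ _ sq_dom(2)]]) (auto simp: abs_mult)
  show "integrable (cyl_measure T) (\<lambda>z. (\<theta> z)\<^sup>2 *\<^sub>R v z)"
    by (rule integrable_dominated[OF _ *[of _ "norm (v _)", OF _ _ sq_dom(6)]]) (auto simp: abs_mult)
qed

lemma slices:
  shows "slice_bounded T \<theta>" "slice_bounded T (\<lambda>z. (\<theta> z)\<^sup>2)"
    and "\<psi> \<in> test_functions T \<Longrightarrow> slice_bounded T (\<lambda>z. \<theta> z * \<psi> z)"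
    and "\<psi> \<in> test_functions T \<Longrightarrow> slice_bounded T (\<lambda>z. (\<theta> z)\<^sup>2 * \<psi> z)"
    and "\<psi> \<in> test_functions T \<Longrightarrow> slice_bounded T \<psi>"
proof -
  have 1: "\<bar>\<theta> z\<bar> \<le> (1 + \<bar>\<theta> z\<bar>)\<^sup>2" "(\<theta> z)\<^sup>2 \<le> (1 + \<bar>\<theta> z\<bar>)\<^sup>2" "1 \<le> (1 + \<bar>\<theta> z\<bar>)\<^sup>2" for z
    by (auto simp: power2_eq_square algebra_simps)
  show "slice_bounded T \<theta>" "slice_bounded T (\<lambda>z. (\<theta> z)\<^sup>2)"
    using 1 by (auto intro!: slice_bounded_mono[OF th_slice, of 1])
  assume \<psi>: "\<psi> \<in> test_functions T"
  obtain M where M: "\<And>z. \<bar>\<psi> z\<bar> \<le> M" using test_functions_bounded[OF \<psi>] by blast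
  have M0: "0 \<le> M" using order_trans[OF abs_ge_zero M] .
  have 2: "\<bar>x * \<psi> z\<bar> \<le> M * \<bar>(1 + \<bar>\<theta> z\<bar>)\<^sup>2\<bar>" if "\<bar>x\<bar> \<le> (1 + \<bar>\<theta> z\<bar>)\<^sup>2" for x z
    unfolding abs_mult mult.commute[of "\<bar>x\<bar>"] using that M M0 by (intro mult_mono) auto
  show "slice_bounded T (\<lambda>z. \<theta> z * \<psi> z)" "slice_bounded T (\<lambda>z. (\<theta> z)\<^sup>2 * \<psi> z)"
    using 1 M0 by (auto intro!: slice_bounded_mono[OF th_slice, of M] 2)
  show "slice_bounded T \<psi>"
    by (rule slice_bounded_mono[OF th_slice, of M]) (use 2[of 1] 1(3) M0 in auto)
qed

lemma correlatedI:
  assumes "f \<in> borel_measurable borel" "integrable (cyl_measure T) f" "x_periodic f" "\<And>t x. t \<notin> {0<..<T} \<Longrightarrow> f (t, x) = 0"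
    and "g \<in> borel_measurable borel" "integrable (cyl_measure T) g" "x_periodic g" "\<And>t x. t \<notin> {0<..<T} \<Longrightarrow> g (t, x) = 0"
    and "k \<in> borel_measurable borel" "periodic k" "\<And>x. \<bar>k x\<bar> \<le> B"
    and "\<And>z l. \<bar>f z * g (shift l z)\<bar> \<le> M * W z + M * W (shift l z)"
  shows "correlated T f g (\<lambda>z. M * W z) k B tbump"
  using assms W_int x_periodic_compose[OF W_per, of "(*) M"]
  by unfold_locales (auto intro: approx_identity_tbump)

end

lemma (in correlated) correlation_integrable: "integrable cell_measure (\<lambda>l. k l * (\<integral>z. f z * g (shift l z) \<partial>cyl_measure T))"
  and product_integrable: "integrable (cyl_measure T) (\<lambda>z. f z * g (shift l z))"
proof -
  interpret P: pair_sigma_finite "cyl_measure T" cell_measure ..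
  have int: "integrable (cyl_measure T \<Otimes>\<^sub>M cell_measure) (\<lambda>(z, l). k l * (f z * g (shift l z)))"
  proof (rule integrable_cyl_pair[where W = W and K = B and e = "\<lambda>l. l"])
    fix z l
    have "\<bar>k l\<bar> * \<bar>f z * g (shift l z)\<bar> \<le> B * (W z + W (shift l z))"
      by (intro mult_mono dom k_bd) (use order_trans[OF abs_ge_zero k_bd[of 0]] in auto)
    then show "norm (case (z, l) of (z, l) \<Rightarrow> k l * (f z * g (shift l z))) \<le> B * (W z + W (shift l z))"
      by (simp add: abs_mult)
  qed (use W_per W_int cell.finite_measure_axioms in auto)
  show "integrable cell_measure (\<lambda>l. k l * (\<integral>z. f z * g (shift l z) \<partial>cyl_measure T))"
    using P.integrable_snd[OF int] by simp
  show "integrable (cyl_measure T) (\<lambda>z. f z * g (shift l z))"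
    by (rule Bochner_Integration.integrable_bound[of _ "\<lambda>z. W z + W (shift l z)"])
      (use W_int integrable_cyl_shift[OF W_borel W_per, of T l] dom in \<open>auto intro!: AE_I2 order_trans[OF _ abs_ge_self]\<close>)
qed

locale flow = flow_base +
  assumes transport: "solves T \<theta> (\<lambda>z. \<theta> z *\<^sub>R v z)" and div_free: "solves T (\<lambda>_. 0) v"

locale flow_test = flow +
  fixes \<psi> :: "spacetime \<Rightarrow> real" and c r :: real
  assumes \<psi>: "\<psi> \<in> test_functions T" and cr: "0 < c" "0 < r" "r < 1/2"
begin

lemma \<psi>_borel [measurable]: "\<psi> \<in> borel_measurable borel"
  and \<psi>t_borel [measurable]: "time_deriv \<psi> \<in> borel_measurable borel"
  and \<psi>x_borel [measurable]: "space_gradient \<psi> \<in> borel_measurable borel"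
  using test_functions_borel space_gradient_borel time_deriv_test \<psi> by blast+

text \<open>One bound for \<psi>, its time derivative and its spatial gradient, so that
  \<open>M * W\<close> can dominate all tested products.\<close>

definition M where "M = (SOME M. \<forall>z. \<bar>\<psi> z\<bar> \<le> M \<and> \<bar>time_deriv \<psi> z\<bar> \<le> M \<and> norm (space_gradient \<psi> z) \<le> M)"

lemma M: "\<bar>\<psi> z\<bar> \<le> M" "\<bar>time_deriv \<psi> z\<bar> \<le> M" "norm (space_gradient \<psi> z) \<le> M" "0 \<le> M"
proof -
  obtain A B C where "\<forall>z. \<bar>\<psi> z\<bar> \<le> A" "\<forall>z. \<bar>time_deriv \<psi> z\<bar> \<le> B" "\<forall>z. norm (space_gradient \<psi> z) \<le> C"
    using test_functions_bounded[OF \<psi>] test_functions_bounded[OF time_deriv_test[OF \<psi>]] space_gradient_bounded[OF \<psi>] by blast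
  then have "\<forall>z. \<bar>\<psi> z\<bar> \<le> max A (max B C) \<and> \<bar>time_deriv \<psi> z\<bar> \<le> max A (max B C) \<and> norm (space_gradient \<psi> z) \<le> max A (max B C)"
    by (auto simp: le_max_iff_disj)
  then have "\<forall>z. \<bar>\<psi> z\<bar> \<le> M \<and> \<bar>time_deriv \<psi> z\<bar> \<le> M \<and> norm (space_gradient \<psi> z) \<le> M"
    unfolding M_def by (rule someI[of "\<lambda>M. \<forall>z. \<bar>\<psi> z\<bar> \<le> M \<and> \<bar>time_deriv \<psi> z\<bar> \<le> M \<and> norm (space_gradient \<psi> z) \<le> M"])
  then show "\<bar>\<psi> z\<bar> \<le> M" "\<bar>time_deriv \<psi> z\<bar> \<le> M" "norm (space_gradient \<psi> z) \<le> M" "0 \<le> M"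
    using order_trans[OF abs_ge_zero] by blast+
qed

text \<open>The material derivative of the test function along \<open>v\<close>.\<close>

definition \<psi>D where "\<psi>D z = time_deriv \<psi> z + v z \<bullet> space_gradient \<psi> z"

lemma \<psi>D_borel [measurable]: "\<psi>D \<in> borel_measurable borel"
  unfolding \<psi>D_def[abs_def] by measurable

lemma \<psi>D_bound: "\<bar>\<psi>D z\<bar> \<le> M * (1 + norm (v z) + norm (v (shift l z)))"
proof -
  have "\<bar>v z \<bullet> space_gradient \<psi> z\<bar> \<le> norm (v z) * M"
    by (rule order_trans[OF Cauchy_Schwarz_ineq2 mult_left_mono[OF M(3)]]) simp
  then have "\<bar>\<psi>D z\<bar> \<le> M * 1 + M * norm (v z) + 0" using M(2)[of z] by (simp add: \<psi>D_def mult.commute)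
  also have "\<dots> \<le> M * (1 + norm (v z) + norm (v (shift l z)))"
    using M(4) by (simp add: distrib_left)
  finally show ?thesis .
qed

lemma v\<psi>_bound:
  assumes "b \<in> Basis"
  shows "\<bar>(v z \<bullet> b) * \<psi> z\<bar> \<le> M * (1 + norm (v z) + norm (v (shift l z)))"
    and "\<bar>\<psi> z * (v (shift l z) \<bullet> b)\<bar> \<le> M * (1 + norm (v z) + norm (v (shift l z)))"
    and "\<bar>(space_gradient \<psi> z \<bullet> b) * (v (shift l z) \<bullet> b)\<bar> \<le> M * (1 + norm (v z) + norm (v (shift l z)))"
    and "\<bar>\<psi> z\<bar> \<le> M * (1 + norm (v z) + norm (v (shift l z)))"
    and "\<bar>space_gradient \<psi> z \<bullet> b\<bar> \<le> M"
proof -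
  have m: "\<bar>y * x\<bar> \<le> M * (1 + norm (v z) + norm (v (shift l z)))"
    if "\<bar>y\<bar> \<le> M" "\<bar>x\<bar> \<le> 1 + norm (v z) + norm (v (shift l z))" for x y
    unfolding abs_mult using that M(4) by (intro mult_mono) auto
  have vb: "\<bar>v z \<bullet> b\<bar> \<le> norm (v z)" "\<bar>v (shift l z) \<bullet> b\<bar> \<le> norm (v (shift l z))" by (rule Basis_le_norm[OF assms])+
  have n: "0 \<le> norm (v z)" "0 \<le> norm (v (shift l z))" by auto
  show "\<bar>space_gradient \<psi> z \<bullet> b\<bar> \<le> M"
    using Basis_le_norm[OF assms, of "space_gradient \<psi> z"] M(3)[of z] by linarith
  then show "\<bar>(space_gradient \<psi> z \<bullet> b) * (v (shift l z) \<bullet> b)\<bar> \<le> M * (1 + norm (v z) + norm (v (shift l z)))"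
    by (rule m) (use vb n in linarith)
  show "\<bar>(v z \<bullet> b) * \<psi> z\<bar> \<le> M * (1 + norm (v z) + norm (v (shift l z)))"
    unfolding mult.commute[of "v z \<bullet> b"] by (rule m[OF M(1)]) (use vb n in linarith)
  show "\<bar>\<psi> z * (v (shift l z) \<bullet> b)\<bar> \<le> M * (1 + norm (v z) + norm (v (shift l z)))"
    by (rule m[OF M(1)]) (use vb n in linarith)
  show "\<bar>\<psi> z\<bar> \<le> M * (1 + norm (v z) + norm (v (shift l z)))" using m[OF M(1)[of z], of 1] n by simp
qed

lemma periodicities:
  shows "x_periodic \<psi>" "x_periodic \<psi>D" "x_periodic (\<lambda>z. v z \<bullet> b)" "x_periodic (\<lambda>z. (\<theta> z)\<^sup>2)"
    "x_periodic (\<lambda>z. v z \<bullet> space_gradient \<psi> z)" "x_periodic (\<lambda>z. space_gradient \<psi> z \<bullet> b)"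
proof -
  show p: "x_periodic \<psi>" by (rule test_functionsD[OF \<psi>])
  have 1: "x_periodic (time_deriv \<psi>)" by (rule test_functionsD[OF time_deriv_test[OF \<psi>]])
  show 2: "x_periodic (\<lambda>z. v z \<bullet> space_gradient \<psi> z)"
    by (rule x_periodic_compose2[OF v_per space_gradient_periodic[OF \<psi>]])
  show "x_periodic \<psi>D" unfolding \<psi>D_def[abs_def] by (rule x_periodic_compose2[OF 1 2])
  show "x_periodic (\<lambda>z. v z \<bullet> b)" by (rule x_periodic_compose[OF v_per])
  show "x_periodic (\<lambda>z. (\<theta> z)\<^sup>2)" by (rule x_periodic_compose[OF th_per])
  show "x_periodic (\<lambda>z. space_gradient \<psi> z \<bullet> b)" by (rule x_periodic_compose[OF space_gradient_periodic[OF \<psi>]])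
qed

lemma test_vanish:
  assumes "t \<notin> {0<..<T}" shows "\<psi> (t, x) = 0" "time_deriv \<psi> (t, x) = 0" "b \<in> Basis \<Longrightarrow> space_gradient \<psi> (t, x) \<bullet> b = 0"
proof -
  have *: "\<eta> (t, x) = 0" if "\<eta> \<in> test_functions T" for \<eta>
    using test_functionsD(3)[OF that] assms by (auto simp: vanishes_outside_def)
  show "\<psi> (t, x) = 0" "time_deriv \<psi> (t, x) = 0" by (intro * \<psi> time_deriv_test)+
  show "space_gradient \<psi> (t, x) \<bullet> b = 0" if "b \<in> Basis" using *[OF space_gradient_test[OF \<psi> that]] .
qed

abbreviation "\<kappa> \<equiv> pbump c r"
abbreviation "\<kappa>' \<equiv> \<lambda>b x. pbump_grad c r x \<bullet> b"

lemma \<kappa>': assumes "b \<in> Basis" shows "periodic (\<kappa>' b)" "\<And>x. \<bar>\<kappa>' b x\<bar> \<le> 4 * c * r"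
  using periodic_pbump_grad[of c r] abs_pbump_grad_inner_le[OF cr(1,2) assms] by (auto simp: periodic_def)

text \<open>\<open>cor1\<close> to \<open>cor8\<close> admit the products behind the flux: 1 to 3
  for transport, 4 to 6 for incompressibility, 7 and 8 for the integration by parts in l. The slice
  bound lies on the second factor in \<open>cor1\<close>, \<open>cor2\<close>, \<open>cor4\<close>,
  \<open>cor5\<close> and on the first factor in \<open>cor3\<close> and
  \<open>cor6\<close>.\<close>

lemma cor1: "correlated T (\<lambda>z. \<theta> z * \<psi>D z) \<theta> (\<lambda>z. M * W z) \<kappa> 1 tbump"
proof (rule correlatedI)
  show *: "\<bar>\<theta> z * \<psi>D z * \<theta> (shift l z)\<bar> \<le> M * W z + M * W (shift l z)" for z l
    using dom_mult[OF \<psi>D_bound sq_dom(4) M(4), of z l] by (simp add: mult_ac)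
  have "\<theta> z * \<psi>D z = \<theta> z * time_deriv \<psi> z + (\<theta> z *\<^sub>R v z) \<bullet> space_gradient \<psi> z" for z
    by (simp add: \<psi>D_def distrib_left)
  then show "integrable (cyl_measure T) (\<lambda>z. \<theta> z * \<psi>D z)"
    using integrable_mult_test[OF time_deriv_test[OF \<psi>] th_int] integrable_inner_gradient[OF \<psi> thv_int] by simp
  show "x_periodic (\<lambda>z. \<theta> z * \<psi>D z)" by (rule x_periodic_compose2[OF th_per periodicities(2)])
qed (auto simp: th_0 th_int th_per periodic_pbump abs_pbump_le)

lemma cor2: "b \<in> Basis \<Longrightarrow> correlated T (\<lambda>z. ((\<theta> z *\<^sub>R v z) \<bullet> b) * \<psi> z) \<theta> (\<lambda>z. M * W z) (\<kappa>' b) (4 * c * r) tbump"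
proof (rule correlatedI)
  assume b: "b \<in> Basis"
  show "\<bar>((\<theta> z *\<^sub>R v z) \<bullet> b) * \<psi> z * \<theta> (shift l z)\<bar> \<le> M * W z + M * W (shift l z)" for z l
    using dom_mult[OF v\<psi>_bound(1)[OF b] sq_dom(4) M(4), of z l] by (simp add: mult_ac)
  show "integrable (cyl_measure T) (\<lambda>z. ((\<theta> z *\<^sub>R v z) \<bullet> b) * \<psi> z)"
    using integrable_mult_test[OF \<psi>, of "\<lambda>z. (\<theta> z *\<^sub>R v z) \<bullet> b"] thv_int by (simp del: inner_scaleR_left)
  show "x_periodic (\<lambda>z. ((\<theta> z *\<^sub>R v z) \<bullet> b) * \<psi> z)"
    by (rule x_periodic_compose2[OF x_periodic_compose2[OF th_per v_per, of "\<lambda>x y. (x *\<^sub>R y) \<bullet> b"] periodicities(1)])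
qed (auto simp: th_0 th_int th_per \<kappa>')

lemma cor3: "b \<in> Basis \<Longrightarrow> correlated T (\<lambda>z. \<theta> z * \<psi> z) (\<lambda>z. (\<theta> z *\<^sub>R v z) \<bullet> b) (\<lambda>z. M * W z) (\<kappa>' b) (4 * c * r) tbump"
proof (rule correlatedI)
  assume b: "b \<in> Basis"
  show "\<bar>\<theta> z * \<psi> z * ((\<theta> (shift l z) *\<^sub>R v (shift l z)) \<bullet> b)\<bar> \<le> M * W z + M * W (shift l z)" for z l
    using dom_mult[OF v\<psi>_bound(2)[OF b] sq_dom(4) M(4), of z l] by (simp add: mult_ac)
  show "integrable (cyl_measure T) (\<lambda>z. (\<theta> z *\<^sub>R v z) \<bullet> b)"
    using thv_int by (simp del: inner_scaleR_left)
  show "integrable (cyl_measure T) (\<lambda>z. \<theta> z * \<psi> z)" by (rule integrable_mult_test[OF \<psi> th_int])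
  show "x_periodic (\<lambda>z. (\<theta> z *\<^sub>R v z) \<bullet> b)" by (rule x_periodic_compose2[OF th_per v_per])
  show "x_periodic (\<lambda>z. \<theta> z * \<psi> z)" by (rule x_periodic_compose2[OF th_per periodicities(1)])
qed (auto simp: th_0 \<kappa>')

lemma cor4: "correlated T (\<lambda>z. v z \<bullet> space_gradient \<psi> z) (\<lambda>z. (\<theta> z)\<^sup>2) (\<lambda>z. M * W z) \<kappa> 1 tbump"
proof (rule correlatedI)
  have "\<bar>v z \<bullet> space_gradient \<psi> z\<bar> \<le> M * (1 + norm (v z) + norm (v (shift l z)))" for z l
  proof -
    have "\<bar>v z \<bullet> space_gradient \<psi> z\<bar> \<le> norm (v z) * M"
      by (rule order_trans[OF Cauchy_Schwarz_ineq2 mult_left_mono[OF M(3)]]) simp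
    also have "\<dots> \<le> M * (1 + norm (v z) + norm (v (shift l z)))" using M(4) by (simp add: algebra_simps)
    finally show ?thesis .
  qed
  from dom_mult[OF this sq_dom(7) M(4)]
  show "\<bar>v z \<bullet> space_gradient \<psi> z * (\<theta> (shift l z))\<^sup>2\<bar> \<le> M * W z + M * W (shift l z)" for z l .
qed (auto simp: th_0 v_0 th2_int integrable_inner_gradient[OF \<psi> v_int] periodicities periodic_pbump abs_pbump_le)

lemma cor5: "b \<in> Basis \<Longrightarrow> correlated T (\<lambda>z. (v z \<bullet> b) * \<psi> z) (\<lambda>z. (\<theta> z)\<^sup>2) (\<lambda>z. M * W z) (\<kappa>' b) (4 * c * r) tbump"
proof (rule correlatedI)
  assume b: "b \<in> Basis"
  show "\<bar>(v z \<bullet> b) * \<psi> z * (\<theta> (shift l z))\<^sup>2\<bar> \<le> M * W z + M * W (shift l z)" for z l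
    by (rule dom_mult[OF v\<psi>_bound(1)[OF b] sq_dom(7) M(4)])
  show "integrable (cyl_measure T) (\<lambda>z. (v z \<bullet> b) * \<psi> z)"
    using integrable_mult_test[OF \<psi>, of "\<lambda>z. v z \<bullet> b"] v_int by simp
  show "x_periodic (\<lambda>z. (v z \<bullet> b) * \<psi> z)" by (rule x_periodic_compose2[OF periodicities(3,1)])
qed (auto simp: th_0 v_0 th2_int periodicities \<kappa>')

lemma cor6: "b \<in> Basis \<Longrightarrow> correlated T (\<lambda>z. (\<theta> z)\<^sup>2 * \<psi> z) (\<lambda>z. v z \<bullet> b) (\<lambda>z. M * W z) (\<kappa>' b) (4 * c * r) tbump"
proof (rule correlatedI)
  assume b: "b \<in> Basis"
  show "\<bar>(\<theta> z)\<^sup>2 * \<psi> z * (v (shift l z) \<bullet> b)\<bar> \<le> M * W z + M * W (shift l z)" for z l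
    using dom_mult[OF v\<psi>_bound(2)[OF b] sq_dom(6) M(4), of z l] by (simp add: mult_ac)
  show "x_periodic (\<lambda>z. (\<theta> z)\<^sup>2 * \<psi> z)" by (rule x_periodic_compose2[OF periodicities(4,1)])
qed (use v_int in \<open>auto simp: th_0 v_0 integrable_mult_test[OF \<psi> th2_int] periodicities \<kappa>'\<close>)

lemma cor7: "b \<in> Basis \<Longrightarrow> correlated T \<psi> (\<lambda>z. ((\<theta> z)\<^sup>2 *\<^sub>R v z) \<bullet> b) (\<lambda>z. M * W z) (\<kappa>' b) (4 * c * r) tbump"
  and cor8: "b \<in> Basis \<Longrightarrow> correlated T (\<lambda>z. space_gradient \<psi> z \<bullet> b) (\<lambda>z. ((\<theta> z)\<^sup>2 *\<^sub>R v z) \<bullet> b) (\<lambda>z. M * W z) \<kappa> 1 tbump"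
proof -
  assume b: "b \<in> Basis"
  have g: "integrable (cyl_measure T) (\<lambda>z. ((\<theta> z)\<^sup>2 *\<^sub>R v z) \<bullet> b)"
    using th2v_int by (simp del: inner_scaleR_left)
  have p: "x_periodic (\<lambda>z. ((\<theta> z)\<^sup>2 *\<^sub>R v z) \<bullet> b)" by (rule x_periodic_compose2[OF th_per v_per])
  have t: "integrable (cyl_measure T) \<eta>" if "\<eta> \<in> test_functions T" for \<eta>
    using integrable_mult_test[OF that, of "\<lambda>_. 1"] by simp
  show "correlated T \<psi> (\<lambda>z. ((\<theta> z)\<^sup>2 *\<^sub>R v z) \<bullet> b) (\<lambda>z. M * W z) (\<kappa>' b) (4 * c * r) tbump"
  proof (rule correlatedI)
    show "\<bar>\<psi> z * (((\<theta> (shift l z))\<^sup>2 *\<^sub>R v (shift l z)) \<bullet> b)\<bar> \<le> M * W z + M * W (shift l z)" for z l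
      using dom_mult[OF v\<psi>_bound(2)[OF b] sq_dom(7) M(4), of z l] by (simp add: mult_ac)
  qed (use g p t[OF \<psi>] in \<open>auto simp: th_0 test_vanish periodicities \<kappa>'[OF b] simp del: inner_scaleR_left\<close>)
  show "correlated T (\<lambda>z. space_gradient \<psi> z \<bullet> b) (\<lambda>z. ((\<theta> z)\<^sup>2 *\<^sub>R v z) \<bullet> b) (\<lambda>z. M * W z) \<kappa> 1 tbump"
  proof (rule correlatedI)
    show "\<bar>(space_gradient \<psi> z \<bullet> b) * (((\<theta> (shift l z))\<^sup>2 *\<^sub>R v (shift l z)) \<bullet> b)\<bar> \<le> M * W z + M * W (shift l z)" for z l
      using dom_mult[OF v\<psi>_bound(3)[OF b] sq_dom(7) M(4), of z l] by (simp add: mult_ac)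
  qed (use g p t[OF space_gradient_test[OF \<psi> b]] b in
      \<open>auto simp: th_0 test_vanish periodicities periodic_pbump abs_pbump_le simp del: inner_scaleR_left\<close>)
qed

end

context flow_test
begin

definition flux_corr :: "space \<Rightarrow> space" where
  "flux_corr l = (\<integral>z. ((\<theta> (shift l z) - \<theta> z)\<^sup>2 * \<psi> z) *\<^sub>R (v (shift l z) - v z) \<partial>cyl_measure T)"

text \<open>H of the overview. The first term collects what the shifted product \<theta>^2 v and
  incompressibility contribute, the second what transport of \<theta>(x) \<theta>(x + l)
  contributes; at l = 0 only the second survives.\<close>

definition energy_corr :: "space \<Rightarrow> real" where
  "energy_corr l = (\<integral>z. - (1/4) * (\<theta> (shift l z))\<^sup>2 * ((v (shift l z) - v z) \<bullet> space_gradient \<psi> z)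
      - (1/2) * (\<theta> z * \<theta> (shift l z)) * \<psi>D z \<partial>cyl_measure T)"

lemma eventually_small: "0 < (e::real) \<Longrightarrow> \<forall>\<^sub>F j in sequentially. 1 / real (Suc j) < e"
proof -
  assume "0 < e"
  then show ?thesis using order_tendstoD(2)[OF LIMSEQ_Suc[OF lim_1_over_n]] by blast
qed

lemma eventually_weight:
  "\<forall>\<^sub>F j in sequentially. \<forall>f w g. solves T f w \<longrightarrow> integrable (cyl_measure T) f \<longrightarrow> integrable (cyl_measure T) w \<longrightarrow>
      integrable (cyl_measure T) g \<longrightarrow>
    (\<Sum>b\<in>Basis. smear T (tbump j) (\<lambda>z. g z * \<psi> z) (\<lambda>z. w z \<bullet> b) (\<kappa>' b)) - smear T (tbump' j) (\<lambda>z. g z * \<psi> z) f \<kappa> = 0"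
proof -
  obtain a b where ab: "0 < a" "b < T" "vanishes_outside a b \<psi>" using test_functionsD(3)[OF \<psi>] by blast
  have "\<forall>\<^sub>F j in sequentially. 1 / real (Suc j) < a" "\<forall>\<^sub>F j in sequentially. 1 / real (Suc j) < T - b"
    using ab by (intro eventually_small; simp)+
  then show ?thesis
  proof eventually_elim
    case (elim j)
    then show ?case
      using smear_equation_weight[OF _ \<psi> cr _ _ _ ab(3), of _ _ _ j] by (auto simp del: of_nat_Suc)
  qed
qed

text \<open>The smeared equations in both variables with f = g = \<theta> contain the same
  \<open>tbump'\<close> term with opposite signs, so their sum has a limit. The terms with \<theta>
  v as second factor use the mirrored limit, the others the direct one.\<close>

lemma transport_identity:
  "correlation T (\<lambda>z. \<theta> z * \<psi>D z) \<theta> \<kappa> - (\<Sum>b\<in>Basis. correlation T (\<lambda>z. ((\<theta> z *\<^sub>R v z) \<bullet> b) * \<psi> z) \<theta> (\<kappa>' b))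
    + (\<Sum>b\<in>Basis. correlation T (\<lambda>z. \<theta> z * \<psi> z) (\<lambda>z. (\<theta> z *\<^sub>R v z) \<bullet> b) (\<kappa>' b)) = 0" (is "?L = 0")
proof -
  let ?S = "\<lambda>j. smear T (tbump j) (\<lambda>z. \<theta> z * \<psi>D z) \<theta> \<kappa>
    - (\<Sum>b\<in>Basis. smear T (tbump j) (\<lambda>z. ((\<theta> z *\<^sub>R v z) \<bullet> b) * \<psi> z) \<theta> (\<kappa>' b))
    + (\<Sum>b\<in>Basis. smear T (tbump j) (\<lambda>z. \<theta> z * \<psi> z) (\<lambda>z. (\<theta> z *\<^sub>R v z) \<bullet> b) (\<kappa>' b))"
  have "?S \<longlonglongrightarrow> ?L"
    by (intro tendsto_intros correlated.smear_tendsto_right[OF cor1] correlated.smear_tendsto_right[OF cor2]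
        correlated.smear_tendsto_left[OF cor3] slices \<psi>)
  moreover have "\<forall>\<^sub>F j in sequentially. ?S j = 0"
    using eventually_weight
  proof eventually_elim
    case (elim j)
    have "\<theta> z * time_deriv \<psi> z + (\<theta> z *\<^sub>R v z) \<bullet> space_gradient \<psi> z = \<theta> z * \<psi>D z" for z
      by (simp add: \<psi>D_def distrib_left)
    then show ?case
      using elim[rule_format, OF transport th_int thv_int th_int]
        smear_equation_base[OF transport \<psi> cr th_int thv_int th_int, of j] by simp
  qed
  then have "?S \<longlonglongrightarrow> 0" by (rule tendsto_eventually)
  ultimately show ?thesis by (rule LIMSEQ_unique)
qed

lemma smear_zero: "smear T \<rho> (\<lambda>z. 0) g k = 0" "smear T \<rho> f (\<lambda>z. 0) k = 0"
  by (simp_all add: smear_def)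

text \<open>With f = 0 there is no time derivative and the smeared identity holds for every j. It
  trades the gradient of the kernel, acting on v at x against \<theta>^2 at x + l, for a gradient of
  \<psi>.\<close>

lemma div_identity_base:
  "correlation T (\<lambda>z. v z \<bullet> space_gradient \<psi> z) (\<lambda>z. (\<theta> z)\<^sup>2) \<kappa>
    - (\<Sum>b\<in>Basis. correlation T (\<lambda>z. (v z \<bullet> b) * \<psi> z) (\<lambda>z. (\<theta> z)\<^sup>2) (\<kappa>' b)) = 0" (is "?L = 0")
proof -
  let ?S = "\<lambda>j. smear T (tbump j) (\<lambda>z. v z \<bullet> space_gradient \<psi> z) (\<lambda>z. (\<theta> z)\<^sup>2) \<kappa>
    - (\<Sum>b\<in>Basis. smear T (tbump j) (\<lambda>z. (v z \<bullet> b) * \<psi> z) (\<lambda>z. (\<theta> z)\<^sup>2) (\<kappa>' b))"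
  have "?S \<longlonglongrightarrow> ?L"
    by (intro tendsto_intros correlated.smear_tendsto_right[OF cor4] correlated.smear_tendsto_right[OF cor5] slices)
  moreover have "?S j = 0" for j
    using smear_equation_base[OF div_free \<psi> cr _ v_int th2_int, of j] by (simp add: smear_zero)
  ultimately show ?thesis by (simp add: LIMSEQ_const_iff)
qed

text \<open>Here \<psi> stays with \<theta>^2 at the unshifted point, so the divergence-free field
  at x + l is tested against the kernels alone and no term with a derivative of \<psi>
  remains.\<close>

lemma div_identity_weight:
  "(\<Sum>b\<in>Basis. correlation T (\<lambda>z. (\<theta> z)\<^sup>2 * \<psi> z) (\<lambda>z. v z \<bullet> b) (\<kappa>' b)) = 0" (is "?L = 0")
proof -
  let ?S = "\<lambda>j. \<Sum>b\<in>Basis. smear T (tbump j) (\<lambda>z. (\<theta> z)\<^sup>2 * \<psi> z) (\<lambda>z. v z \<bullet> b) (\<kappa>' b)"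
  have "?S \<longlonglongrightarrow> ?L"
    by (intro tendsto_intros correlated.smear_tendsto_left[OF cor6] slices \<psi>)
  moreover have "\<forall>\<^sub>F j in sequentially. ?S j = 0"
    using eventually_weight
  proof eventually_elim
    case (elim j)
    then show ?case using elim[rule_format, OF div_free _ v_int th2_int] by (simp add: smear_zero)
  qed
  then have "?S \<longlonglongrightarrow> 0" by (rule tendsto_eventually)
  ultimately show ?thesis by (rule LIMSEQ_unique)
qed

text \<open>For \<theta>^2 v at a single point neither equation is at hand. Shift invariance moves
  -l onto \<psi>, and integration by parts over the cell moves the l-derivative from the kernel to
  \<psi>(x - l); the two minus signs cancel.\<close>

lemma parts_identity:
  assumes b: "b \<in> Basis"
  shows "correlation T \<psi> (\<lambda>z. ((\<theta> z)\<^sup>2 *\<^sub>R v z) \<bullet> b) (\<kappa>' b)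
    = correlation T (\<lambda>z. space_gradient \<psi> z \<bullet> b) (\<lambda>z. ((\<theta> z)\<^sup>2 *\<^sub>R v z) \<bullet> b) \<kappa>"
proof -
  interpret c7: correlated T \<psi> "\<lambda>z. ((\<theta> z)\<^sup>2 *\<^sub>R v z) \<bullet> b" "\<lambda>z. M * W z" "\<kappa>' b" "4 * c * r" tbump by (rule cor7[OF b])
  interpret c8: correlated T "\<lambda>z. space_gradient \<psi> z \<bullet> b" "\<lambda>z. ((\<theta> z)\<^sup>2 *\<^sub>R v z) \<bullet> b" "\<lambda>z. M * W z" \<kappa> 1 tbump by (rule cor8[OF b])
  let ?h = "\<lambda>z. ((\<theta> z)\<^sup>2 *\<^sub>R v z) \<bullet> b"
  \<comment> \<open>After this rewriting both correlations carry the same unshifted factor, so it is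
    enough to compare the inner l-integrals for each z.\<close>
  have flip: "correlation T f ?h k = (\<integral>z. ?h z * (\<integral>l. f (shift (- l) z) * k l \<partial>cell_measure) \<partial>cyl_measure T)"
    if "correlated T f ?h (\<lambda>z. M * W z) k B tbump" for f k B
  proof -
    interpret c: correlated T f ?h "\<lambda>z. M * W z" k B tbump by fact
    have "(\<integral>z. f z * ?h (shift l z) \<partial>cyl_measure T) = (\<integral>z. ?h z * f (shift (- l) z) \<partial>cyl_measure T)" for l
      using integral_cyl_shift[of "\<lambda>z. ?h z * f (shift (- l) z)" T l]
        x_periodic_compose2[OF c.g_per x_periodic_shift[OF c.f_per], of "(*)"] by (simp add: mult.commute)
    then have "correlation T f ?h k = (\<integral>l. k l * (\<integral>z. ?h z * f (shift (- l) z) \<partial>cyl_measure T) \<partial>cell_measure)"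
      by (simp only: correlation_def)
    also have "\<dots> = (\<integral>z. ?h z * (\<integral>l. f (shift (- l) z) * k l \<partial>cell_measure) \<partial>cyl_measure T)"
    proof (rule c.swap_pair[symmetric])
      show "\<bar>?h z * f (shift (- l) z)\<bar> \<le> M * W z + M * W (shift (- l) z)" for z l
        using c.dom[of "shift (- l) z" l] by (simp add: mult.commute)
    qed (use c.k_bd in auto)
    finally show ?thesis .
  qed
  have "(\<integral>l. \<psi> (shift (- l) z) * \<kappa>' b l \<partial>cell_measure) = (\<integral>l. (space_gradient \<psi> (shift (- l) z) \<bullet> b) * \<kappa> l \<partial>cell_measure)" for z
  proof -
    obtain t x where z: "z = (t, x)" by force
    have per: "periodic (\<lambda>l. \<psi> (t, x - l) * \<kappa> l)"
    proof -
      have "\<psi> (t, x - (l + b)) = \<psi> (t, x - l)" if "b \<in> Basis" for l b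
        using periodic_lattice[of "\<lambda>x. \<psi> (t, x)" "- b" "x - l"] periodicities(1) that
        by (simp add: x_periodic_def lattice_closed diff_diff_eq)
      then show ?thesis using periodic_pbump[of c r] by (simp add: periodic_def)
    qed
    let ?G = "\<lambda>l. \<psi> (t, x - l) *\<^sub>R pbump_grad c r l + \<kappa> l *\<^sub>R (- space_gradient \<psi> (t, x - l))"
    have d: "((\<lambda>l. \<psi> (t, x - l) * \<kappa> l) has_derivative (\<lambda>h. ?G l \<bullet> h)) (at l)" for l
    proof (rule gradient_smooth_product[OF _ pbump_has_derivative[OF cr]])
      have "((\<lambda>l. x - l) has_derivative (\<lambda>h. - h)) (at l)" by (auto intro!: derivative_eq_intros)
      from has_derivative_compose[OF this smooth_fun_has_space_gradient(1)[OF test_functionsD(1)[OF \<psi>]]]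
      show "((\<lambda>l. \<psi> (t, x - l)) has_derivative (\<lambda>h. - space_gradient \<psi> (t, x - l) \<bullet> h)) (at l)" by simp
    qed
    have bd: "norm (?G l) \<le> M * (4 * c * r) + 1 * M" for l
    proof -
      have "norm (\<psi> (t, x - l) *\<^sub>R pbump_grad c r l) \<le> M * (4 * c * r)"
        unfolding norm_scaleR using M norm_pbump_grad_le[OF cr(1,2)] by (intro mult_mono) auto
      moreover have "norm (\<kappa> l *\<^sub>R (- space_gradient \<psi> (t, x - l))) \<le> 1 * M"
        unfolding norm_scaleR norm_minus_cancel using M abs_pbump_le by (intro mult_mono) auto
      ultimately show ?thesis by (rule norm_triangle_mono)
    qed
    have "(\<integral>l. ?G l \<bullet> b \<partial>cell_measure) = 0" by (rule integral_cell_derivative[OF per d bd])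
    moreover have "?G l \<bullet> b = \<psi> (t, x - l) * \<kappa>' b l - (space_gradient \<psi> (t, x - l) \<bullet> b) * \<kappa> l" for l
      by (simp add: inner_add_left inner_diff_left)
    moreover have "integrable cell_measure (\<lambda>l. \<psi> (t, x - l) * \<kappa>' b l)"
    proof (rule cell.integrable_const_bound[where B = "M * (4 * c * r)"])
      show "AE l in cell_measure. norm (\<psi> (t, x - l) * \<kappa>' b l) \<le> M * (4 * c * r)"
        using mult_mono[OF M(1) \<kappa>'(2)[OF b] M(4) abs_ge_zero] by (intro AE_I2) (simp add: abs_mult)
    qed measurable
    moreover have "integrable cell_measure (\<lambda>l. (space_gradient \<psi> (t, x - l) \<bullet> b) * \<kappa> l)"
    proof (rule cell.integrable_const_bound[where B = "M * 1"])
      show "AE l in cell_measure. norm ((space_gradient \<psi> (t, x - l) \<bullet> b) * \<kappa> l) \<le> M * 1"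
        using mult_mono[OF v\<psi>_bound(5)[OF b] abs_pbump_le M(4) abs_ge_zero] by (intro AE_I2) (simp add: abs_mult)
    qed measurable
    ultimately show ?thesis unfolding z by simp
  qed
  then show ?thesis unfolding flip[OF cor7[OF b]] flip[OF cor8[OF b]] by simp
qed

text \<open>This disposes of the one product in the flux that does not depend on l.\<close>

lemma integral_pbump_grad: "b \<in> Basis \<Longrightarrow> (\<integral>l. \<kappa>' b l \<partial>cell_measure) = 0"
  by (rule integral_cell_derivative[OF periodic_pbump pbump_has_derivative[OF cr] norm_pbump_grad_le[OF cr(1,2)]])

lemma norm_flux_integrand_le:
  "norm (((\<theta> (shift l z) - \<theta> z)\<^sup>2 * \<psi> z) *\<^sub>R (v (shift l z) - v z)) \<le> M * W z + M * W (shift l z)"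
proof -
  have "M * norm (v (shift l z) - v z) \<le> M * (1 + norm (v z) + norm (v (shift l z)))"
    using norm_triangle_ineq4[of "v (shift l z)" "v z"] M(4) by (intro mult_left_mono) auto
  moreover have "\<bar>\<psi> z\<bar> * norm (v (shift l z) - v z) \<le> M * norm (v (shift l z) - v z)"
    using M(1) by (intro mult_right_mono) auto
  ultimately have "\<bar>\<bar>\<psi> z\<bar> * norm (v (shift l z) - v z)\<bar> \<le> M * (1 + norm (v z) + norm (v (shift l z)))" by simp
  from dom_mult[OF this sq_dom(8) M(4)]
  show ?thesis by (simp add: abs_mult mult_ac)
qed

lemma flux_integrable:
  "integrable (cyl_measure T) (\<lambda>z. ((\<theta> (shift l z) - \<theta> z)\<^sup>2 * \<psi> z) *\<^sub>R (v (shift l z) - v z))"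
  by (rule integrable_dominated[OF _ norm_flux_integrand_le]) measurable

text \<open>Of the six products in the flux, one is killed by \<open>div_identity_weight\<close> and
  one does not depend on l. The other four turn into derivatives of \<psi> through
  \<open>parts_identity\<close>, \<open>div_identity_base\<close> and
  \<open>transport_identity\<close>, and what they leave is -4 times the energy correlation.\<close>

lemma flux_energy_identity:
  "(\<integral>l. pbump_grad c r l \<bullet> flux_corr l \<partial>cell_measure) = - 4 * (\<integral>l. \<kappa> l * energy_corr l \<partial>cell_measure)"
proof -
  let ?I = "\<lambda>f g l. \<integral>z. f z * g (shift l z) \<partial>cyl_measure T"
  let ?q = "\<lambda>b z. ((\<theta> z)\<^sup>2 *\<^sub>R v z) \<bullet> b" and ?p = "\<lambda>b z. (\<theta> z *\<^sub>R v z) \<bullet> b"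
  have F: "flux_corr l \<bullet> b = ?I \<psi> (?q b) l + ?I (\<lambda>z. (\<theta> z)\<^sup>2 * \<psi> z) (\<lambda>z. v z \<bullet> b) l
      - 2 * ?I (\<lambda>z. \<theta> z * \<psi> z) (?p b) l - ?I (\<lambda>z. (v z \<bullet> b) * \<psi> z) (\<lambda>z. (\<theta> z)\<^sup>2) l
      - (\<integral>z. ?q b z * \<psi> z \<partial>cyl_measure T) + 2 * ?I (\<lambda>z. ?p b z * \<psi> z) \<theta> l" if b: "b \<in> Basis" for l b
  proof -
    have q: "integrable (cyl_measure T) (\<lambda>z. ?q b z * \<psi> z)"
      using integrable_mult_test[OF \<psi>, of "?q b"] th2v_int by (simp del: inner_scaleR_left)
    have "flux_corr l \<bullet> b = (\<integral>z. (((\<theta> (shift l z) - \<theta> z)\<^sup>2 * \<psi> z) *\<^sub>R (v (shift l z) - v z)) \<bullet> b \<partial>cyl_measure T)"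
      unfolding flux_corr_def by (rule integral_inner_left[OF _, symmetric]) (rule flux_integrable)
    also have "\<dots> = (\<integral>z. \<psi> z * ?q b (shift l z) + (\<theta> z)\<^sup>2 * \<psi> z * (v (shift l z) \<bullet> b)
      - 2 * (\<theta> z * \<psi> z * ?p b (shift l z)) - (v z \<bullet> b) * \<psi> z * (\<theta> (shift l z))\<^sup>2
      - ?q b z * \<psi> z + 2 * (?p b z * \<psi> z * \<theta> (shift l z)) \<partial>cyl_measure T)"
      by (rule Bochner_Integration.integral_cong) (auto simp: power2_eq_square inner_diff_left algebra_simps)
    also have "\<dots> = ?I \<psi> (?q b) l + ?I (\<lambda>z. (\<theta> z)\<^sup>2 * \<psi> z) (\<lambda>z. v z \<bullet> b) l
      - 2 * ?I (\<lambda>z. \<theta> z * \<psi> z) (?p b) l - ?I (\<lambda>z. (v z \<bullet> b) * \<psi> z) (\<lambda>z. (\<theta> z)\<^sup>2) l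
      - (\<integral>z. ?q b z * \<psi> z \<partial>cyl_measure T) + 2 * ?I (\<lambda>z. ?p b z * \<psi> z) \<theta> l"
      using correlated.product_integrable[OF cor7[OF b], of l] correlated.product_integrable[OF cor6[OF b], of l]
        correlated.product_integrable[OF cor3[OF b], of l] correlated.product_integrable[OF cor5[OF b], of l]
        correlated.product_integrable[OF cor2[OF b], of l] q
      by (simp del: inner_scaleR_left)
    finally show ?thesis .
  qed
  have E: "- 4 * energy_corr l = (\<Sum>b\<in>Basis. ?I (\<lambda>z. space_gradient \<psi> z \<bullet> b) (?q b) l)
      - ?I (\<lambda>z. v z \<bullet> space_gradient \<psi> z) (\<lambda>z. (\<theta> z)\<^sup>2) l + 2 * ?I (\<lambda>z. \<theta> z * \<psi>D z) \<theta> l" for l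
  proof -
    have "- 4 * energy_corr l = (\<integral>z. - 4 * (- (1/4) * (\<theta> (shift l z))\<^sup>2 * ((v (shift l z) - v z) \<bullet> space_gradient \<psi> z)
      - (1/2) * (\<theta> z * \<theta> (shift l z)) * \<psi>D z) \<partial>cyl_measure T)"
      unfolding energy_corr_def by (rule Bochner_Integration.integral_mult_right_zero[symmetric])
    also have "\<dots> = (\<integral>z. (\<Sum>b\<in>Basis. (space_gradient \<psi> z \<bullet> b) * ?q b (shift l z))
      - (v z \<bullet> space_gradient \<psi> z) * (\<theta> (shift l z))\<^sup>2 + 2 * (\<theta> z * \<psi>D z * \<theta> (shift l z)) \<partial>cyl_measure T)"
    proof (rule Bochner_Integration.integral_cong[OF refl])
      fix z
      have "(\<Sum>b\<in>Basis. (space_gradient \<psi> z \<bullet> b) * ?q b (shift l z)) = (\<theta> (shift l z))\<^sup>2 * (v (shift l z) \<bullet> space_gradient \<psi> z)"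
        unfolding euclidean_inner[of "v (shift l z)" "space_gradient \<psi> z"] sum_distrib_left by (intro sum.cong refl) simp
      then show "- 4 * (- (1/4) * (\<theta> (shift l z))\<^sup>2 * ((v (shift l z) - v z) \<bullet> space_gradient \<psi> z)
          - (1/2) * (\<theta> z * \<theta> (shift l z)) * \<psi>D z)
        = (\<Sum>b\<in>Basis. (space_gradient \<psi> z \<bullet> b) * ?q b (shift l z))
          - (v z \<bullet> space_gradient \<psi> z) * (\<theta> (shift l z))\<^sup>2 + 2 * (\<theta> z * \<psi>D z * \<theta> (shift l z))"
        by (simp add: inner_diff_left algebra_simps)
    qed
    also have "\<dots> = (\<Sum>b\<in>Basis. ?I (\<lambda>z. space_gradient \<psi> z \<bullet> b) (?q b) l)
      - ?I (\<lambda>z. v z \<bullet> space_gradient \<psi> z) (\<lambda>z. (\<theta> z)\<^sup>2) l + 2 * ?I (\<lambda>z. \<theta> z * \<psi>D z) \<theta> l"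
      using correlated.product_integrable[OF cor8, of _ l] correlated.product_integrable[OF cor4, of l]
        correlated.product_integrable[OF cor1, of l]
      by (simp del: inner_scaleR_left)
    finally show ?thesis .
  qed
  have "(\<integral>l. pbump_grad c r l \<bullet> flux_corr l \<partial>cell_measure) = (\<integral>l. (\<Sum>b\<in>Basis. \<kappa>' b l * (flux_corr l \<bullet> b)) \<partial>cell_measure)"
    by (subst euclidean_inner) simp
  also have "\<dots> = (\<Sum>b\<in>Basis. \<integral>l. \<kappa>' b l * (flux_corr l \<bullet> b) \<partial>cell_measure)"
  proof (rule Bochner_Integration.integral_sum)
    fix b :: space assume b: "b \<in> Basis"
    have k: "integrable cell_measure (\<kappa>' b)"
      by (rule cell.integrable_const_bound[where B = "4 * c * r"]) (use \<kappa>'(2)[OF b] in auto)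
    show "integrable cell_measure (\<lambda>l. \<kappa>' b l * (flux_corr l \<bullet> b))"
      unfolding F[OF b] distrib_left right_diff_distrib mult.left_commute[of _ 2]
      using correlated.correlation_integrable[OF cor7[OF b]] correlated.correlation_integrable[OF cor6[OF b]]
        correlated.correlation_integrable[OF cor3[OF b]] correlated.correlation_integrable[OF cor5[OF b]]
        correlated.correlation_integrable[OF cor2[OF b]] k
      by (simp del: inner_scaleR_left)
  qed
  also have "\<dots> = (\<Sum>b\<in>Basis. correlation T \<psi> (?q b) (\<kappa>' b) + correlation T (\<lambda>z. (\<theta> z)\<^sup>2 * \<psi> z) (\<lambda>z. v z \<bullet> b) (\<kappa>' b)
      - 2 * correlation T (\<lambda>z. \<theta> z * \<psi> z) (?p b) (\<kappa>' b) - correlation T (\<lambda>z. (v z \<bullet> b) * \<psi> z) (\<lambda>z. (\<theta> z)\<^sup>2) (\<kappa>' b)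
      + 2 * correlation T (\<lambda>z. ?p b z * \<psi> z) \<theta> (\<kappa>' b))"
  proof (rule sum.cong[OF refl])
    fix b :: space assume b: "b \<in> Basis"
    have k: "integrable cell_measure (\<kappa>' b)"
      by (rule cell.integrable_const_bound[where B = "4 * c * r"]) (use \<kappa>'(2)[OF b] in auto)
    show "(\<integral>l. \<kappa>' b l * (flux_corr l \<bullet> b) \<partial>cell_measure)
      = correlation T \<psi> (?q b) (\<kappa>' b) + correlation T (\<lambda>z. (\<theta> z)\<^sup>2 * \<psi> z) (\<lambda>z. v z \<bullet> b) (\<kappa>' b)
      - 2 * correlation T (\<lambda>z. \<theta> z * \<psi> z) (?p b) (\<kappa>' b) - correlation T (\<lambda>z. (v z \<bullet> b) * \<psi> z) (\<lambda>z. (\<theta> z)\<^sup>2) (\<kappa>' b)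
      + 2 * correlation T (\<lambda>z. ?p b z * \<psi> z) \<theta> (\<kappa>' b)"
      unfolding F[OF b] distrib_left right_diff_distrib mult.left_commute[of _ 2] correlation_def
      using correlated.correlation_integrable[OF cor7[OF b]] correlated.correlation_integrable[OF cor6[OF b]]
        correlated.correlation_integrable[OF cor3[OF b]] correlated.correlation_integrable[OF cor5[OF b]]
        correlated.correlation_integrable[OF cor2[OF b]] k integral_pbump_grad[OF b]
      by (simp del: inner_scaleR_left)
  qed
  \<comment> \<open>The two transport sums carry the coefficients -2 and 2, which is -2 times their
    combination in \<open>transport_identity\<close>; this produces twice the term with the material
    derivative.\<close>
  also have "\<dots> = (\<Sum>b\<in>Basis. correlation T (\<lambda>z. space_gradient \<psi> z \<bullet> b) (?q b) \<kappa>)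
      - correlation T (\<lambda>z. v z \<bullet> space_gradient \<psi> z) (\<lambda>z. (\<theta> z)\<^sup>2) \<kappa> + 2 * correlation T (\<lambda>z. \<theta> z * \<psi>D z) \<theta> \<kappa>"
    using transport_identity div_identity_base div_identity_weight
    by (simp add: sum.distrib sum_subtractf parts_identity flip: sum_distrib_left del: inner_scaleR_left)
  also have "\<dots> = (\<integral>l. \<kappa> l * (- 4 * energy_corr l) \<partial>cell_measure)"
    unfolding E distrib_left right_diff_distrib mult.left_commute[of _ 2] correlation_def sum_distrib_left
    using correlated.correlation_integrable[OF cor8] correlated.correlation_integrable[OF cor4]
        correlated.correlation_integrable[OF cor1]
    by (simp del: inner_scaleR_left)
  also have "\<dots> = - 4 * (\<integral>l. \<kappa> l * energy_corr l \<partial>cell_measure)"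
    by (simp add: mult.left_commute[of _ 4])
  finally show ?thesis .
qed

lemma MW: "(\<lambda>z. M * W z) \<in> borel_measurable borel" "x_periodic (\<lambda>z. M * W z)" "integrable (cyl_measure T) (\<lambda>z. M * W z)"
  using W_int x_periodic_compose[OF W_per, of "(*) M"] by auto

text \<open>Velocity and temperature are shifted together as one pair-valued field, so that
  \<open>continuous_shift_functional\<close> covers integrands mixing the two.\<close>

lemma pair_field:
  shows "(\<lambda>z. (v z, \<theta> z)) \<in> borel_measurable borel" "x_periodic (\<lambda>z. (v z, \<theta> z))"
    "integrable (cyl_measure T) (\<lambda>z. (v z, \<theta> z))"
proof -
  show 1: "(\<lambda>z. (v z, \<theta> z)) \<in> borel_measurable borel" by (intro borel_measurable_Pair v_borel th_borel)
  show "x_periodic (\<lambda>z. (v z, \<theta> z))" by (rule x_periodic_compose2[OF v_per th_per])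
  have "integrable (cyl_measure T) (\<lambda>z. norm (v z) + \<bar>\<theta> z\<bar>)" using v_int th_int by auto
  then show "integrable (cyl_measure T) (\<lambda>z. (v z, \<theta> z))"
    by (rule Bochner_Integration.integrable_bound)
      (use 1 in \<open>auto intro!: AE_I2 simp: norm_Pair intro: order_trans[OF sqrt_sum_squares_le_sum_abs]\<close>)
qed

lemma energy_integrand_le:
  "\<bar>- (1/4) * (\<theta> (shift l z))\<^sup>2 * ((v (shift l z) - v z) \<bullet> space_gradient \<psi> z)
      - (1/2) * (\<theta> z * \<theta> (shift l z)) * \<psi>D z\<bar> \<le> M * W z + M * W (shift l z)"
proof -
  have "\<bar>(v (shift l z) - v z) \<bullet> space_gradient \<psi> z\<bar> \<le> norm (v (shift l z) - v z) * M"
    by (rule order_trans[OF Cauchy_Schwarz_ineq2 mult_left_mono[OF M(3)]]) simp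
  also have "\<dots> \<le> M * (1 + norm (v z) + norm (v (shift l z)))"
    using norm_triangle_ineq4[of "v (shift l z)" "v z"] M(4)
    unfolding mult.commute[of _ M] by (intro mult_left_mono) auto
  finally have "\<bar>((v (shift l z) - v z) \<bullet> space_gradient \<psi> z) * (\<theta> (shift l z))\<^sup>2\<bar> \<le> M * W z + M * W (shift l z)"
    by (rule dom_mult[OF _ sq_dom(7) M(4)])
  moreover have "\<bar>\<psi>D z * (\<theta> z * \<theta> (shift l z))\<bar> \<le> M * W z + M * W (shift l z)"
    by (rule dom_mult[OF \<psi>D_bound sq_dom(4) M(4)])
  moreover have "- (1/4) * (\<theta> (shift l z))\<^sup>2 * ((v (shift l z) - v z) \<bullet> space_gradient \<psi> z) - (1/2) * (\<theta> z * \<theta> (shift l z)) * \<psi>D z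
     = - (1/4) * (((v (shift l z) - v z) \<bullet> space_gradient \<psi> z) * (\<theta> (shift l z))\<^sup>2) - (1/2) * (\<psi>D z * (\<theta> z * \<theta> (shift l z)))"
    by (simp only: mult_ac)
  ultimately show ?thesis by linarith
qed

lemma continuous_flux_corr: "continuous_on UNIV flux_corr"
proof -
  have "continuous_on UNIV (\<lambda>l. \<integral>z. (\<lambda>z a a'. ((snd a' - snd a)\<^sup>2 * \<psi> z) *\<^sub>R (fst a' - fst a)) z (v z, \<theta> z) (v (shift l z), \<theta> (shift l z)) \<partial>cyl_measure T)"
    by (rule continuous_shift_functional[OF pair_field MW])
      (auto intro!: continuous_intros simp: norm_flux_integrand_le[unfolded norm_scaleR])
  then show ?thesis by (simp add: flux_corr_def[abs_def])
qed

lemma continuous_energy_corr: "continuous_on UNIV energy_corr"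
proof -
  have "continuous_on UNIV (\<lambda>l. \<integral>z. (\<lambda>z a a'. - (1/4) * (snd a')\<^sup>2 * ((fst a' - fst a) \<bullet> space_gradient \<psi> z)
      - (1/2) * (snd a * snd a') * \<psi>D z) z (v z, \<theta> z) (v (shift l z), \<theta> (shift l z)) \<partial>cyl_measure T)"
    by (rule continuous_shift_functional[OF pair_field MW])
      (use energy_integrand_le in \<open>auto intro!: continuous_intros\<close>)
  then show ?thesis by (simp add: energy_corr_def[abs_def])
qed

lemma energy_corr_0: "energy_corr 0 = - (1/2) * (\<integral>z. (\<theta> z)\<^sup>2 * \<psi>D z \<partial>cyl_measure T)"
  by (simp add: energy_corr_def power2_eq_square flip: Bochner_Integration.integral_mult_right_zero)

end

section \<open>Surface measure on the sphere and integration in polar coordinates\<close>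

section \<open>Polar coordinates\<close>

abbreviation sphere_borel :: "space measure" where
  "sphere_borel \<equiv> restrict_space borel (sphere 0 1)"

abbreviation punctured_ball :: "space measure" where
  "punctured_ball \<equiv> restrict_space lborel (ball 0 1 - {0})"

lemma punctured_ball_borel [measurable]: "ball 0 1 - {0} \<in> sets (borel :: space measure)" by measurable

lemma space_punctured_ball: "space punctured_ball = ball 0 1 - {0}" by (simp add: space_restrict_space)

lemma sgn_measurable [measurable]: "sgn \<in> punctured_ball \<rightarrow>\<^sub>M sphere_borel"
proof (rule measurable_restrict_space2)
  show "sgn \<in> space punctured_ball \<rightarrow> sphere 0 1" by (auto simp: space_restrict_space norm_sgn)
  have "(sgn :: space \<Rightarrow> space) \<in> borel_measurable borel" unfolding sgn_div_norm[abs_def] by measurable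
  then show "sgn \<in> borel_measurable punctured_ball" by (intro measurable_restrict_space1) simp
qed

lemma norm_measurable_ball [measurable]: "norm \<in> punctured_ball \<rightarrow>\<^sub>M borel"
  by (intro measurable_restrict_space1) simp

lemma space_surface_measure: "space surface_measure = sphere 0 1"
  by (simp add: surface_measure_def space_scale_measure space_restrict_space)

lemma sets_surface_measure [measurable_cong]: "sets surface_measure = sets sphere_borel"
  by (simp add: surface_measure_def)

lemma emeasure_surface_measure:
  "B \<in> sets sphere_borel \<Longrightarrow> emeasure surface_measure B = 3 * emeasure punctured_ball (sgn -` B \<inter> (ball 0 1 - {0}))"
  by (simp add: surface_measure_def emeasure_distr space_punctured_ball)

lemma finite_punctured_ball: "emeasure punctured_ball A < \<infinity>"
proof -
  have "emeasure punctured_ball A \<le> emeasure punctured_ball (space punctured_ball)"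
    by (rule emeasure_space)
  also have "\<dots> = emeasure lborel (ball 0 1 - {0} :: space set)"
    unfolding space_punctured_ball by (subst emeasure_restrict_space) auto
  also have "\<dots> \<le> emeasure lborel (ball 0 1 :: space set)" by (intro emeasure_mono) auto
  also have "\<dots> < \<infinity>" by (rule emeasure_lborel_ball_finite)
  finally show ?thesis .
qed

lemma finite_surface_measure: "finite_measure surface_measure"
proof
  have "emeasure surface_measure (sphere 0 1) = 3 * emeasure punctured_ball (sgn -` sphere 0 1 \<inter> (ball 0 1 - {0}))"
    by (rule emeasure_surface_measure) (auto simp: sets_restrict_space_iff)
  also have "\<dots> \<noteq> \<infinity>" using finite_punctured_ball by (auto simp: ennreal_mult_eq_top_iff less_top[symmetric])
  finally show "emeasure surface_measure (space surface_measure) \<noteq> \<infinity>" by (simp add: space_surface_measure)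
qed

interpretation surf: finite_measure surface_measure by (rule finite_surface_measure)

lemma emeasure_lborel_scale:
  fixes A :: "space set"
  assumes [measurable]: "A \<in> sets borel" and a: "a > 0"
  shows "emeasure lborel A = ennreal (a ^ 3) * emeasure lborel ((\<lambda>x. a *\<^sub>R x) -` A)"
proof -
  have "emeasure lborel A = emeasure (density (distr lborel borel (\<lambda>x. 0 + a *\<^sub>R x)) (\<lambda>_. ennreal (\<bar>a\<bar> ^ DIM(space)))) A"
    using lborel_affine[of a "0::space"] a by simp
  also have "\<dots> = ennreal (a ^ 3) * emeasure (distr lborel borel (\<lambda>x. a *\<^sub>R x)) A"
    using a by (subst emeasure_density) (auto simp: nn_integral_cmult)
  also have "emeasure (distr lborel borel (\<lambda>x. a *\<^sub>R x)) A = emeasure lborel ((\<lambda>x. a *\<^sub>R x) -` A)"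
    by (subst emeasure_distr) auto
  finally show ?thesis .
qed

lemma sgn_borel [measurable]: "(sgn :: space \<Rightarrow> space) \<in> borel_measurable borel"
  unfolding sgn_div_norm[abs_def] by measurable

text \<open>The radial part r^2 dr of Lebesgue measure in the unit ball, of total mass 1/3.\<close>

definition radial_measure :: "real measure" where
  "radial_measure = density lborel (\<lambda>r. ennreal (indicator {0<..<1} r * r\<^sup>2))"

lemma sets_radial_measure [measurable_cong, simp]: "sets radial_measure = sets borel"
  and space_radial_measure [simp]: "space radial_measure = UNIV"
  by (simp_all add: radial_measure_def)

lemma emeasure_radial_measure_lessThan:
  "emeasure radial_measure {..<x} = ennreal ((max 0 (min x 1)) ^ 3 / 3)"
proof -
  let ?b = "max 0 (min x 1)"
  have "emeasure radial_measure {..<x} = (\<integral>\<^sup>+r. ennreal (indicator {0<..<1} r * r\<^sup>2) * indicator {..<x} r \<partial>lborel)"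
    by (simp add: radial_measure_def emeasure_density)
  also have "\<dots> = (\<integral>\<^sup>+r. ennreal (r\<^sup>2) * indicator {0..?b} r \<partial>lborel)"
  proof (rule nn_integral_cong_AE)
    have "AE r in lborel. r \<noteq> (1::real)" "AE r in lborel. r \<noteq> x" "AE r in lborel. r \<noteq> 0" by (rule AE_lborel_singleton)+
    then show "AE r in lborel. ennreal (indicator {0<..<1} r * r\<^sup>2) * indicator {..<x} r = ennreal (r\<^sup>2) * indicator {0..?b} r"
      by eventually_elim (auto split: split_indicator)
  qed
  also have "\<dots> = ennreal (?b ^ 3 / 3 - 0 ^ 3 / 3)"
    by (rule nn_integral_FTC_Icc) (auto intro!: derivative_eq_intros simp: power2_eq_square)
  finally show ?thesis by simp
qed

lemma finite_radial_measure: "finite_measure radial_measure"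
proof
  have "emeasure radial_measure (space radial_measure) = (SUP n::nat. emeasure radial_measure {..<real n})"
    by (subst SUP_emeasure_incseq) (auto simp: incseq_def UN_lessThan_UNIV intro!: arg_cong[where f = "emeasure _"] reals_Archimedean2)
  also have "\<dots> \<le> ennreal (1/3)"
  proof (rule SUP_least)
    fix n :: nat
    have "(max 0 (min (real n) 1)) ^ 3 \<le> 1" by (intro power_le_one) auto
    then show "emeasure radial_measure {..<real n} \<le> ennreal (1/3)"
      unfolding emeasure_radial_measure_lessThan by (intro ennreal_leI) simp
  qed
  finally show "emeasure radial_measure (space radial_measure) \<noteq> \<infinity>" by (auto simp: top_unique)
qed

interpretation radial: finite_measure radial_measure by (rule finite_radial_measure)

text \<open>For fixed B both sides are measures in A, so half-lines suffice. For 0 <= x <= 1 the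
  part of the cone over B closer than x to the origin has x^3 times the volume of the whole cone, by
  scaling, whereas r^2 dr gives x^3 / 3; the factor 3 in \<open>surface_measure\<close> makes up for
  this.\<close>

lemma emeasure_cone:
  assumes B: "B \<in> sets sphere_borel" and A: "A \<in> sets borel"
  shows "emeasure radial_measure A * emeasure surface_measure B
    = emeasure punctured_ball {x \<in> ball 0 1 - {0}. norm x \<in> A \<and> sgn x \<in> B}"
proof -
  have B' [measurable]: "B \<in> sets borel" "B \<subseteq> sphere 0 1"
    using B by (auto simp: sets_restrict_space_iff)
  define m where "m = emeasure punctured_ball (sgn -` B \<inter> (ball 0 1 - {0}))"
  \<comment> \<open>The distribution of the distance to the origin within the cone over B.\<close>
  define N where "N = distr (density punctured_ball (indicator (sgn -` B))) borel norm"
  have sB [measurable]: "sgn -` B \<in> sets (borel :: space measure)"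
    using measurable_sets[OF sgn_borel B'(1)] by simp
  have nb: "norm \<in> borel_measurable (borel :: space measure)" by simp
  have N: "emeasure N A = emeasure punctured_ball {x \<in> ball 0 1 - {0}. norm x \<in> A \<and> sgn x \<in> B}"
    if [measurable]: "A \<in> sets borel" for A
  proof -
    have ind: "(indicator (sgn -` B) :: space \<Rightarrow> ennreal) \<in> borel_measurable punctured_ball"
      by (intro measurable_restrict_space1) simp
    have nA: "norm -` A \<inter> (ball 0 1 - {0}) \<in> sets punctured_ball"
      using measurable_sets[OF norm_measurable_ball that] by (simp add: space_punctured_ball)
    have "emeasure N A = emeasure (density punctured_ball (indicator (sgn -` B))) (norm -` A \<inter> (ball 0 1 - {0}))"
      unfolding N_def by (subst emeasure_distr) (auto simp: space_punctured_ball)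
    also have "\<dots> = (\<integral>\<^sup>+x. indicator (sgn -` B) x * indicator (norm -` A \<inter> (ball 0 1 - {0})) x \<partial>punctured_ball)"
      by (rule emeasure_density[OF ind nA])
    also have "\<dots> = (\<integral>\<^sup>+x. indicator {x \<in> ball 0 1 - {0}. norm x \<in> A \<and> sgn x \<in> B} x \<partial>punctured_ball)"
      by (rule nn_integral_cong) (auto split: split_indicator)
    also have "\<dots> = emeasure punctured_ball {x \<in> ball 0 1 - {0}. norm x \<in> A \<and> sgn x \<in> B}"
    proof (rule nn_integral_indicator)
      have "{x \<in> ball 0 1 - {0}. norm x \<in> A \<and> sgn x \<in> B} = norm -` A \<inter> sgn -` B \<inter> (ball 0 1 - {0})" by auto
      also have "\<dots> \<in> sets punctured_ball"
        using measurable_sets[OF nb that] sB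
        by (auto simp: sets_restrict_space_iff)
      finally show "{x \<in> ball 0 1 - {0}. norm x \<in> A \<and> sgn x \<in> B} \<in> sets punctured_ball" .
    qed
    finally show ?thesis .
  qed
  have N_less: "emeasure N {..<x} = ennreal ((max 0 (min x 1)) ^ 3) * m" for x
  proof -
    define S where "S a = {x :: space. 0 < norm x \<and> norm x < a \<and> sgn x \<in> B}" for a
    have S: "S a = norm -` {0<..<a} \<inter> sgn -` B" for a by (auto simp: S_def)
    have scale: "(\<lambda>y. a *\<^sub>R y) -` S a = S 1" if "a > 0" for a
      using that by (auto simp: S_def sgn_scaleR)
    have [measurable]: "S a \<in> sets borel" for a unfolding S
      using measurable_sets[OF nb, of "{0<..<a}"] sB by auto
    have m: "m = emeasure lborel (S 1)"
      unfolding m_def by (subst emeasure_restrict_space) (auto simp: S_def intro!: arg_cong[where f = "emeasure lborel"])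
    have "emeasure N {..<x} = emeasure lborel (S (min x 1))"
      unfolding N[OF lessThan_borel] by (subst emeasure_restrict_space) (auto simp: S_def intro!: arg_cong[where f = "emeasure lborel"])
    also have "\<dots> = ennreal ((max 0 (min x 1)) ^ 3) * m"
    proof (cases "x > 0")
      case True
      then have "emeasure lborel (S (min x 1)) = ennreal ((min x 1) ^ 3) * emeasure lborel ((\<lambda>y. min x 1 *\<^sub>R y) -` S (min x 1))"
        by (intro emeasure_lborel_scale) auto
      also have "(\<lambda>y. min x 1 *\<^sub>R y) -` S (min x 1) = S 1"
        using scale[of "min x 1"] True by simp
      finally show ?thesis using True by (simp add: m max_def)
    next
      case False
      then have "S (min x 1) = {}" using order_le_less_trans[OF norm_ge_zero] by (force simp: S_def)
      then show ?thesis using False by (simp add: max_def min_def)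
    qed
    finally show ?thesis .
  qed
  have "density radial_measure (\<lambda>_. 3 * m) = N"
  proof (rule measure_eqI_generator_eq[where \<Omega> = UNIV and E = "range lessThan" and A = "\<lambda>n::nat. {..<real n}"])
    have "{..<a} \<inter> {..<b} = {..<min a b}" for a b :: real by auto
    then show "Int_stable (range (lessThan :: real \<Rightarrow> real set))" by (auto simp: Int_stable_def)
    show "sets (density radial_measure (\<lambda>_. 3 * m)) = sigma_sets UNIV (range lessThan)" "sets N = sigma_sets UNIV (range lessThan)"
      by (simp_all add: N_def borel_Iio)
    have "emeasure (density radial_measure (\<lambda>_. 3 * m)) {..<x} = emeasure N {..<x}" for x
    proof -
      have "emeasure (density radial_measure (\<lambda>_. 3 * m)) {..<x} = 3 * m * emeasure radial_measure {..<x}"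
        by (subst emeasure_density) (auto simp: nn_integral_cmult)
      also have "\<dots> = (3 * ennreal ((max 0 (min x 1)) ^ 3 / 3)) * m"
        by (simp add: emeasure_radial_measure_lessThan mult_ac)
      also have "3 * ennreal ((max 0 (min x 1)) ^ 3 / 3) = ennreal ((max 0 (min x 1)) ^ 3)"
        by (subst ennreal_numeral[symmetric], subst ennreal_mult[symmetric]) auto
      finally show ?thesis by (simp add: N_less)
    qed
    then show "emeasure (density radial_measure (\<lambda>_. 3 * m)) X = emeasure N X" if "X \<in> range lessThan" for X
      using that by auto
    show "range (\<lambda>n::nat. {..<real n}) \<subseteq> range lessThan" by auto
    show "(\<Union>n. {..<real n}) = UNIV" using reals_Archimedean2 by auto
    fix n :: nat
    have "emeasure (density radial_measure (\<lambda>_. 3 * m)) {..<real n} = 3 * m * emeasure radial_measure {..<real n}"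
      by (subst emeasure_density) (auto simp: nn_integral_cmult)
    then show "emeasure (density radial_measure (\<lambda>_. 3 * m)) {..<real n} \<noteq> \<infinity>"
      using finite_punctured_ball[of "sgn -` B \<inter> (ball 0 1 - {0})"] radial.emeasure_finite[of "{..<real n}"]
      by (auto simp: ennreal_mult_eq_top_iff m_def less_top[symmetric])
  qed auto
  then have "emeasure N A = emeasure (density radial_measure (\<lambda>_. 3 * m)) A" by simp
  also have "\<dots> = 3 * m * emeasure radial_measure A"
    using A by (subst emeasure_density) (auto simp: nn_integral_cmult)
  finally show ?thesis using N[OF A] emeasure_surface_measure[OF B] by (simp add: m_def mult.commute)
qed

text \<open>A product measure is determined by its values on rectangles, and under polar coordinates
  rectangles are pieces of cones.\<close>

lemma polar_measure:
  "radial_measure \<Otimes>\<^sub>M surface_measure = distr punctured_ball (borel \<Otimes>\<^sub>M sphere_borel) (\<lambda>x. (norm x, sgn x))"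
proof (rule pair_measure_eqI)
  show "sets (radial_measure \<Otimes>\<^sub>M surface_measure) = sets (distr punctured_ball (borel \<Otimes>\<^sub>M sphere_borel) (\<lambda>x. (norm x, sgn x)))"
    unfolding sets_distr by (intro sets_pair_measure_cong) (auto simp: sets_surface_measure)
  fix A B assume "A \<in> sets radial_measure" "B \<in> sets surface_measure"
  then have AB: "A \<in> sets borel" "B \<in> sets sphere_borel" by (auto simp: sets_surface_measure)
  have "emeasure (distr punctured_ball (borel \<Otimes>\<^sub>M sphere_borel) (\<lambda>x. (norm x, sgn x))) (A \<times> B)
     = emeasure punctured_ball ((\<lambda>x. (norm x, sgn x)) -` (A \<times> B) \<inter> (ball 0 1 - {0}))"
    using AB by (subst emeasure_distr) (auto simp: space_punctured_ball)
  also have "(\<lambda>x. (norm x, sgn x)) -` (A \<times> B) \<inter> (ball 0 1 - {0}) = {x \<in> ball 0 1 - {0}. norm x \<in> A \<and> sgn x \<in> B}"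
    by auto
  finally show "emeasure radial_measure A * emeasure surface_measure B
    = emeasure (distr punctured_ball (borel \<Otimes>\<^sub>M sphere_borel) (\<lambda>x. (norm x, sgn x))) (A \<times> B)"
    using emeasure_cone[OF AB(2,1)] by simp
qed (use radial.sigma_finite_measure_axioms surf.sigma_finite_measure_axioms in auto)

text \<open>The origin, where the direction is undefined, is a null set. Boundedness of
  \<open>f\<close> gives integrability because radial and surface measure are both finite.\<close>

lemma polar_integral:
  fixes f :: "real \<Rightarrow> space \<Rightarrow> real"
  assumes f [measurable]: "(\<lambda>p. f (fst p) (snd p)) \<in> borel_measurable (borel \<Otimes>\<^sub>M sphere_borel)"
    and K: "\<And>r w. w \<in> sphere 0 1 \<Longrightarrow> \<bar>f r w\<bar> \<le> K"
    and f': "(\<lambda>x. f (norm x) (sgn x)) \<in> borel_measurable borel"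
  shows "(\<integral>x. indicator (ball 0 1) x * f (norm x) (sgn x) \<partial>lborel)
    = (\<integral>r. indicator {0<..<1} r * r\<^sup>2 * (\<integral>w. f r w \<partial>surface_measure) \<partial>lborel)"
proof -
  interpret P: pair_sigma_finite radial_measure surface_measure ..
  have fin: "finite_measure (radial_measure \<Otimes>\<^sub>M surface_measure)"
    by (intro finite_measure_pair_measure radial.finite_measure_axioms surf.finite_measure_axioms)
  have sets: "sets (radial_measure \<Otimes>\<^sub>M surface_measure) = sets (borel \<Otimes>\<^sub>M sphere_borel)"
    by (intro sets_pair_measure_cong) (auto simp: sets_surface_measure)
  have fm: "(\<lambda>p. f (fst p) (snd p)) \<in> borel_measurable (radial_measure \<Otimes>\<^sub>M surface_measure)"
    using f by (simp add: measurable_cong_sets[OF sets refl])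
  have int: "integrable (radial_measure \<Otimes>\<^sub>M surface_measure) (\<lambda>(r, w). f r w)"
  proof (rule finite_measure.integrable_const_bound[OF fin])
    show "AE p in radial_measure \<Otimes>\<^sub>M surface_measure. norm (case p of (r, w) \<Rightarrow> f r w) \<le> K"
      using K by (intro AE_I2) (auto simp: space_pair_measure space_surface_measure)
  qed (use fm in \<open>simp add: case_prod_unfold\<close>)
  have "AE x in lborel. x \<noteq> (0::space)" by (rule AE_lborel_singleton)
  then have "(\<integral>x. indicator (ball 0 1) x * f (norm x) (sgn x) \<partial>lborel)
    = (\<integral>x. indicator (ball 0 1 - {0}) x *\<^sub>R f (norm x) (sgn x) \<partial>lborel)"
    using f' by (intro Bochner_Integration.integral_cong_AE)
      (auto elim!: eventually_mono intro!: borel_measurable_times borel_measurable_indicator split: split_indicator)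
  also have "\<dots> = (\<integral>x. f (norm x) (sgn x) \<partial>punctured_ball)"
    by (rule integral_restrict_space[symmetric]) simp
  also have "\<dots> = (\<integral>p. f (fst p) (snd p) \<partial>distr punctured_ball (borel \<Otimes>\<^sub>M sphere_borel) (\<lambda>x. (norm x, sgn x)))"
    by (subst integral_distr) auto
  also have "\<dots> = (\<integral>p. f (fst p) (snd p) \<partial>(radial_measure \<Otimes>\<^sub>M surface_measure))"
    by (simp add: polar_measure)
  also have "\<dots> = (\<integral>r. \<integral>w. f r w \<partial>surface_measure \<partial>radial_measure)"
    using P.integral_fst[OF int] by (simp add: case_prod_unfold)
  also have "\<dots> = (\<integral>r. (indicator {0<..<1} r * r\<^sup>2) *\<^sub>R (\<integral>w. f r w \<partial>surface_measure) \<partial>lborel)"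
  proof -
    have "(\<lambda>r. \<integral>w. f r w \<partial>surface_measure) \<in> borel_measurable radial_measure"
      using fm by (intro surf.borel_measurable_lebesgue_integral) (simp add: case_prod_unfold)
    then show ?thesis
      unfolding radial_measure_def by (subst integral_density) auto
  qed
  finally show ?thesis by (simp add: mult.assoc)
qed

section \<open>Averages of continuous functions, and radial kernels concentrating on a
  sphere\<close>

section \<open>Averages over small balls and spheres\<close>

lemma integral_cell_eq_lborel:
  fixes f :: "space \<Rightarrow> real"
  assumes [measurable]: "f \<in> borel_measurable borel"
  shows "(\<integral>x. f x \<partial>cell_measure) = (\<integral>x. indicator torus_cell x * f x \<partial>lborel)"
proof -
  have eq: "cell_measure = density lborel (\<lambda>x. ennreal (indicator torus_cell x))"
    unfolding cell_measure_def by (rule arg_cong[where f = "density lborel"]) (auto split: split_indicator)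
  show ?thesis unfolding eq by (subst integral_density) auto
qed

lemma continuous_bounded_on_ball:
  fixes F :: "space \<Rightarrow> 'b::real_normed_vector"
  assumes "continuous_on UNIV F"
  shows "\<exists>K. \<forall>x\<in>cball 0 1. norm (F x) \<le> K"
proof -
  have "bounded (F ` cball 0 1)"
    by (intro compact_imp_bounded compact_continuous_image continuous_on_subset[OF assms]) auto
  then show ?thesis by (auto simp: bounded_iff)
qed

text \<open>Stated for an abstract family of probability densities supported in shrinking balls, so
  that it serves the mollifier and the normalised indicator of a ball alike.\<close>

lemma integral_average_tendsto:
  fixes H :: "space \<Rightarrow> real" and \<phi> :: "real \<Rightarrow> space \<Rightarrow> real"
  assumes H: "continuous_on UNIV H"
    and meas: "\<And>e. 0 < e \<Longrightarrow> \<phi> e \<in> borel_measurable borel" and nn: "\<And>e x. 0 < e \<Longrightarrow> 0 \<le> \<phi> e x"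
    and int: "\<And>e. 0 < e \<Longrightarrow> integrable lborel (\<phi> e)" and one: "\<And>e. 0 < e \<Longrightarrow> (\<integral>x. \<phi> e x \<partial>lborel) = 1"
    and supp: "\<And>e x. 0 < e \<Longrightarrow> e \<le> norm x \<Longrightarrow> \<phi> e x = 0"
  shows "((\<lambda>e. \<integral>x. \<phi> e x * H x \<partial>lborel) \<longlongrightarrow> H 0) (at_right 0)"
proof (rule tendstoI)
  fix \<epsilon> :: real assume "\<epsilon> > 0"
  have [measurable]: "H \<in> borel_measurable borel" using H by (rule borel_measurable_continuous_onI)
  have "isCont H 0" using H by (simp add: continuous_on_eq_continuous_at)
  then obtain d where d: "d > 0" "\<And>x. norm x < d \<Longrightarrow> \<bar>H x - H 0\<bar> < \<epsilon> / 2"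
    using \<open>\<epsilon> > 0\<close> unfolding continuous_at_eps_delta dist_norm by (metis diff_zero half_gt_zero real_norm_def)
  have "dist (\<integral>x. \<phi> e x * H x \<partial>lborel) (H 0) < \<epsilon>" if e: "0 < e" "e < d" for e
  proof -
    have [measurable]: "\<phi> e \<in> borel_measurable borel" by (rule meas[OF e(1)])
    have le: "\<bar>\<phi> e x * (H x - H 0)\<bar> \<le> (\<epsilon> / 2) * \<phi> e x" for x
    proof (cases "norm x < e")
      case True
      then have "\<bar>H x - H 0\<bar> \<le> \<epsilon> / 2" using d(2)[of x] e by simp
      from mult_left_mono[OF this nn[OF e(1), of x]] show ?thesis
        using nn[OF e(1), of x] by (simp add: abs_mult mult.commute)
    qed (use supp[OF e(1), of x] in auto)
    have i: "integrable lborel (\<lambda>x. \<phi> e x * (H x - H 0))"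
      by (rule Bochner_Integration.integrable_bound[of _ "\<lambda>x. (\<epsilon> / 2) * \<phi> e x"])
        (use int[OF e(1)] le in \<open>auto intro: order_trans[OF _ abs_ge_self]\<close>)
    have "(\<integral>x. \<phi> e x * H x \<partial>lborel) = (\<integral>x. \<phi> e x * (H x - H 0) + H 0 * \<phi> e x \<partial>lborel)"
      by (simp add: algebra_simps)
    also have "\<dots> = (\<integral>x. \<phi> e x * (H x - H 0) \<partial>lborel) + H 0"
      using i int[OF e(1)] one[OF e(1)] by simp
    finally have "\<bar>(\<integral>x. \<phi> e x * H x \<partial>lborel) - H 0\<bar> = \<bar>\<integral>x. \<phi> e x * (H x - H 0) \<partial>lborel\<bar>" by simp
    also have "\<dots> \<le> (\<integral>x. \<bar>\<phi> e x * (H x - H 0)\<bar> \<partial>lborel)" by (rule integral_abs_bound)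
    also have "\<dots> \<le> (\<integral>x. (\<epsilon> / 2) * \<phi> e x \<partial>lborel)"
      using i int[OF e(1)] le by (intro integral_mono) auto
    also have "\<dots> = \<epsilon> / 2" using one[OF e(1)] by simp
    finally show ?thesis using \<open>\<epsilon> > 0\<close> by (simp add: dist_real_def)
  qed
  then show "\<forall>\<^sub>F e in at_right 0. dist (\<integral>x. \<phi> e x * H x \<partial>lborel) (H 0) < \<epsilon>"
    unfolding eventually_at_right_field using d(1) by blast
qed

lemma integral_lborel_scale:
  fixes f :: "space \<Rightarrow> real"
  assumes [measurable]: "f \<in> borel_measurable borel" and a: "a > 0"
  shows "(\<integral>x. f x \<partial>lborel) = a ^ 3 * (\<integral>x. f (a *\<^sub>R x) \<partial>lborel)"
    and "integrable lborel f \<Longrightarrow> integrable lborel (\<lambda>x. f (a *\<^sub>R x))"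
proof -
  have eq: "(lborel :: space measure) = density (distr lborel borel (\<lambda>x. a *\<^sub>R x)) (\<lambda>_. ennreal (a ^ 3))"
    using lborel_affine[of a "0::space"] a by simp
  have "(\<integral>x. f x \<partial>lborel) = (\<integral>x. f x \<partial>density (distr lborel borel (\<lambda>x. a *\<^sub>R x)) (\<lambda>_. ennreal (a ^ 3)))"
    using eq by simp
  also have "\<dots> = a ^ 3 * (\<integral>x. f (a *\<^sub>R x) \<partial>lborel)"
    using a by (simp add: integral_density integral_distr)
  finally show "(\<integral>x. f x \<partial>lborel) = a ^ 3 * (\<integral>x. f (a *\<^sub>R x) \<partial>lborel)" .
  assume "integrable lborel f"
  then have "integrable (density (distr lborel borel (\<lambda>x. a *\<^sub>R x)) (\<lambda>_. ennreal (a ^ 3))) f"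
    using eq by simp
  then have "integrable lborel (\<lambda>x. a ^ 3 * f (a *\<^sub>R x))"
    using a by (simp add: integrable_density integrable_distr_eq)
  from Bochner_Integration.integrable_mult_right[OF this, of "1 / a ^ 3"]
  show "integrable lborel (\<lambda>x. f (a *\<^sub>R x))" using a by simp
qed

lemma bump_eq: "bump x = bump_on 1 1 x"
  by (auto simp: bump_def bump_on_def flat_def abs_square_less_1 power_strict_mono)

text \<open>The scaling is absorbed into the steepness: 1 - |x/e|^2 = (e^2 - |x|^2) / e^2.\<close>

lemma mollifier_eps_eq:
  assumes "e > 0" shows "mollifier_eps e = (\<lambda>x. (C0 / e ^ 3) * bump_on (1 / e\<^sup>2) e x)"
  using assms
  by (intro ext) (simp add: mollifier_eps_def mollifier_def bump_eq bump_on_def right_diff_distrib power_mult_distrib power_divide field_simps)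

lemma gradient_mollifier_eps:
  assumes "e > 0" shows "gradient (mollifier_eps e) l = (C0 / e ^ 3) *\<^sub>R bump_grad (1 / e\<^sup>2) e l"
  unfolding mollifier_eps_eq[OF assms]
  by (rule gradient_unique) (use has_derivative_mult_right[OF bump_on_has_derivative, of "C0 / e ^ 3"] in simp)

lemma bump_on_integrable: "c > 0 \<Longrightarrow> r > 0 \<Longrightarrow> integrable lborel (bump_on c r)"
proof (rule Bochner_Integration.integrable_bound)
  assume "c > 0" "r > 0"
  then show "AE x in lborel. norm (bump_on c r x) \<le> norm (indicator (ball 0 r) x :: real)"
    using abs_bump_on_le[of c r] bump_on_eq_0[of c r] by (intro AE_I2) (auto split: split_indicator)
  show "integrable lborel (indicator (ball 0 r) :: space \<Rightarrow> real)"
    by (intro integrable_real_indicator emeasure_lborel_ball_finite) simp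
qed measurable

lemma bump_on_nonneg: "0 \<le> bump_on c r x" by (simp add: bump_on_def flat_nonneg)

text \<open>Positivity makes \<open>C0\<close> a genuine normalising constant rather than a division
  by 0.\<close>

lemma integral_bump_pos: "0 < (\<integral>x. bump x \<partial>lborel)"
proof -
  have int: "integrable lborel bump" using bump_on_integrable[of 1 1] by (simp add: bump_eq[abs_def])
  have bnn: "0 \<le> bump x" for x by (simp add: bump_def)
  have "(\<integral>x. bump x \<partial>lborel) \<noteq> 0"
  proof
    assume "(\<integral>x. bump x \<partial>lborel) = 0"
    then have "AE x in lborel. bump x = 0"
      using integral_nonneg_eq_0_iff_AE[OF int] bnn by simp
    then have "AE x in lborel. x \<notin> ball (0::space) 1" by (rule eventually_mono) (auto simp: bump_def)
    then have "ball (0::space) 1 \<in> null_sets lborel" by (subst AE_iff_null_sets) auto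
    then have "emeasure lborel (ball (0::space) 1) = 0" by blast
    then have "measure lborel (ball (0::space) 1) = 0" by (simp add: measure_def)
    then show False using content_ball_pos[of 1 "0::space"] by simp
  qed
  moreover have "0 \<le> (\<integral>x. bump x \<partial>lborel)" by (intro integral_nonneg_AE) (auto simp: bump_def)
  ultimately show ?thesis by simp
qed

lemma integral_mollifier_eps:
  assumes e: "e > 0" shows "(\<integral>x. mollifier_eps e x \<partial>lborel) = 1"
proof -
  have b [measurable]: "bump \<in> borel_measurable borel" unfolding bump_eq[abs_def] by measurable
  have "(\<integral>x. mollifier_eps e x \<partial>lborel) = e ^ 3 * (\<integral>x. mollifier_eps e (e *\<^sub>R x) \<partial>lborel)"
    by (rule integral_lborel_scale[OF _ e]) (simp add: mollifier_eps_eq[OF e])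
  also have "\<dots> = C0 * (\<integral>x. bump x \<partial>lborel)" using e by (simp add: mollifier_eps_def mollifier_def)
  also have "\<dots> = 1" using integral_bump_pos by (simp add: C0_def)
  finally show ?thesis .
qed

lemma mollifier_average:
  fixes H :: "space \<Rightarrow> real"
  assumes "continuous_on UNIV H"
  shows "((\<lambda>e. \<integral>x. mollifier_eps e x * H x \<partial>lborel) \<longlongrightarrow> H 0) (at_right 0)"
proof (rule integral_average_tendsto[OF assms])
  fix e :: real assume e: "0 < e"
  have C0: "0 \<le> C0" using integral_bump_pos by (simp add: C0_def)
  show "mollifier_eps e \<in> borel_measurable borel" "integrable lborel (mollifier_eps e)"
    using bump_on_integrable[of "1 / e\<^sup>2" e] e by (simp_all add: mollifier_eps_eq)
  show "(\<integral>x. mollifier_eps e x \<partial>lborel) = 1" by (rule integral_mollifier_eps[OF e])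
  fix x
  show "0 \<le> mollifier_eps e x" using e C0 bump_on_nonneg by (simp add: mollifier_eps_eq)
  show "e \<le> norm x \<Longrightarrow> mollifier_eps e x = 0" using e by (simp add: mollifier_eps_eq bump_on_eq_0)
qed

lemma ball_average:
  fixes H :: "space \<Rightarrow> real"
  assumes "continuous_on UNIV H"
  shows "((\<lambda>e. (\<integral>x. indicator (ball 0 e) x * H x \<partial>lborel) / (4/3 * pi * e ^ 3)) \<longlongrightarrow> H 0) (at_right 0)"
proof -
  have vol: "measure lborel (ball (0::space) e) = 4/3 * pi * e ^ 3" if "0 < e" for e
    using content_ball[of e "0::space"] that by (simp add: unit_ball_vol_3)
  have "((\<lambda>e. \<integral>x. (indicator (ball 0 e) x / (4/3 * pi * e ^ 3)) * H x \<partial>lborel) \<longlongrightarrow> H 0) (at_right 0)"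
  proof (rule integral_average_tendsto[OF assms])
    fix e :: real assume e: "0 < e"
    show "(\<lambda>x::space. indicator (ball 0 e) x / (4/3 * pi * e ^ 3) :: real) \<in> borel_measurable borel"
      by (intro borel_measurable_divide borel_measurable_indicator borel_measurable_const) simp
    show i: "integrable lborel (\<lambda>x::space. indicator (ball 0 e) x / (4/3 * pi * e ^ 3) :: real)"
      by (intro Bochner_Integration.integrable_divide integrable_real_indicator emeasure_lborel_ball_finite) simp
    show "(\<integral>x. indicator (ball (0::space) e) x / (4/3 * pi * e ^ 3) \<partial>lborel) = (1::real)"
      using vol[OF e] e pi_gt_zero by simp
  qed (auto simp: pi_ge_zero)
  then show ?thesis by (simp only: times_divide_eq_left Bochner_Integration.integral_divide_zero)
qed

lemma flat_scaled_tendsto: "(\<lambda>k. flat (real k * s)) \<longlonglongrightarrow> (if s > 0 then 1 else 0)"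
proof (cases "s > 0")
  case True
  have "(\<lambda>k. exp (- ((1 / s) * (1 / real k)))) \<longlonglongrightarrow> exp (- ((1 / s) * 0))"
    by (intro tendsto_intros lim_1_over_n)
  moreover have "\<forall>\<^sub>F k in sequentially. exp (- ((1 / s) * (1 / real k))) = flat (real k * s)"
    using eventually_gt_at_top[of 0] by eventually_elim (use True in \<open>simp add: flat_def\<close>)
  ultimately show ?thesis using True by (simp add: tendsto_cong)
next
  case False
  then show ?thesis by (simp add: flat_def zero_less_mult_iff)
qed

text \<open>Minus the radial derivative of \<open>bump_on c r\<close>. Its mass on an interval [0,a]
  is explicit by the fundamental theorem of calculus, and for large c it concentrates at s =
  r.\<close>

definition radial_kernel :: "real \<Rightarrow> real \<Rightarrow> real \<Rightarrow> real" where
  "radial_kernel c r s = 2 * c * s * flat' (c * (r\<^sup>2 - s\<^sup>2))"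

lemma radial_kernel_borel [measurable]: "radial_kernel c r \<in> borel_measurable borel"
  unfolding radial_kernel_def[abs_def] by measurable

lemma radial_kernel_integral:
  assumes "c > 0" "0 \<le> a"
  shows "has_bochner_integral lborel (\<lambda>s. radial_kernel c r s * indicator {0..a} s) (flat (c * r\<^sup>2) - flat (c * (r\<^sup>2 - a\<^sup>2)))"
proof -
  have d: "((\<lambda>s. - flat (c * (r\<^sup>2 - s\<^sup>2))) has_real_derivative radial_kernel c r s) (at s)" for s
  proof -
    have "((\<lambda>s. c * (r\<^sup>2 - s\<^sup>2)) has_real_derivative - 2 * c * s) (at s)"
      by (auto intro!: derivative_eq_intros)
    from DERIV_minus[OF DERIV_chain2[OF flat_deriv this]]
    show ?thesis by (rule DERIV_cong) (simp add: radial_kernel_def)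
  qed
  have "has_bochner_integral lborel (\<lambda>s. radial_kernel c r s * indicator {0..a} s)
    (- flat (c * (r\<^sup>2 - a\<^sup>2)) - - flat (c * (r\<^sup>2 - 0\<^sup>2)))"
    by (rule has_bochner_integral_FTC_Icc_nonneg)
      (use assms d flat'_nonneg in \<open>auto simp: radial_kernel_def intro: has_field_derivative_at_within\<close>)
  then show ?thesis by simp
qed

text \<open>As the steepness grows, the total mass tends to 1, the mass on [0, r - d] tends to 0 and
  nothing lies beyond r: an approximate identity at r, approached from the left.\<close>

lemma radial_kernel_tendsto:
  fixes \<phi> :: "real \<Rightarrow> real"
  assumes [measurable]: "\<phi> \<in> borel_measurable borel" and r: "0 < r" "r < 1" and \<phi>: "isCont \<phi> r"
    and K: "\<And>s. \<bar>\<phi> s\<bar> \<le> K"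
  shows "(\<lambda>k. \<integral>s. radial_kernel (real (Suc k)) r s * indicator {0..1} s * \<phi> s \<partial>lborel) \<longlonglongrightarrow> \<phi> r"
proof (rule LIM_zero_cancel, rule LIMSEQ_I)
  fix e :: real assume e: "e > 0"
  have K0: "0 \<le> K" using order_trans[OF abs_ge_zero K] .
  obtain d0 where d0: "d0 > 0" "\<And>s. \<bar>s - r\<bar> < d0 \<Longrightarrow> \<bar>\<phi> s - \<phi> r\<bar> < e / 3"
    using \<phi> e unfolding continuous_at_eps_delta dist_real_def by (metis zero_less_divide_iff zero_less_numeral)
  \<comment> \<open>Half of the minimum keeps r - d positive and puts the gap between r - d and r
    inside the neighbourhood given by continuity.\<close>
  define d where "d = min d0 r / 2"
  have d: "0 < d" "d < r" "d < d0" using d0 r by (auto simp: d_def)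
  let ?c = "\<lambda>k. real (Suc k)"
  let ?m = "\<lambda>k. flat (?c k * r\<^sup>2)"
  let ?q = "\<lambda>k. flat (?c k * (r\<^sup>2 - (r - d)\<^sup>2))"
  have pos: "0 < r\<^sup>2" "0 < r\<^sup>2 - (r - d)\<^sup>2" using r d power_strict_mono[of "r - d" r 2] by auto
  have mlim: "?m \<longlonglongrightarrow> 1" using LIMSEQ_Suc[OF flat_scaled_tendsto[of "r\<^sup>2"]] pos by simp
  have qlim: "?q \<longlonglongrightarrow> 1" using LIMSEQ_Suc[OF flat_scaled_tendsto[of "r\<^sup>2 - (r - d)\<^sup>2"]] pos by simp
  \<comment> \<open>Two sources of error: the mass far below r, where the values of
    \<open>\<phi>\<close> may differ by 2 K from the one at r, and the mass missing to 1.\<close>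
  have "(\<lambda>k. 2 * K * (?m k - ?q k) + K * (1 - ?m k)) \<longlonglongrightarrow> 2 * K * (1 - 1) + K * (1 - 1)"
    by (intro tendsto_intros mlim qlim)
  then have "(\<lambda>k. 2 * K * (?m k - ?q k) + K * (1 - ?m k)) \<longlonglongrightarrow> 0" by simp
  from LIMSEQ_D[OF this, of "e/3"] e obtain N where N: "\<And>k. k \<ge> N \<Longrightarrow> \<bar>2 * K * (?m k - ?q k) + K * (1 - ?m k)\<bar> < e / 3"
    by auto
  show "\<exists>N. \<forall>k\<ge>N. norm ((\<integral>s. radial_kernel (?c k) r s * indicator {0..1} s * \<phi> s \<partial>lborel) - \<phi> r - 0) < e"
  proof (intro exI allI impI)
    fix k assume "N \<le> k"
    let ?k = "\<lambda>s. radial_kernel (?c k) r s * indicator {0..1} s"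
    let ?j = "\<lambda>s. radial_kernel (?c k) r s * indicator {0..r - d} s"
    have knn: "0 \<le> ?k s" for s using flat'_nonneg by (auto simp: radial_kernel_def split: split_indicator)
    have jnn: "0 \<le> ?j s" for s using flat'_nonneg by (auto simp: radial_kernel_def split: split_indicator)
    have "flat (?c k * (r\<^sup>2 - 1\<^sup>2)) = 0"
    proof -
      have "r\<^sup>2 - 1\<^sup>2 \<le> 0" using r by (simp add: power_le_one)
      then show ?thesis by (simp add: flat_def zero_less_mult_iff)
    qed
    then have km: "has_bochner_integral lborel ?k (?m k)" using radial_kernel_integral[of "?c k" 1 r] by simp
    have jm: "has_bochner_integral lborel ?j (?m k - ?q k)" using radial_kernel_integral[of "?c k" "r - d" r] d by simp
    have kint: "integrable lborel ?k" "integral\<^sup>L lborel ?k = ?m k" using km has_bochner_integral_iff by blast+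
    have jint: "integrable lborel ?j" "integral\<^sup>L lborel ?j = ?m k - ?q k" using jm has_bochner_integral_iff by blast+
    have le: "\<bar>?k s * (\<phi> s - \<phi> r)\<bar> \<le> (e / 3) * ?k s + 2 * K * ?j s" for s
    proof (cases "s \<in> {0..1}")
      case True
      consider "s \<le> r - d" | "\<bar>s - r\<bar> < d0" | "s \<ge> r" using d by linarith
      then show ?thesis
      proof cases
        case 1
        have "\<bar>\<phi> s - \<phi> r\<bar> \<le> 2 * K" using K[of s] K[of r] by linarith
        from mult_left_mono[OF this knn[of s]] have "\<bar>?k s * (\<phi> s - \<phi> r)\<bar> \<le> ?k s * (2 * K)"
          unfolding abs_mult[of "?k s"] abs_of_nonneg[OF knn[of s]] .
        moreover have "?j s = ?k s" using 1 True by auto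
        moreover have "0 \<le> (e / 3) * ?k s" by (rule mult_nonneg_nonneg[OF _ knn]) (use e in simp)
        ultimately show ?thesis by (simp only: mult.commute[of _ "2 * K"])
      next
        case 2
        have "\<bar>?k s * (\<phi> s - \<phi> r)\<bar> \<le> ?k s * (e / 3)"
          unfolding abs_mult[of "?k s"] abs_of_nonneg[OF knn[of s]]
          by (rule mult_left_mono[OF less_imp_le[OF d0(2)[OF 2]] knn[of s]])
        moreover have "0 \<le> 2 * K * ?j s" by (rule mult_nonneg_nonneg[OF _ jnn]) (use K0 in simp)
        ultimately show ?thesis by (simp only: mult.commute[of _ "e / 3"])
      next
        case 3
        have "?c k * (r\<^sup>2 - s\<^sup>2) \<le> 0" using 3 r by (intro mult_nonneg_nonpos) (auto simp: power_mono)
        then have "radial_kernel (?c k) r s = 0" by (simp add: radial_kernel_def flat'_def del: of_nat_Suc)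
        then show ?thesis by (simp del: of_nat_Suc)
      qed
    next
      case False
      then show ?thesis using jnn[of s] K0 by simp
    qed
    have i: "integrable lborel (\<lambda>s. ?k s * (\<phi> s - \<phi> r))"
      by (rule Bochner_Integration.integrable_bound[of _ "\<lambda>s. (e / 3) * ?k s + 2 * K * ?j s"])
        (use kint jint le in \<open>auto intro: order_trans[OF _ abs_ge_self]\<close>)
    have "(\<integral>s. ?k s * \<phi> s \<partial>lborel) = (\<integral>s. ?k s * (\<phi> s - \<phi> r) + \<phi> r * ?k s \<partial>lborel)"
      by (intro Bochner_Integration.integral_cong) (auto simp: algebra_simps)
    also have "\<dots> = (\<integral>s. ?k s * (\<phi> s - \<phi> r) \<partial>lborel) + \<phi> r * ?m k"
      using i kint by simp
    finally have 1: "(\<integral>s. ?k s * \<phi> s \<partial>lborel) - \<phi> r = (\<integral>s. ?k s * (\<phi> s - \<phi> r) \<partial>lborel) - \<phi> r * (1 - ?m k)"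
      by (simp add: algebra_simps)
    have "\<bar>\<integral>s. ?k s * (\<phi> s - \<phi> r) \<partial>lborel\<bar> \<le> (\<integral>s. \<bar>?k s * (\<phi> s - \<phi> r)\<bar> \<partial>lborel)" by (rule integral_abs_bound)
    also have "\<dots> \<le> (\<integral>s. (e / 3) * ?k s + 2 * K * ?j s \<partial>lborel)"
      using i kint jint le by (intro integral_mono) auto
    also have "\<dots> = (e / 3) * ?m k + 2 * K * (?m k - ?q k)" using kint jint by simp
    finally have 2: "\<bar>\<integral>s. ?k s * (\<phi> s - \<phi> r) \<partial>lborel\<bar> \<le> (e / 3) * ?m k + 2 * K * (?m k - ?q k)" .
    have 3: "\<bar>\<phi> r * (1 - ?m k)\<bar> \<le> K * (1 - ?m k)"
      using K[of r] flat_le_1[of "?c k * r\<^sup>2"] by (simp add: abs_mult mult_right_mono)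
    have 4: "(e / 3) * ?m k \<le> e / 3" using flat_le_1[of "?c k * r\<^sup>2"] e by simp
    show "norm ((\<integral>s. ?k s * \<phi> s \<partial>lborel) - \<phi> r - 0) < e"
      using 1 2 3 4 N[OF \<open>N \<le> k\<close>] e unfolding real_norm_def by linarith
  qed
qed

lemma (in flow) flow_testI:
  "\<psi> \<in> test_functions T \<Longrightarrow> 0 < c \<Longrightarrow> 0 < r \<Longrightarrow> r < 1/2 \<Longrightarrow> flow_test T v \<theta> W \<psi> c r"
  by unfold_locales auto

lemma (in flow) increment_dom:
  "norm (((\<theta> (shift l z) - \<theta> z)\<^sup>2) *\<^sub>R (v (shift l z) - v z)) \<le> 1 * W z + 1 * W (shift l z)"
proof -
  have "\<bar>norm (v (shift l z) - v z)\<bar> \<le> 1 * (1 + norm (v z) + norm (v (shift l z)))"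
    using norm_triangle_ineq4[of "v (shift l z)" "v z"] by simp
  from dom_mult[OF this sq_dom(8)] show ?thesis by (simp add: mult.commute)
qed

locale flow_psi = flow +
  fixes \<psi> :: "spacetime \<Rightarrow> real"
  assumes psi: "\<psi> \<in> test_functions T"

text \<open>The values 1 and 1/4 are one admissible choice. The functions \<open>flux_corr\<close>
  and \<open>energy_corr\<close> do not involve the kernel, so identities for other c and r speak of
  the same functions.\<close>

sublocale flow_psi \<subseteq> flow_test T v \<theta> W \<psi> 1 "1/4"
  by (rule flow_testI[OF psi]) auto

context flow_psi
begin

lemma flux_corr_borel [measurable]: "flux_corr \<in> borel_measurable borel"
  and energy_corr_borel [measurable]: "energy_corr \<in> borel_measurable borel"
  by (auto intro: borel_measurable_continuous_onI continuous_flux_corr continuous_energy_corr)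

text \<open>For r < 1/2 the bump is supported in the cell, where it equals its periodisation; the
  identity thus passes from the torus to integrals over the whole space.\<close>

lemma bump_identity:
  assumes cr: "0 < c" "0 < r" "r < 1/2"
  shows "(\<integral>l. bump_grad c r l \<bullet> flux_corr l \<partial>lborel) = - 4 * (\<integral>l. bump_on c r l * energy_corr l \<partial>lborel)"
proof -
  have *: "l \<in> torus_cell" if "norm l < r" for l
    using that cr Basis_le_norm[of _ l] by (force simp: mem_torus_cell)
  have "(\<integral>l. bump_grad c r l \<bullet> flux_corr l \<partial>lborel) = (\<integral>l. indicator torus_cell l * (pbump_grad c r l \<bullet> flux_corr l) \<partial>lborel)"
    using * bump_grad_eq_0[OF cr(1,2)] pbump_cell(2)[OF cr]
    by (intro Bochner_Integration.integral_cong) (auto split: split_indicator simp: not_less, metis inner_zero_left not_less)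
  also have "\<dots> = (\<integral>l. pbump_grad c r l \<bullet> flux_corr l \<partial>cell_measure)"
    by (rule integral_cell_eq_lborel[symmetric]) measurable
  also have "\<dots> = - 4 * (\<integral>l. pbump c r l * energy_corr l \<partial>cell_measure)"
    by (rule flow_test.flux_energy_identity[OF flow_testI[OF psi cr]])
  also have "(\<integral>l. pbump c r l * energy_corr l \<partial>cell_measure) = (\<integral>l. indicator torus_cell l * (pbump c r l * energy_corr l) \<partial>lborel)"
    by (rule integral_cell_eq_lborel) measurable
  also have "\<dots> = (\<integral>l. bump_on c r l * energy_corr l \<partial>lborel)"
    using * bump_on_eq_0[OF cr(1,2)] pbump_cell(1)[OF cr]
    by (intro Bochner_Integration.integral_cong) (auto split: split_indicator simp: not_less, metis not_less)
  finally show ?thesis .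
qed

text \<open>The flux through the unit directions at radius s, not divided by the area 4 pi.\<close>

definition sphere_corr :: "real \<Rightarrow> real" where
  "sphere_corr s = (\<integral>w. w \<bullet> flux_corr (s *\<^sub>R w) \<partial>surface_measure)"

lemma flux_corr_sphere_measurable:
  "(\<lambda>p. snd p \<bullet> flux_corr (fst p *\<^sub>R snd p)) \<in> borel_measurable (borel \<Otimes>\<^sub>M sphere_borel)"
proof -
  have [measurable]: "(\<lambda>p. snd p) \<in> borel_measurable ((borel :: real measure) \<Otimes>\<^sub>M sphere_borel)"
    by (rule measurable_compose[OF measurable_snd measurable_restrict_space1]) simp
  show ?thesis by measurable
qed

text \<open>\<open>bump_identity\<close> in polar coordinates, with steepness tending to infinity.
  On the flux side the radial kernel concentrates at r, and continuity of \<open>sphere_corr\<close>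
  there makes the limit a value at r itself; on the energy side the bumps tend to the indicator of
  the ball.\<close>

lemma sphere_identity:
  assumes r: "0 < r" "r < 1/2"
  shows "r\<^sup>2 * sphere_corr r = 4 * (\<integral>l. indicator (ball 0 r) l * energy_corr l \<partial>lborel)"
proof -
  obtain K where K: "\<And>x. x \<in> cball 0 1 \<Longrightarrow> norm (flux_corr x) \<le> K"
    using continuous_bounded_on_ball[OF continuous_flux_corr] by blast
  have K0: "0 \<le> K" using order_trans[OF norm_ge_zero K[of 0]] by simp
  have wF: "\<bar>w \<bullet> flux_corr (s *\<^sub>R w)\<bar> \<le> K" if "norm w = 1" "0 \<le> s" "s \<le> 1" for s w
    using Cauchy_Schwarz_ineq2[of w "flux_corr (s *\<^sub>R w)"] K[of "s *\<^sub>R w"] that by simp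
  have wmeas: "(\<lambda>w. w \<bullet> flux_corr (s *\<^sub>R w)) \<in> borel_measurable surface_measure" for s
  proof -
    have "(\<lambda>w. w \<bullet> flux_corr (s *\<^sub>R w)) \<in> borel_measurable sphere_borel"
      by (rule measurable_restrict_space1) measurable
    then show ?thesis by (simp add: measurable_cong_sets[OF sets_surface_measure refl])
  qed
  have S_meas: "sphere_corr \<in> borel_measurable borel"
    unfolding sphere_corr_def[abs_def]
    by (rule surf.borel_measurable_lebesgue_integral)
      (use flux_corr_sphere_measurable in \<open>simp add: case_prod_unfold measurable_cong_sets[OF sets_pair_measure_cong[OF refl sets_surface_measure] refl]\<close>)
  \<comment> \<open>The cut-off at 1 makes this bounded on the whole line; near r < 1/2 it has no
    effect.\<close>
  define \<phi> where "\<phi> s = indicator {0..1} s * (s\<^sup>2 * sphere_corr s)" for s :: real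
  have [measurable]: "\<phi> \<in> borel_measurable borel" unfolding \<phi>_def[abs_def] using S_meas by measurable
  have S_bd: "\<bar>sphere_corr s\<bar> \<le> K * measure surface_measure (space surface_measure)" if s: "0 \<le> s" "s \<le> 1" for s
  proof -
    have "\<bar>sphere_corr s\<bar> \<le> (\<integral>w. K \<partial>surface_measure)"
      unfolding sphere_corr_def
    proof (rule order_trans[OF integral_abs_bound integral_mono_AE])
      show "integrable surface_measure (\<lambda>w. \<bar>w \<bullet> flux_corr (s *\<^sub>R w)\<bar>)"
        using wmeas by (intro surf.integrable_const_bound[where B = K] AE_I2) (auto simp: space_surface_measure wF s)
    qed (auto simp: space_surface_measure wF s intro!: AE_I2)
    then show ?thesis by (simp add: mult.commute)
  qed
  let ?A = "measure surface_measure (space surface_measure)"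
  have phi_bd: "\<bar>\<phi> s\<bar> \<le> K * ?A" for s
  proof (cases "s \<in> {0..1}")
    case True
    then have "s\<^sup>2 * \<bar>sphere_corr s\<bar> \<le> 1 * (K * ?A)" using S_bd[of s] by (intro mult_mono) (auto simp: power_le_one)
    then show ?thesis using True by (simp add: \<phi>_def abs_mult)
  qed (use K0 in \<open>auto simp: \<phi>_def\<close>)
  have "isCont \<phi> r"
  proof -
    have "continuous_on {0..1} sphere_corr"
      unfolding continuous_on_sequentially
    proof (intro allI ballI impI, elim conjE)
      fix x :: "nat \<Rightarrow> real" and a assume a: "a \<in> {0..1}" and x: "\<forall>n. x n \<in> {0..1}" "x \<longlonglongrightarrow> a"
      have "(\<lambda>n. sphere_corr (x n)) \<longlonglongrightarrow> sphere_corr a"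
        unfolding sphere_corr_def
      proof (rule integral_dominated_convergence[where w = "\<lambda>_. K"])
        have "(\<lambda>n. flux_corr (x n *\<^sub>R w)) \<longlonglongrightarrow> flux_corr (a *\<^sub>R w)" for w
          using continuous_flux_corr x(2)
          by (intro isCont_tendsto_compose[of _ flux_corr] tendsto_intros) (auto simp: continuous_on_eq_continuous_at)
        then show "AE w in surface_measure. (\<lambda>n. w \<bullet> flux_corr (x n *\<^sub>R w)) \<longlonglongrightarrow> w \<bullet> flux_corr (a *\<^sub>R w)"
          by (intro AE_I2 tendsto_intros)
        show "AE w in surface_measure. norm (w \<bullet> flux_corr (x n *\<^sub>R w)) \<le> K" for n
          using x(1) by (intro AE_I2) (auto simp: space_surface_measure intro!: wF)
      qed (use wmeas in auto)
      then show "(sphere_corr \<circ> x) \<longlonglongrightarrow> sphere_corr a" by (simp add: o_def)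
    qed
    then have "isCont sphere_corr r" using r by (intro continuous_on_interior) auto
    then have "isCont (\<lambda>s. s\<^sup>2 * sphere_corr s) r" by (intro continuous_intros)
    moreover have "\<forall>\<^sub>F s in nhds r. \<phi> s = s\<^sup>2 * sphere_corr s"
    proof (rule eventually_mono)
      show "\<forall>\<^sub>F s in nhds r. s \<in> {0<..<1}" using r by (intro eventually_nhds_in_open) auto
    qed (simp add: \<phi>_def)
    ultimately show ?thesis by (simp add: isCont_cong)
  qed
  then have lim1: "(\<lambda>k. \<integral>s. radial_kernel (real (Suc k)) r s * indicator {0..1} s * \<phi> s \<partial>lborel) \<longlonglongrightarrow> \<phi> r"
    using r phi_bd by (intro radial_kernel_tendsto[where K = "K * ?A"]) auto
  have eq: "(\<integral>s. radial_kernel c r s * indicator {0..1} s * \<phi> s \<partial>lborel) = 4 * (\<integral>l. bump_on c r l * energy_corr l \<partial>lborel)"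
    if c: "0 < c" for c
  proof -
    \<comment> \<open>The integrand of the flux side in polar form; the minus sign appears because
      the bump decreases in the radius.\<close>
    define f where "f s w = indicator {0<..<1} s * (- radial_kernel c r s * (w \<bullet> flux_corr (s *\<^sub>R w)))" for s w
    have kb: "\<bar>radial_kernel c r s\<bar> \<le> 4 * c" if "0 < s" "s < 1" for s
    proof -
      have "2 * c * s * flat' (c * (r\<^sup>2 - s\<^sup>2)) \<le> 2 * c * 1 * 2"
        using that c flat'_nonneg flat'_le_2 by (intro mult_mono) auto
      then show ?thesis using that c flat'_nonneg by (simp add: radial_kernel_def)
    qed
    have pol: "(\<integral>x. indicator (ball 0 1) x * f (norm x) (sgn x) \<partial>lborel)
      = (\<integral>s. indicator {0<..<1} s * s\<^sup>2 * (\<integral>w. f s w \<partial>surface_measure) \<partial>lborel)"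
    proof (rule polar_integral[where K = "4 * c * K"])
      have [measurable]: "(\<lambda>p. fst p) \<in> borel_measurable ((borel :: real measure) \<Otimes>\<^sub>M sphere_borel)" by measurable
      show "(\<lambda>p. f (fst p) (snd p)) \<in> borel_measurable (borel \<Otimes>\<^sub>M sphere_borel)"
        unfolding f_def by (intro borel_measurable_times flux_corr_sphere_measurable) measurable
      show "\<bar>f s w\<bar> \<le> 4 * c * K" if "w \<in> sphere 0 1" for s w
      proof (cases "s \<in> {0<..<1}")
        case True
        then have "\<bar>radial_kernel c r s\<bar> * \<bar>w \<bullet> flux_corr (s *\<^sub>R w)\<bar> \<le> (4 * c) * K"
          using kb[of s] wF[of w s] that c K0 by (intro mult_mono) auto
        then show ?thesis using True by (simp add: f_def abs_mult)
      qed (use c K0 in \<open>auto simp: f_def\<close>)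
      show "(\<lambda>x. f (norm x) (sgn x)) \<in> borel_measurable borel" unfolding f_def by measurable
    qed
    have "(\<integral>l. bump_grad c r l \<bullet> flux_corr l \<partial>lborel) = (\<integral>x. indicator (ball 0 1) x * f (norm x) (sgn x) \<partial>lborel)"
    proof (rule Bochner_Integration.integral_cong[OF refl])
      fix x :: space
      have sx: "norm x *\<^sub>R sgn x = x" by (cases "x = 0") (auto simp: sgn_div_norm)
      show "bump_grad c r x \<bullet> flux_corr x = indicator (ball 0 1) x * f (norm x) (sgn x)"
      proof (cases "x = 0 \<or> norm x \<ge> 1")
        case True
        then have "bump_grad c r x = 0"
          using bump_grad_eq_0[OF c r(1), of x] r by (auto simp: bump_grad_def)
        then show ?thesis using True by (auto simp: f_def)
      next
        case False
        have "x \<bullet> y = norm x * (sgn x \<bullet> y)" for y using sx by (metis inner_scaleR_left)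
        then have "bump_grad c r x \<bullet> flux_corr x = (- 2 * c * flat' (c * (r\<^sup>2 - (norm x)\<^sup>2))) * (norm x * (sgn x \<bullet> flux_corr x))"
          by (simp add: bump_grad_def)
        then show ?thesis using False by (simp add: f_def radial_kernel_def sx)
      qed
    qed
    also note pol
    also have "(\<integral>s. indicator {0<..<1} s * s\<^sup>2 * (\<integral>w. f s w \<partial>surface_measure) \<partial>lborel)
       = (\<integral>s. - (radial_kernel c r s * indicator {0..1} s * \<phi> s) \<partial>lborel)"
    proof (rule integral_cong_AE)
      have "AE s in lborel. s \<noteq> (0::real)" "AE s in lborel. s \<noteq> (1::real)" by (rule AE_lborel_singleton)+
      then show "AE s in lborel. indicator {0<..<1} s * s\<^sup>2 * (\<integral>w. f s w \<partial>surface_measure)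
          = - (radial_kernel c r s * indicator {0..1} s * \<phi> s)"
        by eventually_elim (auto simp: f_def \<phi>_def sphere_corr_def split: split_indicator)
      have "(\<lambda>s. \<integral>w. f s w \<partial>surface_measure) = (\<lambda>s. indicator {0<..<1} s * (- radial_kernel c r s * sphere_corr s))"
        by (simp add: f_def sphere_corr_def)
      moreover note [measurable] = S_meas
      have "(\<lambda>s. indicator {0<..<1} s * (- radial_kernel c r s * sphere_corr s)) \<in> borel_measurable borel" by measurable
      ultimately have [measurable]: "(\<lambda>s. \<integral>w. f s w \<partial>surface_measure) \<in> borel_measurable borel" by (simp only:)
      show "(\<lambda>s. indicator {0<..<1} s * s\<^sup>2 * (\<integral>w. f s w \<partial>surface_measure)) \<in> borel_measurable lborel"
        by measurable
    qed measurable
    finally show ?thesis using bump_identity[OF c r] by simp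
  qed
  have "(\<lambda>k. \<integral>l. bump_on (real (Suc k)) r l * energy_corr l \<partial>lborel) \<longlonglongrightarrow> (\<integral>l. indicator (ball 0 r) l * energy_corr l \<partial>lborel)"
  \<comment> \<open>All bumps are at most 1 and supported in the unit ball, on which the continuous
    function \<open>energy_corr\<close> is bounded.\<close>
  proof (rule integral_dominated_convergence[where w = "\<lambda>l. \<bar>indicator (ball 0 1) l * energy_corr l\<bar>"])
    obtain K' where K': "\<And>x. x \<in> cball 0 1 \<Longrightarrow> norm (energy_corr x) \<le> K'"
      using continuous_bounded_on_ball[OF continuous_energy_corr] by blast
    have "integrable lborel (\<lambda>l. indicator (ball 0 1) l * K' :: real)"
      by (intro Bochner_Integration.integrable_mult_left integrable_real_indicator emeasure_lborel_ball_finite) simp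
    then show "integrable lborel (\<lambda>l. \<bar>indicator (ball 0 1) l * energy_corr l\<bar>)"
    proof (rule Bochner_Integration.integrable_bound)
      show "AE l in lborel. norm \<bar>indicator (ball 0 1) l * energy_corr l\<bar> \<le> norm (indicator (ball 0 1) l * K')"
        by (auto intro!: AE_I2 order_trans[OF K'[unfolded real_norm_def] abs_ge_self] split: split_indicator)
      have "(\<lambda>l. indicator (ball 0 1) l * energy_corr l) \<in> borel_measurable borel"
        by (intro borel_measurable_times borel_measurable_indicator energy_corr_borel) simp
      then show "(\<lambda>l. \<bar>indicator (ball 0 1) l * energy_corr l\<bar>) \<in> borel_measurable lborel" by simp
    qed
    show "AE l in lborel. (\<lambda>k. bump_on (real (Suc k)) r l * energy_corr l) \<longlonglongrightarrow> indicator (ball 0 r) l * energy_corr l"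
    proof (intro AE_I2 tendsto_mult tendsto_const)
      fix l :: space
      have "(r\<^sup>2 - (norm l)\<^sup>2 > 0) = (l \<in> ball 0 r)"
        using r abs_le_square_iff[of r "norm l"] by (auto simp: not_le[symmetric])
      then show "(\<lambda>k. bump_on (real (Suc k)) r l) \<longlonglongrightarrow> indicator (ball 0 r) l"
        using LIMSEQ_Suc[OF flat_scaled_tendsto[of "r\<^sup>2 - (norm l)\<^sup>2"]] unfolding bump_on_def
        by (simp split: if_splits)
    qed
    fix k
    have "\<bar>bump_on (real (Suc k)) r l * y\<bar> \<le> \<bar>indicator (ball 0 1) l * y\<bar>" for l y
    proof (cases "norm l < 1")
      case True
      then show ?thesis using mult_right_mono[OF abs_bump_on_le abs_ge_zero[of y]] by (simp add: abs_mult)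
    qed (use bump_on_eq_0[of "real (Suc k)" r l] r in auto)
    then show "AE l in lborel. norm (bump_on (real (Suc k)) r l * energy_corr l) \<le> \<bar>indicator (ball 0 1) l * energy_corr l\<bar>"
      by (intro AE_I2) simp
    have E: "energy_corr \<in> borel_measurable lborel" using energy_corr_borel by simp
    show "(\<lambda>l. indicator (ball 0 r) l * energy_corr l) \<in> borel_measurable lborel"
      by (intro borel_measurable_times borel_measurable_indicator E) simp
    have "bump_on (real (Suc k)) r \<in> borel_measurable lborel" using bump_on_borel by simp
    then show "(\<lambda>l. bump_on (real (Suc k)) r l * energy_corr l) \<in> borel_measurable lborel"
      by (intro borel_measurable_times E)
  qed
  from tendsto_mult_left[OF this, of 4]
  have "(\<lambda>k. \<integral>s. radial_kernel (real (Suc k)) r s * indicator {0..1} s * \<phi> s \<partial>lborel)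
      \<longlonglongrightarrow> 4 * (\<integral>l. indicator (ball 0 r) l * energy_corr l \<partial>lborel)"
    by (subst eq) auto
  with lim1 have "\<phi> r = 4 * (\<integral>l. indicator (ball 0 r) l * energy_corr l \<partial>lborel)" by (rule LIMSEQ_unique)
  then show ?thesis using r by (simp add: \<phi>_def)
qed

end

section \<open>Identification of the limits and the distribution D\<close>

section \<open>The local energy equation and the 4/3 law\<close>

lemma increment_shift: "increment f l z = f (shift l z) - f z"
  by (cases z) (simp add: increment_def)

lemma cell_measurable_facts:
  "(\<lambda>l. l) \<in> borel_measurable cell_measure" "(\<lambda>l. a *\<^sub>R bump_grad c r l) \<in> borel_measurable cell_measure"
  by measurable

context flow
begin

text \<open>Shared by both averages of the flux: for the mollified one N is the cell with e l = l
  and q the mollifier gradient, for the spherical one N is the surface measure with e w = r w and q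
  w = w.\<close>

lemma flux_pair_integrable:
  assumes N: "finite_measure N" and [measurable]: "e \<in> borel_measurable N" "q \<in> borel_measurable N" "\<eta> \<in> borel_measurable borel"
    and B: "\<And>w. w \<in> space N \<Longrightarrow> norm (q w) \<le> B" and C: "\<And>z. \<bar>\<eta> z\<bar> \<le> C"
  shows "integrable (cyl_measure T \<Otimes>\<^sub>M N)
    (\<lambda>(z, w). (q w \<bullet> increment v (e w) z) * \<bar>increment \<theta> (e w) z\<bar>\<^sup>2 * \<eta> z)"
proof (rule integrable_cyl_pair[OF N, where e = e and W = W and K = "C * B"])
  have C0: "0 \<le> C" using order_trans[OF abs_ge_zero C] .
  fix z w assume w: "w \<in> space N"
  let ?Y = "((\<theta> (shift (e w) z) - \<theta> z)\<^sup>2) *\<^sub>R (v (shift (e w) z) - v z)"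
  have "\<bar>q w \<bullet> ?Y\<bar> \<le> B * (1 * W z + 1 * W (shift (e w) z))"
    using order_trans[OF norm_ge_zero B[OF w]]
    by (intro order_trans[OF Cauchy_Schwarz_ineq2] mult_mono B[OF w] increment_dom) auto
  then have "\<bar>\<eta> z\<bar> * \<bar>q w \<bullet> ?Y\<bar> \<le> C * (B * (1 * W z + 1 * W (shift (e w) z)))"
    using C C0 by (intro mult_mono) auto
  then show "norm (case (z, w) of (z, w) \<Rightarrow> (q w \<bullet> increment v (e w) z) * \<bar>increment \<theta> (e w) z\<bar>\<^sup>2 * \<eta> z) \<le> C * B * (W z + W (shift (e w) z))"
    by (simp add: increment_shift abs_mult mult_ac)
qed (use W_per W_int in \<open>auto simp: increment_shift\<close>)

lemma flux_integral_integrable: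
  assumes N: "finite_measure N" and [measurable]: "e \<in> borel_measurable N" "q \<in> borel_measurable N"
    and B: "\<And>w. w \<in> space N \<Longrightarrow> norm (q w) \<le> B"
  shows "integrable (cyl_measure T) (\<lambda>z. \<integral>w. (q w \<bullet> increment v (e w) z) * \<bar>increment \<theta> (e w) z\<bar>\<^sup>2 \<partial>N)"
proof -
  interpret N: finite_measure N by fact
  interpret P: pair_sigma_finite "cyl_measure T" N ..
  show ?thesis
    using P.integrable_fst[OF flux_pair_integrable[OF N assms(2,3) _ B, of "\<lambda>_. 1" 1]] by simp
qed

lemma locally_integrable_cyl:
  assumes "integrable (cyl_measure T) f" shows "locally_integrable T f"
  unfolding locally_integrable_def
proof (intro allI impI)
  fix a b :: real assume ab: "0 < a" "b < T"
  have [measurable]: "f \<in> borel_measurable borel" using assms by (auto dest: borel_measurable_integrable)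
  have m: "{a..b} \<times> torus_cell \<in> sets (borel :: spacetime measure)" unfolding borel_spacetime by measurable
  have "set_integrable lborel (torus_cyl T) f"
    using assms by (simp add: set_integrable_def integral_cyl_eq_lborel(2))
  then show "set_integrable lborel ({a..b} \<times> torus_cell) f"
    by (rule set_integrable_subset) (use m ab in \<open>auto simp: torus_cyl_def\<close>)
qed

lemma dist_of_cyl:
  assumes "f \<in> borel_measurable borel" "\<psi> \<in> borel_measurable borel"
  shows "dist_of T f \<psi> = (\<integral>z. f z * \<psi> z \<partial>cyl_measure T)"
  using assms by (simp add: dist_of_def set_lebesgue_integral_def integral_cyl_eq_lborel(1))

lemma D_eps_eq:
  assumes "e > 0"
  shows "D_eps v \<theta> e = (\<lambda>z. - (1/4) * (\<integral>l. (((C0 / e ^ 3) *\<^sub>R bump_grad (1 / e\<^sup>2) e l) \<bullet> increment v l z) * \<bar>increment \<theta> l z\<bar>\<^sup>2 \<partial>cell_measure))"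
  unfolding D_eps_def gradient_mollifier_eps[OF assms] set_lebesgue_integral_def
  by (intro ext arg_cong2[where f = "(*)"] refl, subst integral_cell_eq_lborel) (auto simp: increment_shift)

lemma sphere_flux_eq:
  "sphere_flux v \<theta> r = (\<lambda>z. (1 / (4 * pi * r)) * (\<integral>w. (w \<bullet> increment v (r *\<^sub>R w) z) * \<bar>increment \<theta> (r *\<^sub>R w) z\<bar>\<^sup>2 \<partial>surface_measure))"
  by (intro ext) (simp add: sphere_flux_def)

lemma surface_ident [measurable]: "(\<lambda>w. w) \<in> borel_measurable surface_measure"
proof -
  have "(\<lambda>w. w) \<in> borel_measurable sphere_borel" by (rule measurable_restrict_space1) simp
  then show ?thesis by (simp add: measurable_cong_sets[OF sets_surface_measure refl])
qed

lemma D_eps_integrable: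
  assumes e: "e > 0" shows "integrable (cyl_measure T) (D_eps v \<theta> e)"
proof -
  have "norm ((C0 / e ^ 3) *\<^sub>R bump_grad (1 / e\<^sup>2) e l) \<le> \<bar>C0 / e ^ 3\<bar> * (4 * (1 / e\<^sup>2) * e)" for l
    unfolding norm_scaleR by (intro mult_left_mono norm_bump_grad_le) (use e in auto)
  then show ?thesis
    unfolding D_eps_eq[OF e]
    by (intro Bochner_Integration.integrable_mult_right flux_integral_integrable) (auto intro: cell.finite_measure_axioms cell_measurable_facts)
qed

lemma sphere_flux_integrable: "integrable (cyl_measure T) (\<lambda>z. - sphere_flux v \<theta> r z)"
  unfolding sphere_flux_eq
  by (intro Bochner_Integration.integrable_minus Bochner_Integration.integrable_mult_right
      flux_integral_integrable[where B = 1] finite_surface_measure) (auto simp: space_surface_measure)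

end

context flow_psi
begin

text \<open>Testing with \<psi> before averaging over the shifts turns both averaged fluxes into
  averages of the continuous function \<open>flux_corr\<close>.\<close>

lemma flux_fubini:
  assumes N: "finite_measure N" and [measurable]: "e \<in> borel_measurable N" "q \<in> borel_measurable N"
    and B: "\<And>w. w \<in> space N \<Longrightarrow> norm (q w) \<le> B"
  shows "(\<integral>z. (\<integral>w. (q w \<bullet> increment v (e w) z) * \<bar>increment \<theta> (e w) z\<bar>\<^sup>2 \<partial>N) * \<psi> z \<partial>cyl_measure T)
    = (\<integral>w. q w \<bullet> flux_corr (e w) \<partial>N)"
proof -
  interpret N: finite_measure N by fact
  interpret P: pair_sigma_finite "cyl_measure T" N ..
  have "(\<integral>z. (\<integral>w. (q w \<bullet> increment v (e w) z) * \<bar>increment \<theta> (e w) z\<bar>\<^sup>2 \<partial>N) * \<psi> z \<partial>cyl_measure T)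
    = (\<integral>z. \<integral>w. (q w \<bullet> increment v (e w) z) * \<bar>increment \<theta> (e w) z\<bar>\<^sup>2 * \<psi> z \<partial>N \<partial>cyl_measure T)"
    by simp
  also have "\<dots> = (\<integral>w. \<integral>z. (q w \<bullet> increment v (e w) z) * \<bar>increment \<theta> (e w) z\<bar>\<^sup>2 * \<psi> z \<partial>cyl_measure T \<partial>N)"
    by (rule P.Fubini_integral[symmetric]) (rule flux_pair_integrable[OF N assms(2,3) \<psi>_borel B M(1)])
  also have "\<dots> = (\<integral>w. q w \<bullet> flux_corr (e w) \<partial>N)"
  proof (rule Bochner_Integration.integral_cong[OF refl])
    fix w
    have "(\<integral>z. (q w \<bullet> increment v (e w) z) * \<bar>increment \<theta> (e w) z\<bar>\<^sup>2 * \<psi> z \<partial>cyl_measure T)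
      = (\<integral>z. q w \<bullet> (((\<theta> (shift (e w) z) - \<theta> z)\<^sup>2 * \<psi> z) *\<^sub>R (v (shift (e w) z) - v z)) \<partial>cyl_measure T)"
      by (simp add: increment_shift mult_ac)
    also have "\<dots> = q w \<bullet> flux_corr (e w)"
      unfolding flux_corr_def by (rule integral_inner_right) (rule flux_integrable)
    finally show "(\<integral>z. (q w \<bullet> increment v (e w) z) * \<bar>increment \<theta> (e w) z\<bar>\<^sup>2 * \<psi> z \<partial>cyl_measure T) = q w \<bullet> flux_corr (e w)" .
  qed
  finally show ?thesis .
qed

text \<open>For e < 1/2 the mollifier lives inside the cell and \<open>bump_identity\<close> applies
  with c = 1/e^2; the factor -1/4 in \<open>D_eps\<close> cancels the -4 there.\<close>

lemma dist_of_D_eps: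
  assumes e: "0 < e" "e < 1/2"
  shows "dist_of T (D_eps v \<theta> e) \<psi> = (\<integral>l. mollifier_eps e l * energy_corr l \<partial>lborel)"
proof -
  have b: "norm ((C0 / e ^ 3) *\<^sub>R bump_grad (1 / e\<^sup>2) e l) \<le> \<bar>C0 / e ^ 3\<bar> * (4 * (1 / e\<^sup>2) * e)" for l
    unfolding norm_scaleR by (intro mult_left_mono norm_bump_grad_le) (use e in auto)
  have in_cell: "indicator torus_cell l * (bump_grad (1 / e\<^sup>2) e l \<bullet> y) = bump_grad (1 / e\<^sup>2) e l \<bullet> y" for l y
  proof (cases "l \<in> torus_cell")
    case False
    then obtain b where "b \<in> Basis" "\<bar>l \<bullet> b\<bar> > 1/2" by (auto simp: mem_torus_cell not_le)
    then have "norm l \<ge> e" using Basis_le_norm[of b l] e by linarith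
    then show ?thesis using e by (simp add: bump_grad_eq_0)
  qed simp
  have "dist_of T (D_eps v \<theta> e) \<psi> = (\<integral>z. D_eps v \<theta> e z * \<psi> z \<partial>cyl_measure T)"
    using D_eps_integrable[OF e(1)] by (intro dist_of_cyl \<psi>_borel) (auto dest: borel_measurable_integrable)
  also have "\<dots> = - (1/4) * (\<integral>z. (\<integral>l. (((C0 / e ^ 3) *\<^sub>R bump_grad (1 / e\<^sup>2) e l) \<bullet> increment v l z) * \<bar>increment \<theta> l z\<bar>\<^sup>2 \<partial>cell_measure) * \<psi> z \<partial>cyl_measure T)"
    unfolding D_eps_eq[OF e(1)] mult.assoc by (rule Bochner_Integration.integral_mult_right_zero)
  also have "\<dots> = - (1/4) * (\<integral>l. ((C0 / e ^ 3) *\<^sub>R bump_grad (1 / e\<^sup>2) e l) \<bullet> flux_corr l \<partial>cell_measure)"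
    by (subst flux_fubini[OF cell.finite_measure_axioms cell_measurable_facts b]) simp
  also have "\<dots> = - (1/4) * ((C0 / e ^ 3) * (\<integral>l. bump_grad (1 / e\<^sup>2) e l \<bullet> flux_corr l \<partial>cell_measure))"
    by simp
  also have "(\<integral>l. bump_grad (1 / e\<^sup>2) e l \<bullet> flux_corr l \<partial>cell_measure) = (\<integral>l. bump_grad (1 / e\<^sup>2) e l \<bullet> flux_corr l \<partial>lborel)"
    by (subst integral_cell_eq_lborel) (auto simp: in_cell)
  also have "\<dots> = - 4 * (\<integral>l. bump_on (1 / e\<^sup>2) e l * energy_corr l \<partial>lborel)"
    by (rule bump_identity) (use e in auto)
  also have "- (1/4) * ((C0 / e ^ 3) * (- 4 * (\<integral>l. bump_on (1 / e\<^sup>2) e l * energy_corr l \<partial>lborel)))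
     = (\<integral>l. mollifier_eps e l * energy_corr l \<partial>lborel)"
    unfolding mollifier_eps_eq[OF e(1)] mult.assoc[of "C0 / e ^ 3"] Bochner_Integration.integral_mult_right_zero by simp
  finally show ?thesis .
qed

lemma D_eps_tendsto: "((\<lambda>e. dist_of T (D_eps v \<theta> e) \<psi>) \<longlongrightarrow> energy_corr 0) (at_right 0)"
proof (rule Lim_transform_eventually[OF mollifier_average[OF continuous_energy_corr]])
  have "\<forall>\<^sub>F e in at_right 0. 0 < e \<and> e < (1/2::real)"
    unfolding eventually_at_right_field by (intro exI[of _ "1/2"]) auto
  then show "\<forall>\<^sub>F e in at_right 0. (\<integral>l. mollifier_eps e l * energy_corr l \<partial>lborel) = dist_of T (D_eps v \<theta> e) \<psi>"
    by (rule eventually_mono) (simp only: dist_of_D_eps)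
qed

text \<open>The spherical flux with factor 1/(4 pi r) equals, by \<open>sphere_identity\<close>,
  4/(4 pi r^3) times the integral of \<open>energy_corr\<close> over the ball. Relative to the
  volume 4/3 pi r^3 this is 4/3 of the mean value; the minus sign is the one in the definition of
  S.\<close>

lemma dist_of_sphere_flux:
  assumes r: "0 < r" "r < 1/2"
  shows "dist_of T (\<lambda>z. - sphere_flux v \<theta> r z) \<psi>
    = - (4/3) * ((\<integral>l. indicator (ball 0 r) l * energy_corr l \<partial>lborel) / (4/3 * pi * r ^ 3))"
proof -
  have "dist_of T (\<lambda>z. - sphere_flux v \<theta> r z) \<psi> = (\<integral>z. - sphere_flux v \<theta> r z * \<psi> z \<partial>cyl_measure T)"
    using sphere_flux_integrable[of r] by (intro dist_of_cyl \<psi>_borel) (auto dest: borel_measurable_integrable)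
  also have "\<dots> = - (1 / (4 * pi * r)) * (\<integral>z. (\<integral>w. (w \<bullet> increment v (r *\<^sub>R w) z) * \<bar>increment \<theta> (r *\<^sub>R w) z\<bar>\<^sup>2 \<partial>surface_measure) * \<psi> z \<partial>cyl_measure T)"
    unfolding sphere_flux_eq minus_mult_left mult.assoc by (rule Bochner_Integration.integral_mult_right_zero)
  also have "\<dots> = - (1 / (4 * pi * r)) * sphere_corr r"
    unfolding sphere_corr_def
    by (subst flux_fubini[OF finite_surface_measure, where B = 1]) (auto simp: space_surface_measure)
  also have "\<dots> = - (1 / (4 * pi * r ^ 3)) * (r\<^sup>2 * sphere_corr r)"
    using r by (simp add: power2_eq_square power3_eq_cube)
  also have "\<dots> = - (4/3) * ((\<integral>l. indicator (ball 0 r) l * energy_corr l \<partial>lborel) / (4/3 * pi * r ^ 3))"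
    unfolding sphere_identity[OF r] by simp
  finally show ?thesis .
qed

lemma sphere_flux_tendsto:
  "((\<lambda>r. dist_of T (\<lambda>z. - sphere_flux v \<theta> r z) \<psi>) \<longlongrightarrow> - (4/3) * energy_corr 0) (at_right 0)"
proof (rule Lim_transform_eventually[OF tendsto_mult_left[OF ball_average[OF continuous_energy_corr], of "- (4/3)"]])
  have "\<forall>\<^sub>F r in at_right 0. 0 < r \<and> r < (1/2::real)"
    unfolding eventually_at_right_field by (intro exI[of _ "1/2"]) auto
  then show "\<forall>\<^sub>F r in at_right 0. - (4/3) * ((\<integral>l. indicator (ball 0 r) l * energy_corr l \<partial>lborel) / (4/3 * pi * r ^ 3))
      = dist_of T (\<lambda>z. - sphere_flux v \<theta> r z) \<psi>"
    by (rule eventually_mono) (simp only: dist_of_sphere_flux)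
qed

lemma energy_corr_0_eq:
  "energy_corr 0 = - (1/2) * ((\<integral>z. (\<theta> z)\<^sup>2 * time_deriv \<psi> z \<partial>cyl_measure T)
     + (\<Sum>b\<in>Basis. \<integral>z. (((\<theta> z)\<^sup>2 *\<^sub>R v z) \<bullet> b) * (space_gradient \<psi> z \<bullet> b) \<partial>cyl_measure T))"
proof -
  have 1: "integrable (cyl_measure T) (\<lambda>z. (\<theta> z)\<^sup>2 * time_deriv \<psi> z)"
    by (rule integrable_mult_test[OF time_deriv_test[OF \<psi>] th2_int])
  have 2: "integrable (cyl_measure T) (\<lambda>z. (((\<theta> z)\<^sup>2 *\<^sub>R v z) \<bullet> b) * (space_gradient \<psi> z \<bullet> b))" if "b \<in> Basis" for b
    by (rule integrable_mult_test[OF space_gradient_test[OF \<psi> that]]) (use th2v_int in \<open>simp del: inner_scaleR_left\<close>)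
  have "(\<theta> z)\<^sup>2 * \<psi>D z = (\<theta> z)\<^sup>2 * time_deriv \<psi> z + (\<Sum>b\<in>Basis. (((\<theta> z)\<^sup>2 *\<^sub>R v z) \<bullet> b) * (space_gradient \<psi> z \<bullet> b))" for z
    unfolding \<psi>D_def euclidean_inner[of "v z" "space_gradient \<psi> z"] by (simp add: distrib_left sum_distrib_left mult.assoc)
  then show ?thesis using 1 2 by (simp add: energy_corr_0 del: inner_scaleR_left)
qed

lemma energy_equation:
  "dist_dt T (\<lambda>z. 1/2 * \<bar>\<theta> z\<bar>\<^sup>2) \<psi> + dist_div T (\<lambda>z. (1/2 * (\<theta> z)\<^sup>2) *\<^sub>R v z) \<psi> = energy_corr 0"
proof -
  have 1: "integrable (cyl_measure T) (\<lambda>z. (\<theta> z)\<^sup>2 * time_deriv \<psi> z)"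
    by (rule integrable_mult_test[OF time_deriv_test[OF \<psi>] th2_int])
  have 2: "integrable (cyl_measure T) (\<lambda>z. ((\<theta> z)\<^sup>2 *\<^sub>R v z) \<bullet> space_gradient \<psi> z)"
    by (rule integrable_inner_gradient[OF \<psi> th2v_int])
  have "dist_dt T (\<lambda>z. 1/2 * \<bar>\<theta> z\<bar>\<^sup>2) \<psi> = - (\<integral>z. (1/2 * \<bar>\<theta> z\<bar>\<^sup>2) * time_deriv \<psi> z \<partial>cyl_measure T)"
    unfolding dist_dt_def set_lebesgue_integral_def by (subst integral_cyl_eq_lborel(1)) auto
  also have "\<dots> = - (1/2) * (\<integral>z. (\<theta> z)\<^sup>2 * time_deriv \<psi> z \<partial>cyl_measure T)" by simp
  finally have 3: "dist_dt T (\<lambda>z. 1/2 * \<bar>\<theta> z\<bar>\<^sup>2) \<psi> = - (1/2) * (\<integral>z. (\<theta> z)\<^sup>2 * time_deriv \<psi> z \<partial>cyl_measure T)" .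
  have "dist_div T (\<lambda>z. (1/2 * (\<theta> z)\<^sup>2) *\<^sub>R v z) \<psi> = - (\<integral>z. ((1/2 * (\<theta> z)\<^sup>2) *\<^sub>R v z) \<bullet> space_gradient \<psi> z \<partial>cyl_measure T)"
    unfolding dist_div_def set_lebesgue_integral_def by (subst integral_cyl_eq_lborel(1)) auto
  also have "\<dots> = - (1/2) * (\<integral>z. ((\<theta> z)\<^sup>2 *\<^sub>R v z) \<bullet> space_gradient \<psi> z \<partial>cyl_measure T)"
    by (simp add: mult.assoc)
  finally have 4: "dist_div T (\<lambda>z. (1/2 * (\<theta> z)\<^sup>2) *\<^sub>R v z) \<psi> = - (1/2) * (\<integral>z. ((\<theta> z)\<^sup>2 *\<^sub>R v z) \<bullet> space_gradient \<psi> z \<partial>cyl_measure T)" .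
  have "(\<theta> z)\<^sup>2 * \<psi>D z = (\<theta> z)\<^sup>2 * time_deriv \<psi> z + ((\<theta> z)\<^sup>2 *\<^sub>R v z) \<bullet> space_gradient \<psi> z" for z
    by (simp add: \<psi>D_def distrib_left)
  then have "energy_corr 0 = - (1/2) * ((\<integral>z. (\<theta> z)\<^sup>2 * time_deriv \<psi> z \<partial>cyl_measure T)
     + (\<integral>z. ((\<theta> z)\<^sup>2 *\<^sub>R v z) \<bullet> space_gradient \<psi> z \<partial>cyl_measure T))"
    using 1 2 by (simp add: energy_corr_0 del: inner_scaleR_left)
  then show ?thesis unfolding 3 4 by (simp add: algebra_simps)
qed

end

context flow
begin

lemma flow_psiI: "\<psi> \<in> test_functions T \<Longrightarrow> flow_psi T v \<theta> W \<psi>"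
  by unfold_locales

text \<open>An explicit formula outside the context of a fixed \<psi>, so that linearity and
  continuity in \<psi> can be examined. The gradient is split into components because those are
  themselves test functions.\<close>

definition dissipation :: functional where
  "dissipation \<psi> = - (1/2) * ((\<integral>z. (\<theta> z)\<^sup>2 * time_deriv \<psi> z \<partial>cyl_measure T)
     + (\<Sum>b\<in>Basis. \<integral>z. (((\<theta> z)\<^sup>2 *\<^sub>R v z) \<bullet> b) * (space_gradient \<psi> z \<bullet> b) \<partial>cyl_measure T))"

lemma th2v_component_int: "integrable (cyl_measure T) (\<lambda>z. ((\<theta> z)\<^sup>2 *\<^sub>R v z) \<bullet> b)"
  using th2v_int by (simp del: inner_scaleR_left)

lemma integral_uniform_null:
  assumes g: "integrable (cyl_measure T) g" and h: "\<And>k. h k \<in> test_functions T"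
    and u: "uniform_limit UNIV h (\<lambda>_. 0) sequentially"
  shows "(\<lambda>k. \<integral>z. g z * h k z \<partial>cyl_measure T) \<longlonglongrightarrow> (0 :: real)"
proof (rule LIMSEQ_I)
  fix e :: real assume e: "e > 0"
  let ?I = "\<integral>z. \<bar>g z\<bar> \<partial>cyl_measure T"
  have I0: "0 \<le> ?I" by simp
  \<comment> \<open>The added 1 keeps the divisor positive when \<open>g\<close> vanishes almost
    everywhere.\<close>
  have "\<forall>\<^sub>F k in sequentially. \<forall>z. dist (h k z) 0 < e / (?I + 1)"
    using uniform_limitD[OF u, of "e / (?I + 1)"] e I0 by simp
  then obtain N where N: "\<And>k z. k \<ge> N \<Longrightarrow> \<bar>h k z\<bar> < e / (?I + 1)" by (auto simp: eventually_sequentially)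
  show "\<exists>N. \<forall>k\<ge>N. norm ((\<integral>z. g z * h k z \<partial>cyl_measure T) - 0) < e"
  proof (intro exI allI impI)
    fix k assume k: "N \<le> k"
    have "\<bar>\<integral>z. g z * h k z \<partial>cyl_measure T\<bar> \<le> (\<integral>z. \<bar>g z\<bar> * (e / (?I + 1)) \<partial>cyl_measure T)"
    proof (rule order_trans[OF integral_abs_bound integral_mono])
      show "integrable (cyl_measure T) (\<lambda>z. \<bar>g z * h k z\<bar>)"
        using integrable_mult_test[OF h g] by simp
      show "integrable (cyl_measure T) (\<lambda>z. \<bar>g z\<bar> * (e / (?I + 1)))" using g by simp
      show "\<bar>g z * h k z\<bar> \<le> \<bar>g z\<bar> * (e / (?I + 1))" for z
        unfolding abs_mult using less_imp_le[OF N[OF k]] by (intro mult_left_mono) auto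
    qed
    also have "\<dots> = ?I * (e / (?I + 1))" by simp
    also have "\<dots> = e * (?I / (?I + 1))" by simp
    also have "\<dots> < e * 1"
    proof (rule mult_strict_left_mono[OF _ e])
      have "0 < ?I + 1" using I0 by linarith
      then show "?I / (?I + 1) < 1" by (subst pos_divide_less_eq) simp_all
    qed
    also have "e * 1 = e" by simp
    finally show "norm ((\<integral>z. g z * h k z \<partial>cyl_measure T) - 0) < e" by simp
  qed
qed

text \<open>Only first derivatives of \<psi> occur, paired with integrable functions, and along a
  null sequence these derivatives tend to 0 uniformly.\<close>

lemma dissipation_distribution: "is_distribution T dissipation"
  unfolding is_distribution_def
proof (intro conjI ballI allI impI)
  fix \<psi> \<eta> assume \<psi>: "\<psi> \<in> test_functions T" and \<eta>: "\<eta> \<in> test_functions T"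
  have t: "time_deriv (\<lambda>z. \<psi> z + \<eta> z) z = time_deriv \<psi> z + time_deriv \<eta> z" for z
    using DERIV_add[OF smooth_fun_has_time_deriv(1)[OF test_functionsD(1)[OF \<psi>]] smooth_fun_has_time_deriv(1)[OF test_functionsD(1)[OF \<eta>]]]
    by (cases z) (auto intro: time_deriv_unique)
  have x: "space_gradient (\<lambda>z. \<psi> z + \<eta> z) z = space_gradient \<psi> z + space_gradient \<eta> z" for z
    using has_derivative_add[OF smooth_fun_has_space_gradient(1)[OF test_functionsD(1)[OF \<psi>]] smooth_fun_has_space_gradient(1)[OF test_functionsD(1)[OF \<eta>]]]
    by (cases z) (auto intro!: space_gradient_unique simp: inner_add_left)
  note i = integrable_mult_test[OF time_deriv_test[OF \<psi>] th2_int] integrable_mult_test[OF time_deriv_test[OF \<eta>] th2_int]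
    integrable_mult_test[OF space_gradient_test[OF \<psi>] th2v_component_int] integrable_mult_test[OF space_gradient_test[OF \<eta>] th2v_component_int]
  show "dissipation (\<lambda>z. \<psi> z + \<eta> z) = dissipation \<psi> + dissipation \<eta>"
    unfolding dissipation_def t x inner_add_left distrib_left
    using i by (simp add: sum.distrib algebra_simps del: inner_scaleR_left)
next
  fix c \<psi> assume \<psi>: "\<psi> \<in> test_functions T"
  have t: "time_deriv (\<lambda>z. c * \<psi> z) z = c * time_deriv \<psi> z" for z
    using DERIV_cmult[OF smooth_fun_has_time_deriv(1)[OF test_functionsD(1)[OF \<psi>]], of c]
    by (cases z) (auto intro: time_deriv_unique)
  have x: "space_gradient (\<lambda>z. c * \<psi> z) z = c *\<^sub>R space_gradient \<psi> z" for z
    using has_derivative_mult_right[OF smooth_fun_has_space_gradient(1)[OF test_functionsD(1)[OF \<psi>]], of c]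
    by (cases z) (auto intro!: space_gradient_unique)
  show "dissipation (\<lambda>z. c * \<psi> z) = c * dissipation \<psi>"
    unfolding dissipation_def t x inner_scaleR_left[of c] mult.left_commute[of _ c] Bochner_Integration.integral_mult_right_zero
    by (simp add: algebra_simps sum_distrib_left)
next
  fix \<psi> assume n: "null_sequence T \<psi>"
  have \<psi>: "\<And>k. \<psi> k \<in> test_functions T"
    and u: "\<And>bs. set bs \<subseteq> Basis \<Longrightarrow> uniform_limit UNIV (\<lambda>k. pderivs bs (\<psi> k)) (\<lambda>_. 0) sequentially"
    using n by (auto simp: null_sequence_def)
  have "time_deriv (\<psi> k) = pderivs [(1, 0)] (\<psi> k)" for k
    using smooth_fun_has_time_deriv(2)[OF test_functionsD(1)[OF \<psi>]] by auto
  then have ut: "uniform_limit UNIV (\<lambda>k. time_deriv (\<psi> k)) (\<lambda>_. 0) sequentially"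
    using u[of "[(1, 0)]"] by (simp add: Basis_prod_def)
  have "(\<lambda>z. space_gradient (\<psi> k) z \<bullet> b) = pderivs [(0, b)] (\<psi> k)" if "b \<in> Basis" for k b
    using space_gradient_inner[OF \<psi> that] by simp
  then have ux: "uniform_limit UNIV (\<lambda>k z. space_gradient (\<psi> k) z \<bullet> b) (\<lambda>_. 0) sequentially" if "b \<in> Basis" for b
    using u[of "[(0, b)]"] that by (simp add: Basis_prod_def)
  have "(\<lambda>k. dissipation (\<psi> k)) \<longlonglongrightarrow> - (1/2) * (0 + (\<Sum>b\<in>(Basis::space set). 0))"
    unfolding dissipation_def
    by (intro tendsto_intros integral_uniform_null th2_int th2v_component_int time_deriv_test space_gradient_test \<psi> ut ux)
  then show "(\<lambda>k. dissipation (\<psi> k)) \<longlonglongrightarrow> 0" by simp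
qed

lemma is_distribution_scale:
  assumes "is_distribution T D" shows "is_distribution T (\<lambda>\<psi>. c * D \<psi>)"
  using assms unfolding is_distribution_def
  by (auto simp: distrib_left mult.left_commute intro: tendsto_mult_right_zero)

text \<open>Both averages, once tested with \<psi>, converge to multiples of
  \<open>energy_corr\<close> at 0, which is also the left-hand side of the energy equation. Thus S
  can be exhibited directly as -4/3 times \<open>dissipation\<close>.\<close>

lemma four_thirds_law:
  "\<exists>D. is_distribution T D \<and>
      tendsto_dist T (D_eps v \<theta>) D (at_right 0) \<and>
      (\<forall>\<psi>\<in>test_functions T.
        dist_dt T (\<lambda>z. 1/2 * \<bar>\<theta> z\<bar>\<^sup>2) \<psi> + dist_div T (\<lambda>z. (1/2 * (\<theta> z)\<^sup>2) *\<^sub>R v z) \<psi> = D \<psi>) \<and>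
      (\<exists>S. is_distribution T S \<and>
        tendsto_dist T (\<lambda>r z. - sphere_flux v \<theta> r z) S (at_right 0) \<and>
        (\<forall>\<psi>\<in>test_functions T. S \<psi> = - (4/3) * D \<psi>))"
proof -
  have eq: "dissipation \<psi> = flow_test.energy_corr T v \<theta> \<psi> 0" if "\<psi> \<in> test_functions T" for \<psi>
  proof -
    interpret flow_psi T v \<theta> W \<psi> by (rule flow_psiI[OF that])
    show ?thesis by (simp only: dissipation_def energy_corr_0_eq)
  qed
  have "\<forall>\<^sub>F e in at_right 0. locally_integrable T (D_eps v \<theta> e)"
    using eventually_at_right_less[of "0::real"] by eventually_elim (intro locally_integrable_cyl D_eps_integrable)
  then have D: "tendsto_dist T (D_eps v \<theta>) dissipation (at_right 0)"
    unfolding tendsto_dist_def using flow_psi.D_eps_tendsto[OF flow_psiI] by (auto simp: eq)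
  have "\<forall>\<^sub>F r in at_right 0. locally_integrable T (\<lambda>z. - sphere_flux v \<theta> r z)"
    by (intro always_eventually allI locally_integrable_cyl sphere_flux_integrable)
  then have S: "tendsto_dist T (\<lambda>r z. - sphere_flux v \<theta> r z) (\<lambda>\<psi>. - (4/3) * dissipation \<psi>) (at_right 0)"
    unfolding tendsto_dist_def using flow_psi.sphere_flux_tendsto[OF flow_psiI] by (auto simp: eq)
  have E: "dist_dt T (\<lambda>z. 1/2 * \<bar>\<theta> z\<bar>\<^sup>2) \<psi> + dist_div T (\<lambda>z. (1/2 * (\<theta> z)\<^sup>2) *\<^sub>R v z) \<psi> = dissipation \<psi>"
    if \<psi>: "\<psi> \<in> test_functions T" for \<psi>
    unfolding eq[OF \<psi>] by (rule flow_psi.energy_equation[OF flow_psiI[OF \<psi>]])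
  show ?thesis
  proof (rule exI[of _ dissipation], intro conjI ballI)
    show "\<exists>S. is_distribution T S \<and> tendsto_dist T (\<lambda>r z. - sphere_flux v \<theta> r z) S (at_right 0) \<and>
        (\<forall>\<psi>\<in>test_functions T. S \<psi> = - (4/3) * dissipation \<psi>)"
      by (rule exI[of _ "\<lambda>\<psi>. - (4/3) * dissipation \<psi>"], intro conjI ballI refl S
          is_distribution_scale dissipation_distribution)
  qed (fact dissipation_distribution D E)+
qed

end

section \<open>From mixed Lebesgue norms to a single integrable majorant\<close>

section \<open>Reduction of the integrability hypotheses\<close>

text \<open>With M the larger of the two powers, x <= M^(1/s) and y <= M^(1/u), and the exponents
  collected from x y^2 add up to 1.\<close>

lemma young_three:
  fixes x y s u :: real
  assumes "0 \<le> x" "0 \<le> y" "0 < s" "0 < u" "2 / u + 1 / s = 1"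
  shows "x * y\<^sup>2 \<le> x powr s + y powr u"
proof -
  define M where "M = max (x powr s) (y powr u)"
  have M: "x powr s \<le> M" "y powr u \<le> M" "0 \<le> M" by (auto simp: M_def le_max_iff_disj)
  have "x = (x powr s) powr (1 / s)" "y = (y powr u) powr (1 / u)" using assms by (simp_all add: powr_powr)
  then have "x \<le> M powr (1 / s)" "y \<le> M powr (1 / u)"
    using powr_mono2[of "1 / s" "x powr s" M] powr_mono2[of "1 / u" "y powr u" M] assms M by auto
  then have "x * y\<^sup>2 \<le> M powr (1 / s) * (M powr (1 / u))\<^sup>2"
    using assms by (intro mult_mono power_mono) auto
  also have "\<dots> = M powr (1 / s + (1 / u + 1 / u))" by (simp only: powr_add power2_eq_square)
  also have "1 / s + (1 / u + 1 / u) = 1" using assms(5) by simp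
  finally have "x * y\<^sup>2 \<le> M" using M(3) by simp
  also have "M \<le> x powr s + y powr u" by (simp add: M_def)
  finally show ?thesis .
qed

lemma powr_add_le:
  fixes x y s :: real
  assumes "0 \<le> x" "0 \<le> y" "0 < s"
  shows "(x + y) powr s \<le> 2 powr s * (x powr s + y powr s)"
proof -
  have "(x + y) powr s \<le> (2 * max x y) powr s" using assms by (intro powr_mono2) auto
  also have "\<dots> = 2 powr s * max x y powr s" using assms by (simp add: powr_mult)
  also have "\<dots> \<le> 2 powr s * (x powr s + y powr s)" by (intro mult_left_mono) (auto simp: max_def)
  finally show ?thesis .
qed

definition slice_norm :: "real \<Rightarrow> (spacetime \<Rightarrow> 'b::real_normed_vector) \<Rightarrow> real \<Rightarrow> real" where
  "slice_norm q f t = (\<integral>x. norm (f (t, x)) powr q \<partial>cell_measure) powr (1 / q)"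

text \<open>Young's inequality for the fields divided by 1 plus their slice norms, multiplied back
  by these factors. The normalisation is there because time and space exponents differ: |v|^n and
  |\<theta>|^q need not be integrable over space-time, whereas the normalised powers have slice
  integrals bounded uniformly in t. The added 1 avoids division by 0.\<close>

definition majorant :: "real \<Rightarrow> real \<Rightarrow> (spacetime \<Rightarrow> space) \<Rightarrow> (spacetime \<Rightarrow> real) \<Rightarrow> spacetime \<Rightarrow> real" where
  "majorant n q v \<theta> z = (1 + slice_norm n v (fst z)) * (1 + slice_norm q \<theta> (fst z))\<^sup>2 *
     (2 powr n * ((1 + norm (v z)) / (1 + slice_norm n v (fst z))) powr n
      + 2 powr q * ((1 + \<bar>\<theta> z\<bar>) / (1 + slice_norm q \<theta> (fst z))) powr q)"

lemma slice_norm_nonneg: "0 \<le> slice_norm q f t" by (simp add: slice_norm_def)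

lemma slice_norm_borel [measurable]:
  assumes [measurable]: "f \<in> borel_measurable borel"
  shows "slice_norm q f \<in> borel_measurable borel"
  unfolding slice_norm_def[abs_def]
  by measurable

text \<open>A spatial shift does not change t, so the slice norms at z and at its shift coincide and
  can be taken out before Young's inequality is applied to the sums of normalised
  quantities.\<close>

lemma majorant_dominates:
  assumes "1 < n" "1 < q" "2 / q + 1 / n = 1"
  shows "(1 + norm (v z) + norm (v (shift l z))) * (2 + \<bar>\<theta> z\<bar> + \<bar>\<theta> (shift l z)\<bar>)\<^sup>2
    \<le> majorant n q v \<theta> z + majorant n q v \<theta> (shift l z)"
proof -
  let ?a = "1 + slice_norm n v (fst z)" and ?b = "1 + slice_norm q \<theta> (fst z)"
  have a: "0 < ?a" and b: "0 < ?b" using slice_norm_nonneg by (smt (verit))+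
  let ?x = "(1 + norm (v z)) / ?a" and ?x' = "(1 + norm (v (shift l z))) / ?a"
  let ?y = "(1 + \<bar>\<theta> z\<bar>) / ?b" and ?y' = "(1 + \<bar>\<theta> (shift l z)\<bar>) / ?b"
  have nn: "0 \<le> ?x" "0 \<le> ?x'" "0 \<le> ?y" "0 \<le> ?y'" using a b by auto
  have eqx: "?a * (?x + ?x') = (1 + norm (v z)) + (1 + norm (v (shift l z)))"
    using a by (simp add: add_divide_distrib[symmetric])
  have eqy: "?b * (?y + ?y') = (1 + \<bar>\<theta> z\<bar>) + (1 + \<bar>\<theta> (shift l z)\<bar>)"
    using b by (simp add: add_divide_distrib[symmetric])
  have "(1 + norm (v z) + norm (v (shift l z))) * (2 + \<bar>\<theta> z\<bar> + \<bar>\<theta> (shift l z)\<bar>)\<^sup>2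
    \<le> (?a * (?x + ?x')) * (?b * (?y + ?y'))\<^sup>2"
    unfolding eqx eqy by (intro mult_mono) auto
  also have "\<dots> = ?a * ?b\<^sup>2 * ((?x + ?x') * (?y + ?y')\<^sup>2)" by (simp only: power_mult_distrib mult_ac)
  also have "\<dots> \<le> ?a * ?b\<^sup>2 * ((?x + ?x') powr n + (?y + ?y') powr q)"
    using assms nn a b by (intro mult_left_mono young_three) auto
  also have "\<dots> \<le> ?a * ?b\<^sup>2 * (2 powr n * (?x powr n + ?x' powr n) + 2 powr q * (?y powr q + ?y' powr q))"
    using assms nn a b by (intro mult_left_mono add_mono powr_add_le) auto
  also have "\<dots> = majorant n q v \<theta> z + majorant n q v \<theta> (shift l z)"
    by (simp add: majorant_def algebra_simps)
  finally show ?thesis .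
qed

text \<open>The slice integral of |f|^q is the q-th power of the slice norm, so after normalisation
  it is bounded by a constant that depends on q alone.\<close>

lemma slice_power_le:
  fixes f :: "spacetime \<Rightarrow> 'b::real_normed_vector"
  assumes [measurable]: "f \<in> borel_measurable borel" and q: "0 < q"
    and int: "integrable cell_measure (\<lambda>x. norm (f (t, x)) powr q)"
  shows "(\<integral>\<^sup>+x. ennreal (((1 + norm (f (t, x))) / (1 + slice_norm q f t)) powr q) \<partial>cell_measure) \<le> ennreal (2 * 2 powr q)"
proof -
  let ?a = "1 + slice_norm q f t"
  have a: "1 \<le> ?a" using slice_norm_nonneg by simp
  have I: "(\<integral>x. norm (f (t, x)) powr q \<partial>cell_measure) = slice_norm q f t powr q"
    using q by (simp add: slice_norm_def powr_powr)
  have pt: "((1 + norm (f (t, x))) / ?a) powr q \<le> 2 powr q / ?a powr q * (1 + norm (f (t, x)) powr q)" for x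
  proof -
    have "((1 + norm (f (t, x))) / ?a) powr q = (1 + norm (f (t, x))) powr q / ?a powr q"
      by (rule powr_divide)
    also have "\<dots> \<le> 2 powr q * (1 powr q + norm (f (t, x)) powr q) / ?a powr q"
      using q by (intro divide_right_mono powr_add_le) auto
    finally show ?thesis by simp
  qed
  have "(\<integral>\<^sup>+x. ennreal (((1 + norm (f (t, x))) / ?a) powr q) \<partial>cell_measure)
      \<le> (\<integral>\<^sup>+x. ennreal (2 powr q / ?a powr q * (1 + norm (f (t, x)) powr q)) \<partial>cell_measure)"
    by (intro nn_integral_mono ennreal_leI pt)
  also have "\<dots> = ennreal (\<integral>x. 2 powr q / ?a powr q * (1 + norm (f (t, x)) powr q) \<partial>cell_measure)"
    using int by (intro nn_integral_eq_integral) auto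
  also have "(\<integral>x. 2 powr q / ?a powr q * (1 + norm (f (t, x)) powr q) \<partial>cell_measure)
      = 2 powr q / ?a powr q * (1 + slice_norm q f t powr q)"
    using int I by simp
  also have "\<dots> \<le> 2 powr q / ?a powr q * (?a powr q + ?a powr q)"
    using q a slice_norm_nonneg[of q f t] by (intro mult_left_mono add_mono powr_mono2 ge_one_powr_ge_zero) auto
  also have "\<dots> = 2 * 2 powr q" using a by simp
  finally show ?thesis by (simp add: ennreal_leI)
qed

text \<open>The spatial integral at time t is at most a constant times one plus the slice norm of v,
  times the square of one plus the slice norm of \<theta>. A second application of Young's
  inequality, with the time exponents, bounds this by powers that are integrable in t.\<close>

lemma majorant_integrable:
  assumes [measurable]: "v \<in> borel_measurable borel" "\<theta> \<in> borel_measurable borel"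
    and pq: "1 < p" "1 < q" "1 < m" "1 < n" "2 / p + 1 / m = 1" "2 / q + 1 / n = 1"
    and v: "AE t in time_measure T. integrable cell_measure (\<lambda>x. norm (v (t, x)) powr n)"
    and v': "integrable (time_measure T) (\<lambda>t. slice_norm n v t powr m)"
    and th: "AE t in time_measure T. integrable cell_measure (\<lambda>x. norm (\<theta> (t, x)) powr q)"
    and th': "integrable (time_measure T) (\<lambda>t. slice_norm q \<theta> t powr p)"
  shows "majorant n q v \<theta> \<in> borel_measurable borel" "integrable (cyl_measure T) (majorant n q v \<theta>)"
proof -
  show [measurable]: "majorant n q v \<theta> \<in> borel_measurable borel"
    unfolding majorant_def[abs_def] by measurable
  let ?a = "\<lambda>t. 1 + slice_norm n v t" and ?b = "\<lambda>t. 1 + slice_norm q \<theta> t"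
  have ab: "0 < ?a t" "0 < ?b t" for t using slice_norm_nonneg by (smt (verit))+
  define K where "K = 2 powr n * (2 * 2 powr n) + 2 powr q * (2 * 2 powr q)"
  let ?g = "\<lambda>t. K * (2 powr m * (1 + slice_norm n v t powr m) + 2 powr p * (1 + slice_norm q \<theta> t powr p))"
  have K0: "0 \<le> K" by (simp add: K_def)
  have Wnn: "0 \<le> majorant n q v \<theta> z" for z
    unfolding majorant_def by (intro mult_nonneg_nonneg add_nonneg_nonneg slice_norm_nonneg) auto
  have "(\<integral>\<^sup>+z. ennreal (norm (majorant n q v \<theta> z)) \<partial>cyl_measure T)
     = (\<integral>\<^sup>+t. \<integral>\<^sup>+x. ennreal (majorant n q v \<theta> (t, x)) \<partial>cell_measure \<partial>time_measure T)"
    using Wnn by (subst nn_integral_cyl) auto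
  also have "\<dots> \<le> (\<integral>\<^sup>+t. ennreal (?g t) \<partial>time_measure T)"
  proof (rule nn_integral_mono_AE, use v th in eventually_elim)
    case (elim t)
    have "(\<integral>\<^sup>+x. ennreal (majorant n q v \<theta> (t, x)) \<partial>cell_measure)
      = (\<integral>\<^sup>+x. ennreal (?a t * (?b t)\<^sup>2) * (ennreal (2 powr n) * ennreal (((1 + norm (v (t, x))) / ?a t) powr n)
          + ennreal (2 powr q) * ennreal (((1 + norm (\<theta> (t, x))) / ?b t) powr q)) \<partial>cell_measure)"
      using ab[of t] by (intro nn_integral_cong) (simp add: majorant_def flip: ennreal_mult ennreal_plus)
    also have "\<dots> = ennreal (?a t * (?b t)\<^sup>2) * (ennreal (2 powr n) * (\<integral>\<^sup>+x. ennreal (((1 + norm (v (t, x))) / ?a t) powr n) \<partial>cell_measure)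
          + ennreal (2 powr q) * (\<integral>\<^sup>+x. ennreal (((1 + norm (\<theta> (t, x))) / ?b t) powr q) \<partial>cell_measure))"
      by (simp add: nn_integral_cmult nn_integral_add)
    also have "\<dots> \<le> ennreal (?a t * (?b t)\<^sup>2) * (ennreal (2 powr n) * ennreal (2 * 2 powr n)
          + ennreal (2 powr q) * ennreal (2 * 2 powr q))"
      using pq elim by (intro mult_left_mono add_mono slice_power_le) auto
    also have "\<dots> = ennreal (?a t * (?b t)\<^sup>2 * K)"
      using ab[of t] K0 by (simp add: K_def flip: ennreal_mult ennreal_plus)
    also have "\<dots> \<le> ennreal (?g t)"
    proof (rule ennreal_leI)
      \<comment> \<open>The relation 2/p + 1/m = 1 enters here; its counterpart 2/q + 1/n = 1 in
        space is used in \<open>majorant_dominates\<close>.\<close>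
      have "?a t * (?b t)\<^sup>2 \<le> ?a t powr m + ?b t powr p"
        using ab[of t] pq by (intro young_three) auto
      also have "\<dots> \<le> 2 powr m * (1 powr m + slice_norm n v t powr m) + 2 powr p * (1 powr p + slice_norm q \<theta> t powr p)"
        using pq by (intro add_mono powr_add_le slice_norm_nonneg) auto
      finally show "?a t * (?b t)\<^sup>2 * K \<le> ?g t"
        using K0 by (simp add: mult.commute[of _ K] mult_left_mono)
    qed
    finally show ?case .
  qed
  also have "\<dots> < \<infinity>"
  proof -
    have "integrable (time_measure T) ?g" using v' th' by auto
    moreover have "0 \<le> ?g t" for t using K0 by (intro mult_nonneg_nonneg add_nonneg_nonneg) auto
    ultimately show ?thesis by (subst nn_integral_eq_integral) auto
  qed
  finally show "integrable (cyl_measure T) (majorant n q v \<theta>)" by (simp add: integrable_iff_bounded)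
qed

text \<open>The hypotheses control the fields on (0,T) only. Extension by 0 gives Borel functions on
  all of space-time, periodic in x, and the integrals in the theorem run over times in
  (0,T).\<close>

definition zero_ext :: "real \<Rightarrow> (spacetime \<Rightarrow> 'b::real_normed_vector) \<Rightarrow> spacetime \<Rightarrow> 'b" where
  "zero_ext T f z = (if fst z \<in> {0<..<T} then f z else 0)"

lemma zero_ext_properties:
  fixes f :: "spacetime \<Rightarrow> 'b::real_normed_vector"
  assumes "torus_field T f"
  shows "zero_ext T f \<in> borel_measurable borel" "x_periodic (zero_ext T f)"
    "\<And>t x. t \<notin> {0<..<T} \<Longrightarrow> zero_ext T f (t, x) = 0"
proof -
  have S: "{0<..<T} \<times> UNIV \<in> sets (borel :: spacetime measure)" unfolding borel_spacetime by measurable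
  have "(\<lambda>z. indicator ({0<..<T} \<times> UNIV) z *\<^sub>R f z) \<in> borel_measurable borel"
    using assms S by (subst borel_measurable_restrict_space_iff[symmetric]) (auto simp: torus_field_def)
  also have "(\<lambda>z. indicator ({0<..<T} \<times> UNIV) z *\<^sub>R f z) = zero_ext T f"
    by (auto simp: zero_ext_def fun_eq_iff split: split_indicator)
  finally show "zero_ext T f \<in> borel_measurable borel" .
  show "x_periodic (zero_ext T f)" using assms by (auto simp: x_periodic_def periodic_def zero_ext_def torus_field_def)
qed (auto simp: zero_ext_def)

lemma AE_time_measure:
  "(AE t in time_measure T. P t) \<longleftrightarrow> (AE t in lborel. t \<in> {0<..<T} \<longrightarrow> P t)"
proof -
  have "(0 < (indicator {0<..<T} t :: ennreal)) = (t \<in> {0<..<T})" for t by (simp split: split_indicator)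
  then show ?thesis unfolding time_measure_def by (subst AE_density) auto
qed

lemma integrable_time_measure:
  assumes [measurable]: "f \<in> borel_measurable borel"
  shows "integrable (time_measure T) f \<longleftrightarrow> set_integrable lborel {0<..<T} (f :: real \<Rightarrow> real)"
proof -
  have *: "time_measure T = density lborel (\<lambda>t. ennreal (indicator {0<..<T} t))"
    unfolding time_measure_def by (rule arg_cong[where f = "density lborel"]) (auto split: split_indicator)
  show ?thesis unfolding * set_integrable_def by (subst integrable_density) auto
qed

lemma cell_measure_set_integral:
  fixes f :: "space \<Rightarrow> real"
  assumes [measurable]: "f \<in> borel_measurable borel"
  shows "integrable cell_measure f \<longleftrightarrow> set_integrable lborel torus_cell f"
    and "(\<integral>x. f x \<partial>cell_measure) = (LINT x:torus_cell|lborel. f x)"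
proof -
  have *: "cell_measure = density lborel (\<lambda>x. ennreal (indicator torus_cell x))"
    unfolding cell_measure_def by (rule arg_cong[where f = "density lborel"]) (auto split: split_indicator)
  show "integrable cell_measure f \<longleftrightarrow> set_integrable lborel torus_cell f"
    unfolding * set_integrable_def by (subst integrable_density) auto
  show "(\<integral>x. f x \<partial>cell_measure) = (LINT x:torus_cell|lborel. f x)"
    unfolding * set_lebesgue_integral_def by (subst integral_density) auto
qed

lemma slices_zero_ext:
  fixes f :: "spacetime \<Rightarrow> 'b::real_normed_vector"
  assumes f: "torus_field T f" and t: "t \<in> {0<..<T}"
  shows "in_Lq q (\<lambda>x. f (t, x)) \<longleftrightarrow> integrable cell_measure (\<lambda>x. norm (zero_ext T f (t, x)) powr q)"
    and "Lq_norm q (\<lambda>x. f (t, x)) = slice_norm q (zero_ext T f) t"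
proof -
  note [measurable] = zero_ext_properties(1)[OF f]
  have eq: "f (t, x) = zero_ext T f (t, x)" for x using t by (simp add: zero_ext_def)
  show "in_Lq q (\<lambda>x. f (t, x)) \<longleftrightarrow> integrable cell_measure (\<lambda>x. norm (zero_ext T f (t, x)) powr q)"
    unfolding in_Lq_def eq by (rule cell_measure_set_integral(1)[symmetric]) measurable
  show "Lq_norm q (\<lambda>x. f (t, x)) = slice_norm q (zero_ext T f) t"
    unfolding Lq_norm_def slice_norm_def eq by (subst cell_measure_set_integral(2)) auto
qed

lemma in_LpLq_zero_ext:
  fixes f :: "spacetime \<Rightarrow> 'b::real_normed_vector"
  assumes "in_LpLq T p q f"
  shows "AE t in time_measure T. integrable cell_measure (\<lambda>x. norm (zero_ext T f (t, x)) powr q)"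
    and "integrable (time_measure T) (\<lambda>t. slice_norm q (zero_ext T f) t powr p)"
proof -
  have f: "torus_field T f" using assms by (simp add: in_LpLq_def)
  note [measurable] = zero_ext_properties(1)[OF f]
  show "AE t in time_measure T. integrable cell_measure (\<lambda>x. norm (zero_ext T f (t, x)) powr q)"
    unfolding AE_time_measure using assms
    by (auto simp: in_LpLq_def slices_zero_ext(1)[OF f] elim!: eventually_mono)
  have "set_integrable lborel {0<..<T} (\<lambda>t. slice_norm q (zero_ext T f) t powr p)
      \<longleftrightarrow> set_integrable lborel {0<..<T} (\<lambda>t. Lq_norm q (\<lambda>x. f (t, x)) powr p)"
    unfolding set_integrable_def
    by (intro Bochner_Integration.integrable_cong refl) (auto simp: slices_zero_ext(2)[OF f] split: split_indicator)
  then show "integrable (time_measure T) (\<lambda>t. slice_norm q (zero_ext T f) t powr p)"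
    using assms by (subst integrable_time_measure) (auto simp: in_LpLq_def)
qed

text \<open>From (1 + a)^2 <= 2 + 2 a^2. This is the point where the hypothesis \<theta> in
  L^infinity(0,T;L2) supplies the slice bounds.\<close>

lemma in_LinfLq_slice:
  fixes f :: "spacetime \<Rightarrow> real"
  assumes "in_LinfLq T 2 f"
  shows "slice_bounded T (\<lambda>z. (1 + \<bar>zero_ext T f z\<bar>)\<^sup>2)"
proof -
  have f: "torus_field T f" using assms by (simp add: in_LinfLq_def)
  note [measurable] = zero_ext_properties(1)[OF f]
  obtain C where C: "AE t in lborel. t \<in> {0<..<T} \<longrightarrow> in_Lq 2 (\<lambda>x. f (t, x)) \<and> Lq_norm 2 (\<lambda>x. f (t, x)) \<le> C"
    using assms by (auto simp: in_LinfLq_def)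
  have "AE t in time_measure T. (\<integral>\<^sup>+x. ennreal \<bar>(1 + \<bar>zero_ext T f (t, x)\<bar>)\<^sup>2\<bar> \<partial>cell_measure) \<le> ennreal (2 + 2 * C\<^sup>2)"
    unfolding AE_time_measure using C
  proof eventually_elim
    case (elim t)
    show ?case
    proof
      assume t: "t \<in> {0<..<T}"
      let ?g = "\<lambda>x. zero_ext T f (t, x)"
      have p2: "norm (?g x) powr 2 = (?g x)\<^sup>2" for x by (cases "?g x = 0") (auto simp: powr_numeral)
      have i: "integrable cell_measure (\<lambda>x. (?g x)\<^sup>2)" and s: "slice_norm 2 (zero_ext T f) t \<le> C"
        using elim t slices_zero_ext(1)[OF f t, of 2] slices_zero_ext(2)[OF f t, of 2] by (auto simp: p2)
      have I: "(\<integral>x. (?g x)\<^sup>2 \<partial>cell_measure) = (slice_norm 2 (zero_ext T f) t)\<^sup>2"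
        unfolding slice_norm_def p2 by (simp add: powr_half_sqrt)
      have "(\<integral>\<^sup>+x. ennreal \<bar>(1 + \<bar>?g x\<bar>)\<^sup>2\<bar> \<partial>cell_measure) \<le> (\<integral>\<^sup>+x. ennreal (2 + 2 * (?g x)\<^sup>2) \<partial>cell_measure)"
      proof (intro nn_integral_mono ennreal_leI)
        fix x
        have "0 \<le> (1 - \<bar>?g x\<bar>)\<^sup>2" by simp
        then show "\<bar>(1 + \<bar>?g x\<bar>)\<^sup>2\<bar> \<le> 2 + 2 * (?g x)\<^sup>2" by (simp add: power2_eq_square algebra_simps)
      qed
      also have "\<dots> = ennreal (\<integral>x. 2 + 2 * (?g x)\<^sup>2 \<partial>cell_measure)"
        using i by (intro nn_integral_eq_integral) auto
      also have "(\<integral>x. 2 + 2 * (?g x)\<^sup>2 \<partial>cell_measure) = 2 + 2 * (slice_norm 2 (zero_ext T f) t)\<^sup>2" using i I by simp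
      also have "\<dots> \<le> 2 + 2 * C\<^sup>2" using s slice_norm_nonneg[of 2 "zero_ext T f" t] by (simp add: power_mono)
      finally show "(\<integral>\<^sup>+x. ennreal \<bar>(1 + \<bar>?g x\<bar>)\<^sup>2\<bar> \<partial>cell_measure) \<le> ennreal (2 + 2 * C\<^sup>2)" by (simp add: ennreal_leI)
    qed
  qed
  then show ?thesis unfolding slice_bounded_def by blast
qed

lemma cyl_integral_cong:
  fixes f g :: "spacetime \<Rightarrow> real"
  assumes "\<And>z. fst z \<in> {0<..<T} \<Longrightarrow> f z = g z"
  shows "(LINT z:torus_cyl T|lborel. f z) = (LINT z:torus_cyl T|lborel. g z)"
  unfolding set_lebesgue_integral_def
  by (rule Bochner_Integration.integral_cong) (use assms in \<open>auto simp: torus_cyl_def split: split_indicator\<close>)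

lemma tendsto_dist_cong:
  assumes "\<And>r z. fst z \<in> {0<..<T} \<Longrightarrow> f r z = g r z"
  shows "tendsto_dist T f D F \<longleftrightarrow> tendsto_dist T g D F"
proof -
  have "dist_of T (f r) \<psi> = dist_of T (g r) \<psi>" for r \<psi>
    unfolding dist_of_def by (rule cyl_integral_cong) (simp add: assms)
  moreover have "locally_integrable T (f r) \<longleftrightarrow> locally_integrable T (g r)" for r
  proof -
    have "set_integrable lborel ({a..b} \<times> torus_cell) (f r) = set_integrable lborel ({a..b} \<times> torus_cell) (g r)"
      if "0 < a" "b < T" for a b
      unfolding set_integrable_def
      by (rule Bochner_Integration.integrable_cong) (use assms that in \<open>auto split: split_indicator\<close>)
    then show ?thesis unfolding locally_integrable_def by metis
  qed
  ultimately show ?thesis by (simp add: tendsto_dist_def)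
qed

theorem theorem1p1:
  fixes T p q m n :: real
    and v :: "real \<times> (real ^ 3) \<Rightarrow> real ^ 3"
    and \<theta> :: "real \<times> (real ^ 3) \<Rightarrow> real"
  assumes "T > 0"
    and "1 < p" and "1 < q" and "1 < m" and "1 < n"
    and "2 / p + 1 / m = 1" and "2 / q + 1 / n = 1"
    and "in_LinfLq T 2 \<theta>" and "in_LpLq T p q \<theta>" and "in_LpLq T m n v"
    and "weak_solution T v \<theta>"
  shows "\<exists>D. is_distribution T D \<and>
      tendsto_dist T (D_eps v \<theta>) D (at_right 0) \<and>
      (\<forall>\<psi>\<in>test_functions T.
        dist_dt T (\<lambda>z. 1/2 * \<bar>\<theta> z\<bar>\<^sup>2) \<psi> + dist_div T (\<lambda>z. (1/2 * (\<theta> z)\<^sup>2) *\<^sub>R v z) \<psi> = D \<psi>) \<and>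
      (\<exists>S. is_distribution T S \<and>
        tendsto_dist T (\<lambda>r z. - sphere_flux v \<theta> r z) S (at_right 0) \<and>
        (\<forall>\<psi>\<in>test_functions T. S \<psi> = - (4/3) * D \<psi>))"
proof -
  \<comment> \<open>The whole argument runs for the extended fields; the original ones return only
    in the final comparison on (0,T).\<close>
  define v0 where "v0 = zero_ext T v"
  define \<theta>0 where "\<theta>0 = zero_ext T \<theta>"
  have fields: "torus_field T v" "torus_field T \<theta>" using assms(9,10) by (auto simp: in_LpLq_def)
  have v0: "v0 z = v z" and th0: "\<theta>0 z = \<theta> z" if "fst z \<in> {0<..<T}" for z
    using that by (simp_all add: v0_def \<theta>0_def zero_ext_def)
  note props = zero_ext_properties[OF fields(1), folded v0_def] zero_ext_properties[OF fields(2), folded \<theta>0_def]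
  note W = majorant_integrable[OF props(1,4) assms(2-7) in_LpLq_zero_ext[OF assms(10), folded v0_def]
      in_LpLq_zero_ext[OF assms(9), folded \<theta>0_def]]
  have W_per: "x_periodic (majorant n q v0 \<theta>0)"
    using props(2,5) by (simp add: x_periodic_def periodic_def majorant_def)
  \<comment> \<open>The estimates precede the equations: integrability of v, \<theta> and \<theta>
    v, obtained in \<open>flow_base\<close>, is what permits rewriting the weak formulation as
    \<open>solves\<close>.\<close>
  interpret flow_base T v0 \<theta>0 "majorant n q v0 \<theta>0"
    by unfold_locales
      (fact props W W_per majorant_dominates[OF assms(5,3,7)] in_LinfLq_slice[OF assms(8), folded \<theta>0_def])+
  have weak: "(LINT z:torus_cyl T|lborel. f z) = (\<integral>z. g z \<partial>cyl_measure T)"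
    if "\<And>z. fst z \<in> {0<..<T} \<Longrightarrow> f z = g z" "integrable (cyl_measure T) g" for f g :: "spacetime \<Rightarrow> real"
  proof -
    have "g \<in> borel_measurable borel" using that(2) by (auto dest: borel_measurable_integrable)
    then show ?thesis
      using cyl_integral_cong[of T f g] that(1) by (simp add: set_lebesgue_integral_def integral_cyl_eq_lborel(1))
  qed
  interpret flow T v0 \<theta>0 "majorant n q v0 \<theta>0"
  proof unfold_locales
    show "solves T \<theta>0 (\<lambda>z. \<theta>0 z *\<^sub>R v0 z)"
      unfolding solves_def
    proof
      fix \<psi> assume \<psi>: "\<psi> \<in> test_functions T"
      have i: "integrable (cyl_measure T) (\<lambda>z. \<theta>0 z * time_deriv \<psi> z)"
        "integrable (cyl_measure T) (\<lambda>z. (\<theta>0 z *\<^sub>R v0 z) \<bullet> space_gradient \<psi> z)"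
        using integrable_mult_test[OF time_deriv_test[OF \<psi>] th_int] integrable_inner_gradient[OF \<psi> thv_int] by auto
      have "dist_dt T \<theta> \<psi> = - (\<integral>z. \<theta>0 z * time_deriv \<psi> z \<partial>cyl_measure T)"
        unfolding dist_dt_def by (subst weak[OF _ i(1)]) (auto simp: th0)
      moreover have "dist_div T (\<lambda>z. \<theta> z *\<^sub>R v z) \<psi> = - (\<integral>z. (\<theta>0 z *\<^sub>R v0 z) \<bullet> space_gradient \<psi> z \<partial>cyl_measure T)"
        unfolding dist_div_def by (subst weak[OF _ i(2)]) (auto simp: th0 v0)
      moreover have "dist_dt T \<theta> \<psi> + dist_div T (\<lambda>z. \<theta> z *\<^sub>R v z) \<psi> = 0"
        using assms(11) \<psi> by (simp add: weak_solution_def)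
      ultimately show "(\<integral>z. \<theta>0 z * time_deriv \<psi> z + (\<theta>0 z *\<^sub>R v0 z) \<bullet> space_gradient \<psi> z \<partial>cyl_measure T) = 0"
        using i by (simp del: inner_scaleR_left)
    qed
    show "solves T (\<lambda>_. 0) v0"
      unfolding solves_def
    proof
      fix \<psi> assume \<psi>: "\<psi> \<in> test_functions T"
      have "dist_div T v \<psi> = - (\<integral>z. v0 z \<bullet> space_gradient \<psi> z \<partial>cyl_measure T)"
        unfolding dist_div_def by (subst weak[OF _ integrable_inner_gradient[OF \<psi> v_int]]) (auto simp: v0)
      then show "(\<integral>z. 0 * time_deriv \<psi> z + v0 z \<bullet> space_gradient \<psi> z \<partial>cyl_measure T) = 0"
        using assms(11) \<psi> by (simp add: weak_solution_def)
    qed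
  qed
  \<comment> \<open>Increments compare points at the same time, so for times in (0,T) the extension
    does not change them.\<close>
  have inc: "increment v0 l z = increment v l z" "increment \<theta>0 l z = increment \<theta> l z" if "fst z \<in> {0<..<T}" for l z
    using that by (auto simp: increment_shift v0 th0)
  have "tendsto_dist T (D_eps v0 \<theta>0) D F = tendsto_dist T (D_eps v \<theta>) D F" for D F
    by (rule tendsto_dist_cong) (simp add: D_eps_def inc)
  moreover have "tendsto_dist T (\<lambda>r z. - sphere_flux v0 \<theta>0 r z) D F = tendsto_dist T (\<lambda>r z. - sphere_flux v \<theta> r z) D F" for D F
    by (rule tendsto_dist_cong) (simp add: sphere_flux_def inc)
  moreover have "dist_dt T (\<lambda>z. 1/2 * \<bar>\<theta>0 z\<bar>\<^sup>2) \<psi> = dist_dt T (\<lambda>z. 1/2 * \<bar>\<theta> z\<bar>\<^sup>2) \<psi>" for \<psi>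
    unfolding dist_dt_def by (intro arg_cong[where f = uminus] cyl_integral_cong) (simp add: th0)
  moreover have "dist_div T (\<lambda>z. (1/2 * (\<theta>0 z)\<^sup>2) *\<^sub>R v0 z) \<psi> = dist_div T (\<lambda>z. (1/2 * (\<theta> z)\<^sup>2) *\<^sub>R v z) \<psi>" for \<psi>
    unfolding dist_div_def by (intro arg_cong[where f = uminus] cyl_integral_cong) (simp add: th0 v0)
  ultimately show ?thesis using four_thirds_law by simp
qed

end
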